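(* Let $(\mathbb{D},\boxtimes_{\mathbb{D}})$ be a monoidal derivator. Define the external product on $\mathbb{D}^{\underline{\mathbb{N}}}$ as $X\boxtimes_{\mathbb{A}^1_{\mathbb{D}}}Y:=+_!(X\boxtimes_{\mathbb{D}}Y)$. This makes $\mathbb{A}^1_{\mathbb{D}}=\mathbb{D}^{\underline{\mathbb{N}}}$ a monoidal derivator. Its monoidal unit is $i_!\mathbf{1}_{\mathbb{D}}$.
   Context: Derivators. A prederivator is a strict 2-functor $\mathbb{D}\colon\mathrm{Cat}^{op}\to\mathrm{CAT}$ from small categories to categories (reversing functors, preserving the direction of natural transformations); for a functor $u$ write $u^*=\mathbb{D}(u)$. Let $e$ be the terminal category. A derivator is a prederivator with: (Der1) $\mathbb{D}$ takes finite coproducts to products; (Der2) a morphism $f$ of $\mathbb{D}(A)$ is an isomorphism iff $a^*f$ is an isomorphism in $\mathbb{D}(e)$ for all objects $a\colon e\to A$; (Der3) every $u^*$ has a left adjoint $u_!$ and a right adjoint $u_*$; (Der4) for $u\colon A\to B$ and $b\in B$ the canonical maps $\pi_!\,\mathrm{pr}^*\to b^*u_!$ (over the slice category $(u/b)$) and $b^*u_*\to\pi_*\,\mathrm{pr}^*$ (over $(b/u)$) are isomorphisms, where $\mathrm{pr}$ is the forgetful functor to $A$ and $\pi$ the projection to $e$. For a small category $L$, $\mathbb{D}^L(I)=\mathbb{D}(L\times I)$ is a derivator. Monoidal derivators. A monoidal prederivator is a pseudomonoid in the category of prederivators and pseudonatural transformations: each $\mathbb{D}(A)$ is monoidal with product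 $\otimes_A$, compatibly with the $u^*$, which are strong monoidal. The external product of $X\in\mathbb{D}(A)$, $Y\in\mathbb{D}(B)$ is $X\boxtimes_{\mathbb{D}}Y=\pi_B^*X\otimes_{A\times B}\pi_A^*Y\in\mathbb{D}(A\times B)$, with $\pi_B\colon A\times B\to A$, $\pi_A\colon A\times B\to B$ the projections; the products $\otimes_A$ are recovered as $\Delta_A^*(X\boxtimes Y)$ for the diagonal $\Delta_A\colon A\to A\times A$, so that a monoidal structure can be specified by its external product. A monoidal derivator is a derivator that is a monoidal prederivator whose product is cocontinuous in each variable: for $X\in\mathbb{D}(A)$, $Y\in\mathbb{D}(C)$, $u\colon A\to B$, $v\colon C\to D$, the canonical maps $(u\times1)_!(X\boxtimes Y)\to u_!X\boxtimes Y$ and $(1\times v)_!(X\boxtimes Y)\to X\boxtimes v_!Y$ are isomorphisms. $\mathbf{1}_{\mathbb{D}}\in\mathbb{D}(e)$ is the unit. $\underline{\mathbb{N}}$ is the category with one object and endomorphism monoid $(\mathbb{N},+)$, $\mathbb N=\{0,1,2,\dots\}$; $i\colon e\to\underline{\mathbb{N}}$ is the unique functor; $+\colon\underline{\mathbb{N}}\times\underline{\mathbb{N}}\to\underline{\mathbb{N}}$ sends $(a,b)$ to $a+b$. For $X\in\mathbb{D}(\underline{\mathbb{N}}\times I)$ and $Y\in\mathbb{D}(\underline{\mathbb{N}}\times J)$, $+_!(X\boxtimes_{\mathbb{D}}Y)$ means $(+\times1_{I\times J})_!(X\boxtimes_{\mathbb{D}}Y)\in\mathbb{D}(\underline{\mathbb{N}}\times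 I\times J)$, after the evident reordering of factors. *)

theory Defs
  imports "HOL-Library.FuncSet" "HOL-Library.Countable_Set"
begin

unbundle cardinal_syntax

section \<open>Categories, functors, transformations\<close>

text \<open>All operations are undefined outside their domain (this is what the constructors \<open>mk_cat\<close>,
  \<open>mk_fctr\<close>, \<open>mk_ntrans\<close> enforce), so that equality of records is equality of categories, functors
  and natural transformations. In \<open>Comp C g f\<close> the arrow \<open>f\<close> comes first.\<close>

record ('o, 'm) cat =
  Obj :: "'o set"
  Arr :: "'m set"
  Dom :: "'m \<Rightarrow> 'o"
  Cod :: "'m \<Rightarrow> 'o"
  Idt :: "'o \<Rightarrow> 'm"
  Comp :: "'m \<Rightarrow> 'm \<Rightarrow> 'm"

abbreviation comp_in :: "'m \<Rightarrow> ('o, 'm) cat \<Rightarrow> 'm \<Rightarrow> 'm" (\<open>(_ \<cdot>\<^bsub>_\<^esub> _)\<close> [66, 0, 65] 65)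
  where "g \<cdot>\<^bsub>C\<^esub> f \<equiv> Comp C g f"

definition hom :: "('o, 'm) cat \<Rightarrow> 'o \<Rightarrow> 'o \<Rightarrow> 'm set" where
  "hom C x y = {f \<in> Arr C. Dom C f = x \<and> Cod C f = y}"

locale category =
  fixes C :: "('o, 'm) cat"
  assumes dom_in: "f \<in> Arr C \<Longrightarrow> Dom C f \<in> Obj C"
    and cod_in: "f \<in> Arr C \<Longrightarrow> Cod C f \<in> Obj C"
    and id_in: "x \<in> Obj C \<Longrightarrow> Idt C x \<in> hom C x x"
    and comp_in: "\<lbrakk>f \<in> hom C x y; g \<in> hom C y z\<rbrakk> \<Longrightarrow> g \<cdot>\<^bsub>C\<^esub> f \<in> hom C x z"
    and id_right: "f \<in> Arr C \<Longrightarrow> f \<cdot>\<^bsub>C\<^esub> Idt C (Dom C f) = f"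
    and id_left: "f \<in> Arr C \<Longrightarrow> Idt C (Cod C f) \<cdot>\<^bsub>C\<^esub> f = f"
    and assoc: "\<lbrakk>f \<in> hom C w x; g \<in> hom C x y; h \<in> hom C y z\<rbrakk>
      \<Longrightarrow> h \<cdot>\<^bsub>C\<^esub> (g \<cdot>\<^bsub>C\<^esub> f) = (h \<cdot>\<^bsub>C\<^esub> g) \<cdot>\<^bsub>C\<^esub> f"
    and dom_ext: "Dom C \<in> extensional (Arr C)"
    and cod_ext: "Cod C \<in> extensional (Arr C)"
    and id_ext: "Idt C \<in> extensional (Obj C)"
    and comp_ext: "\<not> (g \<in> Arr C \<and> f \<in> Arr C \<and> Dom C g = Cod C f) \<Longrightarrow> g \<cdot>\<^bsub>C\<^esub> f = undefined"

definition mk_cat ::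
  "'o set \<Rightarrow> 'm set \<Rightarrow> ('m \<Rightarrow> 'o) \<Rightarrow> ('m \<Rightarrow> 'o) \<Rightarrow> ('o \<Rightarrow> 'm) \<Rightarrow> ('m \<Rightarrow> 'm \<Rightarrow> 'm) \<Rightarrow> ('o, 'm) cat" where
  "mk_cat Ob Ar d c i m = \<lparr>Obj = Ob, Arr = Ar, Dom = restrict d Ar, Cod = restrict c Ar,
     Idt = restrict i Ob,
     Comp = (\<lambda>g f. if g \<in> Ar \<and> f \<in> Ar \<and> d g = c f then m g f else undefined)\<rparr>"

definition iso_in :: "('o, 'm) cat \<Rightarrow> 'm \<Rightarrow> bool" where
  "iso_in C f \<longleftrightarrow> f \<in> Arr C \<and> (\<exists>g \<in> hom C (Cod C f) (Dom C f).
     g \<cdot>\<^bsub>C\<^esub> f = Idt C (Dom C f) \<and> f \<cdot>\<^bsub>C\<^esub> g = Idt C (Cod C f))"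

record ('a, 'b, 'c, 'd) fctr =
  Src :: "('a, 'b) cat"
  Trg :: "('c, 'd) cat"
  FObj :: "'a \<Rightarrow> 'c"
  FArr :: "'b \<Rightarrow> 'd"

locale is_functor =
  fixes F :: "('a, 'b, 'c, 'd) fctr"
  assumes src_cat: "category (Src F)"
    and trg_cat: "category (Trg F)"
    and obj_in: "x \<in> Obj (Src F) \<Longrightarrow> FObj F x \<in> Obj (Trg F)"
    and arr_in: "f \<in> hom (Src F) x y \<Longrightarrow> FArr F f \<in> hom (Trg F) (FObj F x) (FObj F y)"
    and pres_id: "x \<in> Obj (Src F) \<Longrightarrow> FArr F (Idt (Src F) x) = Idt (Trg F) (FObj F x)"
    and pres_comp: "\<lbrakk>f \<in> hom (Src F) x y; g \<in> hom (Src F) y z\<rbrakk>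
      \<Longrightarrow> FArr F (g \<cdot>\<^bsub>Src F\<^esub> f) = FArr F g \<cdot>\<^bsub>Trg F\<^esub> FArr F f"
    and obj_ext: "FObj F \<in> extensional (Obj (Src F))"
    and arr_ext: "FArr F \<in> extensional (Arr (Src F))"

definition mk_fctr ::
  "('a, 'b) cat \<Rightarrow> ('c, 'd) cat \<Rightarrow> ('a \<Rightarrow> 'c) \<Rightarrow> ('b \<Rightarrow> 'd) \<Rightarrow> ('a, 'b, 'c, 'd) fctr" where
  "mk_fctr A B o' a' = \<lparr>Src = A, Trg = B, FObj = restrict o' (Obj A), FArr = restrict a' (Arr A)\<rparr>"

definition id_f :: "('a, 'b) cat \<Rightarrow> ('a, 'b, 'a, 'b) fctr" where
  "id_f A = mk_fctr A A (\<lambda>x. x) (\<lambda>f. f)"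

definition comp_f ::
  "('c, 'd, 'e, 'f) fctr \<Rightarrow> ('a, 'b, 'c, 'd) fctr \<Rightarrow> ('a, 'b, 'e, 'f) fctr" (infixl \<open>\<circ>\<^sub>F\<close> 70) where
  "G \<circ>\<^sub>F F = mk_fctr (Src F) (Trg G) (\<lambda>x. FObj G (FObj F x)) (\<lambda>f. FArr G (FArr F f))"

record ('a, 'b, 'c, 'd) ntrans =
  NSrc :: "('a, 'b, 'c, 'd) fctr"
  NTrg :: "('a, 'b, 'c, 'd) fctr"
  Cpt :: "'a \<Rightarrow> 'd"

locale nat_trans =
  fixes \<alpha> :: "('a, 'b, 'c, 'd) ntrans"
  assumes nsrc: "is_functor (NSrc \<alpha>)"
    and ntrg: "is_functor (NTrg \<alpha>)"
    and src_eq: "Src (NTrg \<alpha>) = Src (NSrc \<alpha>)"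
    and trg_eq: "Trg (NTrg \<alpha>) = Trg (NSrc \<alpha>)"
    and cpt_in: "x \<in> Obj (Src (NSrc \<alpha>))
      \<Longrightarrow> Cpt \<alpha> x \<in> hom (Trg (NSrc \<alpha>)) (FObj (NSrc \<alpha>) x) (FObj (NTrg \<alpha>) x)"
    and natural: "f \<in> hom (Src (NSrc \<alpha>)) x y
      \<Longrightarrow> Cpt \<alpha> y \<cdot>\<^bsub>Trg (NSrc \<alpha>)\<^esub> FArr (NSrc \<alpha>) f = FArr (NTrg \<alpha>) f \<cdot>\<^bsub>Trg (NSrc \<alpha>)\<^esub> Cpt \<alpha> x"
    and cpt_ext: "Cpt \<alpha> \<in> extensional (Obj (Src (NSrc \<alpha>)))"

definition mk_ntrans :: "('a, 'b, 'c, 'd) fctr \<Rightarrow> ('a, 'b, 'c, 'd) fctr \<Rightarrow> ('a \<Rightarrow> 'd)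
    \<Rightarrow> ('a, 'b, 'c, 'd) ntrans" where
  "mk_ntrans F G c = \<lparr>NSrc = F, NTrg = G, Cpt = restrict c (Obj (Src F))\<rparr>"

definition id_n :: "('a, 'b, 'c, 'd) fctr \<Rightarrow> ('a, 'b, 'c, 'd) ntrans" where
  "id_n F = mk_ntrans F F (\<lambda>x. Idt (Trg F) (FObj F x))"

definition vcomp :: "('a, 'b, 'c, 'd) ntrans \<Rightarrow> ('a, 'b, 'c, 'd) ntrans \<Rightarrow> ('a, 'b, 'c, 'd) ntrans" where
  "vcomp \<beta> \<alpha> = mk_ntrans (NSrc \<alpha>) (NTrg \<beta>) (\<lambda>x. Cpt \<beta> x \<cdot>\<^bsub>Trg (NSrc \<alpha>)\<^esub> Cpt \<alpha> x)"

definition hcomp :: "('c, 'd, 'e, 'f) ntrans \<Rightarrow> ('a, 'b, 'c, 'd) ntrans \<Rightarrow> ('a, 'b, 'e, 'f) ntrans" where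
  "hcomp \<beta> \<alpha> = mk_ntrans (NSrc \<beta> \<circ>\<^sub>F NSrc \<alpha>) (NTrg \<beta> \<circ>\<^sub>F NTrg \<alpha>)
     (\<lambda>x. Cpt \<beta> (FObj (NTrg \<alpha>) x) \<cdot>\<^bsub>Trg (NSrc \<beta>)\<^esub> FArr (NSrc \<beta>) (Cpt \<alpha> x))"

definition nat_iso :: "('a, 'b, 'c, 'd) ntrans \<Rightarrow> bool" where
  "nat_iso \<alpha> \<longleftrightarrow> nat_trans \<alpha> \<and> (\<forall>x \<in> Obj (Src (NSrc \<alpha>)). iso_in (Trg (NSrc \<alpha>)) (Cpt \<alpha> x))"

definition is_equivalence :: "('a, 'b, 'c, 'd) fctr \<Rightarrow> bool" where
  "is_equivalence F \<longleftrightarrow> is_functor F \<and> (\<exists>G \<eta> \<epsilon>. is_functor G \<and> Src G = Trg F \<and> Trg G = Src F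
     \<and> nat_iso \<eta> \<and> NSrc \<eta> = id_f (Src F) \<and> NTrg \<eta> = G \<circ>\<^sub>F F
     \<and> nat_iso \<epsilon> \<and> NSrc \<epsilon> = F \<circ>\<^sub>F G \<and> NTrg \<epsilon> = id_f (Trg F))"

definition prod_cat :: "('a, 'b) cat \<Rightarrow> ('c, 'd) cat \<Rightarrow> ('a \<times> 'c, 'b \<times> 'd) cat" where
  "prod_cat A B = mk_cat (Obj A \<times> Obj B) (Arr A \<times> Arr B)
     (\<lambda>(f, g). (Dom A f, Dom B g)) (\<lambda>(f, g). (Cod A f, Cod B g))
     (\<lambda>(x, y). (Idt A x, Idt B y)) (\<lambda>(f', g') (f, g). (f' \<cdot>\<^bsub>A\<^esub> f, g' \<cdot>\<^bsub>B\<^esub> g))"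

definition prod_f :: "('a, 'b, 'c, 'd) fctr \<Rightarrow> ('e, 'f, 'g, 'h) fctr
    \<Rightarrow> ('a \<times> 'e, 'b \<times> 'f, 'c \<times> 'g, 'd \<times> 'h) fctr" where
  "prod_f F G = mk_fctr (prod_cat (Src F) (Src G)) (prod_cat (Trg F) (Trg G))
     (\<lambda>(x, y). (FObj F x, FObj G y)) (\<lambda>(f, g). (FArr F f, FArr G g))"

definition fam_prod_cat :: "nat \<Rightarrow> (nat \<Rightarrow> ('o, 'm) cat) \<Rightarrow> (nat \<Rightarrow> 'o, nat \<Rightarrow> 'm) cat" where
  "fam_prod_cat n C = mk_cat (PiE {..<n} (\<lambda>k. Obj (C k))) (PiE {..<n} (\<lambda>k. Arr (C k)))
     (\<lambda>f. \<lambda>k\<in>{..<n}. Dom (C k) (f k)) (\<lambda>f. \<lambda>k\<in>{..<n}. Cod (C k) (f k))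
     (\<lambda>x. \<lambda>k\<in>{..<n}. Idt (C k) (x k)) (\<lambda>g f. \<lambda>k\<in>{..<n}. g k \<cdot>\<^bsub>C k\<^esub> f k)"

text \<open>\<open>F\<close> is left adjoint to \<open>G\<close>, with unit \<open>\<eta>\<close> and counit \<open>\<epsilon>\<close>.\<close>

locale adjunction =
  fixes F :: "('a, 'b, 'c, 'd) fctr" and G :: "('c, 'd, 'a, 'b) fctr"
    and \<eta> :: "('a, 'b, 'a, 'b) ntrans" and \<epsilon> :: "('c, 'd, 'c, 'd) ntrans"
  assumes left_functor: "is_functor F"
    and right_functor: "is_functor G"
    and src_right: "Src G = Trg F"
    and trg_right: "Trg G = Src F"
    and unit_trans: "nat_trans \<eta>" "NSrc \<eta> = id_f (Src F)" "NTrg \<eta> = G \<circ>\<^sub>F F"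
    and counit_trans: "nat_trans \<epsilon>" "NSrc \<epsilon> = F \<circ>\<^sub>F G" "NTrg \<epsilon> = id_f (Trg F)"
    and triangle_left: "x \<in> Obj (Src F)
      \<Longrightarrow> Cpt \<epsilon> (FObj F x) \<cdot>\<^bsub>Trg F\<^esub> FArr F (Cpt \<eta> x) = Idt (Trg F) (FObj F x)"
    and triangle_right: "y \<in> Obj (Trg F)
      \<Longrightarrow> FArr G (Cpt \<epsilon> y) \<cdot>\<^bsub>Src F\<^esub> Cpt \<eta> (FObj G y) = Idt (Src F) (FObj G y)"


section \<open>Small categories\<close>

text \<open>Objects and arrows of small categories are taken from the type \<open>'k univ\<close>, which is closed under
  pairing; for infinite \<open>'k\<close> it has the cardinality of \<open>'k\<close>, and small means having fewer than
  \<open>|UNIV :: 'k set|\<close> arrows (objects embed into arrows). When this cardinal is inaccessible, these are,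
  up to isomorphism, the categories that are small for the corresponding Grothendieck universe. The
  only closure properties needed (finite products, finite coproducts, slices, the monoid of natural
  numbers) hold as soon as \<open>'k\<close> is uncountable.\<close>

datatype 'k univ = Atom 'k | Num (nm: nat) | Pr (fs: "'k univ") (sn: "'k univ")

type_synonym 'k scat = "('k univ, 'k univ) cat"
type_synonym 'k sfun = "('k univ, 'k univ, 'k univ, 'k univ) fctr"
type_synonym 'k strans = "('k univ, 'k univ, 'k univ, 'k univ) ntrans"

definition small_cat :: "'k scat \<Rightarrow> bool" where
  "small_cat A \<longleftrightarrow> category A \<and> |Arr A| <o |UNIV :: 'k set|"

definition small_functor :: "'k sfun \<Rightarrow> bool" where
  "small_functor u \<longleftrightarrow> is_functor u \<and> small_cat (Src u) \<and> small_cat (Trg u)"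

definition small_trans :: "'k strans \<Rightarrow> bool" where
  "small_trans \<alpha> \<longleftrightarrow> nat_trans \<alpha> \<and> small_functor (NSrc \<alpha>) \<and> small_functor (NTrg \<alpha>)"

definition pt :: "'k scat" where
  "pt = mk_cat {Num 0} {Num 0} (\<lambda>_. Num 0) (\<lambda>_. Num 0) (\<lambda>_. Num 0) (\<lambda>_ _. Num 0)"

definition to_pt :: "'k scat \<Rightarrow> 'k sfun" where
  "to_pt A = mk_fctr A pt (\<lambda>_. Num 0) (\<lambda>_. Num 0)"

definition obj_f :: "'k scat \<Rightarrow> 'k univ \<Rightarrow> 'k sfun" where
  "obj_f A a = mk_fctr pt A (\<lambda>_. a) (\<lambda>_. Idt A a)"

definition prod_s :: "'k scat \<Rightarrow> 'k scat \<Rightarrow> 'k scat" (infixr \<open>\<otimes>\<^sub>s\<close> 75) where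
  "A \<otimes>\<^sub>s B = mk_cat {Pr x y | x y. x \<in> Obj A \<and> y \<in> Obj B} {Pr f g | f g. f \<in> Arr A \<and> g \<in> Arr B}
     (\<lambda>p. Pr (Dom A (fs p)) (Dom B (sn p))) (\<lambda>p. Pr (Cod A (fs p)) (Cod B (sn p)))
     (\<lambda>x. Pr (Idt A (fs x)) (Idt B (sn x)))
     (\<lambda>q p. Pr (fs q \<cdot>\<^bsub>A\<^esub> fs p) (sn q \<cdot>\<^bsub>B\<^esub> sn p))"

definition prod_sf :: "'k sfun \<Rightarrow> 'k sfun \<Rightarrow> 'k sfun" (infixr \<open>\<otimes>\<^sub>f\<close> 75) where
  "u \<otimes>\<^sub>f v = mk_fctr (Src u \<otimes>\<^sub>s Src v) (Trg u \<otimes>\<^sub>s Trg v)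
     (\<lambda>x. Pr (FObj u (fs x)) (FObj v (sn x))) (\<lambda>p. Pr (FArr u (fs p)) (FArr v (sn p)))"

definition prod_st :: "'k strans \<Rightarrow> 'k strans \<Rightarrow> 'k strans" (infixr \<open>\<otimes>\<^sub>t\<close> 75) where
  "\<alpha> \<otimes>\<^sub>t \<beta> = mk_ntrans (NSrc \<alpha> \<otimes>\<^sub>f NSrc \<beta>) (NTrg \<alpha> \<otimes>\<^sub>f NTrg \<beta>)
     (\<lambda>x. Pr (Cpt \<alpha> (fs x)) (Cpt \<beta> (sn x)))"

definition prj1 :: "'k scat \<Rightarrow> 'k scat \<Rightarrow> 'k sfun" where
  "prj1 A B = mk_fctr (A \<otimes>\<^sub>s B) A fs fs"

definition prj2 :: "'k scat \<Rightarrow> 'k scat \<Rightarrow> 'k sfun" where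
  "prj2 A B = mk_fctr (A \<otimes>\<^sub>s B) B sn sn"

definition diag :: "'k scat \<Rightarrow> 'k sfun" where
  "diag A = mk_fctr A (A \<otimes>\<^sub>s A) (\<lambda>x. Pr x x) (\<lambda>f. Pr f f)"

text \<open>The reordering \<open>(A \<times> B) \<times> (C \<times> D) \<rightarrow> (A \<times> C) \<times> (B \<times> D)\<close>.\<close>

definition interchange :: "'k scat \<Rightarrow> 'k scat \<Rightarrow> 'k scat \<Rightarrow> 'k scat \<Rightarrow> 'k sfun" where
  "interchange A B C D = (let s = (\<lambda>p. Pr (Pr (fs (fs p)) (fs (sn p))) (Pr (sn (fs p)) (sn (sn p)))) in
     mk_fctr ((A \<otimes>\<^sub>s B) \<otimes>\<^sub>s (C \<otimes>\<^sub>s D)) ((A \<otimes>\<^sub>s C) \<otimes>\<^sub>s (B \<otimes>\<^sub>s D)) s s)"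

definition coprod_s :: "nat \<Rightarrow> (nat \<Rightarrow> 'k scat) \<Rightarrow> 'k scat" where
  "coprod_s n A = mk_cat {Pr (Num k) x | k x. k < n \<and> x \<in> Obj (A k)}
     {Pr (Num k) f | k f. k < n \<and> f \<in> Arr (A k)}
     (\<lambda>p. Pr (fs p) (Dom (A (nm (fs p))) (sn p))) (\<lambda>p. Pr (fs p) (Cod (A (nm (fs p))) (sn p)))
     (\<lambda>x. Pr (fs x) (Idt (A (nm (fs x))) (sn x)))
     (\<lambda>q p. Pr (fs p) (sn q \<cdot>\<^bsub>A (nm (fs p))\<^esub> sn p))"

definition coprod_inj :: "nat \<Rightarrow> (nat \<Rightarrow> 'k scat) \<Rightarrow> nat \<Rightarrow> 'k sfun" where
  "coprod_inj n A k = mk_fctr (A k) (coprod_s n A) (Pr (Num k)) (Pr (Num k))"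

text \<open>The slice \<open>(u/b)\<close>: objects \<open>Pr a f\<close> with \<open>f : u a \<rightarrow> b\<close>; an arrow \<open>x \<rightarrow> y\<close> is encoded as
  \<open>Pr (Pr x y) g\<close> with \<open>g\<close> the underlying arrow of the source of \<open>u\<close>. Dually \<open>(b/u)\<close>.\<close>

definition slice_cat :: "'k scat \<Rightarrow> 'k univ set \<Rightarrow> ('k univ \<Rightarrow> 'k univ \<Rightarrow> 'k univ \<Rightarrow> bool) \<Rightarrow> 'k scat" where
  "slice_cat A Ob P = mk_cat Ob
     {Pr (Pr x y) g | x y g. x \<in> Ob \<and> y \<in> Ob \<and> g \<in> hom A (fs x) (fs y) \<and> P x y g}
     (\<lambda>p. fs (fs p)) (\<lambda>p. sn (fs p)) (\<lambda>x. Pr (Pr x x) (Idt A (fs x)))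
     (\<lambda>q p. Pr (Pr (fs (fs p)) (sn (fs q))) (sn q \<cdot>\<^bsub>A\<^esub> sn p))"

definition slice_over :: "'k sfun \<Rightarrow> 'k univ \<Rightarrow> 'k scat" where
  "slice_over u b = slice_cat (Src u)
     {Pr a f | a f. a \<in> Obj (Src u) \<and> f \<in> hom (Trg u) (FObj u a) b}
     (\<lambda>x y g. sn y \<cdot>\<^bsub>Trg u\<^esub> FArr u g = sn x)"

definition slice_under :: "'k univ \<Rightarrow> 'k sfun \<Rightarrow> 'k scat" where
  "slice_under b u = slice_cat (Src u)
     {Pr a f | a f. a \<in> Obj (Src u) \<and> f \<in> hom (Trg u) b (FObj u a)}
     (\<lambda>x y g. FArr u g \<cdot>\<^bsub>Trg u\<^esub> sn x = sn y)"

definition over_pr :: "'k sfun \<Rightarrow> 'k univ \<Rightarrow> 'k sfun" where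
  "over_pr u b = mk_fctr (slice_over u b) (Src u) fs sn"

definition under_pr :: "'k univ \<Rightarrow> 'k sfun \<Rightarrow> 'k sfun" where
  "under_pr b u = mk_fctr (slice_under b u) (Src u) fs sn"

definition over_cell :: "'k sfun \<Rightarrow> 'k univ \<Rightarrow> 'k strans" where
  "over_cell u b = mk_ntrans (u \<circ>\<^sub>F over_pr u b) (obj_f (Trg u) b \<circ>\<^sub>F to_pt (slice_over u b)) sn"

definition under_cell :: "'k univ \<Rightarrow> 'k sfun \<Rightarrow> 'k strans" where
  "under_cell b u = mk_ntrans (obj_f (Trg u) b \<circ>\<^sub>F to_pt (slice_under b u)) (u \<circ>\<^sub>F under_pr b u) sn"

text \<open>The one-object category of the additive monoid of natural numbers.\<close>

definition NN :: "'k scat" where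
  "NN = mk_cat {Num 0} (range Num) (\<lambda>_. Num 0) (\<lambda>_. Num 0) (\<lambda>_. Num 0)
     (\<lambda>q p. Num (nm q + nm p))"

definition plus_f :: "'k sfun" where
  "plus_f = mk_fctr (NN \<otimes>\<^sub>s NN) NN (\<lambda>_. Num 0) (\<lambda>p. Num (nm (fs p) + nm (sn p)))"


section \<open>Derivators\<close>

text \<open>\<open>DC\<close>, \<open>DF\<close>, \<open>DT\<close> are the actions on small categories, functors and transformations; their
  values on other arguments are irrelevant.\<close>

record ('k, 'o, 'm) pder =
  DC :: "'k scat \<Rightarrow> ('o, 'm) cat"
  DF :: "'k sfun \<Rightarrow> ('o, 'm, 'o, 'm) fctr"
  DT :: "'k strans \<Rightarrow> ('o, 'm, 'o, 'm) ntrans"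

locale prederivator =
  fixes D :: "('k, 'o, 'm) pder"
  assumes DC_cat: "small_cat A \<Longrightarrow> category (DC D A)"
    and DF_functor: "small_functor u \<Longrightarrow> is_functor (DF D u)"
    and DF_src: "small_functor u \<Longrightarrow> Src (DF D u) = DC D (Trg u)"
    and DF_trg: "small_functor u \<Longrightarrow> Trg (DF D u) = DC D (Src u)"
    and DF_id: "small_cat A \<Longrightarrow> DF D (id_f A) = id_f (DC D A)"
    and DF_comp: "\<lbrakk>small_functor u; small_functor v; Src v = Trg u\<rbrakk>
      \<Longrightarrow> DF D (v \<circ>\<^sub>F u) = DF D u \<circ>\<^sub>F DF D v"
    and DT_trans: "small_trans \<alpha> \<Longrightarrow> nat_trans (DT D \<alpha>)"
    and DT_src: "small_trans \<alpha> \<Longrightarrow> NSrc (DT D \<alpha>) = DF D (NSrc \<alpha>)"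
    and DT_trg: "small_trans \<alpha> \<Longrightarrow> NTrg (DT D \<alpha>) = DF D (NTrg \<alpha>)"
    and DT_id: "small_functor u \<Longrightarrow> DT D (id_n u) = id_n (DF D u)"
    and DT_vcomp: "\<lbrakk>small_trans \<alpha>; small_trans \<beta>; NSrc \<beta> = NTrg \<alpha>\<rbrakk>
      \<Longrightarrow> DT D (vcomp \<beta> \<alpha>) = vcomp (DT D \<beta>) (DT D \<alpha>)"
    and DT_hcomp: "\<lbrakk>small_trans \<alpha>; small_trans \<beta>; Src (NSrc \<beta>) = Trg (NSrc \<alpha>)\<rbrakk>
      \<Longrightarrow> DT D (hcomp \<beta> \<alpha>) = hcomp (DT D \<alpha>) (DT D \<beta>)"

abbreviation pbO :: "('k, 'o, 'm) pder \<Rightarrow> 'k sfun \<Rightarrow> 'o \<Rightarrow> 'o" where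
  "pbO D u X \<equiv> FObj (DF D u) X"

abbreviation pbA :: "('k, 'o, 'm) pder \<Rightarrow> 'k sfun \<Rightarrow> 'm \<Rightarrow> 'm" where
  "pbA D u f \<equiv> FArr (DF D u) f"

text \<open>A choice of adjoints of \<open>u\<^sup>*\<close>: \<open>lan D u\<close> is \<open>u\<^sub>!\<close> and \<open>ran D u\<close> is \<open>u\<^sub>*\<close>, each with its unit and
  counit.\<close>

definition lan_adj where
  "lan_adj D u = (SOME (F, \<eta>, \<epsilon>). adjunction F (DF D u) \<eta> \<epsilon>)"

definition ran_adj where
  "ran_adj D u = (SOME (G, \<eta>, \<epsilon>). adjunction (DF D u) G \<eta> \<epsilon>)"

definition lan :: "('k, 'o, 'm) pder \<Rightarrow> 'k sfun \<Rightarrow> ('o, 'm, 'o, 'm) fctr" where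
  "lan D u = fst (lan_adj D u)"

definition lan_unit :: "('k, 'o, 'm) pder \<Rightarrow> 'k sfun \<Rightarrow> ('o, 'm, 'o, 'm) ntrans" where
  "lan_unit D u = fst (snd (lan_adj D u))"

definition lan_counit :: "('k, 'o, 'm) pder \<Rightarrow> 'k sfun \<Rightarrow> ('o, 'm, 'o, 'm) ntrans" where
  "lan_counit D u = snd (snd (lan_adj D u))"

definition ran :: "('k, 'o, 'm) pder \<Rightarrow> 'k sfun \<Rightarrow> ('o, 'm, 'o, 'm) fctr" where
  "ran D u = fst (ran_adj D u)"

definition ran_unit :: "('k, 'o, 'm) pder \<Rightarrow> 'k sfun \<Rightarrow> ('o, 'm, 'o, 'm) ntrans" where
  "ran_unit D u = fst (snd (ran_adj D u))"

definition ran_counit :: "('k, 'o, 'm) pder \<Rightarrow> 'k sfun \<Rightarrow> ('o, 'm, 'o, 'm) ntrans" where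
  "ran_counit D u = snd (snd (ran_adj D u))"

text \<open>The map \<open>u\<^sub>! Z \<rightarrow> Y\<close> adjoint to \<open>f : Z \<rightarrow> u\<^sup>* Y\<close>, and the map \<open>Y \<rightarrow> u\<^sub>* Z\<close> adjoint to
  \<open>f : u\<^sup>* Y \<rightarrow> Z\<close>.\<close>

definition lan_transpose :: "('k, 'o, 'm) pder \<Rightarrow> 'k sfun \<Rightarrow> 'o \<Rightarrow> 'm \<Rightarrow> 'm" where
  "lan_transpose D u Y f = Cpt (lan_counit D u) Y \<cdot>\<^bsub>DC D (Trg u)\<^esub> FArr (lan D u) f"

definition ran_transpose :: "('k, 'o, 'm) pder \<Rightarrow> 'k sfun \<Rightarrow> 'o \<Rightarrow> 'm \<Rightarrow> 'm" where
  "ran_transpose D u Y f = FArr (ran D u) f \<cdot>\<^bsub>DC D (Trg u)\<^esub> Cpt (ran_unit D u) Y"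

text \<open>The canonical maps \<open>\<pi>\<^sub>! pr\<^sup>* X \<rightarrow> b\<^sup>* u\<^sub>! X\<close> and \<open>b\<^sup>* u\<^sub>* X \<rightarrow> \<pi>\<^sub>* pr\<^sup>* X\<close>, i.e. the mates of
  \<open>pr\<^sup>* u\<^sup>* \<rightarrow> \<pi>\<^sup>* b\<^sup>*\<close> and \<open>\<pi>\<^sup>* b\<^sup>* \<rightarrow> pr\<^sup>* u\<^sup>*\<close>.\<close>

definition der4_left :: "('k, 'o, 'm) pder \<Rightarrow> 'k sfun \<Rightarrow> 'k univ \<Rightarrow> 'o \<Rightarrow> 'm" where
  "der4_left D u b X = (let W = FObj (lan D u) X in
     lan_transpose D (to_pt (slice_over u b)) (pbO D (obj_f (Trg u) b) W)
       (Cpt (DT D (over_cell u b)) W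
        \<cdot>\<^bsub>DC D (slice_over u b)\<^esub> pbA D (over_pr u b) (Cpt (lan_unit D u) X)))"

definition der4_right :: "('k, 'o, 'm) pder \<Rightarrow> 'k sfun \<Rightarrow> 'k univ \<Rightarrow> 'o \<Rightarrow> 'm" where
  "der4_right D u b X = (let W = FObj (ran D u) X in
     ran_transpose D (to_pt (slice_under b u)) (pbO D (obj_f (Trg u) b) W)
       (pbA D (under_pr b u) (Cpt (ran_counit D u) X)
        \<cdot>\<^bsub>DC D (slice_under b u)\<^esub> Cpt (DT D (under_cell b u)) W))"

definition coprod_comparison ::
  "('k, 'o, 'm) pder \<Rightarrow> nat \<Rightarrow> (nat \<Rightarrow> 'k scat) \<Rightarrow> ('o, 'm, nat \<Rightarrow> 'o, nat \<Rightarrow> 'm) fctr" where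
  "coprod_comparison D n A = mk_fctr (DC D (coprod_s n A)) (fam_prod_cat n (\<lambda>k. DC D (A k)))
     (\<lambda>X. \<lambda>k\<in>{..<n}. pbO D (coprod_inj n A k) X) (\<lambda>f. \<lambda>k\<in>{..<n}. pbA D (coprod_inj n A k) f)"

locale derivator = prederivator D for D :: "('k, 'o, 'm) pder" +
  assumes der1: "(\<And>k. k < n \<Longrightarrow> small_cat (A k)) \<Longrightarrow> is_equivalence (coprod_comparison D n A)"
    and der2: "\<lbrakk>small_cat B; f \<in> Arr (DC D B)\<rbrakk>
      \<Longrightarrow> iso_in (DC D B) f \<longleftrightarrow> (\<forall>b \<in> Obj B. iso_in (DC D pt) (pbA D (obj_f B b) f))"
    and der3_left: "small_functor u \<Longrightarrow> \<exists>F \<eta> \<epsilon>. adjunction F (DF D u) \<eta> \<epsilon>"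
    and der3_right: "small_functor u \<Longrightarrow> \<exists>G \<eta> \<epsilon>. adjunction (DF D u) G \<eta> \<epsilon>"
    and der4_left: "\<lbrakk>small_functor u; b \<in> Obj (Trg u); X \<in> Obj (DC D (Src u))\<rbrakk>
      \<Longrightarrow> iso_in (DC D pt) (der4_left D u b X)"
    and der4_right: "\<lbrakk>small_functor u; b \<in> Obj (Trg u); X \<in> Obj (DC D (Src u))\<rbrakk>
      \<Longrightarrow> iso_in (DC D pt) (der4_right D u b X)"

text \<open>The shifted prederivator \<open>I \<mapsto> D (L \<times> I)\<close>.\<close>

definition shift :: "('k, 'o, 'm) pder \<Rightarrow> 'k scat \<Rightarrow> ('k, 'o, 'm) pder" where
  "shift D L = \<lparr>DC = (\<lambda>I. DC D (L \<otimes>\<^sub>s I)), DF = (\<lambda>u. DF D (id_f L \<otimes>\<^sub>f u)),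
     DT = (\<lambda>\<alpha>. DT D (id_n (id_f L) \<otimes>\<^sub>t \<alpha>))\<rparr>"


section \<open>Monoidal derivators\<close>

record ('o, 'm) mon_str =
  Ten :: "('o \<times> 'o, 'm \<times> 'm, 'o, 'm) fctr"
  Unt :: 'o
  Asc :: "'o \<Rightarrow> 'o \<Rightarrow> 'o \<Rightarrow> 'm"
  LUn :: "'o \<Rightarrow> 'm"
  RUn :: "'o \<Rightarrow> 'm"

abbreviation tenO :: "('o, 'm) mon_str \<Rightarrow> 'o \<Rightarrow> 'o \<Rightarrow> 'o" where
  "tenO S x y \<equiv> FObj (Ten S) (x, y)"

abbreviation tenA :: "('o, 'm) mon_str \<Rightarrow> 'm \<Rightarrow> 'm \<Rightarrow> 'm" where
  "tenA S f g \<equiv> FArr (Ten S) (f, g)"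

locale monoidal_category = category C for C :: "('o, 'm) cat" +
  fixes S :: "('o, 'm) mon_str"
  assumes ten_functor: "is_functor (Ten S)" "Src (Ten S) = prod_cat C C" "Trg (Ten S) = C"
    and unt_in: "Unt S \<in> Obj C"
    and asc_in: "\<lbrakk>x \<in> Obj C; y \<in> Obj C; z \<in> Obj C\<rbrakk>
      \<Longrightarrow> Asc S x y z \<in> hom C (tenO S (tenO S x y) z) (tenO S x (tenO S y z))"
    and asc_iso: "\<lbrakk>x \<in> Obj C; y \<in> Obj C; z \<in> Obj C\<rbrakk> \<Longrightarrow> iso_in C (Asc S x y z)"
    and asc_nat: "\<lbrakk>f \<in> hom C x x'; g \<in> hom C y y'; h \<in> hom C z z'\<rbrakk>
      \<Longrightarrow> Asc S x' y' z' \<cdot>\<^bsub>C\<^esub> tenA S (tenA S f g) h = tenA S f (tenA S g h) \<cdot>\<^bsub>C\<^esub> Asc S x y z"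
    and lun_in: "x \<in> Obj C \<Longrightarrow> LUn S x \<in> hom C (tenO S (Unt S) x) x"
    and lun_iso: "x \<in> Obj C \<Longrightarrow> iso_in C (LUn S x)"
    and lun_nat: "f \<in> hom C x y \<Longrightarrow> LUn S y \<cdot>\<^bsub>C\<^esub> tenA S (Idt C (Unt S)) f = f \<cdot>\<^bsub>C\<^esub> LUn S x"
    and run_in: "x \<in> Obj C \<Longrightarrow> RUn S x \<in> hom C (tenO S x (Unt S)) x"
    and run_iso: "x \<in> Obj C \<Longrightarrow> iso_in C (RUn S x)"
    and run_nat: "f \<in> hom C x y \<Longrightarrow> RUn S y \<cdot>\<^bsub>C\<^esub> tenA S f (Idt C (Unt S)) = f \<cdot>\<^bsub>C\<^esub> RUn S x"
    and pentagon: "\<lbrakk>w \<in> Obj C; x \<in> Obj C; y \<in> Obj C; z \<in> Obj C\<rbrakk>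
      \<Longrightarrow> tenA S (Idt C w) (Asc S x y z)
            \<cdot>\<^bsub>C\<^esub> (Asc S w (tenO S x y) z \<cdot>\<^bsub>C\<^esub> tenA S (Asc S w x y) (Idt C z))
          = Asc S w x (tenO S y z) \<cdot>\<^bsub>C\<^esub> Asc S (tenO S w x) y z"
    and triangle: "\<lbrakk>x \<in> Obj C; y \<in> Obj C\<rbrakk>
      \<Longrightarrow> tenA S (Idt C x) (LUn S y) \<cdot>\<^bsub>C\<^esub> Asc S x (Unt S) y = tenA S (RUn S x) (Idt C y)"

text \<open>A strong monoidal structure on \<open>F\<close>, with \<open>mu x y : F x \<otimes> F y \<rightarrow> F (x \<otimes> y)\<close> and \<open>ep : 1 \<rightarrow> F 1\<close>.\<close>

locale strong_monoidal =
  fixes F :: "('a, 'b, 'c, 'd) fctr" and S :: "('a, 'b) mon_str" and T :: "('c, 'd) mon_str"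
    and mu :: "'a \<Rightarrow> 'a \<Rightarrow> 'd" and ep :: 'd
  assumes functor_ax: "is_functor F"
    and src_monoidal: "monoidal_category (Src F) S"
    and trg_monoidal: "monoidal_category (Trg F) T"
    and mu_in: "\<lbrakk>x \<in> Obj (Src F); y \<in> Obj (Src F)\<rbrakk>
      \<Longrightarrow> mu x y \<in> hom (Trg F) (tenO T (FObj F x) (FObj F y)) (FObj F (tenO S x y))"
    and mu_iso: "\<lbrakk>x \<in> Obj (Src F); y \<in> Obj (Src F)\<rbrakk> \<Longrightarrow> iso_in (Trg F) (mu x y)"
    and mu_nat: "\<lbrakk>f \<in> hom (Src F) x x'; g \<in> hom (Src F) y y'\<rbrakk>
      \<Longrightarrow> mu x' y' \<cdot>\<^bsub>Trg F\<^esub> tenA T (FArr F f) (FArr F g) = FArr F (tenA S f g) \<cdot>\<^bsub>Trg F\<^esub> mu x y"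
    and ep_in: "ep \<in> hom (Trg F) (Unt T) (FObj F (Unt S))"
    and ep_iso: "iso_in (Trg F) ep"
    and mu_assoc: "\<lbrakk>x \<in> Obj (Src F); y \<in> Obj (Src F); z \<in> Obj (Src F)\<rbrakk>
      \<Longrightarrow> FArr F (Asc S x y z)
            \<cdot>\<^bsub>Trg F\<^esub> (mu (tenO S x y) z \<cdot>\<^bsub>Trg F\<^esub> tenA T (mu x y) (Idt (Trg F) (FObj F z)))
          = mu x (tenO S y z)
            \<cdot>\<^bsub>Trg F\<^esub> (tenA T (Idt (Trg F) (FObj F x)) (mu y z)
                \<cdot>\<^bsub>Trg F\<^esub> Asc T (FObj F x) (FObj F y) (FObj F z))"
    and mu_lun: "x \<in> Obj (Src F)
      \<Longrightarrow> FArr F (LUn S x)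
            \<cdot>\<^bsub>Trg F\<^esub> (mu (Unt S) x \<cdot>\<^bsub>Trg F\<^esub> tenA T ep (Idt (Trg F) (FObj F x)))
          = LUn T (FObj F x)"
    and mu_run: "x \<in> Obj (Src F)
      \<Longrightarrow> FArr F (RUn S x)
            \<cdot>\<^bsub>Trg F\<^esub> (mu x (Unt S) \<cdot>\<^bsub>Trg F\<^esub> tenA T (Idt (Trg F) (FObj F x)) ep)
          = RUn T (FObj F x)"

text \<open>A pseudomonoid in prederivators and pseudonatural transformations, written out. The product
  \<open>D \<times> D \<rightarrow> D\<close> has components \<open>Ten (MS M A)\<close> and pseudonaturality isomorphisms
  \<open>Mu M u X Y : u\<^sup>* X \<otimes> u\<^sup>* Y \<rightarrow> u\<^sup>* (X \<otimes> Y)\<close>, the unit \<open>e \<rightarrow> D\<close> has components \<open>Unt (MS M A)\<close> and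
  isomorphisms \<open>Ep M u : 1 \<rightarrow> u\<^sup>* 1\<close>; that the associator and unitors are modifications is part of
  \<open>strong_monoidal\<close>.\<close>

record ('k, 'o, 'm) mon_pder =
  MS :: "'k scat \<Rightarrow> ('o, 'm) mon_str"
  Mu :: "'k sfun \<Rightarrow> 'o \<Rightarrow> 'o \<Rightarrow> 'm"
  Ep :: "'k sfun \<Rightarrow> 'm"

locale monoidal_prederivator = prederivator D for D :: "('k, 'o, 'm) pder" +
  fixes M :: "('k, 'o, 'm) mon_pder"
  assumes monoidal: "small_cat A \<Longrightarrow> monoidal_category (DC D A) (MS M A)"
    and pb_strong: "small_functor u
      \<Longrightarrow> strong_monoidal (DF D u) (MS M (Trg u)) (MS M (Src u)) (Mu M u) (Ep M u)"
    and Mu_id: "\<lbrakk>small_cat A; X \<in> Obj (DC D A); Y \<in> Obj (DC D A)\<rbrakk>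
      \<Longrightarrow> Mu M (id_f A) X Y = Idt (DC D A) (tenO (MS M A) X Y)"
    and Ep_id: "small_cat A \<Longrightarrow> Ep M (id_f A) = Idt (DC D A) (Unt (MS M A))"
    and Mu_comp: "\<lbrakk>small_functor u; small_functor v; Src v = Trg u;
        X \<in> Obj (DC D (Trg v)); Y \<in> Obj (DC D (Trg v))\<rbrakk>
      \<Longrightarrow> Mu M (v \<circ>\<^sub>F u) X Y = pbA D u (Mu M v X Y) \<cdot>\<^bsub>DC D (Src u)\<^esub> Mu M u (pbO D v X) (pbO D v Y)"
    and Ep_comp: "\<lbrakk>small_functor u; small_functor v; Src v = Trg u\<rbrakk>
      \<Longrightarrow> Ep M (v \<circ>\<^sub>F u) = pbA D u (Ep M v) \<cdot>\<^bsub>DC D (Src u)\<^esub> Ep M u"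
    and Mu_trans: "\<lbrakk>small_trans \<alpha>; u = NSrc \<alpha>; v = NTrg \<alpha>;
        X \<in> Obj (DC D (Trg u)); Y \<in> Obj (DC D (Trg u))\<rbrakk>
      \<Longrightarrow> Cpt (DT D \<alpha>) (tenO (MS M (Trg u)) X Y) \<cdot>\<^bsub>DC D (Src u)\<^esub> Mu M u X Y
          = Mu M v X Y \<cdot>\<^bsub>DC D (Src u)\<^esub> tenA (MS M (Src u)) (Cpt (DT D \<alpha>) X) (Cpt (DT D \<alpha>) Y)"
    and Ep_trans: "\<lbrakk>small_trans \<alpha>; u = NSrc \<alpha>; v = NTrg \<alpha>\<rbrakk>
      \<Longrightarrow> Cpt (DT D \<alpha>) (Unt (MS M (Trg u))) \<cdot>\<^bsub>DC D (Src u)\<^esub> Ep M u = Ep M v"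

definition ext_prod :: "('k, 'o, 'm) pder \<Rightarrow> ('k, 'o, 'm) mon_pder \<Rightarrow> 'k scat \<Rightarrow> 'k scat
    \<Rightarrow> ('o \<times> 'o, 'm \<times> 'm, 'o, 'm) fctr" where
  "ext_prod D M A B = Ten (MS M (A \<otimes>\<^sub>s B)) \<circ>\<^sub>F prod_f (DF D (prj1 A B)) (DF D (prj2 A B))"

text \<open>The isomorphism \<open>u\<^sup>* X \<boxtimes> v\<^sup>* Y \<rightarrow> (u \<times> v)\<^sup>* (X \<boxtimes> Y)\<close>; its source is as stated because
  \<open>(u \<times> v)\<^sup>* prj1\<^sup>* = prj1\<^sup>* u\<^sup>*\<close> and \<open>(u \<times> v)\<^sup>* prj2\<^sup>* = prj2\<^sup>* v\<^sup>*\<close> strictly.\<close>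

definition ext_mu :: "('k, 'o, 'm) pder \<Rightarrow> ('k, 'o, 'm) mon_pder \<Rightarrow> 'k sfun \<Rightarrow> 'k sfun
    \<Rightarrow> 'o \<Rightarrow> 'o \<Rightarrow> 'm" where
  "ext_mu D M u v X Y = Mu M (u \<otimes>\<^sub>f v)
     (pbO D (prj1 (Trg u) (Trg v)) X) (pbO D (prj2 (Trg u) (Trg v)) Y)"

text \<open>The canonical maps \<open>(u \<times> 1)\<^sub>! (X \<boxtimes> Y) \<rightarrow> u\<^sub>! X \<boxtimes> Y\<close> and \<open>(1 \<times> v)\<^sub>! (X \<boxtimes> Y) \<rightarrow> X \<boxtimes> v\<^sub>! Y\<close>, adjoint to
  \<open>X \<boxtimes> Y \<rightarrow> u\<^sup>* u\<^sub>! X \<boxtimes> Y \<cong> (u \<times> 1)\<^sup>* (u\<^sub>! X \<boxtimes> Y)\<close> and its analogue.\<close>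

definition cocont_left :: "('k, 'o, 'm) pder \<Rightarrow> ('k, 'o, 'm) mon_pder \<Rightarrow> 'k sfun \<Rightarrow> 'k scat
    \<Rightarrow> 'o \<Rightarrow> 'o \<Rightarrow> 'm" where
  "cocont_left D M u C X Y = (let W = FObj (lan D u) X in
     lan_transpose D (u \<otimes>\<^sub>f id_f C) (FObj (ext_prod D M (Trg u) C) (W, Y))
       (ext_mu D M u (id_f C) W Y \<cdot>\<^bsub>DC D (Src u \<otimes>\<^sub>s C)\<^esub>
        FArr (ext_prod D M (Src u) C) (Cpt (lan_unit D u) X, Idt (DC D C) Y)))"

definition cocont_right :: "('k, 'o, 'm) pder \<Rightarrow> ('k, 'o, 'm) mon_pder \<Rightarrow> 'k scat \<Rightarrow> 'k sfun
    \<Rightarrow> 'o \<Rightarrow> 'o \<Rightarrow> 'm" where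
  "cocont_right D M A v X Y = (let W = FObj (lan D v) Y in
     lan_transpose D (id_f A \<otimes>\<^sub>f v) (FObj (ext_prod D M A (Trg v)) (X, W))
       (ext_mu D M (id_f A) v X W \<cdot>\<^bsub>DC D (A \<otimes>\<^sub>s Src v)\<^esub>
        FArr (ext_prod D M A (Src v)) (Idt (DC D A) X, Cpt (lan_unit D v) Y)))"

locale monoidal_derivator = derivator D + monoidal_prederivator D M
  for D :: "('k, 'o, 'm) pder" and M :: "('k, 'o, 'm) mon_pder" +
  assumes cocont_left: "\<lbrakk>small_functor u; small_cat C; X \<in> Obj (DC D (Src u)); Y \<in> Obj (DC D C)\<rbrakk>
      \<Longrightarrow> iso_in (DC D (Trg u \<otimes>\<^sub>s C)) (cocont_left D M u C X Y)"
    and cocont_right: "\<lbrakk>small_cat A; small_functor v; X \<in> Obj (DC D A); Y \<in> Obj (DC D (Src v))\<rbrakk>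
      \<Longrightarrow> iso_in (DC D (A \<otimes>\<^sub>s Trg v)) (cocont_right D M A v X Y)"


section \<open>The affine line over a monoidal derivator\<close>

abbreviation affine_line :: "('k, 'o, 'm) pder \<Rightarrow> ('k, 'o, 'm) pder" where
  "affine_line D \<equiv> shift D NN"

definition plus_I :: "'k scat \<Rightarrow> 'k sfun" where
  "plus_I K = plus_f \<otimes>\<^sub>f id_f K"

text \<open>\<open>(X, Y) \<mapsto> (+ \<times> 1)\<^sub>! \<sigma>\<^sup>* (X \<boxtimes> Y)\<close> for \<open>X \<in> D (N \<times> I)\<close>, \<open>Y \<in> D (N \<times> J)\<close>, where \<open>\<sigma>\<close> is the reordering
  \<open>(N \<times> N) \<times> (I \<times> J) \<rightarrow> (N \<times> I) \<times> (N \<times> J)\<close>.\<close>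

definition affine_ext_prod :: "('k, 'o, 'm) pder \<Rightarrow> ('k, 'o, 'm) mon_pder \<Rightarrow> 'k scat \<Rightarrow> 'k scat
    \<Rightarrow> ('o \<times> 'o, 'm \<times> 'm, 'o, 'm) fctr" where
  "affine_ext_prod D M I J = lan D (plus_I (I \<otimes>\<^sub>s J)) \<circ>\<^sub>F DF D (interchange NN NN I J)
     \<circ>\<^sub>F ext_prod D M (NN \<otimes>\<^sub>s I) (NN \<otimes>\<^sub>s J)"

text \<open>The canonical comparison of this product with pullbacks, for \<open>u : I \<rightarrow> I'\<close> and \<open>v : J \<rightarrow> J'\<close>, from
  \<open>+\<^sub>! ((1 \<times> u)\<^sup>* X \<boxtimes> (1 \<times> v)\<^sup>* Y)\<close> to \<open>(1 \<times> (u \<times> v))\<^sup>* +\<^sub>! (X \<boxtimes> Y)\<close>. With \<open>P = + \<times> 1\<close> over \<open>I \<times> J\<close>, \<open>P'\<close> over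
  \<open>I' \<times> J'\<close>, and \<open>w = 1 \<times> (u \<times> v)\<close> on \<open>(N \<times> N) \<times> (I \<times> J)\<close>, it is adjoint to
  \<open>\<sigma>\<^sup>* ((1 \<times> u)\<^sup>* X \<boxtimes> (1 \<times> v)\<^sup>* Y) \<rightarrow> \<sigma>\<^sup>* ((1 \<times> u) \<times> (1 \<times> v))\<^sup>* (X \<boxtimes> Y) = w\<^sup>* \<sigma>'\<^sup>* (X \<boxtimes> Y)
    \<rightarrow> w\<^sup>* P'\<^sup>* P'\<^sub>! \<sigma>'\<^sup>* (X \<boxtimes> Y) = P\<^sup>* (1 \<times> (u \<times> v))\<^sup>* P'\<^sub>! \<sigma>'\<^sup>* (X \<boxtimes> Y)\<close>.\<close>

definition affine_ext_mu :: "('k, 'o, 'm) pder \<Rightarrow> ('k, 'o, 'm) mon_pder \<Rightarrow> 'k sfun \<Rightarrow> 'k sfun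
    \<Rightarrow> 'o \<Rightarrow> 'o \<Rightarrow> 'm" where
  "affine_ext_mu D M u v X Y = (let
       I = Src u; J = Src v; I' = Trg u; J' = Trg v;
       P = plus_I (I \<otimes>\<^sub>s J); P' = plus_I (I' \<otimes>\<^sub>s J');
       w = id_f (NN \<otimes>\<^sub>s NN) \<otimes>\<^sub>f u \<otimes>\<^sub>f v;
       Z = pbO D (interchange NN NN I' J') (FObj (ext_prod D M (NN \<otimes>\<^sub>s I') (NN \<otimes>\<^sub>s J')) (X, Y))
     in lan_transpose D P (pbO D (id_f NN \<otimes>\<^sub>f u \<otimes>\<^sub>f v) (FObj (lan D P') Z))
          (pbA D w (Cpt (lan_unit D P') Z)
           \<cdot>\<^bsub>DC D ((NN \<otimes>\<^sub>s NN) \<otimes>\<^sub>s I \<otimes>\<^sub>s J)\<^esub>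
           pbA D (interchange NN NN I J) (ext_mu D M (id_f NN \<otimes>\<^sub>f u) (id_f NN \<otimes>\<^sub>f v) X Y)))"

text \<open>\<open>i\<^sub>! 1\<close>, moved from \<open>D N\<close> to \<open>D (N \<times> e)\<close> along the isomorphism \<open>N \<times> e \<rightarrow> N\<close>.\<close>

definition affine_unit :: "('k, 'o, 'm) pder \<Rightarrow> ('k, 'o, 'm) mon_pder \<Rightarrow> 'o" where
  "affine_unit D M = pbO D (prj1 NN pt) (FObj (lan D (obj_f NN (Num 0))) (Unt (MS M pt)))"

text \<open>A monoidal structure \<open>M'\<close> on the affine line is the one specified by the external product
  \<open>affine_ext_prod\<close>: its products over \<open>A\<close> are obtained from it by restriction along the diagonal,
  including the pseudonaturality isomorphisms, and conversely the external product that \<open>M'\<close> induces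
  is \<open>affine_ext_prod\<close>, via \<open>X \<boxtimes> Y = \<Delta>\<^sup>* (prj1\<^sup>* X \<boxtimes> prj2\<^sup>* Y) \<rightarrow> \<Delta>\<^sup>* (prj1 \<times> prj2)\<^sup>* (X \<boxtimes> Y) = X \<boxtimes> Y\<close>, where
  \<open>\<Delta>\<close> is the diagonal of \<open>I \<times> J\<close>.\<close>

definition specified_by_affine_ext_prod ::
  "('k, 'o, 'm) pder \<Rightarrow> ('k, 'o, 'm) mon_pder \<Rightarrow> ('k, 'o, 'm) mon_pder \<Rightarrow> bool" where
  "specified_by_affine_ext_prod D M M' \<longleftrightarrow>
     (\<forall>A. small_cat A
        \<longrightarrow> Ten (MS M' A) = DF (affine_line D) (diag A) \<circ>\<^sub>F affine_ext_prod D M A A) \<and>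
     (\<forall>u X Y. small_functor u \<and> X \<in> Obj (DC (affine_line D) (Trg u))
          \<and> Y \<in> Obj (DC (affine_line D) (Trg u))
        \<longrightarrow> Mu M' u X Y = pbA (affine_line D) (diag (Src u)) (affine_ext_mu D M u u X Y)) \<and>
     (\<forall>I J X Y. small_cat I \<and> small_cat J \<and> X \<in> Obj (DC (affine_line D) I)
          \<and> Y \<in> Obj (DC (affine_line D) J)
        \<longrightarrow> (let \<theta> = pbA (affine_line D) (diag (I \<otimes>\<^sub>s J))
                     (affine_ext_mu D M (prj1 I J) (prj2 I J) X Y);
                 E = DC (affine_line D) (I \<otimes>\<^sub>s J)
             in \<theta> \<in> hom E (FObj (ext_prod (affine_line D) M' I J) (X, Y))
                       (FObj (affine_ext_prod D M I J) (X, Y)) \<and> iso_in E \<theta>))"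

end

theory Submission
  imports Defs
begin

text \<open>Call an arrow \<open>X \<rightarrow> u\<^sup>* Y\<close> an arrow from \<open>X\<close> to \<open>Y\<close> over \<open>u\<close>; left Kan extensions are then the opcartesian
  arrows, and a Beck-Chevalley condition says that opcartesian arrows are stable under a base change. By
  (Der2) and (Der4) this may be tested on slices, where it follows from finality of a functor that has a
  left adjoint. This gives base change along products \<open>n \<times> 1\<close>, and the axioms of a derivator for \<open>D\<^sup>N\<close>.

  An element of \<open>X \<in> D (N \<times> I)\<close> is an arrow \<open>x : P \<rightarrow> X\<close> over some \<open>\<langle>n, i\<rangle> : A \<rightarrow> N \<times> I\<close>. The unit of \<open>+\<^sub>!\<close> multiplies
  elements over \<open>\<langle>n, i\<rangle>\<close> and \<open>\<langle>m, i\<rangle>\<close> to an element \<open>P \<otimes> Q \<rightarrow> X \<otimes> Y\<close> over \<open>\<langle>n + m, i\<rangle>\<close>, and products of opcartesian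
  elements are opcartesian because \<open>\<boxtimes>\<close> is cocontinuous in each variable. So an arrow out of an iterated
  product is the same as a compatible assignment on products of elements: associator and unitors are
  defined by the rules \<open>(x y) z \<mapsto> x (y z)\<close>, \<open>e x \<mapsto> x\<close>, \<open>x e \<mapsto> x\<close>, with \<open>e\<close> the element \<open>1 \<rightarrow> i\<^sub>! 1\<close> over \<open>0\<close>, and all
  coherence laws reduce to those of the fibres \<open>D A\<close>.\<close>

text \<open>Opcartesian arrows replace the chosen functors \<open>lan D u\<close> because mates of
  chosen adjoints would have to be pasted, whereas opcartesian arrows simply compose, cancel and
  survive isomorphisms; an axiom "this canonical map is invertible" becomes "this arrow is
  opcartesian" (\<open>lan_transpose_iso\<close>). The obstacle is that the new tensor is itself a
  left Kan extension, so its associativity cannot be read off a formula. Strictness of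
  \<open>D\<close> is what makes elements convenient: re-reading an element of \<open>u^* X\<close>
  as an element of \<open>X\<close> keeps the underlying arrow. But restriction preserves the tensor
  only up to \<open>Mu\<close>, so a product of restricted elements is a restricted product only up
  to an isomorphism of domains; \<open>ipb\<close> records this. Base change along products is used
  twice: along \<open>u \<times> v\<close>, to make the new product pseudonatural, and along the
  diagonal of \<open>I\<close>, to pass from external to internal universality. For
  \<open>D^N\<close> itself, Der4 on the right is deduced from Der4 on the left by
  conjugation.\<close>

notation prod_s (infixr \<open>**\<close> 75) and prod_sf (infixr \<open>***\<close> 75) and comp_f (infixl \<open>oo\<close> 70)

section \<open>Categories, functors and transformations\<close>

context category
begin

lemma homD:
  assumes "f \<in> hom C x y"
  shows "f \<in> Arr C" "Dom C f = x" "Cod C f = y" "x \<in> Obj C" "y \<in> Obj C"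
  using assms dom_in[of f] cod_in[of f] by (auto simp: hom_def)

lemma idr: "f \<in> hom C x y \<Longrightarrow> f \<cdot>\<^bsub>C\<^esub> Idt C x = f"
  using id_right homD by metis

lemma idl: "f \<in> hom C x y \<Longrightarrow> Idt C y \<cdot>\<^bsub>C\<^esub> f = f"
  using id_left homD by metis

lemma isoI:
  assumes "f \<in> hom C x y" "g \<in> hom C y x" "g \<cdot>\<^bsub>C\<^esub> f = Idt C x" "f \<cdot>\<^bsub>C\<^esub> g = Idt C y"
  shows "iso_in C f"
  using assms unfolding iso_in_def by (auto simp: hom_def)

lemma isoE:
  assumes "iso_in C f" "f \<in> hom C x y"
  obtains g where "g \<in> hom C y x" "g \<cdot>\<^bsub>C\<^esub> f = Idt C x" "f \<cdot>\<^bsub>C\<^esub> g = Idt C y" "iso_in C g"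
proof -
  obtain g where "g \<in> hom C y x" "g \<cdot>\<^bsub>C\<^esub> f = Idt C x" "f \<cdot>\<^bsub>C\<^esub> g = Idt C y"
    using assms unfolding iso_in_def by (auto simp: hom_def)
  then show thesis using isoI[of g y x f] that assms(2) by blast
qed

lemma iso_id: "x \<in> Obj C \<Longrightarrow> iso_in C (Idt C x)"
  using isoI[OF id_in id_in] idr[OF id_in] by blast

lemma iso_comp:
  assumes "f \<in> hom C x y" "g \<in> hom C y z" "iso_in C f" "iso_in C g"
  shows "iso_in C (g \<cdot>\<^bsub>C\<^esub> f)"
proof -
  obtain f' where f': "f' \<in> hom C y x" "f' \<cdot>\<^bsub>C\<^esub> f = Idt C x" "f \<cdot>\<^bsub>C\<^esub> f' = Idt C y"
    using isoE assms by metis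
  obtain g' where g': "g' \<in> hom C z y" "g' \<cdot>\<^bsub>C\<^esub> g = Idt C y" "g \<cdot>\<^bsub>C\<^esub> g' = Idt C z"
    using isoE assms by metis
  have 1: "(f' \<cdot>\<^bsub>C\<^esub> g') \<cdot>\<^bsub>C\<^esub> (g \<cdot>\<^bsub>C\<^esub> f) = Idt C x"
    using assms f' g' assoc[OF assms(1) assms(2) g'(1)] idl[OF assms(1)]
      assoc[OF comp_in[OF assms(1,2)] g'(1) f'(1)] by metis
  have 2: "(g \<cdot>\<^bsub>C\<^esub> f) \<cdot>\<^bsub>C\<^esub> (f' \<cdot>\<^bsub>C\<^esub> g') = Idt C z"
    using assms f' g' assoc[OF g'(1) f'(1) assms(1)] idl[OF g'(1)]
      assoc[OF comp_in[OF g'(1) f'(1)] assms(1,2)] by metis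
  show ?thesis using isoI[OF comp_in comp_in 1 2] assms f' g' by blast
qed

lemma iso_monic:
  assumes "f \<in> hom C x y" "g \<in> hom C x y" "h \<in> hom C y z" "iso_in C h" "h \<cdot>\<^bsub>C\<^esub> f = h \<cdot>\<^bsub>C\<^esub> g"
  shows "f = g"
proof -
  obtain h' where h': "h' \<in> hom C z y" "h' \<cdot>\<^bsub>C\<^esub> h = Idt C y"
    using isoE assms by metis
  show ?thesis using assoc[OF assms(1,3) h'(1)] assoc[OF assms(2,3) h'(1)] h' assms idl by metis
qed

lemma iso_epic:
  assumes "f \<in> hom C y z" "g \<in> hom C y z" "h \<in> hom C x y" "iso_in C h" "f \<cdot>\<^bsub>C\<^esub> h = g \<cdot>\<^bsub>C\<^esub> h"
  shows "f = g"
proof -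
  obtain h' where h': "h' \<in> hom C y x" "h \<cdot>\<^bsub>C\<^esub> h' = Idt C y"
    using isoE assms by metis
  show ?thesis using assoc[OF h'(1) assms(3,1)] assoc[OF h'(1) assms(3,2)] h' assms idr by metis
qed

end

lemma mk_cat_simps [simp]:
  "Obj (mk_cat Ob Ar d c i m) = Ob" "Arr (mk_cat Ob Ar d c i m) = Ar"
  "f \<in> Ar \<Longrightarrow> Dom (mk_cat Ob Ar d c i m) f = d f" "f \<in> Ar \<Longrightarrow> Cod (mk_cat Ob Ar d c i m) f = c f"
  "x \<in> Ob \<Longrightarrow> Idt (mk_cat Ob Ar d c i m) x = i x"
  "\<lbrakk>f \<in> Ar; g \<in> Ar; d g = c f\<rbrakk> \<Longrightarrow> g \<cdot>\<^bsub>mk_cat Ob Ar d c i m\<^esub> f = m g f"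
  by (auto simp: mk_cat_def)

lemma mk_cat_hom: "f \<in> hom (mk_cat Ob Ar d c i m) x y \<longleftrightarrow> f \<in> Ar \<and> d f = x \<and> c f = y"
  by (auto simp: mk_cat_def hom_def)

lemma mk_cat_category:
  assumes "\<And>f. f \<in> Ar \<Longrightarrow> d f \<in> Ob" "\<And>f. f \<in> Ar \<Longrightarrow> c f \<in> Ob"
    and "\<And>x. x \<in> Ob \<Longrightarrow> i x \<in> Ar \<and> d (i x) = x \<and> c (i x) = x"
    and "\<And>f g. \<lbrakk>f \<in> Ar; g \<in> Ar; d g = c f\<rbrakk> \<Longrightarrow> m g f \<in> Ar \<and> d (m g f) = d f \<and> c (m g f) = c g"
    and "\<And>f. f \<in> Ar \<Longrightarrow> m f (i (d f)) = f" "\<And>f. f \<in> Ar \<Longrightarrow> m (i (c f)) f = f"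
    and "\<And>f g h. \<lbrakk>f \<in> Ar; g \<in> Ar; h \<in> Ar; d g = c f; d h = c g\<rbrakk> \<Longrightarrow> m h (m g f) = m (m h g) f"
  shows "category (mk_cat Ob Ar d c i m)"
  using assms by unfold_locales (auto simp: mk_cat_hom, auto simp: mk_cat_def)

lemma mk_fctr_simps [simp]:
  "Src (mk_fctr A B p q) = A" "Trg (mk_fctr A B p q) = B"
  "x \<in> Obj A \<Longrightarrow> FObj (mk_fctr A B p q) x = p x" "f \<in> Arr A \<Longrightarrow> FArr (mk_fctr A B p q) f = q f"
  by (auto simp: mk_fctr_def)

lemma mk_fctrI:
  assumes "category A" "category B" "\<And>x. x \<in> Obj A \<Longrightarrow> p x \<in> Obj B"
    and "\<And>f x y. f \<in> hom A x y \<Longrightarrow> q f \<in> hom B (p x) (p y)"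
    and "\<And>x. x \<in> Obj A \<Longrightarrow> q (Idt A x) = Idt B (p x)"
    and "\<And>f g x y z. \<lbrakk>f \<in> hom A x y; g \<in> hom A y z\<rbrakk> \<Longrightarrow> q (g \<cdot>\<^bsub>A\<^esub> f) = q g \<cdot>\<^bsub>B\<^esub> q f"
  shows "is_functor (mk_fctr A B p q)"
proof -
  interpret A: category A by fact
  interpret B: category B by fact
  show ?thesis
  proof (rule is_functor.intro)
    fix f x y assume "f \<in> hom (Src (mk_fctr A B p q)) x y"
    then show "FArr (mk_fctr A B p q) f \<in> hom (Trg (mk_fctr A B p q))
        (FObj (mk_fctr A B p q) x) (FObj (mk_fctr A B p q) y)"
      using A.homD[of f x y] assms(4) by simp
  next
    fix x assume "x \<in> Obj (Src (mk_fctr A B p q))"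
    then show "FArr (mk_fctr A B p q) (Idt (Src (mk_fctr A B p q)) x)
        = Idt (Trg (mk_fctr A B p q)) (FObj (mk_fctr A B p q) x)"
      using A.id_in[of x] A.homD(1) assms(5) by simp
  next
    fix f x y g z assume "f \<in> hom (Src (mk_fctr A B p q)) x y" "g \<in> hom (Src (mk_fctr A B p q)) y z"
    then show "FArr (mk_fctr A B p q) (g \<cdot>\<^bsub>Src (mk_fctr A B p q)\<^esub> f)
        = FArr (mk_fctr A B p q) g \<cdot>\<^bsub>Trg (mk_fctr A B p q)\<^esub> FArr (mk_fctr A B p q) f"
      using A.homD(1)[of f x y] A.homD(1)[of g y z] A.homD(1)[OF A.comp_in, of f x y g z] assms(6) by simp
  qed (auto simp: assms mk_fctr_def)
qed

text \<open>Extensionality makes agreement on the source genuine equality of records. This matters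
  because \<open>D\<close> is strict: equal small functors give equal, not merely isomorphic,
  restrictions.\<close>

lemma fctr_eqI:
  assumes "is_functor F" "is_functor G" "Src F = Src G" "Trg F = Trg G"
    and "\<And>x. x \<in> Obj (Src F) \<Longrightarrow> FObj F x = FObj G x" "\<And>f. f \<in> Arr (Src F) \<Longrightarrow> FArr F f = FArr G f"
  shows "F = G"
proof -
  interpret F: is_functor F by fact
  interpret G: is_functor G by fact
  have "FObj F = FObj G" using F.obj_ext G.obj_ext assms(3,5) extensionalityI by metis
  moreover have "FArr F = FArr G" using F.arr_ext G.arr_ext assms(3,6) extensionalityI by metis
  ultimately show ?thesis using assms(3,4) by (intro fctr.equality) auto
qed

lemma mk_fctr_cong:
  "\<lbrakk>A = A'; B = B'; \<And>x. x \<in> Obj A \<Longrightarrow> p x = p' x; \<And>f. f \<in> Arr A \<Longrightarrow> q f = q' f\<rbrakk>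
    \<Longrightarrow> mk_fctr A B p q = mk_fctr A' B' p' q'"
  by (auto simp: mk_fctr_def intro!: restrict_ext)

context is_functor
begin

sublocale S: category "Src F" by (rule src_cat)
sublocale T: category "Trg F" by (rule trg_cat)

lemma arr_in': "f \<in> Arr (Src F) \<Longrightarrow> FArr F f \<in> Arr (Trg F)"
  using arr_in[of f "Dom (Src F) f" "Cod (Src F) f"] by (auto simp: hom_def)

lemma eta: "mk_fctr (Src F) (Trg F) (FObj F) (FArr F) = F"
  using obj_ext arr_ext by (simp add: mk_fctr_def extensional_restrict)

lemma pres_iso:
  assumes "iso_in (Src F) f"
  shows "iso_in (Trg F) (FArr F f)"
proof -
  have f: "f \<in> hom (Src F) (Dom (Src F) f) (Cod (Src F) f)" using assms by (auto simp: iso_in_def hom_def)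
  obtain g where g: "g \<in> hom (Src F) (Cod (Src F) f) (Dom (Src F) f)"
    "g \<cdot>\<^bsub>Src F\<^esub> f = Idt (Src F) (Dom (Src F) f)" "f \<cdot>\<^bsub>Src F\<^esub> g = Idt (Src F) (Cod (Src F) f)"
    using S.isoE[OF assms f] by blast
  show ?thesis
    using T.isoI[OF arr_in[OF f] arr_in[OF g(1)]] pres_comp[OF f g(1)] pres_comp[OF g(1) f] g pres_id S.homD[OF f]
    by simp
qed

end

lemma id_f_simps [simp]:
  "Src (id_f A) = A" "Trg (id_f A) = A" "x \<in> Obj A \<Longrightarrow> FObj (id_f A) x = x" "f \<in> Arr A \<Longrightarrow> FArr (id_f A) f = f"
  by (auto simp: id_f_def)

lemma id_f_functor: "category A \<Longrightarrow> is_functor (id_f A)"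
  unfolding id_f_def by (rule mk_fctrI) auto

lemma comp_f_simps [simp]:
  "Src (G oo F) = Src F" "Trg (G oo F) = Trg G"
  "x \<in> Obj (Src F) \<Longrightarrow> FObj (G oo F) x = FObj G (FObj F x)"
  "f \<in> Arr (Src F) \<Longrightarrow> FArr (G oo F) f = FArr G (FArr F f)"
  by (auto simp: comp_f_def)

lemma comp_f_functor:
  assumes "is_functor F" "is_functor G" "Src G = Trg F"
  shows "is_functor (G oo F)"
proof -
  interpret F: is_functor F by fact
  interpret G: is_functor G by fact
  show ?thesis unfolding comp_f_def
    using F.src_cat G.trg_cat F.obj_in F.arr_in F.pres_id F.pres_comp
      G.obj_in G.arr_in G.pres_id G.pres_comp assms(3)
    by (intro mk_fctrI) (auto, metis+)
qed

lemma comp_f_id_left: "is_functor F \<Longrightarrow> Trg F = A \<Longrightarrow> id_f A oo F = F"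
  by (rule fctr_eqI)
    (auto simp: is_functor.obj_in is_functor.arr_in' is_functor.trg_cat intro!: comp_f_functor id_f_functor)

lemma comp_f_id_right: "is_functor F \<Longrightarrow> Src F = A \<Longrightarrow> F oo id_f A = F"
  by (rule fctr_eqI) (auto simp: is_functor.src_cat intro!: comp_f_functor id_f_functor)

lemma comp_f_assoc:
  assumes "is_functor F" "is_functor G" "is_functor H" "Src G = Trg F" "Src H = Trg G"
  shows "(H oo G) oo F = H oo (G oo F)"
  using assms is_functor.obj_in[of F] is_functor.arr_in'[of F]
  by (intro fctr_eqI comp_f_functor) auto

lemma mk_ntrans_simps [simp]:
  "NSrc (mk_ntrans F G c) = F" "NTrg (mk_ntrans F G c) = G"
  "x \<in> Obj (Src F) \<Longrightarrow> Cpt (mk_ntrans F G c) x = c x"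
  by (auto simp: mk_ntrans_def)

lemma mk_ntransI:
  assumes "is_functor F" "is_functor G" "Src G = Src F" "Trg G = Trg F"
    and "\<And>x. x \<in> Obj (Src F) \<Longrightarrow> c x \<in> hom (Trg F) (FObj F x) (FObj G x)"
    and "\<And>f x y. f \<in> hom (Src F) x y \<Longrightarrow> c y \<cdot>\<^bsub>Trg F\<^esub> FArr F f = FArr G f \<cdot>\<^bsub>Trg F\<^esub> c x"
  shows "nat_trans (mk_ntrans F G c)"
proof -
  interpret F: is_functor F by fact
  show ?thesis
  proof (rule nat_trans.intro)
    fix f x y assume f: "f \<in> hom (Src (NSrc (mk_ntrans F G c))) x y"
    then show "Cpt (mk_ntrans F G c) y \<cdot>\<^bsub>Trg (NSrc (mk_ntrans F G c))\<^esub> FArr (NSrc (mk_ntrans F G c)) f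
      = FArr (NTrg (mk_ntrans F G c)) f \<cdot>\<^bsub>Trg (NSrc (mk_ntrans F G c))\<^esub> Cpt (mk_ntrans F G c) x"
      using F.S.homD[of f x y] assms(6) by simp
  qed (use assms in \<open>auto simp: mk_ntrans_def\<close>)
qed

lemma ntrans_eqI:
  assumes "nat_trans \<alpha>" "nat_trans \<beta>" "NSrc \<alpha> = NSrc \<beta>" "NTrg \<alpha> = NTrg \<beta>"
    and "\<And>x. x \<in> Obj (Src (NSrc \<alpha>)) \<Longrightarrow> Cpt \<alpha> x = Cpt \<beta> x"
  shows "\<alpha> = \<beta>"
proof -
  have "Cpt \<alpha> = Cpt \<beta>"
    using nat_trans.cpt_ext[OF assms(1)] nat_trans.cpt_ext[OF assms(2)] assms(3,5) extensionalityI by metis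
  then show ?thesis using assms by (intro ntrans.equality) auto
qed

lemma id_n_simps [simp]:
  "NSrc (id_n F) = F" "NTrg (id_n F) = F" "x \<in> Obj (Src F) \<Longrightarrow> Cpt (id_n F) x = Idt (Trg F) (FObj F x)"
  by (auto simp: id_n_def)

lemma id_n_trans: "is_functor F \<Longrightarrow> nat_trans (id_n F)"
  unfolding id_n_def
proof (rule mk_ntransI)
  assume "is_functor F"
  then interpret F: is_functor F .
  show "Idt (Trg F) (FObj F x) \<in> hom (Trg F) (FObj F x) (FObj F x)" if "x \<in> Obj (Src F)" for x
    using that F.obj_in F.T.id_in by blast
  show "Idt (Trg F) (FObj F y) \<cdot>\<^bsub>Trg F\<^esub> FArr F f = FArr F f \<cdot>\<^bsub>Trg F\<^esub> Idt (Trg F) (FObj F x)"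
    if "f \<in> hom (Src F) x y" for f x y
    using F.T.idl[OF F.arr_in[OF that]] F.T.idr[OF F.arr_in[OF that]] by simp
qed auto

lemma vcomp_simps [simp]:
  "NSrc (vcomp \<beta> \<alpha>) = NSrc \<alpha>" "NTrg (vcomp \<beta> \<alpha>) = NTrg \<beta>"
  "x \<in> Obj (Src (NSrc \<alpha>)) \<Longrightarrow> Cpt (vcomp \<beta> \<alpha>) x = Cpt \<beta> x \<cdot>\<^bsub>Trg (NSrc \<alpha>)\<^esub> Cpt \<alpha> x"
  by (auto simp: vcomp_def)

lemma hcomp_simps [simp]:
  "NSrc (hcomp \<beta> \<alpha>) = NSrc \<beta> oo NSrc \<alpha>" "NTrg (hcomp \<beta> \<alpha>) = NTrg \<beta> oo NTrg \<alpha>"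
  "x \<in> Obj (Src (NSrc \<alpha>)) \<Longrightarrow> Cpt (hcomp \<beta> \<alpha>) x
    = Cpt \<beta> (FObj (NTrg \<alpha>) x) \<cdot>\<^bsub>Trg (NSrc \<beta>)\<^esub> FArr (NSrc \<beta>) (Cpt \<alpha> x)"
  by (auto simp: hcomp_def)

lemma vcomp_trans:
  assumes "nat_trans \<alpha>" "nat_trans \<beta>" "NSrc \<beta> = NTrg \<alpha>"
  shows "nat_trans (vcomp \<beta> \<alpha>)"
proof -
  interpret a: nat_trans \<alpha> by fact
  interpret b: nat_trans \<beta> by fact
  interpret F: is_functor "NSrc \<alpha>" by (rule a.nsrc)
  interpret G: is_functor "NTrg \<alpha>" by (rule a.ntrg)
  interpret H: is_functor "NTrg \<beta>" by (rule b.ntrg)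
  note eqs [simp] = a.src_eq a.trg_eq b.src_eq b.trg_eq assms(3)
  show ?thesis unfolding vcomp_def
  proof (rule mk_ntransI)
    fix x assume x: "x \<in> Obj (Src (NSrc \<alpha>))"
    show "Cpt \<beta> x \<cdot>\<^bsub>Trg (NSrc \<alpha>)\<^esub> Cpt \<alpha> x \<in> hom (Trg (NSrc \<alpha>)) (FObj (NSrc \<alpha>) x) (FObj (NTrg \<beta>) x)"
      using F.T.comp_in[OF a.cpt_in[OF x]] b.cpt_in[of x] x by simp
  next
    fix f x y assume f: "f \<in> hom (Src (NSrc \<alpha>)) x y"
    note xy = F.S.homD(4,5)[OF f]
    have b: "Cpt \<beta> z \<in> hom (Trg (NSrc \<alpha>)) (FObj (NTrg \<alpha>) z) (FObj (NTrg \<beta>) z)" if "z \<in> {x, y}" for z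
      using b.cpt_in[of z] that xy by auto
    have nb: "Cpt \<beta> y \<cdot>\<^bsub>Trg (NSrc \<alpha>)\<^esub> FArr (NTrg \<alpha>) f = FArr (NTrg \<beta>) f \<cdot>\<^bsub>Trg (NSrc \<alpha>)\<^esub> Cpt \<beta> x"
      using b.natural[of f x y] f by simp
    have "(Cpt \<beta> y \<cdot>\<^bsub>Trg (NSrc \<alpha>)\<^esub> Cpt \<alpha> y) \<cdot>\<^bsub>Trg (NSrc \<alpha>)\<^esub> FArr (NSrc \<alpha>) f
      = Cpt \<beta> y \<cdot>\<^bsub>Trg (NSrc \<alpha>)\<^esub> (FArr (NTrg \<alpha>) f \<cdot>\<^bsub>Trg (NSrc \<alpha>)\<^esub> Cpt \<alpha> x)"
      using F.T.assoc[OF F.arr_in[OF f] a.cpt_in[OF xy(2)] b] a.natural[OF f] by simp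
    also have "\<dots> = (FArr (NTrg \<beta>) f \<cdot>\<^bsub>Trg (NSrc \<alpha>)\<^esub> Cpt \<beta> x) \<cdot>\<^bsub>Trg (NSrc \<alpha>)\<^esub> Cpt \<alpha> x"
      using F.T.assoc[OF a.cpt_in[OF xy(1)] _ b, of "FArr (NTrg \<alpha>) f" y] G.arr_in[of f x y] f nb by simp
    also have "\<dots> = FArr (NTrg \<beta>) f \<cdot>\<^bsub>Trg (NSrc \<alpha>)\<^esub> (Cpt \<beta> x \<cdot>\<^bsub>Trg (NSrc \<alpha>)\<^esub> Cpt \<alpha> x)"
      using F.T.assoc[OF a.cpt_in[OF xy(1)] b, of "FArr (NTrg \<beta>) f" "FObj (NTrg \<beta>) y"] H.arr_in[of f x y] f
      by simp
    finally show "(Cpt \<beta> y \<cdot>\<^bsub>Trg (NSrc \<alpha>)\<^esub> Cpt \<alpha> y) \<cdot>\<^bsub>Trg (NSrc \<alpha>)\<^esub> FArr (NSrc \<alpha>) f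
      = FArr (NTrg \<beta>) f \<cdot>\<^bsub>Trg (NSrc \<alpha>)\<^esub> (Cpt \<beta> x \<cdot>\<^bsub>Trg (NSrc \<alpha>)\<^esub> Cpt \<alpha> x)" .
  qed (use a.nsrc b.ntrg in auto)
qed

lemma hcomp_trans:
  assumes "nat_trans \<alpha>" "nat_trans \<beta>" "Src (NSrc \<beta>) = Trg (NSrc \<alpha>)"
  shows "nat_trans (hcomp \<beta> \<alpha>)"
proof -
  interpret a: nat_trans \<alpha> by fact
  interpret b: nat_trans \<beta> by fact
  interpret F: is_functor "NSrc \<alpha>" by (rule a.nsrc)
  interpret F': is_functor "NTrg \<alpha>" by (rule a.ntrg)
  interpret G: is_functor "NSrc \<beta>" by (rule b.nsrc)
  interpret G': is_functor "NTrg \<beta>" by (rule b.ntrg)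
  note eqs [simp] = a.src_eq a.trg_eq b.src_eq b.trg_eq assms(3)
  let ?T = "Trg (NSrc \<beta>)"
  show ?thesis unfolding hcomp_def
  proof (rule mk_ntransI)
    fix x assume "x \<in> Obj (Src (NSrc \<beta> oo NSrc \<alpha>))"
    then have x: "x \<in> Obj (Src (NSrc \<alpha>))" by simp
    have "FArr (NSrc \<beta>) (Cpt \<alpha> x) \<in> hom ?T (FObj (NSrc \<beta>) (FObj (NSrc \<alpha>) x)) (FObj (NSrc \<beta>) (FObj (NTrg \<alpha>) x))"
      using G.arr_in[of "Cpt \<alpha> x"] a.cpt_in[OF x] by simp
    moreover have "Cpt \<beta> (FObj (NTrg \<alpha>) x) \<in> hom ?T (FObj (NSrc \<beta>) (FObj (NTrg \<alpha>) x)) (FObj (NTrg \<beta>) (FObj (NTrg \<alpha>) x))"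
      using b.cpt_in[of "FObj (NTrg \<alpha>) x"] F'.obj_in[of x] x by simp
    ultimately show "Cpt \<beta> (FObj (NTrg \<alpha>) x) \<cdot>\<^bsub>?T\<^esub> FArr (NSrc \<beta>) (Cpt \<alpha> x)
      \<in> hom (Trg (NSrc \<beta> oo NSrc \<alpha>)) (FObj (NSrc \<beta> oo NSrc \<alpha>) x) (FObj (NTrg \<beta> oo NTrg \<alpha>) x)"
      using G.T.comp_in x by simp
  next
    fix f x y assume "f \<in> hom (Src (NSrc \<beta> oo NSrc \<alpha>)) x y"
    then have f: "f \<in> hom (Src (NSrc \<alpha>)) x y" by simp
    note xy = F.S.homD(4,5)[OF f]
    have fa: "f \<in> Arr (Src (NSrc \<alpha>))" using F.S.homD[OF f] by simp
    have 1: "FArr (NSrc \<alpha>) f \<in> hom (Trg (NSrc \<alpha>)) (FObj (NSrc \<alpha>) x) (FObj (NSrc \<alpha>) y)"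
      using F.arr_in f by blast
    have 2: "FArr (NTrg \<alpha>) f \<in> hom (Trg (NSrc \<alpha>)) (FObj (NTrg \<alpha>) x) (FObj (NTrg \<alpha>) y)"
      using F'.arr_in[of f] f by simp
    note cx = a.cpt_in[OF xy(1)] and cy = a.cpt_in[OF xy(2)]
    note G1 = G.arr_in[unfolded eqs]
    have bz: "Cpt \<beta> z \<in> hom ?T (FObj (NSrc \<beta>) z) (FObj (NTrg \<beta>) z)" if "z \<in> Obj (Trg (NSrc \<alpha>))" for z
      using b.cpt_in[of z] that by simp
    have o: "FObj (NTrg \<alpha>) x \<in> Obj (Trg (NSrc \<alpha>))" "FObj (NTrg \<alpha>) y \<in> Obj (Trg (NSrc \<alpha>))"
      using F.T.homD[OF 2] by auto
    have "(Cpt \<beta> (FObj (NTrg \<alpha>) y) \<cdot>\<^bsub>?T\<^esub> FArr (NSrc \<beta>) (Cpt \<alpha> y)) \<cdot>\<^bsub>?T\<^esub> FArr (NSrc \<beta>) (FArr (NSrc \<alpha>) f)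
      = Cpt \<beta> (FObj (NTrg \<alpha>) y) \<cdot>\<^bsub>?T\<^esub> FArr (NSrc \<beta>) (FArr (NTrg \<alpha>) f \<cdot>\<^bsub>Trg (NSrc \<alpha>)\<^esub> Cpt \<alpha> x)"
      using G.T.assoc[OF G1[OF 1] G1[OF cy] bz[OF o(2)]] G.pres_comp[unfolded eqs, OF 1 cy] a.natural[OF f] by simp
    also have "\<dots> = (Cpt \<beta> (FObj (NTrg \<alpha>) y) \<cdot>\<^bsub>?T\<^esub> FArr (NSrc \<beta>) (FArr (NTrg \<alpha>) f)) \<cdot>\<^bsub>?T\<^esub> FArr (NSrc \<beta>) (Cpt \<alpha> x)"
      using G.T.assoc[OF G1[OF cx] G1[OF 2] bz[OF o(2)]] G.pres_comp[unfolded eqs, OF cx 2] by simp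
    also have "\<dots> = (FArr (NTrg \<beta>) (FArr (NTrg \<alpha>) f) \<cdot>\<^bsub>?T\<^esub> Cpt \<beta> (FObj (NTrg \<alpha>) x)) \<cdot>\<^bsub>?T\<^esub> FArr (NSrc \<beta>) (Cpt \<alpha> x)"
      using b.natural[unfolded eqs, OF 2] by simp
    also have "\<dots> = FArr (NTrg \<beta>) (FArr (NTrg \<alpha>) f) \<cdot>\<^bsub>?T\<^esub> (Cpt \<beta> (FObj (NTrg \<alpha>) x) \<cdot>\<^bsub>?T\<^esub> FArr (NSrc \<beta>) (Cpt \<alpha> x))"
      using G.T.assoc[OF G1[OF cx] bz[OF o(1)] G'.arr_in[unfolded eqs, OF 2]] by simp
    finally show "(Cpt \<beta> (FObj (NTrg \<alpha>) y) \<cdot>\<^bsub>?T\<^esub> FArr (NSrc \<beta>) (Cpt \<alpha> y)) \<cdot>\<^bsub>Trg (NSrc \<beta> oo NSrc \<alpha>)\<^esub> FArr (NSrc \<beta> oo NSrc \<alpha>) f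
      = FArr (NTrg \<beta> oo NTrg \<alpha>) f \<cdot>\<^bsub>Trg (NSrc \<beta> oo NSrc \<alpha>)\<^esub> (Cpt \<beta> (FObj (NTrg \<alpha>) x) \<cdot>\<^bsub>?T\<^esub> FArr (NSrc \<beta>) (Cpt \<alpha> x))"
      using fa by simp
  qed (use a.nsrc a.ntrg b.nsrc b.ntrg in \<open>auto intro!: comp_f_functor\<close>)
qed

section \<open>Small categories\<close>

text \<open>Pairing is the normal form for functors into products: products of functors, diagonals
  and reorderings are rewritten to pairings of projections, so that most equations between base
  functors are decided by simplification.\<close>

definition pair :: "'k sfun \<Rightarrow> 'k sfun \<Rightarrow> 'k sfun" (\<open><|_, _|>\<close>) where
  "<|u, v|> = mk_fctr (Src u) (Trg u ** Trg v) (\<lambda>x. Pr (FObj u x) (FObj v x)) (\<lambda>f. Pr (FArr u f) (FArr v f))"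

text \<open>This is \<open>plus_f\<close> after the pairing, under its own name so that
  associativity and the zero laws of the natural numbers become strict equations of functors. Hence
  the base of a triple product does not depend on the bracketing.\<close>

definition nadd :: "'k sfun \<Rightarrow> 'k sfun \<Rightarrow> 'k sfun" where
  "nadd n m = mk_fctr (Src n) NN (\<lambda>_. Num 0) (\<lambda>f. Num (nm (FArr n f) + nm (FArr m f)))"

definition nzero :: "'k scat \<Rightarrow> 'k sfun" where
  "nzero A = mk_fctr A NN (\<lambda>_. Num 0) (\<lambda>_. Num 0)"

definition const_f :: "'k scat \<Rightarrow> 'k scat \<Rightarrow> 'k univ \<Rightarrow> 'k sfun" where
  "const_f A B b = obj_f B b oo to_pt A"

lemma src_trg [simp]:
  "Src (to_pt A) = A" "Trg (to_pt A) = pt" "Src (obj_f A a) = pt" "Trg (obj_f A a) = A"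
  "Src (u *** v) = Src u ** Src v" "Trg (u *** v) = Trg u ** Trg v"
  "Src (prj1 A B) = A ** B" "Trg (prj1 A B) = A" "Src (prj2 A B) = A ** B" "Trg (prj2 A B) = B"
  "Src (diag A) = A" "Trg (diag A) = A ** A"
  "Src (interchange A B C D) = (A ** B) ** (C ** D)"
  "Trg (interchange A B C D) = (A ** C) ** (B ** D)"
  "Src plus_f = NN ** NN" "Trg plus_f = NN"
  "Src <|u, v|> = Src u" "Trg <|u, v|> = Trg u ** Trg v"
  "Src (nadd n m) = Src n" "Trg (nadd n m) = NN" "Src (nzero A) = A" "Trg (nzero A) = NN"
  "Src (over_pr u b) = slice_over u b" "Trg (over_pr u b) = Src u"
  "Src (under_pr b u) = slice_under b u" "Trg (under_pr b u) = Src u"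
  by (auto simp: to_pt_def obj_f_def prod_sf_def prj1_def prj2_def diag_def interchange_def plus_f_def
      pair_def nadd_def nzero_def over_pr_def under_pr_def Let_def)

lemma prod_Obj: "p \<in> Obj (A ** B) \<longleftrightarrow> (\<exists>x y. p = Pr x y \<and> x \<in> Obj A \<and> y \<in> Obj B)"
  and prod_Arr: "p \<in> Arr (A ** B) \<longleftrightarrow> (\<exists>f g. p = Pr f g \<and> f \<in> Arr A \<and> g \<in> Arr B)"
  by (auto simp: prod_s_def)

lemma prod_simps [simp]:
  "Pr x y \<in> Obj (A ** B) \<longleftrightarrow> x \<in> Obj A \<and> y \<in> Obj B"
  "Pr f g \<in> Arr (A ** B) \<longleftrightarrow> f \<in> Arr A \<and> g \<in> Arr B"
  "\<lbrakk>x \<in> Obj A; y \<in> Obj B\<rbrakk> \<Longrightarrow> Idt (A ** B) (Pr x y) = Pr (Idt A x) (Idt B y)"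
  "\<lbrakk>f \<in> Arr A; g \<in> Arr B\<rbrakk> \<Longrightarrow> Dom (A ** B) (Pr f g) = Pr (Dom A f) (Dom B g)"
  "\<lbrakk>f \<in> Arr A; g \<in> Arr B\<rbrakk> \<Longrightarrow> Cod (A ** B) (Pr f g) = Pr (Cod A f) (Cod B g)"
  by (auto simp: prod_s_def)

lemma prod_hom [simp]: "Pr f g \<in> hom (A ** B) (Pr x y) (Pr x' y') \<longleftrightarrow> f \<in> hom A x x' \<and> g \<in> hom B y y'"
  by (auto simp: prod_s_def mk_cat_hom hom_def)

lemma prod_homE:
  assumes "p \<in> hom (A ** B) x y"
  obtains f g where "p = Pr f g" "x = Pr (fs x) (sn x)" "y = Pr (fs y) (sn y)"
    "f \<in> hom A (fs x) (fs y)" "g \<in> hom B (sn x) (sn y)"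
proof -
  obtain f g where p: "p = Pr f g" "f \<in> Arr A" "g \<in> Arr B" "x = Pr (Dom A f) (Dom B g)" "y = Pr (Cod A f) (Cod B g)"
    using assms by (auto simp: prod_s_def mk_cat_hom)
  show thesis by (rule that[OF p(1)]) (use p in \<open>auto simp: hom_def\<close>)
qed

lemma prod_comp [simp]:
  "\<lbrakk>f \<in> Arr A; f' \<in> Arr A; g \<in> Arr B; g' \<in> Arr B; Dom A f' = Cod A f; Dom B g' = Cod B g\<rbrakk>
    \<Longrightarrow> Pr f' g' \<cdot>\<^bsub>A ** B\<^esub> Pr f g = Pr (f' \<cdot>\<^bsub>A\<^esub> f) (g' \<cdot>\<^bsub>B\<^esub> g)"
  by (auto simp: prod_s_def)

lemma prod_category:
  assumes "category A" "category B"
  shows "category (A ** B)"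
proof -
  interpret A: category A by fact
  interpret B: category B by fact
  have hA: "f \<in> Arr A \<Longrightarrow> f \<in> hom A (Dom A f) (Cod A f)" for f by (simp add: hom_def)
  have hB: "f \<in> Arr B \<Longrightarrow> f \<in> hom B (Dom B f) (Cod B f)" for f by (simp add: hom_def)
  show ?thesis unfolding prod_s_def
  proof (rule mk_cat_category, goal_cases)
    case (3 x) then show ?case using A.homD(1-3)[OF A.id_in] B.homD(1-3)[OF B.id_in] by (cases x) auto
  next
    case (4 p q)
    then obtain f g f' g' where p: "p = Pr f g" "q = Pr f' g'" "f \<in> Arr A" "g \<in> Arr B" "f' \<in> Arr A" "g' \<in> Arr B"
      "Dom A f' = Cod A f" "Dom B g' = Cod B g" by auto
    show ?case using p A.homD(1-3)[OF A.comp_in[OF hA hA[of f', unfolded p(7)]]]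
      B.homD(1-3)[OF B.comp_in[OF hB hB[of g', unfolded p(8)]]] by auto
  next
    case (7 p q r)
    then obtain f g f' g' f'' g'' where p: "p = Pr f g" "q = Pr f' g'" "r = Pr f'' g''"
      "f \<in> Arr A" "g \<in> Arr B" "f' \<in> Arr A" "g' \<in> Arr B" "f'' \<in> Arr A" "g'' \<in> Arr B"
      "Dom A f' = Cod A f" "Dom B g' = Cod B g" "Dom A f'' = Cod A f'" "Dom B g'' = Cod B g'" by auto
    show ?case using p A.assoc[OF hA hA[of f', unfolded p(10)] hA[of f'', unfolded p(12)]]
      B.assoc[OF hB hB[of g', unfolded p(11)] hB[of g'', unfolded p(13)]] by simp
  qed (auto simp: A.id_left A.id_right B.id_left B.id_right A.dom_in B.dom_in A.cod_in B.cod_in)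
qed

lemma pt_simps [simp]: "Obj pt = {Num 0}" "Arr pt = {Num 0}" "Idt pt (Num 0) = Num 0"
  "Dom pt (Num 0) = Num 0" "Cod pt (Num 0) = Num 0" "Num 0 \<cdot>\<^bsub>pt\<^esub> Num 0 = Num 0"
  by (auto simp: pt_def)

lemma pt_hom [simp]: "f \<in> hom pt x y \<longleftrightarrow> f = Num 0 \<and> x = Num 0 \<and> y = Num 0"
  by (auto simp: hom_def)

lemma pt_category: "category pt"
  unfolding pt_def by (rule mk_cat_category) auto

lemma NN_simps [simp]: "Obj NN = {Num 0}" "Arr NN = range Num" "Idt NN (Num 0) = Num 0"
  "Dom NN (Num k) = Num 0" "Cod NN (Num k) = Num 0" "Num l \<cdot>\<^bsub>NN\<^esub> Num k = Num (l + k)"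
  by (auto simp: NN_def)

lemma NN_hom [simp]: "f \<in> hom NN x y \<longleftrightarrow> f \<in> range Num \<and> x = Num 0 \<and> y = Num 0"
  by (auto simp: hom_def)

lemma NN_category: "category NN"
  unfolding NN_def by (rule mk_cat_category) auto

lemma small_cat_category [simp]: "small_cat A \<Longrightarrow> category A"
  unfolding small_cat_def by blast

lemma small_catI: "\<lbrakk>category A; |Arr A :: 'k univ set| <o |UNIV :: 'k set|\<rbrakk> \<Longrightarrow> small_cat A"
  unfolding small_cat_def by blast

lemma small_cat_card: "small_cat (A :: 'k scat) \<Longrightarrow> |Arr A| <o |UNIV :: 'k set|"
  unfolding small_cat_def by blast

lemma small_functor_functor [simp]: "small_functor u \<Longrightarrow> is_functor u"
  and small_functor_src [simp]: "small_functor u \<Longrightarrow> small_cat (Src u)"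
  and small_functor_trg [simp]: "small_functor u \<Longrightarrow> small_cat (Trg u)"
  unfolding small_functor_def by blast+

lemma small_functorI: "\<lbrakk>is_functor u; small_cat (Src u); small_cat (Trg u)\<rbrakk> \<Longrightarrow> small_functor u"
  unfolding small_functor_def by blast

lemma small_functor_obj [simp]: "\<lbrakk>small_functor u; x \<in> Obj (Src u)\<rbrakk> \<Longrightarrow> FObj u x \<in> Obj (Trg u)"
  and small_functor_arr [simp]: "\<lbrakk>small_functor u; f \<in> Arr (Src u)\<rbrakk> \<Longrightarrow> FArr u f \<in> Arr (Trg u)"
  and small_functor_dom [simp]: "\<lbrakk>small_functor u; f \<in> Arr (Src u)\<rbrakk>
    \<Longrightarrow> Dom (Trg u) (FArr u f) = FObj u (Dom (Src u) f)"
  and small_functor_cod [simp]: "\<lbrakk>small_functor u; f \<in> Arr (Src u)\<rbrakk>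
    \<Longrightarrow> Cod (Trg u) (FArr u f) = FObj u (Cod (Src u) f)"
  and small_functor_id [simp]: "\<lbrakk>small_functor u; x \<in> Obj (Src u)\<rbrakk>
    \<Longrightarrow> FArr u (Idt (Src u) x) = Idt (Trg u) (FObj u x)"
  using is_functor.obj_in[of u x] is_functor.arr_in'[of u] is_functor.pres_id[of u]
    is_functor.arr_in[of u f "Dom (Src u) f" "Cod (Src u) f"]
  by (auto simp: hom_def)

lemma small_functor_hom:
  "\<lbrakk>small_functor u; f \<in> hom (Src u) x y\<rbrakk> \<Longrightarrow> FArr u f \<in> hom (Trg u) (FObj u x) (FObj u y)"
  by (simp add: is_functor.arr_in)

lemma small_functor_comp:
  "\<lbrakk>small_functor u; f \<in> hom (Src u) x y; g \<in> hom (Src u) y z\<rbrakk>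
    \<Longrightarrow> FArr u (g \<cdot>\<^bsub>Src u\<^esub> f) = FArr u g \<cdot>\<^bsub>Trg u\<^esub> FArr u f"
  by (simp add: is_functor.pres_comp)

lemma small_functor_comp' [simp]:
  "\<lbrakk>small_functor u; f \<in> Arr (Src u); g \<in> Arr (Src u); Dom (Src u) g = Cod (Src u) f\<rbrakk>
    \<Longrightarrow> FArr u (g \<cdot>\<^bsub>Src u\<^esub> f) = FArr u g \<cdot>\<^bsub>Trg u\<^esub> FArr u f"
  by (rule small_functor_comp) (auto simp: hom_def)

lemma small_eqI:
  assumes "small_functor F" "small_functor G" "Src F = Src G" "Trg F = Trg G"
    and "\<And>x. x \<in> Obj (Src G) \<Longrightarrow> FObj F x = FObj G x" "\<And>f. f \<in> Arr (Src G) \<Longrightarrow> FArr F f = FArr G f"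
  shows "F = G"
  using assms by (intro fctr_eqI) auto

lemma small_id [simp]: "small_cat A \<Longrightarrow> small_functor (id_f A)"
  by (rule small_functorI) (simp_all add: id_f_functor)

lemma small_comp [simp]: "\<lbrakk>small_functor u; small_functor v; Src v = Trg u\<rbrakk> \<Longrightarrow> small_functor (v oo u)"
  by (rule small_functorI) (simp_all add: comp_f_functor)

lemma small_id_left [simp]: "small_functor u \<Longrightarrow> Trg u = A \<Longrightarrow> id_f A oo u = u"
  and small_id_right [simp]: "small_functor u \<Longrightarrow> Src u = A \<Longrightarrow> u oo id_f A = u"
  and small_assoc [simp]: "\<lbrakk>small_functor u; small_functor v; small_functor w; Src v = Trg u; Src w = Trg v\<rbrakk>
    \<Longrightarrow> (w oo v) oo u = w oo (v oo u)"
  by (simp_all add: comp_f_id_left comp_f_id_right comp_f_assoc)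

lemma Obj_card: "category A \<Longrightarrow> |Obj A| \<le>o |Arr A|"
proof -
  assume "category A"
  then interpret category A .
  have "inj_on (Idt A) (Obj A)" using homD(2)[OF id_in] by (metis inj_onI)
  moreover have "Idt A ` Obj A \<subseteq> Arr A" using homD(1)[OF id_in] by auto
  ultimately show ?thesis by (auto simp: card_of_ordLeq[symmetric])
qed

text \<open>Over- and under-slices share this construction; \<open>P\<close> stands for the
  commuting triangle, and the hypotheses say that such triangles contain identities and
  paste.\<close>

lemma slice_category:
  assumes "category A" "\<And>x. x \<in> Ob \<Longrightarrow> fs x \<in> Obj A \<and> P x x (Idt A (fs x))"
    and "\<And>x y z g h. \<lbrakk>x \<in> Ob; y \<in> Ob; z \<in> Ob; g \<in> hom A (fs x) (fs y); h \<in> hom A (fs y) (fs z); P x y g; P y z h\<rbrakk>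
      \<Longrightarrow> P x z (h \<cdot>\<^bsub>A\<^esub> g)"
  shows "category (slice_cat A Ob P)"
proof -
  interpret A: category A by fact
  show ?thesis unfolding slice_cat_def
  proof (rule mk_cat_category, goal_cases)
    case (3 x) then show ?case using assms(2) A.id_in by auto
  next
    case (4 f g) then show ?case using assms(3) A.comp_in by auto
  next
    case (5 f) then show ?case using A.idr by auto
  next
    case (6 f) then show ?case using A.idl by auto
  next
    case (7 f g h) then show ?case using A.assoc by auto
  qed auto
qed

lemma slice_simps [simp]:
  "Obj (slice_cat A Ob P) = Ob"
  "Pr (Pr x y) g \<in> Arr (slice_cat A Ob P) \<longleftrightarrow> x \<in> Ob \<and> y \<in> Ob \<and> g \<in> hom A (fs x) (fs y) \<and> P x y g"
  "x \<in> Ob \<Longrightarrow> Idt (slice_cat A Ob P) x = Pr (Pr x x) (Idt A (fs x))"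
  by (auto simp: slice_cat_def)

lemma slice_Arr: "p \<in> Arr (slice_cat A Ob P) \<longleftrightarrow>
    (\<exists>x y g. p = Pr (Pr x y) g \<and> x \<in> Ob \<and> y \<in> Ob \<and> g \<in> hom A (fs x) (fs y) \<and> P x y g)"
  by (auto simp: slice_cat_def)

lemma slice_hom: "p \<in> hom (slice_cat A Ob P) x y \<longleftrightarrow>
    (\<exists>g. p = Pr (Pr x y) g \<and> x \<in> Ob \<and> y \<in> Ob \<and> g \<in> hom A (fs x) (fs y) \<and> P x y g)"
  by (auto simp: slice_cat_def mk_cat_hom)

lemma slice_comp:
  "\<lbrakk>Pr (Pr x y) g \<in> Arr (slice_cat A Ob P); Pr (Pr y z) h \<in> Arr (slice_cat A Ob P)\<rbrakk>
    \<Longrightarrow> Pr (Pr y z) h \<cdot>\<^bsub>slice_cat A Ob P\<^esub> Pr (Pr x y) g = Pr (Pr x z) (h \<cdot>\<^bsub>A\<^esub> g)"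
  by (subst (asm) (1 2) slice_simps) (simp add: slice_cat_def)

lemma over_Obj [simp]: "x \<in> Obj (slice_over u b) \<longleftrightarrow>
    (\<exists>a f. x = Pr a f \<and> a \<in> Obj (Src u) \<and> f \<in> hom (Trg u) (FObj u a) b)"
  and over_hom: "p \<in> hom (slice_over u b) x y \<longleftrightarrow> x \<in> Obj (slice_over u b) \<and> y \<in> Obj (slice_over u b) \<and>
    (\<exists>g. p = Pr (Pr x y) g \<and> g \<in> hom (Src u) (fs x) (fs y) \<and> sn y \<cdot>\<^bsub>Trg u\<^esub> FArr u g = sn x)"
  and over_comp: "\<lbrakk>Pr (Pr x y) g \<in> Arr (slice_over u b); Pr (Pr y z) h \<in> Arr (slice_over u b)\<rbrakk>
    \<Longrightarrow> Pr (Pr y z) h \<cdot>\<^bsub>slice_over u b\<^esub> Pr (Pr x y) g = Pr (Pr x z) (h \<cdot>\<^bsub>Src u\<^esub> g)"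
  and over_id: "x \<in> Obj (slice_over u b) \<Longrightarrow> Idt (slice_over u b) x = Pr (Pr x x) (Idt (Src u) (fs x))"
  unfolding slice_over_def by (auto simp: slice_hom slice_comp)

lemma under_Obj [simp]: "x \<in> Obj (slice_under b u) \<longleftrightarrow>
    (\<exists>a f. x = Pr a f \<and> a \<in> Obj (Src u) \<and> f \<in> hom (Trg u) b (FObj u a))"
  and under_hom: "p \<in> hom (slice_under b u) x y \<longleftrightarrow> x \<in> Obj (slice_under b u) \<and> y \<in> Obj (slice_under b u) \<and>
    (\<exists>g. p = Pr (Pr x y) g \<and> g \<in> hom (Src u) (fs x) (fs y) \<and> FArr u g \<cdot>\<^bsub>Trg u\<^esub> sn x = sn y)"
  and under_comp: "\<lbrakk>Pr (Pr x y) g \<in> Arr (slice_under b u); Pr (Pr y z) h \<in> Arr (slice_under b u)\<rbrakk>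
    \<Longrightarrow> Pr (Pr y z) h \<cdot>\<^bsub>slice_under b u\<^esub> Pr (Pr x y) g = Pr (Pr x z) (h \<cdot>\<^bsub>Src u\<^esub> g)"
  and under_id: "x \<in> Obj (slice_under b u) \<Longrightarrow> Idt (slice_under b u) x = Pr (Pr x x) (Idt (Src u) (fs x))"
  unfolding slice_under_def by (auto simp: slice_hom slice_comp)

lemma over_category: assumes "is_functor u" shows "category (slice_over u b)"
proof -
  interpret u: is_functor u by fact
  show ?thesis unfolding slice_over_def
  proof (rule slice_category, goal_cases)
    case (3 x y z g h)
    then have "sn z \<in> hom (Trg u) (FObj u (fs z)) b" by auto
    from u.T.assoc[OF u.arr_in[OF 3(4)] u.arr_in[OF 3(5)] this] show ?case
      using 3 u.pres_comp[OF 3(4,5)] by simp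
  qed (auto simp: u.pres_id u.T.idr u.src_cat)
qed

lemma under_category: assumes "is_functor u" shows "category (slice_under b u)"
proof -
  interpret u: is_functor u by fact
  show ?thesis unfolding slice_under_def
  proof (rule slice_category, goal_cases)
    case (3 x y z g h)
    then have "sn x \<in> hom (Trg u) b (FObj u (fs x))" by auto
    from u.T.assoc[OF this u.arr_in[OF 3(4)] u.arr_in[OF 3(5)]] show ?case
      using 3 u.pres_comp[OF 3(4,5)] by simp
  qed (auto simp: u.pres_id u.T.idl u.src_cat)
qed

lemma over_pr_functor: assumes "is_functor u" shows "is_functor (over_pr u b)"
proof -
  interpret u: is_functor u by fact
  interpret S: category "slice_over u b" by (rule over_category) fact
  show ?thesis unfolding over_pr_def
  proof (rule mk_fctrI, goal_cases)
    case (6 f g x y z)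
    obtain g' f' where e: "f = Pr (Pr x y) f'" "g = Pr (Pr y z) g'" using 6 by (auto simp: over_hom)
    show ?case using over_comp[of x y f' u b z g'] S.homD(1)[OF 6(1)] S.homD(1)[OF 6(2)] e by simp
  qed (auto simp: over_hom over_id u.src_cat S.category_axioms)
qed

lemma under_pr_functor: assumes "is_functor u" shows "is_functor (under_pr b u)"
proof -
  interpret u: is_functor u by fact
  interpret S: category "slice_under b u" by (rule under_category) fact
  show ?thesis unfolding under_pr_def
  proof (rule mk_fctrI, goal_cases)
    case (6 f g x y z)
    obtain g' f' where e: "f = Pr (Pr x y) f'" "g = Pr (Pr y z) g'" using 6 by (auto simp: under_hom)
    show ?case using under_comp[of x y f' b u z g'] S.homD(1)[OF 6(1)] S.homD(1)[OF 6(2)] e by simp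
  qed (auto simp: under_hom under_id u.src_cat S.category_axioms)
qed

text \<open>The size hypothesis: \<open>NN\<close> is countably infinite and must have strictly
  fewer arrows than \<open>'k\<close> has elements. The parameter \<open>ty\<close> only fixes the
  type.\<close>

locale big =
  fixes ty :: "'k itself"
  assumes unc: "uncountable (UNIV :: 'k set)"
begin

text \<open>A product is dominated by the square of its larger factor; an infinite set is equipotent
  to its square, and a finite square lies below the infinite type \<open>'k\<close>.\<close>

lemma small_times:
  assumes "|A| <o |UNIV :: 'k set|" "|B| <o |UNIV :: 'k set|"
  shows "|A \<times> B| <o |UNIV :: 'k set|"
proof -
  have inf: "infinite (UNIV :: 'k set)" using unc countable_finite by blast
  have *: "|C \<times> C| <o |UNIV :: 'k set|" if "|C| <o |UNIV :: 'k set|" for C :: "'z set"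
  proof (cases "finite C")
    case True
    then show ?thesis using finite_ordLess_infinite[OF card_of_Well_order card_of_Well_order, of "C \<times> C" "UNIV :: 'k set"] inf
      by (simp add: Field_card_of)
  next
    case False
    then show ?thesis using card_of_Times_same_infinite that ordIso_ordLess_trans by blast
  qed
  show ?thesis
  proof (cases "|A| \<le>o |B|")
    case True
    then have "|A \<times> B| \<le>o |B \<times> B|" by (rule card_of_Times_mono1)
    then show ?thesis using *[OF assms(2)] ordLeq_ordLess_trans by blast
  next
    case False
    then have "|B| \<le>o |A|" using ordLeq_total[OF card_of_Well_order card_of_Well_order, of A B] by blast
    then have "|A \<times> B| \<le>o |A \<times> A|" by (rule card_of_Times_mono2)
    then show ?thesis using *[OF assms(1)] ordLeq_ordLess_trans by blast
  qed
qed

lemma small_countable: "countable A \<Longrightarrow> |A| <o |UNIV :: 'k set|"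
proof (rule ccontr)
  assume A: "countable A" and "\<not> |A| <o |UNIV :: 'k set|"
  then have "|UNIV :: 'k set| \<le>o |A|"
    using not_ordLess_iff_ordLeq[OF card_of_Well_order card_of_Well_order] by blast
  then obtain f :: "'k \<Rightarrow> _" where "inj_on f UNIV" "f ` UNIV \<subseteq> A"
    using card_of_ordLeq[of "UNIV :: 'k set" A] by blast
  then show False using A unc countable_image_inj_on[of f UNIV] countable_subset by metis
qed

lemma small_subset_image:
  assumes "|B| <o |UNIV :: 'k set|" "A \<subseteq> f ` B" shows "|A| <o |UNIV :: 'k set|"
  using assms surj_imp_ordLeq ordLeq_ordLess_trans by blast

lemma small_prod [simp]: "\<lbrakk>small_cat (A :: 'k scat); small_cat B\<rbrakk> \<Longrightarrow> small_cat (A ** B)"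
proof -
  assume A: "small_cat A" and B: "small_cat B"
  have "|Arr A \<times> Arr B| <o |UNIV :: 'k set|" using small_times small_cat_card A B by blast
  moreover have "Arr (A ** B) \<subseteq> (\<lambda>(f, g). Pr f g) ` (Arr A \<times> Arr B)" by (auto simp: prod_Arr)
  ultimately have "|Arr (A ** B)| <o |UNIV :: 'k set|" by (rule small_subset_image)
  then show ?thesis using A B by (intro small_catI prod_category) auto
qed

lemma small_pt [simp]: "small_cat (pt :: 'k scat)" and small_NN [simp]: "small_cat (NN :: 'k scat)"
  by (auto simp: pt_category NN_category intro!: small_countable small_catI)

text \<open>A slice arrow is encoded by its endpoints and its underlying arrow, so a product of
  three small sets covers all of them.\<close>

lemma small_slice:
  assumes "small_cat A" "|Ob| <o |UNIV :: 'k set|"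
  shows "|Arr (slice_cat A Ob P :: 'k scat)| <o |UNIV :: 'k set|"
proof (rule small_subset_image)
  show "|(Ob \<times> Ob) \<times> Arr A| <o |UNIV :: 'k set|"
    using assms by (intro small_times small_cat_card) auto
  show "Arr (slice_cat A Ob P) \<subseteq> (\<lambda>((x, y), g). Pr (Pr x y) g) ` ((Ob \<times> Ob) \<times> Arr A)"
  proof
    fix p assume "p \<in> Arr (slice_cat A Ob P)"
    then obtain x y g where "p = Pr (Pr x y) g" "x \<in> Ob" "y \<in> Ob" "g \<in> Arr A"
      unfolding slice_Arr hom_def by blast
    then show "p \<in> (\<lambda>((x, y), g). Pr (Pr x y) g) ` ((Ob \<times> Ob) \<times> Arr A)"
      by (intro image_eqI[of _ _ "((x, y), g)"]) auto
  qed
qed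

lemma small_hom_pairs:
  assumes "small_functor (u :: 'k sfun)" "Ob \<subseteq> (\<lambda>(a, f). Pr a f) ` (Obj (Src u) \<times> Arr (Trg u))"
  shows "|Ob| <o |UNIV :: 'k set|"
proof (rule small_subset_image[OF _ assms(2)])
  show "|Obj (Src u) \<times> Arr (Trg u)| <o |UNIV :: 'k set|"
    using assms(1) by (intro small_times ordLeq_ordLess_trans[OF Obj_card small_cat_card] small_cat_card) auto
qed

lemma small_over [simp]: "small_functor (u :: 'k sfun) \<Longrightarrow> small_cat (slice_over u b)"
proof -
  assume u: "small_functor u"
  have "|Arr (slice_over u b)| <o |UNIV :: 'k set|" unfolding slice_over_def
    by (rule small_slice[OF _ small_hom_pairs[OF u]]) (use u in \<open>auto simp: hom_def\<close>)
  then show ?thesis using u by (intro small_catI over_category) auto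
qed

lemma small_under [simp]: "small_functor (u :: 'k sfun) \<Longrightarrow> small_cat (slice_under b u)"
proof -
  assume u: "small_functor u"
  have "|Arr (slice_under b u)| <o |UNIV :: 'k set|" unfolding slice_under_def
    by (rule small_slice[OF _ small_hom_pairs[OF u]]) (use u in \<open>auto simp: hom_def\<close>)
  then show ?thesis using u by (intro small_catI under_category) auto
qed

lemma small_over_pr [simp]: "small_functor (u :: 'k sfun) \<Longrightarrow> small_functor (over_pr u b)"
  and small_under_pr [simp]: "small_functor (u :: 'k sfun) \<Longrightarrow> small_functor (under_pr b u)"
  by (auto intro!: small_functorI over_pr_functor under_pr_functor)

lemma small_mk:
  assumes "small_cat A" "small_cat B" "\<And>x. x \<in> Obj A \<Longrightarrow> p x \<in> Obj B"
    and "\<And>f. f \<in> Arr A \<Longrightarrow> q f \<in> Arr B \<and> Dom B (q f) = p (Dom A f) \<and> Cod B (q f) = p (Cod A f)"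
    and "\<And>x. x \<in> Obj A \<Longrightarrow> q (Idt A x) = Idt B (p x)"
    and "\<And>f g. \<lbrakk>f \<in> Arr A; g \<in> Arr A; Dom A g = Cod A f\<rbrakk> \<Longrightarrow> q (g \<cdot>\<^bsub>A\<^esub> f) = q g \<cdot>\<^bsub>B\<^esub> q f"
  shows "small_functor (mk_fctr A B p q :: 'k sfun)"
  using assms by (auto intro!: small_functorI mk_fctrI simp: hom_def)

lemma small_pair [simp]:
  assumes "small_functor (u :: 'k sfun)" "small_functor v" "Src v = Src u"
  shows "small_functor <|u, v|>"
proof -
  have [simp]: "FArr v (Idt (Src u) x) = Idt (Trg v) (FObj v x)" "Dom (Trg v) (FArr v f) = FObj v (Dom (Src u) f)"
    "Cod (Trg v) (FArr v f) = FObj v (Cod (Src u) f)" if "x \<in> Obj (Src u)" "f \<in> Arr (Src u)" for x f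
    using small_functor_id[of v] small_functor_dom[of v] small_functor_cod[of v] assms that by auto
  have "FArr v (Idt (Src u) x) = Idt (Trg v) (FObj v x)" if "x \<in> Obj (Src u)" for x
    using small_functor_id[of v] assms that by auto
  moreover have "FArr v (g \<cdot>\<^bsub>Src u\<^esub> f) = FArr v g \<cdot>\<^bsub>Trg v\<^esub> FArr v f"
    if "f \<in> Arr (Src u)" "g \<in> Arr (Src u)" "Dom (Src u) g = Cod (Src u) f" for f g
    using small_functor_comp'[of v f g] assms that by auto
  moreover have "Dom (Trg v) (FArr v f) = FObj v (Dom (Src u) f)"
    "Cod (Trg v) (FArr v f) = FObj v (Cod (Src u) f)" if "f \<in> Arr (Src u)" for f
    using small_functor_dom[of v] small_functor_cod[of v] assms that by auto
  ultimately show ?thesis unfolding pair_def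
    using assms small_functor_obj[of v] small_functor_arr[of v] by (intro small_mk) auto
qed

lemma small_prj [simp]:
  assumes "small_cat (A :: 'k scat)" "small_cat B"
  shows "small_functor (prj1 A B)" "small_functor (prj2 A B)"
  unfolding prj1_def prj2_def using assms by (auto intro!: small_mk simp: prod_Obj prod_Arr)

lemma small_to_pt [simp]: "small_cat (A :: 'k scat) \<Longrightarrow> small_functor (to_pt A)"
  unfolding to_pt_def by (rule small_mk) (auto simp: category.dom_in)

lemma small_obj_f [simp]: "\<lbrakk>small_cat (A :: 'k scat); a \<in> Obj A\<rbrakk> \<Longrightarrow> small_functor (obj_f A a)"
  unfolding obj_f_def using category.homD[OF _ category.id_in, of A a] category.idl[OF _ category.id_in, of A a]
  by (intro small_mk) auto

lemma small_nzero [simp]: "small_cat (A :: 'k scat) \<Longrightarrow> small_functor (nzero A)"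
  unfolding nzero_def by (rule small_mk) auto

lemma NN_arr:
  assumes "small_functor (n :: 'k sfun)" "Trg n = NN" "f \<in> Arr (Src n)"
  shows "FArr n f = Num (nm (FArr n f))"
  using small_functor_arr[OF assms(1,3)] assms(2) by auto

lemma NN_obj: "\<lbrakk>small_functor (n :: 'k sfun); Trg n = NN; x \<in> Obj (Src n)\<rbrakk> \<Longrightarrow> FObj n x = Num 0"
  using small_functor_obj[of n x] by auto

lemma nm_id: "\<lbrakk>small_functor (n :: 'k sfun); Trg n = NN; x \<in> Obj (Src n)\<rbrakk> \<Longrightarrow> nm (FArr n (Idt (Src n) x)) = 0"
  by (simp add: NN_obj)

lemma nm_comp: "\<lbrakk>small_functor (n :: 'k sfun); Trg n = NN; f \<in> Arr (Src n); g \<in> Arr (Src n); Dom (Src n) g = Cod (Src n) f\<rbrakk>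
    \<Longrightarrow> nm (FArr n (g \<cdot>\<^bsub>Src n\<^esub> f)) = nm (FArr n g) + nm (FArr n f)"
proof -
  assume a: "small_functor n" "Trg n = NN" "f \<in> Arr (Src n)" "g \<in> Arr (Src n)" "Dom (Src n) g = Cod (Src n) f"
  obtain k l where "FArr n f = Num k" "FArr n g = Num l"
    using small_functor_arr[OF a(1,3)] small_functor_arr[OF a(1,4)] a(2) by auto
  then show ?thesis using small_functor_comp'[OF a(1,3,4,5)] a(2) by simp
qed

lemma small_nadd [simp]:
  assumes "small_functor (n :: 'k sfun)" "small_functor m" "Src m = Src n" "Trg n = NN" "Trg m = NN"
  shows "small_functor (nadd n m)"
  unfolding nadd_def
proof (rule small_mk, goal_cases)
  case (5 x) then show ?case using assms nm_id[of n x] nm_id[of m x] by simp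
next
  case (6 f g) then show ?case using assms nm_comp[of n f g] nm_comp[of m f g] by simp
qed (use assms in auto)

subsection \<open>Equations between functors\<close>

lemma pair_apply [simp]:
  "x \<in> Obj (Src u) \<Longrightarrow> FObj <|u, v|> x = Pr (FObj u x) (FObj v x)"
  "f \<in> Arr (Src u) \<Longrightarrow> FArr <|u, v|> f = Pr (FArr u f) (FArr v f)"
  by (simp_all add: pair_def)

lemma prj_apply [simp]:
  "\<lbrakk>x \<in> Obj A; y \<in> Obj B\<rbrakk> \<Longrightarrow> FObj (prj1 A B) (Pr x y) = x"
  "\<lbrakk>x \<in> Obj A; y \<in> Obj B\<rbrakk> \<Longrightarrow> FObj (prj2 A B) (Pr x y) = y"
  "\<lbrakk>f \<in> Arr A; g \<in> Arr B\<rbrakk> \<Longrightarrow> FArr (prj1 A B) (Pr f g) = f"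
  "\<lbrakk>f \<in> Arr A; g \<in> Arr B\<rbrakk> \<Longrightarrow> FArr (prj2 A B) (Pr f g) = g"
  by (simp_all add: prj1_def prj2_def)

lemma prod_sf_apply [simp]:
  "\<lbrakk>x \<in> Obj (Src u); y \<in> Obj (Src v)\<rbrakk> \<Longrightarrow> FObj (u *** v) (Pr x y) = Pr (FObj u x) (FObj v y)"
  "\<lbrakk>f \<in> Arr (Src u); g \<in> Arr (Src v)\<rbrakk> \<Longrightarrow> FArr (u *** v) (Pr f g) = Pr (FArr u f) (FArr v g)"
  by (simp_all add: prod_sf_def)

lemma const_apply [simp]:
  "x \<in> Obj A \<Longrightarrow> FObj (to_pt A) x = Num 0" "f \<in> Arr A \<Longrightarrow> FArr (to_pt A) f = Num 0"
  "FObj (obj_f A a) (Num 0) = a" "FArr (obj_f A a) (Num 0) = Idt A a"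
  "x \<in> Obj A \<Longrightarrow> FObj (nzero A) x = Num 0" "f \<in> Arr A \<Longrightarrow> FArr (nzero A) f = Num 0"
  "x \<in> Obj (Src n) \<Longrightarrow> FObj (nadd n m) x = Num 0"
  "f \<in> Arr (Src n) \<Longrightarrow> FArr (nadd n m) f = Num (nm (FArr n f) + nm (FArr m f))"
  by (simp_all add: to_pt_def obj_f_def nzero_def nadd_def)

lemma over_pr_apply [simp]:
  "x \<in> Obj (slice_over u b) \<Longrightarrow> FObj (over_pr u b) x = fs x"
  "f \<in> Arr (slice_over u b) \<Longrightarrow> FArr (over_pr u b) f = sn f"
  "x \<in> Obj (slice_under b u) \<Longrightarrow> FObj (under_pr b u) x = fs x"
  "f \<in> Arr (slice_under b u) \<Longrightarrow> FArr (under_pr b u) f = sn f"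
  by (simp_all add: over_pr_def under_pr_def del: over_Obj under_Obj)

lemma plus_apply [simp]:
  "x \<in> Obj (NN ** NN) \<Longrightarrow> FObj plus_f x = Num 0"
  "f \<in> Arr (NN ** NN) \<Longrightarrow> FArr plus_f f = Num (nm (fs f) + nm (sn f))"
  by (simp_all add: plus_f_def)

lemma interchange_apply [simp]:
  "\<lbrakk>x \<in> Obj A; y \<in> Obj B; z \<in> Obj C; w \<in> Obj D\<rbrakk>
    \<Longrightarrow> FObj (interchange A B C D) (Pr (Pr x y) (Pr z w)) = Pr (Pr x z) (Pr y w)"
  "\<lbrakk>f \<in> Arr A; g \<in> Arr B; h \<in> Arr C; k \<in> Arr D\<rbrakk>
    \<Longrightarrow> FArr (interchange A B C D) (Pr (Pr f g) (Pr h k)) = Pr (Pr f h) (Pr g k)"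
  by (simp_all add: interchange_def Let_def)

lemma prod_sf_eq: "small_functor (u :: 'k sfun) \<Longrightarrow> small_functor v \<Longrightarrow>
    u *** v = <|u oo prj1 (Src u) (Src v), v oo prj2 (Src u) (Src v)|>"
  unfolding prod_sf_def pair_def by (rule mk_fctr_cong) (auto simp: prod_Obj prod_Arr)

lemma diag_eq: "diag (A :: 'k scat) = <|id_f A, id_f A|>"
  unfolding diag_def pair_def by (rule mk_fctr_cong) auto

lemma interchange_eq:
  assumes "small_cat (A :: 'k scat)" "small_cat B" "small_cat C" "small_cat D"
  shows "interchange A B C D =
    <|<|prj1 A B oo prj1 (A ** B) (C ** D), prj1 C D oo prj2 (A ** B) (C ** D)|>,
     <|prj2 A B oo prj1 (A ** B) (C ** D), prj2 C D oo prj2 (A ** B) (C ** D)|>|>"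
  unfolding interchange_def Let_def pair_def[of "<|_, _|>"] by (rule mk_fctr_cong) (auto simp: prod_Obj prod_Arr)

lemma plus_eq: "plus_f = nadd (prj1 NN NN :: 'k sfun) (prj2 NN NN)"
  unfolding plus_f_def nadd_def by (rule mk_fctr_cong) (auto simp: prod_Obj prod_Arr)

lemma small_prod_sf [simp]: "\<lbrakk>small_functor (u :: 'k sfun); small_functor v\<rbrakk> \<Longrightarrow> small_functor (u *** v)"
  by (simp add: prod_sf_eq)

lemma small_diag [simp]: "small_cat (A :: 'k scat) \<Longrightarrow> small_functor (diag A)"
  by (simp add: diag_eq)

lemma small_interchange [simp]: "\<lbrakk>small_cat (A :: 'k scat); small_cat B; small_cat C; small_cat D\<rbrakk>
    \<Longrightarrow> small_functor (interchange A B C D)"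
  by (simp add: interchange_eq)

lemma small_plus [simp]: "small_functor (plus_f :: 'k sfun)"
  by (simp add: plus_eq)

lemma prj_pair [simp]:
  assumes "small_functor (u :: 'k sfun)" "small_functor v" "Src v = Src u" "Trg u = B" "Trg v = C"
  shows "prj1 B C oo <|u, v|> = u" "prj2 B C oo <|u, v|> = v"
  using assms small_functor_obj[of v] small_functor_arr[of v]
  by (auto intro!: small_eqI)

lemma prj_pair_comp [simp]:
  assumes "small_functor (u :: 'k sfun)" "small_functor v" "Src v = Src u" "Trg u = B" "Trg v = C"
    "small_functor k" "Trg k = Src u"
  shows "prj1 B C oo (<|u, v|> oo k) = u oo k" "prj2 B C oo (<|u, v|> oo k) = v oo k"
  using assms small_assoc[of k "<|u, v|>" "prj1 B C"] small_assoc[of k "<|u, v|>" "prj2 B C"] by auto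

lemma pair_comp [simp]:
  assumes "small_functor (u :: 'k sfun)" "small_functor v" "Src v = Src u" "small_functor k" "Trg k = Src u"
  shows "<|u, v|> oo k = <|u oo k, v oo k|>"
  using assms small_functor_obj[of k] small_functor_arr[of k] by (intro small_eqI) auto

lemma pair_eta: "\<lbrakk>small_functor (k :: 'k sfun); Trg k = A ** B; small_cat A; small_cat B\<rbrakk>
    \<Longrightarrow> <|prj1 A B oo k, prj2 A B oo k|> = k"
  using small_functor_obj[of k] small_functor_arr[of k]
  by (intro small_eqI) (auto simp: prod_Obj prod_Arr, force+)

lemma pair_prj [simp]: "\<lbrakk>small_cat (A :: 'k scat); small_cat B\<rbrakk> \<Longrightarrow> <|prj1 A B, prj2 A B|> = id_f (A ** B)"
  using pair_eta[of "id_f (A ** B)" A B] by simp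

lemma prj_prod [simp]:
  assumes "small_functor (u :: 'k sfun)" "small_functor v" "Trg u = B" "Trg v = C"
  shows "prj1 B C oo (u *** v) = u oo prj1 (Src u) (Src v)" "prj2 B C oo (u *** v) = v oo prj2 (Src u) (Src v)"
  using assms by (simp_all add: prod_sf_eq)

lemma prod_pair [simp]:
  assumes "small_functor (u :: 'k sfun)" "small_functor v" "small_functor f" "small_functor g"
    "Src v = Src u" "Src f = Trg u" "Src g = Trg v"
  shows "(f *** g) oo <|u, v|> = <|f oo u, g oo v|>"
  using assms by (simp add: prod_sf_eq)

lemma prod_comp_sf: assumes "small_functor (u :: 'k sfun)" "small_functor v" "small_functor f" "small_functor g"
    "Src f = Trg u" "Src g = Trg v"
  shows "(f *** g) oo (u *** v) = (f oo u) *** (g oo v)"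
  using assms by (simp add: prod_sf_eq)

lemma prod_id [simp]: "\<lbrakk>small_cat (A :: 'k scat); small_cat B\<rbrakk> \<Longrightarrow> id_f A *** id_f B = id_f (A ** B)"
  by (simp add: prod_sf_eq)

lemma diag_comp [simp]: "\<lbrakk>small_functor (u :: 'k sfun); Trg u = A\<rbrakk> \<Longrightarrow> diag A oo u = <|u, u|>"
  by (auto simp: diag_eq)

lemma interchange_pair [simp]:
  assumes "small_functor (a :: 'k sfun)" "small_functor b" "small_functor c" "small_functor d"
    "Src b = Src a" "Src c = Src a" "Src d = Src a" "Trg a = A" "Trg b = B" "Trg c = C" "Trg d = D"
  shows "interchange A B C D oo <|<|a, b|>, <|c, d|>|> = <|<|a, c|>, <|b, d|>|>"
  using assms small_functor_trg by (auto simp: interchange_eq)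

lemma nadd_comp [simp]:
  assumes "small_functor (n :: 'k sfun)" "small_functor m" "Src m = Src n" "Trg n = NN" "Trg m = NN"
    "small_functor k" "Trg k = Src n"
  shows "nadd n m oo k = nadd (n oo k) (m oo k)"
  using assms small_functor_obj[of k] small_functor_arr[of k] by (intro small_eqI) auto

lemma plus_pair [simp]:
  assumes "small_functor (n :: 'k sfun)" "small_functor m" "Src m = Src n" "Trg n = NN" "Trg m = NN"
  shows "plus_f oo <|n, m|> = nadd n m"
  using assms by (simp add: plus_eq)

lemma to_pt_unique: "\<lbrakk>small_functor (u :: 'k sfun); Trg u = pt\<rbrakk> \<Longrightarrow> u = to_pt (Src u)"
  using small_functor_obj[of u] small_functor_arr[of u] by (intro small_eqI) auto

lemma to_pt_comp [simp]: "\<lbrakk>small_functor (u :: 'k sfun); Trg u = A\<rbrakk> \<Longrightarrow> to_pt A oo u = to_pt (Src u)"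
  using to_pt_unique[of "to_pt A oo u"] by auto

lemma to_pt_pt [simp]: "to_pt pt = (id_f pt :: 'k sfun)"
  using to_pt_unique[of "id_f pt"] by simp

lemma nzero_comp [simp]: "\<lbrakk>small_functor (u :: 'k sfun); Trg u = A\<rbrakk> \<Longrightarrow> nzero A oo u = nzero (Src u)"
  using small_functor_obj[of u] small_functor_arr[of u] by (intro small_eqI) auto

text \<open>The composite of the point \<open>i\<close> with the projection to \<open>pt\<close> is
  the zero functor; this is why the unit element lies over degree 0 at every stage.\<close>

lemma nzero_eq: "small_cat (A :: 'k scat) \<Longrightarrow> obj_f NN (Num 0) oo to_pt A = nzero A"
  by (intro small_eqI) auto

lemma nadd_assoc [simp]:
  assumes "small_functor (n :: 'k sfun)" "small_functor m" "small_functor l" "Src m = Src n" "Src l = Src n"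
    "Trg n = NN" "Trg m = NN" "Trg l = NN"
  shows "nadd (nadd n m) l = nadd n (nadd m l)"
  unfolding nadd_def[of "nadd n m"] nadd_def[of n "nadd m l"] using assms by (intro mk_fctr_cong) auto

lemma nadd_zero [simp]:
  assumes "small_functor (n :: 'k sfun)" "Src n = A" "Trg n = NN"
  shows "nadd (nzero A) n = n" "nadd n (nzero A) = n"
  using assms by (auto intro!: small_eqI simp: NN_obj NN_arr[symmetric])

lemma obj_f_comp: "\<lbrakk>small_functor (u :: 'k sfun); a \<in> Obj (Src u)\<rbrakk> \<Longrightarrow> u oo obj_f (Src u) a = obj_f (Trg u) (FObj u a)"
  by (intro small_eqI) auto

lemma small_const [simp]: "\<lbrakk>small_cat (A :: 'k scat); small_cat B; b \<in> Obj B\<rbrakk> \<Longrightarrow> small_functor (const_f A B b)"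
  by (simp add: const_f_def)

lemma const_f_simps [simp]: "Src (const_f A B b) = A" "Trg (const_f A B b) = B"
  "x \<in> Obj A \<Longrightarrow> FObj (const_f A B b) x = b" "f \<in> Arr A \<Longrightarrow> FArr (const_f A B b) f = Idt B b"
  by (simp_all add: const_f_def)

end

subsection \<open>Small transformations\<close>

lemma small_transD:
  assumes "small_trans \<alpha>"
  shows "nat_trans \<alpha>" "small_functor (NSrc \<alpha>)" "small_functor (NTrg \<alpha>)"
    "Src (NTrg \<alpha>) = Src (NSrc \<alpha>)" "Trg (NTrg \<alpha>) = Trg (NSrc \<alpha>)"
  using assms nat_trans.src_eq nat_trans.trg_eq unfolding small_trans_def by auto

lemma small_transI:
  assumes "small_functor F" "small_functor G" "Src G = Src F" "Trg G = Trg F"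
    and "\<And>x. x \<in> Obj (Src F) \<Longrightarrow> c x \<in> hom (Trg F) (FObj F x) (FObj G x)"
    and "\<And>f x y. f \<in> hom (Src F) x y \<Longrightarrow> c y \<cdot>\<^bsub>Trg F\<^esub> FArr F f = FArr G f \<cdot>\<^bsub>Trg F\<^esub> c x"
  shows "small_trans (mk_ntrans F G c)"
  unfolding small_trans_def using assms by (auto intro!: mk_ntransI)

lemma small_trans_eqI:
  "\<lbrakk>small_trans \<alpha>; small_trans \<beta>; NSrc \<alpha> = NSrc \<beta>; NTrg \<alpha> = NTrg \<beta>; 
    \<And>x. x \<in> Obj (Src (NSrc \<beta>)) \<Longrightarrow> Cpt \<alpha> x = Cpt \<beta> x\<rbrakk> \<Longrightarrow> \<alpha> = \<beta>"
  by (rule ntrans_eqI) (auto dest: small_transD)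

lemma small_id_n [simp]: "small_functor u \<Longrightarrow> small_trans (id_n u)"
  unfolding small_trans_def by (simp add: id_n_trans)

lemma small_vcomp [simp]: "\<lbrakk>small_trans \<alpha>; small_trans \<beta>; NSrc \<beta> = NTrg \<alpha>\<rbrakk> \<Longrightarrow> small_trans (vcomp \<beta> \<alpha>)"
  using vcomp_trans unfolding small_trans_def by auto

lemma small_hcomp [simp]: "\<lbrakk>small_trans \<alpha>; small_trans \<beta>; Src (NSrc \<beta>) = Trg (NSrc \<alpha>)\<rbrakk> \<Longrightarrow> small_trans (hcomp \<beta> \<alpha>)"
  using hcomp_trans small_transD[of \<alpha>] small_transD[of \<beta>] unfolding small_trans_def by auto

lemma over_cell_simps [simp]:
  "NSrc (over_cell u b) = u oo over_pr u b" "NTrg (over_cell u b) = obj_f (Trg u) b oo to_pt (slice_over u b)"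
  "x \<in> Obj (slice_over u b) \<Longrightarrow> Cpt (over_cell u b) x = sn x"
  by (auto simp: over_cell_def)

lemma under_cell_simps [simp]:
  "NTrg (under_cell b u) = u oo under_pr b u" "NSrc (under_cell b u) = obj_f (Trg u) b oo to_pt (slice_under b u)"
  "x \<in> Obj (slice_under b u) \<Longrightarrow> Cpt (under_cell b u) x = sn x"
  by (auto simp: under_cell_def)

context big
begin

lemma small_over_cell [simp]:
  assumes u: "small_functor (u :: 'k sfun)" and b: "b \<in> Obj (Trg u)"
  shows "small_trans (over_cell u b)"
proof -
  interpret T: category "Trg u" using u by simp
  interpret S: category "slice_over u b" using u by (simp add: over_category)
  show ?thesis unfolding over_cell_def
  proof (rule small_transI, goal_cases)
    case (6 f x y)
    then have "f \<in> hom (slice_over u b) x y" by simp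
    from S.homD[OF this] this show ?case using T.idl[of "sn x"] by (auto simp: over_hom)
  qed (use u b in auto)
qed

lemma small_under_cell [simp]:
  assumes u: "small_functor (u :: 'k sfun)" and b: "b \<in> Obj (Trg u)"
  shows "small_trans (under_cell b u)"
proof -
  interpret T: category "Trg u" using u by simp
  interpret S: category "slice_under b u" using u by (simp add: under_category)
  show ?thesis unfolding under_cell_def
  proof (rule small_transI, goal_cases)
    case (6 f x y)
    then have "f \<in> hom (slice_under b u) x y" by simp
    from S.homD[OF this] this show ?case using T.idr[of "sn y"] by (auto simp: under_hom)
  qed (use u b in auto)
qed

end

section \<open>Arrows over a functor\<close>

text \<open>An element of \<open>H D u X Y\<close> is an arrow \<open>X \<rightarrow> Y\<close> over \<open>u\<close> in the Grothendieck construction of \<open>D\<close>.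
  Since \<open>D\<close> is strict, \<open>H D (v \<circ> u) X Z = H D u X (v\<^sup>* Z)\<close>: factoring through a cartesian arrow does not
  change the underlying arrow.\<close>

definition H :: "('k, 'o, 'm) pder \<Rightarrow> 'k sfun \<Rightarrow> 'o \<Rightarrow> 'o \<Rightarrow> 'm set" where
  "H D u X Y = {f. small_functor u \<and> Y \<in> Obj (DC D (Trg u)) \<and> f \<in> hom (DC D (Src u)) X (pbO D u Y)}"

text \<open>Composition in the Grothendieck construction. The functor over which \<open>g\<close>
  lies does not occur in the formula, so the same operation serves for fibre arrows and for arrows
  over any further functor.\<close>

definition cmp :: "('k, 'o, 'm) pder \<Rightarrow> 'k sfun \<Rightarrow> 'm \<Rightarrow> 'm \<Rightarrow> 'm" where
  "cmp D u g f = pbA D u g \<cdot>\<^bsub>DC D (Src u)\<^esub> f"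

text \<open>Only factorisations over \<open>u\<close> itself are demanded. Those over a composite
  \<open>v oo u\<close> follow, because an arrow to \<open>Z'\<close> over \<open>v oo u\<close> is
  an arrow to \<open>v^* Z'\<close> over \<open>u\<close>.\<close>

definition opc :: "('k, 'o, 'm) pder \<Rightarrow> 'k sfun \<Rightarrow> 'o \<Rightarrow> 'o \<Rightarrow> 'm \<Rightarrow> bool" where
  "opc D u X Z f \<longleftrightarrow> f \<in> H D u X Z \<and>
     (\<forall>Z' g. g \<in> H D u X Z' \<longrightarrow> (\<exists>!h. h \<in> hom (DC D (Trg u)) Z Z' \<and> cmp D u h f = g))"

locale pd = prederivator D + big "TYPE('k)" for D :: "('k, 'o, 'm) pder"
begin

abbreviation "ob A \<equiv> Obj (DC D A)"
abbreviation "ar A \<equiv> Arr (DC D A)"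
abbreviation "hm A \<equiv> hom (DC D A)"
abbreviation "idt A \<equiv> Idt (DC D A)"
abbreviation "isoin A \<equiv> iso_in (DC D A)"
abbreviation "pb \<equiv> pbO D"
abbreviation "pa \<equiv> pbA D"
abbreviation "cm \<equiv> cmp D"
abbreviation dcomp (\<open>(_ \<cdot>[_] _)\<close> [66, 0, 65] 65) where "g \<cdot>[A] f \<equiv> g \<cdot>\<^bsub>DC D A\<^esub> f"

lemma DC_cat' [simp]: "small_cat A \<Longrightarrow> category (DC D A)"
  by (rule DC_cat)

lemma DF_src' [simp]: "small_functor u \<Longrightarrow> Src (DF D u) = DC D (Trg u)"
  and DF_trg' [simp]: "small_functor u \<Longrightarrow> Trg (DF D u) = DC D (Src u)"
  by (simp_all add: DF_src DF_trg)

lemma pbO_in [simp]: "\<lbrakk>small_functor u; X \<in> ob (Trg u)\<rbrakk> \<Longrightarrow> pb u X \<in> ob (Src u)"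
  using is_functor.obj_in[OF DF_functor, of u X] by simp

lemma pbO_in' [simp]: "\<lbrakk>small_functor u; X \<in> ob (Trg u); Src u = A\<rbrakk> \<Longrightarrow> pb u X \<in> ob A"
  using pbO_in by auto

lemma pbA_in: "\<lbrakk>small_functor u; f \<in> hm (Trg u) X Y\<rbrakk>
    \<Longrightarrow> pa u f \<in> hm (Src u) (pb u X) (pb u Y)"
  using is_functor.arr_in[OF DF_functor, of u f X Y] by simp

lemma pbA_in': "\<lbrakk>small_functor u; Src u = A; Trg u = B; f \<in> hm B X Y\<rbrakk>
    \<Longrightarrow> pa u f \<in> hm A (pb u X) (pb u Y)"
  using pbA_in by auto

lemma pbA_Arr [simp]: "\<lbrakk>small_functor u; f \<in> ar (Trg u)\<rbrakk> \<Longrightarrow> pa u f \<in> ar (Src u)"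
  using is_functor.arr_in'[OF DF_functor, of u f] by simp

lemma pbA_Idt [simp]: "\<lbrakk>small_functor u; X \<in> ob (Trg u); Trg u = B\<rbrakk>
    \<Longrightarrow> pa u (idt B X) = idt (Src u) (pb u X)"
  using is_functor.pres_id[OF DF_functor, of u X] by auto

lemma pbA_mult: "\<lbrakk>small_functor u; f \<in> hm (Trg u) X Y; g \<in> hm (Trg u) Y Z\<rbrakk>
    \<Longrightarrow> pa u (g \<cdot>[Trg u] f) = pa u g \<cdot>[Src u] pa u f"
  using is_functor.pres_comp[OF DF_functor, of u f X Y g Z] by simp

lemma pbA_iso: "\<lbrakk>small_functor u; isoin (Trg u) f\<rbrakk> \<Longrightarrow> isoin (Src u) (pa u f)"
  using is_functor.pres_iso[OF DF_functor, of u f] by simp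

lemma pbO_id [simp]: "\<lbrakk>small_cat A; X \<in> ob A\<rbrakk> \<Longrightarrow> pb (id_f A) X = X"
  and pbA_id [simp]: "\<lbrakk>small_cat A; f \<in> ar A\<rbrakk> \<Longrightarrow> pa (id_f A) f = f"
  by (simp_all add: DF_id)

lemma pbO_comp [simp]: "\<lbrakk>small_functor u; small_functor v; Src v = Trg u; X \<in> ob (Trg v)\<rbrakk>
    \<Longrightarrow> pb (v oo u) X = pb u (pb v X)"
  by (simp add: DF_comp)

lemma pbA_comp [simp]: "\<lbrakk>small_functor u; small_functor v; Src v = Trg u; f \<in> ar (Trg v)\<rbrakk>
    \<Longrightarrow> pa (v oo u) f = pa u (pa v f)"
  by (simp add: DF_comp)

lemma homA: "\<lbrakk>small_cat A; f \<in> hm A X Y\<rbrakk> \<Longrightarrow> f \<in> ar A"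
  and homO: "\<lbrakk>small_cat A; f \<in> hm A X Y\<rbrakk> \<Longrightarrow> X \<in> ob A \<and> Y \<in> ob A"
  using category.homD[of "DC D A" f X Y] by auto

lemma HI: "\<lbrakk>small_functor u; Y \<in> ob (Trg u); f \<in> hm (Src u) X (pb u Y)\<rbrakk> \<Longrightarrow> f \<in> H D u X Y"
  by (simp add: H_def)

lemma HD:
  assumes "f \<in> H D u X Y"
  shows "small_functor u" "Y \<in> ob (Trg u)" "f \<in> hm (Src u) X (pb u Y)"
    "X \<in> ob (Src u)" "f \<in> ar (Src u)"
  using assms homA[of "Src u" f] homO[of "Src u" f] by (auto simp: H_def)

lemma H_id: "small_cat A \<Longrightarrow> f \<in> H D (id_f A) X Y \<longleftrightarrow> f \<in> hm A X Y"
  using homO[of A f X Y] by (auto simp: H_def)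

lemma H_comp: "\<lbrakk>small_functor u; small_functor v; Src v = Trg u; Z \<in> ob (Trg v)\<rbrakk>
    \<Longrightarrow> f \<in> H D (v oo u) X Z \<longleftrightarrow> f \<in> H D u X (pb v Z)"
  using pbO_in[of v Z] by (auto simp: H_def)

lemma cmp_in: "\<lbrakk>f \<in> H D u X Y; g \<in> H D v Y Z; Src v = Trg u\<rbrakk> \<Longrightarrow> cm u g f \<in> H D (v oo u) X Z"
  unfolding H_def cmp_def using pbA_in[of u g Y "pb v Z"] category.comp_in[OF DC_cat, of "Src u" f] by auto

lemma cmp_in_v: "\<lbrakk>f \<in> H D u X Y; g \<in> hm (Trg u) Y Z\<rbrakk> \<Longrightarrow> cm u g f \<in> H D u X Z"
  unfolding H_def cmp_def using pbA_in[of u g Y Z] category.comp_in[OF DC_cat, of "Src u" f] homO[of "Trg u" g Y Z] by auto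

text \<open>No coherence isomorphism intervenes, since \<open>(v oo u)^*\<close> is strictly
  \<open>u^*\<close> after \<open>v^*\<close>.\<close>

lemma cmp_assoc:
  assumes f: "f \<in> H D u W X" and g: "g \<in> H D v X Y" and h: "h \<in> H D w Y Z" and e: "Src v = Trg u" "Src w = Trg v"
  shows "cm u (cm v h g) f = cm (v oo u) h (cm u g f)"
proof -
  note f' = HD[OF f] and g' = HD[OF g] and h' = HD[OF h]
  interpret U: category "DC D (Src u)" using f' by simp
  have vh: "pa v h \<in> hm (Src v) (pb v Y) (pb v (pb w Z))" using g' h' e pbA_in[of v h Y "pb w Z"] by simp
  show ?thesis
    using U.assoc[OF f'(3) pbA_in[OF f'(1)] pbA_in[OF f'(1)], of g "pb v Y" "pa v h" "pb v (pb w Z)"]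
      pbA_mult[OF f'(1), of g X "pb v Y" "pa v h" "pb v (pb w Z)"] f' g' h' e vh
    unfolding cmp_def by simp
qed

lemma cmp_assoc_v:
  assumes f: "f \<in> H D u W X" and g: "g \<in> hm (Trg u) X Y" and h: "h \<in> H D w Y Z" and e: "Src w = Trg u"
  shows "cm u (h \<cdot>[Src w] g) f = cm u h (cm u g f)"
  using cmp_assoc[OF f _ h, of g "id_f (Trg u)"] HD[OF f] HD[OF h] e g H_id
  by (simp add: cmp_def)

lemma cmp_mult:
  assumes f: "f \<in> H D u W X" and g: "g \<in> hm (Trg u) X Y" and h: "h \<in> hm (Trg u) Y Z"
  shows "cm u (h \<cdot>[Trg u] g) f = cm u h (cm u g f)"
  using cmp_assoc_v[OF f g, of h "id_f (Trg u)" Z] HD[OF f] h H_id by simp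

lemma cmp_pre:
  assumes f: "f \<in> H D u X Y" and g: "g \<in> H D v Y Z" and k: "k \<in> hm (Src u) W X" and e: "Src v = Trg u"
  shows "cm u g (f \<cdot>[Src u] k) = cm u g f \<cdot>[Src u] k"
  unfolding cmp_def using category.assoc[OF DC_cat k HD(3)[OF f] pbA_in[OF HD(1)[OF f]]] HD[OF f] HD[OF g] e by simp

lemma cmp_pre_v:
  assumes f: "f \<in> H D u X Y" and g: "g \<in> hm (Trg u) Y Z" and k: "k \<in> hm (Src u) W X"
  shows "cm u g (f \<cdot>[Src u] k) = cm u g f \<cdot>[Src u] k"
  using cmp_pre[OF f _ k, of g "id_f (Trg u)" Z] g HD[OF f] H_id by simp

lemma H_pre: "\<lbrakk>f \<in> H D u X Y; k \<in> hm (Src u) W X\<rbrakk> \<Longrightarrow> f \<cdot>[Src u] k \<in> H D u W Y"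
  using category.comp_in[OF DC_cat, of "Src u" k W X f] by (auto simp: H_def)

lemma cmp_id [simp]: "\<lbrakk>small_cat A; f \<in> ar A\<rbrakk> \<Longrightarrow> cm (id_f A) f g = f \<cdot>[A] g"
  by (simp add: cmp_def)

lemma cmp_crt: "\<lbrakk>f \<in> H D u X Y; Trg u = B\<rbrakk> \<Longrightarrow> cm u (idt B Y) f = f"
  using HD[of f u X Y] category.idl[OF DC_cat, of "Src u" f X] by (auto simp: cmp_def)

lemma cmp_Idt: "\<lbrakk>g \<in> H D v Y Z; small_functor u; Src v = Trg u; Src u = A\<rbrakk>
    \<Longrightarrow> cm u g (idt A (pb u Y)) = pa u g"
  using HD[of g v Y Z] category.idr[OF DC_cat pbA_in, of u g Y "pb v Z"] by (auto simp: cmp_def)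

lemma crt_in: "\<lbrakk>small_functor u; Y \<in> ob (Trg u); Src u = A\<rbrakk> \<Longrightarrow> idt A (pb u Y) \<in> H D u (pb u Y) Y"
  using category.id_in[OF DC_cat, of A "pb u Y"] pbO_in[of u Y] by (auto simp: H_def)

text \<open>For a strictly commuting square the functors \<open>(u oo g)^*\<close> and
  \<open>(h oo u')^*\<close> are the same, so restriction along \<open>g\<close> carries arrows over
  \<open>u\<close> to arrows over \<open>u'\<close> without any comparison map.\<close>

lemma pb_H: "\<lbrakk>f \<in> H D u X Y; small_functor g; Trg g = Src u; u oo g = h oo u'; small_functor h; small_functor u'; Src h = Trg u'\<rbrakk>
    \<Longrightarrow> pa g f \<in> H D u' (pb g X) (pb h Y)"
proof -
  assume a: "f \<in> H D u X Y" "small_functor g" "Trg g = Src u" "u oo g = h oo u'" "small_functor h" "small_functor u'" "Src h = Trg u'"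
  note f = HD[OF a(1)]
  have src: "Src u' = Src g" "Trg h = Trg u" using a(4) comp_f_simps(1,2) by metis+
  have "pb g (pb u Y) = pb u' (pb h Y)"
    using a f src pbO_comp[of g u Y] pbO_comp[of u' h Y] by simp
  moreover have "pa g f \<in> hm (Src g) (pb g X) (pb g (pb u Y))"
    using pbA_in[OF a(2)] a f by simp
  ultimately show ?thesis using a f src pbO_in[of h Y] by (simp add: H_def)
qed

subsection \<open>Opcartesian arrows\<close>

lemma opcD: "opc D u X Z f \<Longrightarrow> f \<in> H D u X Z"
  by (simp add: opc_def)

lemma opc_ex:
  assumes "opc D u X Z f" "g \<in> H D u X Z'"
  obtains h where "h \<in> hm (Trg u) Z Z'" "cm u h f = g"
proof -
  have "\<exists>!h. h \<in> hm (Trg u) Z Z' \<and> cm u h f = g" using assms unfolding opc_def by simp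
  then show thesis using that by auto
qed

lemma opc_eq:
  assumes "opc D u X Z f" "h \<in> hm (Trg u) Z Z'" "h' \<in> hm (Trg u) Z Z'" "cm u h f = cm u h' f"
  shows "h = h'"
proof -
  have "cm u h f \<in> H D u X Z'" using cmp_in_v[OF opcD[OF assms(1)] assms(2)] .
  then have "\<exists>!k. k \<in> hm (Trg u) Z Z' \<and> cm u k f = cm u h f"
    using assms(1) unfolding opc_def by simp
  then show ?thesis using assms(2-4) by auto
qed

lemma opcI:
  assumes "f \<in> H D u X Z"
    and "\<And>Z' g. g \<in> H D u X Z' \<Longrightarrow> \<exists>h. h \<in> hm (Trg u) Z Z' \<and> cm u h f = g"
    and "\<And>Z' h h'. \<lbrakk>h \<in> hm (Trg u) Z Z'; h' \<in> hm (Trg u) Z Z'; cm u h f = cm u h' f\<rbrakk> \<Longrightarrow> h = h'"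
  shows "opc D u X Z f"
  unfolding opc_def
proof (intro conjI allI impI assms(1))
  fix Z' g assume "g \<in> H D u X Z'"
  then obtain h where h: "h \<in> hm (Trg u) Z Z'" "cm u h f = g" using assms(2) by metis
  show "\<exists>!h. h \<in> hm (Trg u) Z Z' \<and> cm u h f = g"
  proof (rule ex1I[of _ h])
    fix k assume "k \<in> hm (Trg u) Z Z' \<and> cm u k f = g"
    then show "k = h" using assms(3)[of k Z' h] h by simp
  qed (use h in simp)
qed

text \<open>Factor in two stages: \<open>f\<close> turns an arrow over \<open>v oo u\<close> into an
  arrow over \<open>v\<close>, which \<open>g\<close> then turns into a fibre arrow. This replaces
  the isomorphism between \<open>(v u)_!\<close> and \<open>v_! u_!\<close>.\<close>

lemma opc_comp:
  assumes f: "opc D u X Y f" and g: "opc D v Y Z g" and e: "Src v = Trg u"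
  shows "opc D (v oo u) X Z (cm u g f)"
proof (rule opcI)
  note f' = opcD[OF f] and g' = opcD[OF g]
  note fH = HD[OF f'] and gH = HD[OF g']
  show "cm u g f \<in> H D (v oo u) X Z" using cmp_in[OF f' g' e] .
  have as: "cm (v oo u) h (cm u g f) = cm u (cm v h g) f" if "h \<in> hm (Trg v) Z Z'" for h Z'
    using cmp_assoc[OF f' g', of h "id_f (Trg v)" Z'] that e gH(1) H_id by simp
  fix Z'
  show "\<exists>h. h \<in> hm (Trg (v oo u)) Z Z' \<and> cm (v oo u) h (cm u g f) = k" if k: "k \<in> H D (v oo u) X Z'" for k
  proof -
    have Z': "Z' \<in> ob (Trg v)" using HD(2)[OF k] by simp
    then have "k \<in> H D u X (pb v Z')" using k H_comp[OF fH(1) gH(1) e Z'] by simp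
    then obtain h1 where h1: "h1 \<in> hm (Trg u) Y (pb v Z')" "cm u h1 f = k" using opc_ex[OF f] by metis
    then have "h1 \<in> H D v Y Z'" using gH Z' e by (simp add: H_def)
    then obtain h where h: "h \<in> hm (Trg v) Z Z'" "cm v h g = h1" using opc_ex[OF g] by metis
    then show ?thesis using as[OF h(1)] h1 by auto
  qed
  fix h h' assume "h \<in> hm (Trg (v oo u)) Z Z'" "h' \<in> hm (Trg (v oo u)) Z Z'"
    and eq: "cm (v oo u) h (cm u g f) = cm (v oo u) h' (cm u g f)"
  then have h: "h \<in> hm (Trg v) Z Z'" "h' \<in> hm (Trg v) Z Z'" by simp_all
  have "cm v h g \<in> hm (Trg u) Y (pb v Z')" "cm v h' g \<in> hm (Trg u) Y (pb v Z')"
    using HD(3)[OF cmp_in_v[OF g' h(1)]] HD(3)[OF cmp_in_v[OF g' h(2)]] e by simp_all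
  then have "cm v h g = cm v h' g" using opc_eq[OF f] eq as[OF h(1)] as[OF h(2)] by simp
  then show "h = h'" using opc_eq[OF g h] by simp
qed

text \<open>Composition with \<open>f\<close> is a bijection from arrows out of \<open>Y\<close>
  over \<open>v\<close> to arrows out of \<open>X\<close> over \<open>v oo u\<close>, so the
  universal property of the composite is that of \<open>g\<close>.\<close>

lemma opc_cancel:
  assumes f: "opc D u X Y f" and gf: "opc D (v oo u) X Z (cm u g f)" and g': "g \<in> H D v Y Z" and e: "Src v = Trg u"
  shows "opc D v Y Z g"
proof (rule opcI)
  note f' = opcD[OF f]
  note fH = HD[OF f'] and gH = HD[OF g']
  show "g \<in> H D v Y Z" by fact
  have as: "cm (v oo u) h (cm u g f) = cm u (cm v h g) f" if "h \<in> hm (Trg v) Z Z'" for h Z'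
    using cmp_assoc[OF f' g', of h "id_f (Trg v)" Z'] that e gH(1) H_id by simp
  have hv: "cm v h g \<in> hm (Trg u) Y (pb v Z')" if "h \<in> hm (Trg v) Z Z'" for h Z'
    using HD(3)[OF cmp_in_v[OF g' that]] e by simp
  fix Z'
  show "\<exists>h. h \<in> hm (Trg v) Z Z' \<and> cm v h g = k" if k: "k \<in> H D v Y Z'" for k
  proof -
    have "cm u k f \<in> H D (v oo u) X Z'" using cmp_in[OF f' k e] .
    then obtain h where h: "h \<in> hm (Trg v) Z Z'" "cm (v oo u) h (cm u g f) = cm u k f"
      using opc_ex[OF gf] by (metis comp_f_simps(2))
    then have "cm v h g = k"
      using opc_eq[OF f hv[OF h(1)], of k] HD(3)[OF k] as[OF h(1)] e by simp
    then show ?thesis using h by blast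
  qed
  fix h h' assume h: "h \<in> hm (Trg v) Z Z'" "h' \<in> hm (Trg v) Z Z'" and eq: "cm v h g = cm v h' g"
  then show "h = h'" using opc_eq[OF gf, of h Z' h'] as[OF h(1)] as[OF h(2)] by simp
qed

text \<open>Targets of opcartesian arrows with the same source are compared by a unique map, and
  that map is invertible exactly when both arrows are universal. This is how invertibility
  statements are converted into opcartesianness and back.\<close>

lemma opc_iso_post:
  assumes f: "opc D u X Y f" and h: "h \<in> hm (Trg u) Y Z"
  shows "opc D u X Z (cm u h f) \<longleftrightarrow> isoin (Trg u) h"
proof
  note f' = opcD[OF f]
  note fH = HD[OF f']
  interpret T: category "DC D (Trg u)" using fH by simp
  {
    assume a: "opc D u X Z (cm u h f)"
    then obtain k where k: "k \<in> hm (Trg u) Z Y" "cm u k (cm u h f) = f"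
      using opc_ex[OF a f'] by metis
    have Y: "Y \<in> ob (Trg u)" "Z \<in> ob (Trg u)" using T.homD[OF h] by auto
    have kh: "k \<cdot>[Trg u] h = idt (Trg u) Y"
      using opc_eq[OF f T.comp_in[OF h k(1)] T.id_in[OF Y(1)]] cmp_mult[OF f' h k(1)] k cmp_crt[OF f'] by simp
    have "cm u (h \<cdot>[Trg u] k) (cm u h f) = cm u h f"
      using cmp_mult[OF cmp_in_v[OF f' h] k(1) h] k by simp
    then have "h \<cdot>[Trg u] k = idt (Trg u) Z"
      using opc_eq[OF a T.comp_in[OF k(1) h] T.id_in[OF Y(2)]] cmp_crt[OF opcD[OF a]] by simp
    then show "isoin (Trg u) h" using T.isoI[OF h k(1) kh] by blast
  }
  assume i: "isoin (Trg u) h"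
  then obtain k where k: "k \<in> hm (Trg u) Z Y" "k \<cdot>[Trg u] h = idt (Trg u) Y"
      "h \<cdot>[Trg u] k = idt (Trg u) Z" using T.isoE[OF _ h] by metis
  show "opc D u X Z (cm u h f)"
  proof (rule opcI)
    show "cm u h f \<in> H D u X Z" using cmp_in_v[OF f' h] .
    fix Z'
    show "\<exists>h'. h' \<in> hm (Trg u) Z Z' \<and> cm u h' (cm u h f) = g" if g: "g \<in> H D u X Z'" for g
    proof -
      obtain l where l: "l \<in> hm (Trg u) Y Z'" "cm u l f = g" using opc_ex[OF f g] by metis
      have "cm u (l \<cdot>[Trg u] k) (cm u h f) = cm u ((l \<cdot>[Trg u] k) \<cdot>[Trg u] h) f"
        using cmp_mult[OF f' h T.comp_in[OF k(1) l(1)]] by simp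
      also have "\<dots> = g" using T.assoc[OF h k(1) l(1)] k T.idr[OF l(1)] l by simp
      finally show ?thesis using T.comp_in[OF k(1) l(1)] by blast
    qed
    fix a b assume a: "a \<in> hm (Trg u) Z Z'" and b: "b \<in> hm (Trg u) Z Z'"
      and eq: "cm u a (cm u h f) = cm u b (cm u h f)"
    then have "a \<cdot>[Trg u] h = b \<cdot>[Trg u] h"
      using opc_eq[OF f T.comp_in[OF h a] T.comp_in[OF h b]] cmp_mult[OF f' h a] cmp_mult[OF f' h b] by simp
    then show "a = b" using T.iso_epic[OF a b h i] by blast
  qed
qed

text \<open>For invertible \<open>w\<close> the functor \<open>w^*\<close> has the strict inverse
  \<open>w'^*\<close>, so the cartesian arrow, whose underlying arrow is an identity, is opcartesian
  as well.\<close>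

lemma opc_iso_functor:
  assumes w: "small_functor w" "small_functor w'" "Trg w = Src w'" "Trg w' = Src w"
    "w' oo w = id_f (Src w)" "w oo w' = id_f (Src w')" and Y: "Y \<in> ob (Trg w)"
  shows "opc D w (pb w Y) Y (idt (Src w) (pb w Y))"
proof (rule opcI)
  interpret A: category "DC D (Src w)" using w by simp
  interpret B: category "DC D (Trg w)" using w by simp
  show "idt (Src w) (pb w Y) \<in> H D w (pb w Y) Y" using crt_in w Y by simp
  have cm: "cm w h (idt (Src w) (pb w Y)) = pa w h" if "h \<in> hm (Trg w) Y Z'" for h Z'
    using cmp_Idt[of h "id_f (Trg w)" Y Z' w] that w H_id by simp
  have wY: "pb w' (pb w Z) = Z" if "Z \<in> ob (Trg w)" for Z
    using pbO_comp[of w' w Z] that w by simp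
  fix Z'
  show "\<exists>h. h \<in> hm (Trg w) Y Z' \<and> cm w h (idt (Src w) (pb w Y)) = g" if g: "g \<in> H D w (pb w Y) Z'" for g
  proof -
    note gH = HD[OF g]
    have h: "pa w' g \<in> hm (Trg w) Y Z'" using pbA_in[OF w(2), of g "pb w Y" "pb w Z'"] gH w wY Y by simp
    have "pa w (pa w' g) = g" using pbA_comp[of w w' g] w gH by simp
    then show ?thesis using h cm[OF h] by auto
  qed
  fix h h' assume h: "h \<in> hm (Trg w) Y Z'" "h' \<in> hm (Trg w) Y Z'"
    and "cm w h (idt (Src w) (pb w Y)) = cm w h' (idt (Src w) (pb w Y))"
  then have "pa w' (pa w h) = pa w' (pa w h')" using cm by simp
  then show "h = h'" using pbA_comp[of w' w h] pbA_comp[of w' w h'] h w B.homD(1) by simp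
qed

lemma opc_iso_id: "\<lbrakk>small_cat A; f \<in> hm A X Y; isoin A f\<rbrakk> \<Longrightarrow> opc D (id_f A) X Y f"
proof -
  assume a: "small_cat A" "f \<in> hm A X Y" "isoin A f"
  interpret A: category "DC D A" using a by simp
  have "opc D (id_f A) X X (idt A X)"
    using opc_iso_functor[of "id_f A" "id_f A" X] a A.homD(4)[OF a(2)] by simp
  then have "opc D (id_f A) X Y (cm (id_f A) f (idt A X))"
    using opc_iso_post[of "id_f A" X X "idt A X" f Y] a by simp
  then show ?thesis using A.homD(1)[OF a(2)] a A.idr[OF a(2)] by simp
qed

lemma opc_pre:
  assumes f: "opc D u X Y f" and k: "k \<in> hm (Src u) W X" "isoin (Src u) k"
  shows "opc D u W Y (f \<cdot>[Src u] k)"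
  using opc_comp[OF opc_iso_id[OF _ k] f] HD[OF opcD[OF f]] by (simp add: cmp_def)

text \<open>Both \<open>g\<close> and \<open>h\<close> are invertible: prepend the opcartesian arrow
  over \<open>g\<close>, append the one over the inverse of \<open>h\<close>, and observe that
  neither changes the underlying arrow \<open>pa g f\<close>.\<close>

lemma opc_iso_square:
  assumes f: "opc D u X Z f" and g: "small_functor g" "small_functor g'" "Trg g = Src g'" "Trg g' = Src g"
    "g' oo g = id_f (Src g)" "g oo g' = id_f (Src g')"
    and h: "small_functor h" "small_functor h'" "Trg h = Src h'" "Trg h' = Src h"
    "h' oo h = id_f (Src h)" "h oo h' = id_f (Src h')"
    and sq: "u oo g = h oo u'" "small_functor u'" "Src h = Trg u'" "Trg g = Src u"
  shows "opc D u' (pb g X) (pb h Z) (pa g f)"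
proof -
  note fH = HD[OF opcD[OF f]]
  have src: "Src u' = Src g" "Trg h = Trg u" using sq(1) comp_f_simps(1,2) by metis+
  have X: "X \<in> ob (Trg g)" using fH(4) sq(4) by simp
  have "opc D (u oo g) (pb g X) Z (cm g f (idt (Src g) (pb g X)))"
    by (rule opc_comp[OF opc_iso_functor[OF g X] f]) (simp add: sq(4))
  then have 1: "opc D (u oo g) (pb g X) Z (pa g f)" using cmp_Idt[OF opcD[OF f] g(1)] sq(4) by simp
  have Z: "pb h' (pb h Z) = Z" using pbO_comp[of h' h Z] fH h src by simp
  have "opc D h' Z (pb h Z) (idt (Src h') Z)"
    using opc_iso_functor[of h' h "pb h Z"] h fH src Z by simp
  from opc_comp[OF 1 this] have "opc D (h' oo (u oo g)) (pb g X) (pb h Z) (cm (u oo g) (idt (Src h') Z) (pa g f))"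
    using h src by simp
  moreover have "h' oo (h oo u') = u'"
    by (subst small_assoc[symmetric]) (use sq(2,3) h in simp_all)
  then have "h' oo (u oo g) = u'" using sq(1) by simp
  moreover have "cm (u oo g) (idt (Src h') Z) (pa g f) = pa g f"
    using cmp_crt[OF opcD[OF 1]] h src by simp
  ultimately show ?thesis by simp
qed

subsection \<open>Transformations\<close>

lemma DT_in: "\<lbrakk>small_trans \<alpha>; Z \<in> ob (Trg (NSrc \<alpha>))\<rbrakk>
    \<Longrightarrow> Cpt (DT D \<alpha>) Z \<in> hm (Src (NSrc \<alpha>)) (pb (NSrc \<alpha>) Z) (pb (NTrg \<alpha>) Z)"
  using nat_trans.cpt_in[OF DT_trans, of \<alpha> Z] by (simp add: DT_src DT_trg small_transD)

lemma DT_nat: "\<lbrakk>small_trans \<alpha>; f \<in> hm (Trg (NSrc \<alpha>)) X Y\<rbrakk>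
    \<Longrightarrow> Cpt (DT D \<alpha>) Y \<cdot>[Src (NSrc \<alpha>)] pa (NSrc \<alpha>) f
      = pa (NTrg \<alpha>) f \<cdot>[Src (NSrc \<alpha>)] Cpt (DT D \<alpha>) X"
  using nat_trans.natural[OF DT_trans, of \<alpha> f X Y] by (simp add: DT_src DT_trg small_transD)

lemma DT_id_n [simp]: "\<lbrakk>small_functor u; Z \<in> ob (Trg u)\<rbrakk>
    \<Longrightarrow> Cpt (DT D (id_n u)) Z = idt (Src u) (pb u Z)"
  by (simp add: DT_id)

lemma DT_vcomp': "\<lbrakk>small_trans \<alpha>; small_trans \<beta>; NSrc \<beta> = NTrg \<alpha>; Z \<in> ob (Trg (NSrc \<alpha>))\<rbrakk>
    \<Longrightarrow> Cpt (DT D (vcomp \<beta> \<alpha>)) Z = Cpt (DT D \<beta>) Z \<cdot>[Src (NSrc \<alpha>)] Cpt (DT D \<alpha>) Z"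
  by (simp add: DT_vcomp DT_src small_transD)

text \<open>\<open>D\<close> reverses functors: precomposing \<alpha> with \<open>k\<close> applies
  \<open>k^*\<close> to the component, while postcomposing with \<open>h\<close> evaluates the
  component at \<open>h^* Z\<close>.\<close>

lemma DT_whisker_left: "\<lbrakk>small_trans \<alpha>; small_functor k; Trg k = Src (NSrc \<alpha>); Z \<in> ob (Trg (NSrc \<alpha>))\<rbrakk>
    \<Longrightarrow> Cpt (DT D (hcomp \<alpha> (id_n k))) Z = pa k (Cpt (DT D \<alpha>) Z)"
proof -
  assume a: "small_trans \<alpha>" "small_functor k" "Trg k = Src (NSrc \<alpha>)" "Z \<in> ob (Trg (NSrc \<alpha>))"
  note t = small_transD[OF a(1)]
  have "pa k (Cpt (DT D \<alpha>) Z) \<in> hm (Src k) (pb k (pb (NSrc \<alpha>) Z)) (pb k (pb (NTrg \<alpha>) Z))"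
    using pbA_in[OF a(2)] DT_in[OF a(1,4)] a(3) by simp
  from category.idl[OF DC_cat this] show ?thesis using a t pbO_in[OF t(3), of Z]
    by (simp add: DT_hcomp DT_id DT_src DT_trg)
qed

lemma DT_whisker_right: "\<lbrakk>small_trans \<alpha>; small_functor h; Src h = Trg (NSrc \<alpha>); Z \<in> ob (Trg h)\<rbrakk>
    \<Longrightarrow> Cpt (DT D (hcomp (id_n h) \<alpha>)) Z = Cpt (DT D \<alpha>) (pb h Z)"
proof -
  assume a: "small_trans \<alpha>" "small_functor h" "Src h = Trg (NSrc \<alpha>)" "Z \<in> ob (Trg h)"
  note t = small_transD[OF a(1)]
  have Z: "pb h Z \<in> ob (Trg (NSrc \<alpha>))" using pbO_in[OF a(2,4)] a(3) by simp
  have "Cpt (DT D \<alpha>) (pb h Z) \<in> hm (Src (NSrc \<alpha>)) (pb (NSrc \<alpha>) (pb h Z)) (pb (NTrg \<alpha>) (pb h Z))"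
    using DT_in[OF a(1) Z] .
  from category.idr[OF DC_cat this] show ?thesis using a t Z
    by (simp add: DT_hcomp DT_id DT_src DT_trg)
qed

end

section \<open>Kan extensions and base change\<close>

text \<open>Triangle identities and naturality yield the bijection of hom sets in explicit form;
  adjunctions are used below only through it.\<close>

lemma adjunction_universal:
  assumes a: "adjunction F G \<eta> \<epsilon>" and x: "x \<in> Obj (Src F)" and y: "y \<in> Obj (Trg F)"
  shows "Cpt \<eta> x \<in> hom (Src F) x (FObj G (FObj F x))"
    and "Cpt \<epsilon> y \<in> hom (Trg F) (FObj F (FObj G y)) y"
    and "g \<in> hom (Src F) x (FObj G y) \<Longrightarrow> Cpt \<epsilon> y \<cdot>\<^bsub>Trg F\<^esub> FArr F g \<in> hom (Trg F) (FObj F x) y"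
    and "g \<in> hom (Src F) x (FObj G y) \<Longrightarrow> FArr G (Cpt \<epsilon> y \<cdot>\<^bsub>Trg F\<^esub> FArr F g) \<cdot>\<^bsub>Src F\<^esub> Cpt \<eta> x = g"
    and "h \<in> hom (Trg F) (FObj F x) y \<Longrightarrow> FArr G h \<cdot>\<^bsub>Src F\<^esub> Cpt \<eta> x \<in> hom (Src F) x (FObj G y)"
    and "h \<in> hom (Trg F) (FObj F x) y \<Longrightarrow> Cpt \<epsilon> y \<cdot>\<^bsub>Trg F\<^esub> FArr F (FArr G h \<cdot>\<^bsub>Src F\<^esub> Cpt \<eta> x) = h"
proof -
  interpret adjunction F G \<eta> \<epsilon> by fact
  interpret F: is_functor F by (rule left_functor)
  interpret G: is_functor G by (rule right_functor)
  interpret e: nat_trans \<eta> by (rule unit_trans)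
  interpret c: nat_trans \<epsilon> by (rule counit_trans)
  note [simp] = src_right trg_right unit_trans counit_trans
  have eta: "Cpt \<eta> z \<in> hom (Src F) z (FObj G (FObj F z))" if "z \<in> Obj (Src F)" for z
    using e.cpt_in[of z] that by simp
  have eps: "Cpt \<epsilon> z \<in> hom (Trg F) (FObj F (FObj G z)) z" if "z \<in> Obj (Trg F)" for z
    using c.cpt_in[of z] that by simp
  have nat_eta: "Cpt \<eta> z' \<cdot>\<^bsub>Src F\<^esub> f = FArr G (FArr F f) \<cdot>\<^bsub>Src F\<^esub> Cpt \<eta> z" if "f \<in> hom (Src F) z z'" for f z z'
    using e.natural[of f z z'] that F.S.homD[OF that] by simp
  have nat_eps: "Cpt \<epsilon> z' \<cdot>\<^bsub>Trg F\<^esub> FArr F (FArr G f) = f \<cdot>\<^bsub>Trg F\<^esub> Cpt \<epsilon> z" if "f \<in> hom (Trg F) z z'" for f z z'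
    using c.natural[of f z z'] that F.T.homD[OF that] by simp
  have GI: "FArr G h \<in> hom (Src F) (FObj G z) (FObj G z')" if "h \<in> hom (Trg F) z z'" for h z z'
    using G.arr_in[of h z z'] that by simp
  have GC: "FArr G (k \<cdot>\<^bsub>Trg F\<^esub> h) = FArr G k \<cdot>\<^bsub>Src F\<^esub> FArr G h"
    if "h \<in> hom (Trg F) z z'" "k \<in> hom (Trg F) z' z''" for h k z z' z''
    using G.pres_comp[of h z z' k z''] that by simp
  have o: "FObj F x \<in> Obj (Trg F)" "FObj G y \<in> Obj (Src F)" using F.obj_in[OF x] G.obj_in[of y] y by auto
  show "Cpt \<eta> x \<in> hom (Src F) x (FObj G (FObj F x))" using eta[OF x] .
  show "Cpt \<epsilon> y \<in> hom (Trg F) (FObj F (FObj G y)) y" using eps[OF y] .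
  show "Cpt \<epsilon> y \<cdot>\<^bsub>Trg F\<^esub> FArr F g \<in> hom (Trg F) (FObj F x) y" if g: "g \<in> hom (Src F) x (FObj G y)"
    using F.T.comp_in[OF F.arr_in[OF g] eps[OF y]] .
  show "FArr G (Cpt \<epsilon> y \<cdot>\<^bsub>Trg F\<^esub> FArr F g) \<cdot>\<^bsub>Src F\<^esub> Cpt \<eta> x = g" if g: "g \<in> hom (Src F) x (FObj G y)"
  proof -
    have "FArr G (Cpt \<epsilon> y \<cdot>\<^bsub>Trg F\<^esub> FArr F g) \<cdot>\<^bsub>Src F\<^esub> Cpt \<eta> x
      = FArr G (Cpt \<epsilon> y) \<cdot>\<^bsub>Src F\<^esub> (FArr G (FArr F g) \<cdot>\<^bsub>Src F\<^esub> Cpt \<eta> x)"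
      using GC[OF F.arr_in[OF g] eps[OF y]] F.S.assoc[OF eta[OF x] GI[OF F.arr_in[OF g]] GI[OF eps[OF y]]] by simp
    also have "\<dots> = (FArr G (Cpt \<epsilon> y) \<cdot>\<^bsub>Src F\<^esub> Cpt \<eta> (FObj G y)) \<cdot>\<^bsub>Src F\<^esub> g"
      using nat_eta[OF g] F.S.assoc[OF g eta[OF o(2)] GI[OF eps[OF y]]] by simp
    finally show ?thesis using triangle_right[OF y] F.S.idl[OF g] by simp
  qed
  show hx: "FArr G h \<cdot>\<^bsub>Src F\<^esub> Cpt \<eta> x \<in> hom (Src F) x (FObj G y)" if h: "h \<in> hom (Trg F) (FObj F x) y"
    using F.S.comp_in[OF eta[OF x] GI[OF h]] .
  show "Cpt \<epsilon> y \<cdot>\<^bsub>Trg F\<^esub> FArr F (FArr G h \<cdot>\<^bsub>Src F\<^esub> Cpt \<eta> x) = h" if h: "h \<in> hom (Trg F) (FObj F x) y"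
  proof -
    have "Cpt \<epsilon> y \<cdot>\<^bsub>Trg F\<^esub> FArr F (FArr G h \<cdot>\<^bsub>Src F\<^esub> Cpt \<eta> x)
      = (Cpt \<epsilon> y \<cdot>\<^bsub>Trg F\<^esub> FArr F (FArr G h)) \<cdot>\<^bsub>Trg F\<^esub> FArr F (Cpt \<eta> x)"
      using F.pres_comp[OF eta[OF x] GI[OF h]] F.T.assoc[OF F.arr_in[OF eta[OF x]] F.arr_in[OF GI[OF h]] eps[OF y]] by simp
    also have "\<dots> = h \<cdot>\<^bsub>Trg F\<^esub> (Cpt \<epsilon> (FObj F x) \<cdot>\<^bsub>Trg F\<^esub> FArr F (Cpt \<eta> x))"
      using nat_eps[OF h] F.T.assoc[OF F.arr_in[OF eta[OF x]] eps[OF o(1)] h] by simp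
    finally show ?thesis using triangle_left[OF x] F.T.idr[OF h] by simp
  qed
qed

text \<open>Homotopy finality relative to the given \<open>D\<close>: opcartesian arrows over the
  functor to the point are colimits, and these are to be unchanged by restriction along
  \<open>q\<close>.\<close>

definition final :: "('k, 'o, 'm) pder \<Rightarrow> 'k sfun \<Rightarrow> bool" where
  "final D q \<longleftrightarrow> small_functor q \<and> (\<forall>V W f. opc D (to_pt (Trg q)) V W f
     \<longrightarrow> opc D (to_pt (Src q)) (pbO D q V) W (pbA D q f))"

text \<open>For a square with a transformation \<open>\<alpha> : u \<circ> g \<rightarrow> h \<circ> u'\<close>, the induced functor \<open>(u'/b) \<rightarrow> (u/hb)\<close>.\<close>

definition slice_map :: "'k sfun \<Rightarrow> 'k strans \<Rightarrow> 'k sfun \<Rightarrow> 'k sfun \<Rightarrow> 'k sfun \<Rightarrow> 'k univ \<Rightarrow> 'k sfun" where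
  "slice_map u \<alpha> g h u' b = (let p = (\<lambda>x. Pr (FObj g (fs x)) (FArr h (sn x) \<cdot>\<^bsub>Trg u\<^esub> Cpt \<alpha> (fs x))) in
     mk_fctr (slice_over u' b) (slice_over u (FObj h b)) p
       (\<lambda>q. Pr (Pr (p (fs (fs q))) (p (sn (fs q)))) (FArr g (sn q))))"

lemma slice_map_simps [simp]:
  "Src (slice_map u \<alpha> g h u' b) = slice_over u' b" "Trg (slice_map u \<alpha> g h u' b) = slice_over u (FObj h b)"
  "x \<in> Obj (slice_over u' b) \<Longrightarrow> FObj (slice_map u \<alpha> g h u' b) x
    = Pr (FObj g (fs x)) (FArr h (sn x) \<cdot>\<^bsub>Trg u\<^esub> Cpt \<alpha> (fs x))"
  "q \<in> Arr (slice_over u' b) \<Longrightarrow> FArr (slice_map u \<alpha> g h u' b) q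
    = Pr (Pr (Pr (FObj g (fs (fs (fs q)))) (FArr h (sn (fs (fs q))) \<cdot>\<^bsub>Trg u\<^esub> Cpt \<alpha> (fs (fs (fs q)))))
             (Pr (FObj g (fs (sn (fs q)))) (FArr h (sn (sn (fs q))) \<cdot>\<^bsub>Trg u\<^esub> Cpt \<alpha> (fs (sn (fs q))))))
         (FArr g (sn q))"
  by (simp_all add: slice_map_def Let_def del: over_Obj)

locale square = big "TYPE('k)" for u :: "'k sfun" and \<alpha> :: "'k strans" and g h u' :: "'k sfun" +
  assumes small_sq [simp]: "small_functor u" "small_functor g" "small_functor h" "small_functor u'" "small_trans \<alpha>"
    and sq_eqs [simp]: "Trg g = Src u" "Src u' = Src g" "Src h = Trg u'" "Trg h = Trg u"
      "NSrc \<alpha> = u oo g" "NTrg \<alpha> = h oo u'"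
begin

lemma cell_in: "x \<in> Obj (Src g) \<Longrightarrow> Cpt \<alpha> x \<in> hom (Trg u) (FObj u (FObj g x)) (FObj h (FObj u' x))"
  using nat_trans.cpt_in[OF small_transD(1)[OF small_sq(5)], of x] by simp

lemma cell_nat: "f \<in> hom (Src g) x y
    \<Longrightarrow> Cpt \<alpha> y \<cdot>\<^bsub>Trg u\<^esub> FArr u (FArr g f) = FArr h (FArr u' f) \<cdot>\<^bsub>Trg u\<^esub> Cpt \<alpha> x"
  using nat_trans.natural[OF small_transD(1)[OF small_sq(5)], of f x y] by (simp add: hom_def)

lemma slice_map_obj:
  assumes "x \<in> Obj (slice_over u' b)"
  shows "Pr (FObj g (fs x)) (FArr h (sn x) \<cdot>\<^bsub>Trg u\<^esub> Cpt \<alpha> (fs x)) \<in> Obj (slice_over u (FObj h b))"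
proof -
  interpret B: category "Trg u" by simp
  show ?thesis using assms B.comp_in[OF cell_in[of "fs x"] small_functor_hom[OF small_sq(3), of "sn x" "FObj u' (fs x)" b, simplified]]
    small_functor_obj[OF small_sq(2)] by auto
qed

lemma slice_map_small [simp]:
  assumes b: "b \<in> Obj (Src h)"
  shows "small_functor (slice_map u \<alpha> g h u' b)"
proof -
  interpret A: category "Src u" by simp
  interpret B: category "Trg u" by simp
  interpret A': category "Src g" by simp
  interpret B': category "Trg u'" by simp
  interpret S: category "slice_over u' b" by (simp add: over_category)
  interpret T: category "slice_over u (FObj h b)" by (simp add: over_category)
  have hom: "Pr (Pr (Pr (FObj g (fs x)) (FArr h (sn x) \<cdot>\<^bsub>Trg u\<^esub> Cpt \<alpha> (fs x)))
             (Pr (FObj g (fs y)) (FArr h (sn y) \<cdot>\<^bsub>Trg u\<^esub> Cpt \<alpha> (fs y)))) (FArr g (sn q))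
      \<in> hom (slice_over u (FObj h b)) (Pr (FObj g (fs x)) (FArr h (sn x) \<cdot>\<^bsub>Trg u\<^esub> Cpt \<alpha> (fs x)))
        (Pr (FObj g (fs y)) (FArr h (sn y) \<cdot>\<^bsub>Trg u\<^esub> Cpt \<alpha> (fs y)))"
    if q: "q \<in> hom (slice_over u' b) x y" for q x y
  proof -
    obtain r where r: "q = Pr (Pr x y) r" "r \<in> hom (Src g) (fs x) (fs y)" "sn y \<cdot>\<^bsub>Trg u'\<^esub> FArr u' r = sn x"
      and xy: "x \<in> Obj (slice_over u' b)" "y \<in> Obj (slice_over u' b)"
      using q unfolding over_hom by auto
    have y: "fs y \<in> Obj (Src g)" "sn y \<in> hom (Trg u') (FObj u' (fs y)) b" using xy by auto
    have ur: "FArr u' r \<in> hom (Trg u') (FObj u' (fs x)) (FObj u' (fs y))" using small_functor_hom[of u' r] r by simp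
    have hy: "FArr h (sn y) \<in> hom (Trg u) (FObj h (FObj u' (fs y))) (FObj h b)"
      using small_functor_hom[OF small_sq(3), of "sn y"] y by simp
    have hur: "FArr h (FArr u' r) \<in> hom (Trg u) (FObj h (FObj u' (fs x))) (FObj h (FObj u' (fs y)))"
      using small_functor_hom[OF small_sq(3), of "FArr u' r"] ur by simp
    have gr: "FArr g r \<in> hom (Src u) (FObj g (fs x)) (FObj g (fs y))" using small_functor_hom[OF small_sq(2) r(2)] by simp
    note ugr = small_functor_hom[OF small_sq(1) gr]
    have cx: "Cpt \<alpha> (fs x) \<in> hom (Trg u) (FObj u (FObj g (fs x))) (FObj h (FObj u' (fs x)))"
      using cell_in A'.homD[OF r(2)] by simp
    have "(FArr h (sn y) \<cdot>\<^bsub>Trg u\<^esub> Cpt \<alpha> (fs y)) \<cdot>\<^bsub>Trg u\<^esub> FArr u (FArr g r)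
      = FArr h (sn y) \<cdot>\<^bsub>Trg u\<^esub> (FArr h (FArr u' r) \<cdot>\<^bsub>Trg u\<^esub> Cpt \<alpha> (fs x))"
      using B.assoc[OF ugr cell_in[OF y(1)] hy] cell_nat[OF r(2)] by simp
    also have "\<dots> = FArr h (sn x) \<cdot>\<^bsub>Trg u\<^esub> Cpt \<alpha> (fs x)"
      using B.assoc[OF cx hur hy] small_functor_comp[OF small_sq(3), of "FArr u' r" _ _ "sn y" b] ur y(2) r(3) by simp
    finally show ?thesis
      unfolding over_hom using slice_map_obj[OF xy(1)] slice_map_obj[OF xy(2)] gr r(1) by simp
  qed
  show ?thesis unfolding slice_map_def Let_def
  proof (rule small_functorI; (rule mk_fctrI)?, goal_cases)
    case (3 x) then show ?case by (rule slice_map_obj)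
  next
    case (4 q x y)
    show ?case using hom[OF 4] 4 by (auto simp: over_hom)
  next
    case (5 x)
    then show ?case using over_id[of x u' b] over_id[OF slice_map_obj[OF 5]] by auto
  next
    case (6 p q x y z)
    obtain r s where e: "p = Pr (Pr x y) r" "q = Pr (Pr y z) s" "r \<in> hom (Src g) (fs x) (fs y)" "s \<in> hom (Src g) (fs y) (fs z)"
      using 6 unfolding over_hom by auto
    have "FArr g (s \<cdot>\<^bsub>Src g\<^esub> r) = FArr g s \<cdot>\<^bsub>Src u\<^esub> FArr g r" using small_functor_comp[OF small_sq(2) e(3,4)] by simp
    moreover have "q \<cdot>\<^bsub>slice_over u' b\<^esub> p = Pr (Pr x z) (s \<cdot>\<^bsub>Src g\<^esub> r)"
      using over_comp[of x y r u' b z s] S.homD(1)[OF 6(1)] S.homD(1)[OF 6(2)] e by simp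
    ultimately show ?case using over_comp[OF T.homD(1)[OF hom[OF 6(1)], unfolded e univ.sel]
          T.homD(1)[OF hom[OF 6(2)], unfolded e univ.sel]] e by simp
  qed (use b in \<open>auto simp: over_category\<close>)
qed

lemma slice_map_pr:
  assumes b: "b \<in> Obj (Src h)"
  shows "over_pr u (FObj h b) oo slice_map u \<alpha> g h u' b = g oo over_pr u' b"
proof -
  note q = slice_map_small[OF b]
  show ?thesis
  proof (rule small_eqI, goal_cases)
    case (5 x)
    then have x: "x \<in> Obj (slice_over u' b)" by simp
    then show ?case using slice_map_obj[OF x] by (simp del: over_Obj)
  next
    case (6 f)
    then have f: "f \<in> Arr (slice_over u' b)" by simp
    then have "FArr (slice_map u \<alpha> g h u' b) f \<in> Arr (slice_over u (FObj h b))" using small_functor_arr[OF q, of f] by simp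
    moreover have "FArr (over_pr u' b) f \<in> Arr (Src g)" using small_functor_arr[of "over_pr u' b" f] f by simp
    ultimately show ?case using f by simp
  qed (use q b in auto)
qed

text \<open>The slice cell of \<open>u\<close> at \<open>h b\<close>, restricted along the slice
  map, is the slice cell of \<open>u'\<close> at \<open>b\<close> pasted with \<alpha>. This
  identity makes the two instances of Der4 comparable in the base change theorem.\<close>

lemma slice_map_cell:
  assumes b: "b \<in> Obj (Src h)"
  shows "hcomp (over_cell u (FObj h b)) (id_n (slice_map u \<alpha> g h u' b))
    = vcomp (hcomp (id_n h) (over_cell u' b)) (hcomp \<alpha> (id_n (over_pr u' b)))"
proof -
  let ?q = "slice_map u \<alpha> g h u' b"
  interpret B: category "Trg u" by simp
  have hb: "FObj h b \<in> Obj (Trg u)" using small_functor_obj[OF small_sq(3) b] by simp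
  have b': "b \<in> Obj (Trg u')" using b by simp
  note q = slice_map_small[OF b]
  have s: "(u oo over_pr u (FObj h b)) oo ?q = (u oo g) oo over_pr u' b"
    using slice_map_pr[OF b] q by simp
  have t: "(obj_f (Trg u) (FObj h b) oo to_pt (slice_over u (FObj h b))) oo ?q = h oo obj_f (Trg u') b oo to_pt (slice_over u' b)"
    using q hb b' obj_f_comp[of h b] b by simp
  show ?thesis
  proof (rule small_trans_eqI, goal_cases)
    case 1 show ?case using q hb by simp
  next
    case 2 show ?case using b' by (intro small_vcomp small_hcomp small_over_cell) auto
  next
    case 3 show ?case using s by simp
  next
    case 4 show ?case using t b' hb q b by simp
  next
    case (5 x)
    then have x: "x \<in> Obj (slice_over u' b)" by simp
    then obtain a f where af: "x = Pr a f" "a \<in> Obj (Src g)" "f \<in> hom (Trg u') (FObj u' a) b" by auto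
    have hf: "FArr h f \<in> hom (Trg u) (FObj h (FObj u' a)) (FObj h b)" using small_functor_hom[OF small_sq(3), of f] af by simp
    note c = cell_in[OF af(2)]
    have o: "FObj ?q x \<in> Obj (slice_over u (FObj h b))" using slice_map_obj[OF x] x by (simp del: over_Obj)
    have "Cpt (hcomp (over_cell u (FObj h b)) (id_n ?q)) x
      = sn (FObj ?q x) \<cdot>\<^bsub>Trg u\<^esub> FArr (u oo over_pr u (FObj h b)) (Idt (slice_over u (FObj h b)) (FObj ?q x))"
      using x o by (simp del: over_Obj slice_map_simps(3))
    also have "FArr (u oo over_pr u (FObj h b)) (Idt (slice_over u (FObj h b)) (FObj ?q x))
      = Idt (Trg u) (FObj u (FObj g a))"
    proof -
      have "FArr (u oo over_pr u (FObj h b)) (Idt (slice_over u (FObj h b)) (FObj ?q x))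
        = Idt (Trg u) (FObj (u oo over_pr u (FObj h b)) (FObj ?q x))"
        using small_functor_id[of "u oo over_pr u (FObj h b)" "FObj ?q x"] o by (simp del: over_Obj slice_map_simps(3))
      also have "FObj (u oo over_pr u (FObj h b)) (FObj ?q x) = FObj u (FObj g a)"
        using o x af(1) by (simp del: over_Obj)
      finally show ?thesis .
    qed
    also have "sn (FObj ?q x) \<cdot>\<^bsub>Trg u\<^esub> Idt (Trg u) (FObj u (FObj g a)) = FArr h f \<cdot>\<^bsub>Trg u\<^esub> Cpt \<alpha> a"
      using x af(1) B.idr[OF B.comp_in[OF c hf]] by (simp del: over_Obj)
    finally have L: "Cpt (hcomp (over_cell u (FObj h b)) (id_n ?q)) x = FArr h f \<cdot>\<^bsub>Trg u\<^esub> Cpt \<alpha> a" .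
    have oa: "FObj u' a \<in> Obj (Trg u')" "FObj h b \<in> Obj (Trg u)" using af hb by (auto simp: category.homD)
    have 1: "Cpt (hcomp (id_n h) (over_cell u' b)) x = FArr h f"
      using x af(1) B.idl[OF hf] b' by (simp del: over_Obj)
    have "FArr g (Idt (Src g) a) = Idt (Src u) (FObj g a)" "FObj g a \<in> Obj (Src u)"
      using small_functor_id[OF small_sq(2) af(2)] small_functor_obj[OF small_sq(2) af(2)] by simp_all
    then have 2: "Cpt (hcomp \<alpha> (id_n (over_pr u' b))) x = Cpt \<alpha> a"
      using x af(1,2) B.idr[OF c] category.homD(1)[OF _ category.id_in, of "Src g" a]
      by (simp del: over_Obj)
    show ?case using L 1 2 x by (simp del: over_Obj)
  qed
qed

end

text \<open>The axioms on left Kan extensions, with Der2 as joint conservativity of the points.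
  Isolating them allows base change to be applied to a shifted prederivator before it is known to be
  a derivator.\<close>

locale ldv = pd D for D :: "('k, 'o, 'm) pder" +
  assumes L_der2: "\<lbrakk>small_cat B; f \<in> Arr (DC D B); \<And>b. b \<in> Obj B \<Longrightarrow> iso_in (DC D pt) (pbA D (obj_f B b) f)\<rbrakk> \<Longrightarrow> iso_in (DC D B) f"
    and L_der3: "small_functor u \<Longrightarrow> \<exists>F \<eta> \<epsilon>. adjunction F (DF D u) \<eta> \<epsilon>"
    and L_der4: "\<lbrakk>small_functor u; b \<in> Obj (Trg u); X \<in> Obj (DC D (Src u))\<rbrakk> \<Longrightarrow> iso_in (DC D pt) (der4_left D u b X)"
begin

lemma lan_adjunction: "small_functor u \<Longrightarrow> adjunction (lan D u) (DF D u) (lan_unit D u) (lan_counit D u)"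
proof -
  assume "small_functor u"
  then obtain F \<eta> \<epsilon> where "adjunction F (DF D u) \<eta> \<epsilon>" using L_der3 by blast
  then have "case (F, \<eta>, \<epsilon>) of (F, \<eta>, \<epsilon>) \<Rightarrow> adjunction F (DF D u) \<eta> \<epsilon>" by simp
  then have "case lan_adj D u of (F, \<eta>, \<epsilon>) \<Rightarrow> adjunction F (DF D u) \<eta> \<epsilon>"
    unfolding lan_adj_def by (rule someI)
  then show ?thesis by (simp add: lan_def lan_unit_def lan_counit_def split: prod.splits)
qed

lemma lan_functor: "small_functor u \<Longrightarrow> is_functor (lan D u)"
  and lan_src [simp]: "small_functor u \<Longrightarrow> Src (lan D u) = DC D (Src u)"
  and lan_trg [simp]: "small_functor u \<Longrightarrow> Trg (lan D u) = DC D (Trg u)"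
  using lan_adjunction[of u] adjunction.left_functor adjunction.src_right adjunction.trg_right DF_src DF_trg by metis+

lemma lan_obj [simp]: "\<lbrakk>small_functor u; X \<in> ob (Src u)\<rbrakk> \<Longrightarrow> FObj (lan D u) X \<in> ob (Trg u)"
  using is_functor.obj_in[OF lan_functor, of u X] by simp

lemma lan_transpose:
  assumes g: "g \<in> H D u X Y"
  shows "lan_transpose D u Y g \<in> hm (Trg u) (FObj (lan D u) X) Y"
    and "cm u (lan_transpose D u Y g) (Cpt (lan_unit D u) X) = g"
  using adjunction_universal(3,4)[OF lan_adjunction, of u X Y g] HD[OF g] by (auto simp: lan_transpose_def cmp_def)

lemma lan_opc: "\<lbrakk>small_functor u; X \<in> ob (Src u)\<rbrakk> \<Longrightarrow> opc D u X (FObj (lan D u) X) (Cpt (lan_unit D u) X)"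
proof (rule opcI, goal_cases)
  case 1
  then show ?case using adjunction_universal(1)[OF lan_adjunction, of u X "FObj (lan D u) X"] by (simp add: H_def)
next
  case (2 Z' g) then show ?case using lan_transpose by blast
next
  case (3 Z' h h')
  then show ?case using adjunction_universal(6)[OF lan_adjunction, of u X Z' h]
      adjunction_universal(6)[OF lan_adjunction, of u X Z' h'] homO[of "Trg u" h] by (simp add: cmp_def)
qed

text \<open>The transpose is the fibre arrow through which \<open>g\<close> factors over the
  universal arrow of the chosen extension. This is the dictionary between the axioms, which speak of
  transposes, and opcartesian arrows.\<close>

lemma lan_transpose_iso:
  assumes "g \<in> H D u X Y"
  shows "isoin (Trg u) (lan_transpose D u Y g) \<longleftrightarrow> opc D u X Y g"
  using opc_iso_post[OF lan_opc lan_transpose(1)[OF assms]] lan_transpose(2)[OF assms] HD[OF assms] by simp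

lemma lan_arr:
  assumes "small_functor u" "f \<in> hm (Src u) X X'"
  shows "FArr (lan D u) f \<in> hm (Trg u) (FObj (lan D u) X) (FObj (lan D u) X')"
    and "cm u (FArr (lan D u) f) (Cpt (lan_unit D u) X) = Cpt (lan_unit D u) X' \<cdot>[Src u] f"
proof -
  show "FArr (lan D u) f \<in> hm (Trg u) (FObj (lan D u) X) (FObj (lan D u) X')"
    using is_functor.arr_in[OF lan_functor, of u f X X'] assms by simp
  interpret adjunction "lan D u" "DF D u" "lan_unit D u" "lan_counit D u" using lan_adjunction assms by simp
  show "cm u (FArr (lan D u) f) (Cpt (lan_unit D u) X) = Cpt (lan_unit D u) X' \<cdot>[Src u] f"
    using nat_trans.natural[OF unit_trans(1), of f X X'] assms homA[OF _ assms(2)] by (simp add: unit_trans cmp_def)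
qed

text \<open>Der4 speaks of the chosen extension; the statement is carried to an arbitrary one along
  the comparison isomorphism by naturality of the slice cell.\<close>

lemma der4_opc:
  assumes f: "opc D u X Z f" and b: "b \<in> Obj (Trg u)"
  shows "opc D (to_pt (slice_over u b)) (pb (over_pr u b) X) (pb (obj_f (Trg u) b) Z)
    (Cpt (DT D (over_cell u b)) Z \<cdot>[slice_over u b] pa (over_pr u b) f)"
proof -
  note fH = HD[OF opcD[OF f]]
  let ?S = "slice_over u b" and ?W = "FObj (lan D u) X" and ?e = "Cpt (lan_unit D u) X"
  let ?g = "Cpt (DT D (over_cell u b)) ?W \<cdot>[?S] pa (over_pr u b) ?e"
  note e = lan_opc[OF fH(1) fH(4)]
  note eH = HD[OF opcD[OF e]]
  interpret S: category "DC D ?S" using fH by simp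
  have cell: "Cpt (DT D (over_cell u b)) Y \<in> hm ?S (pb (over_pr u b) (pb u Y))
      (pb (to_pt ?S) (pb (obj_f (Trg u) b) Y))" if "Y \<in> ob (Trg u)" for Y
    using DT_in[of "over_cell u b" Y] that fH b by simp
  have pe: "pa (over_pr u b) k \<in> hm ?S (pb (over_pr u b) Y) (pb (over_pr u b) (pb u Y'))"
    if "k \<in> H D u Y Y'" for k Y Y'
    using pbA_in[of "over_pr u b" k] HD[OF that] by simp
  have g: "?g \<in> H D (to_pt ?S) (pb (over_pr u b) X) (pb (obj_f (Trg u) b) ?W)"
    using S.comp_in[OF pe[OF opcD[OF e]] cell[OF eH(2)]] fH eH b by (auto intro!: HI)
  have go: "opc D (to_pt ?S) (pb (over_pr u b) X) (pb (obj_f (Trg u) b) ?W) ?g"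
    using L_der4[OF fH(1) b fH(4)] lan_transpose_iso[OF g] by (simp add: der4_left_def Let_def)
  \<comment> \<open>\<open>k\<close> compares the chosen extension with the given one; its
    restriction to \<open>b\<close> is the isomorphism by which the two arrows over the slice
    differ.\<close>
  obtain k where k: "k \<in> hm (Trg u) ?W Z" "cm u k ?e = f" using opc_ex[OF e opcD[OF f]] by metis
  then have "isoin (Trg u) k" using opc_iso_post[OF e k(1)] f by simp
  then have kb: "isoin pt (pa (obj_f (Trg u) b) k)" using pbA_iso[of "obj_f (Trg u) b" k] fH b by simp
  have kb': "pa (obj_f (Trg u) b) k \<in> hm pt (pb (obj_f (Trg u) b) ?W) (pb (obj_f (Trg u) b) Z)"
    using pbA_in[of "obj_f (Trg u) b" k] k fH b by simp
  have r: "opc D (to_pt ?S) (pb (over_pr u b) X) (pb (obj_f (Trg u) b) Z) (cm (to_pt ?S) (pa (obj_f (Trg u) b) k) ?g)"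
    using opc_iso_post[OF go, of "pa (obj_f (Trg u) b) k"] kb kb' by simp
  have uk: "pa u k \<in> hm (Src u) (pb u ?W) (pb u Z)" using pbA_in[OF fH(1) k(1)] .
  have puk: "pa (over_pr u b) (pa u k) \<in> hm ?S (pb (over_pr u b) (pb u ?W)) (pb (over_pr u b) (pb u Z))"
    using pbA_in[of "over_pr u b" "pa u k"] uk fH by simp
  have kk: "pa (to_pt ?S) (pa (obj_f (Trg u) b) k) \<in> hm ?S (pb (to_pt ?S) (pb (obj_f (Trg u) b) ?W))
     (pb (to_pt ?S) (pb (obj_f (Trg u) b) Z))" using pbA_in[of "to_pt ?S"] kb' fH by simp
  have n: "Cpt (DT D (over_cell u b)) Z \<cdot>[?S] pa (over_pr u b) (pa u k)
      = pa (to_pt ?S) (pa (obj_f (Trg u) b) k) \<cdot>[?S] Cpt (DT D (over_cell u b)) ?W"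
    using DT_nat[of "over_cell u b" k ?W Z] k fH b homA[OF _ k(1)] by simp
  have "pa (over_pr u b) f = pa (over_pr u b) (pa u k) \<cdot>[?S] pa (over_pr u b) ?e"
    using pbA_mult[of "over_pr u b" ?e X "pb u ?W" "pa u k" "pb u Z"] k(2) eH uk fH by (simp add: cmp_def)
  then have "cm (to_pt ?S) (pa (obj_f (Trg u) b) k) ?g
    = Cpt (DT D (over_cell u b)) Z \<cdot>[?S] pa (over_pr u b) f"
    using S.assoc[OF pe[OF opcD[OF e]] puk cell[OF fH(2)]] S.assoc[OF pe[OF opcD[OF e]] cell[OF eH(2)] kk] n
    by (simp add: cmp_def)
  then show ?thesis using r by simp
qed

text \<open>Pointwise criterion for base change: by \<open>der2\<close> and \<open>der4\<close> it suffices to compare slices.\<close>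

theorem base_change:
  assumes "square u \<alpha> g h u'" and fin: "\<And>b. b \<in> Obj (Src h) \<Longrightarrow> final D (slice_map u \<alpha> g h u' b)"
    and f: "opc D u X Z f"
  shows "opc D u' (pb g X) (pb h Z) (Cpt (DT D \<alpha>) Z \<cdot>[Src g] pa g f)"
proof -
  interpret square u \<alpha> g h u' by fact
  note fH = HD[OF opcD[OF f]]
  interpret A': category "DC D (Src g)" by simp
  let ?f' = "Cpt (DT D \<alpha>) Z \<cdot>[Src g] pa g f"
  have gf: "pa g f \<in> hm (Src g) (pb g X) (pb g (pb u Z))" using pbA_in[of g f] fH by simp
  have aZ: "Cpt (DT D \<alpha>) Z \<in> hm (Src g) (pb g (pb u Z)) (pb u' (pb h Z))"
    using DT_in[of \<alpha> Z] fH by simp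
  have f': "?f' \<in> H D u' (pb g X) (pb h Z)" using A'.comp_in[OF gf aZ] fH by (auto intro!: HI)
  let ?Z = "FObj (lan D u') (pb g X)" and ?e = "Cpt (lan_unit D u') (pb g X)"
  have e: "opc D u' (pb g X) ?Z ?e" using lan_opc[of u' "pb g X"] fH by simp
  note eH = HD[OF opcD[OF e]]
  \<comment> \<open>\<open>k\<close> is the Beck-Chevalley comparison from the left extension of
    \<open>g^* X\<close> along \<open>u'\<close> to \<open>h^* Z\<close>; it remains to see that it
    is invertible at every object \<open>b\<close>.\<close>
  obtain k where k: "k \<in> hm (Trg u') ?Z (pb h Z)" "cm u' k ?e = ?f'" using opc_ex[OF e f'] by metis
  have "isoin (Trg u') k"
  proof (rule L_der2)
    fix b assume b: "b \<in> Obj (Trg u')"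
    then have b': "b \<in> Obj (Src h)" by simp
    let ?q = "slice_map u \<alpha> g h u' b" and ?S = "slice_over u' b" and ?T = "slice_over u (FObj h b)"
      and ?b = "obj_f (Trg u') b" and ?pr = "over_pr u' b"
    have hb: "FObj h b \<in> Obj (Trg u)" using small_functor_obj[OF small_sq(3) b'] by simp
    note q = slice_map_small[OF b']
    interpret S: category "DC D ?S" by simp
    let ?c = "Cpt (DT D (over_cell u (FObj h b))) Z" and ?c' = "Cpt (DT D (over_cell u' b))"
    have bh: "pb (obj_f (Trg u) (FObj h b)) Z = pb ?b (pb h Z)"
      using obj_f_comp[of h b] pbO_comp[of ?b h Z] b fH by simp
    have 1: "opc D (to_pt ?S) (pb ?q (pb (over_pr u (FObj h b)) X)) (pb ?b (pb h Z))
        (pa ?q (?c \<cdot>[?T] pa (over_pr u (FObj h b)) f))"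
      using fin[OF b'] der4_opc[OF f hb] bh unfolding final_def by simp
    have dom: "pb ?q (pb (over_pr u (FObj h b)) X) = pb ?pr (pb g X)"
      using pbO_comp[of ?q "over_pr u (FObj h b)" X] pbO_comp[of ?pr g X] slice_map_pr[OF b'] fH q by simp
    have cl: "?c \<in> hm ?T (pb (over_pr u (FObj h b)) (pb u Z)) (pb (to_pt ?T) (pb (obj_f (Trg u) (FObj h b)) Z))"
      using DT_in[of "over_cell u (FObj h b)" Z] hb fH by simp
    have pf: "pa (over_pr u (FObj h b)) f \<in> hm ?T (pb (over_pr u (FObj h b)) X) (pb (over_pr u (FObj h b)) (pb u Z))"
      using pbA_in[of "over_pr u (FObj h b)" f] fH by simp
    have qf: "pa ?q (pa (over_pr u (FObj h b)) f) = pa ?pr (pa g f)"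
      using pbA_comp[of ?q "over_pr u (FObj h b)" f] pbA_comp[of ?pr g f] slice_map_pr[OF b'] fH q by simp
    have Zo: "Z \<in> ob (Trg u)" by (rule fH)
    have hZ: "pb h Z \<in> ob (Trg u')" using pbO_in[of h Z] fH by simp
    have pa: "pa ?pr (Cpt (DT D \<alpha>) Z) \<in> hm ?S (pb ?pr (pb g (pb u Z))) (pb ?pr (pb u' (pb h Z)))"
      by (rule pbA_in'[OF _ _ _ aZ]) simp_all
    have c'h: "?c' Y \<in> hm ?S (pb ?pr (pb u' Y)) (pb (to_pt ?S) (pb ?b Y))" if "Y \<in> ob (Trg u')" for Y
      using DT_in[of "over_cell u' b" Y] that b by simp
    \<comment> \<open>The pasting identity for slice cells, read in \<open>D\<close>: the restricted
      cell at \<open>h b\<close> splits into the cell at \<open>b\<close> and the component of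
      \<alpha>.\<close>
    have qc: "pa ?q ?c = ?c' (pb h Z) \<cdot>[?S] pa ?pr (Cpt (DT D \<alpha>) Z)"
    proof -
      have "pa ?q ?c = Cpt (DT D (hcomp (over_cell u (FObj h b)) (id_n ?q))) Z"
        using DT_whisker_left[of "over_cell u (FObj h b)" ?q Z] hb q Zo by simp
      also have "\<dots> = Cpt (DT D (vcomp (hcomp (id_n h) (over_cell u' b)) (hcomp \<alpha> (id_n ?pr)))) Z"
        using slice_map_cell[OF b'] by simp
      also have "\<dots> = Cpt (DT D (hcomp (id_n h) (over_cell u' b))) Z \<cdot>[?S] Cpt (DT D (hcomp \<alpha> (id_n ?pr))) Z"
        using DT_vcomp'[of "hcomp \<alpha> (id_n ?pr)" "hcomp (id_n h) (over_cell u' b)" Z] Zo b by simp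
      finally show ?thesis using DT_whisker_left[of \<alpha> ?pr Z] DT_whisker_right[of "over_cell u' b" h Z] Zo b by simp
    qed
    have pe: "pa ?pr ?e \<in> hm ?S (pb ?pr (pb g X)) (pb ?pr (pb u' ?Z))"
      using pbA_in[of ?pr ?e] eH by simp
    have 2: "opc D (to_pt ?S) (pb ?pr (pb g X)) (pb ?b ?Z) (?c' ?Z \<cdot>[?S] pa ?pr ?e)"
      using der4_opc[OF e b] by simp
    have bk: "pa ?b k \<in> hm pt (pb ?b ?Z) (pb ?b (pb h Z))" using pbA_in[of ?b k] k b by simp
    have tbk: "pa (to_pt ?S) (pa ?b k) \<in> hm ?S (pb (to_pt ?S) (pb ?b ?Z)) (pb (to_pt ?S) (pb ?b (pb h Z)))"
      by (rule pbA_in'[OF _ _ _ bk]) simp_all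
    have uk: "pa u' k \<in> hm (Src g) (pb u' ?Z) (pb u' (pb h Z))" using pbA_in[of u' k] k by simp
    have puk: "pa ?pr (pa u' k) \<in> hm ?S (pb ?pr (pb u' ?Z)) (pb ?pr (pb u' (pb h Z)))"
      using pbA_in[of ?pr "pa u' k"] uk by simp
    have n: "?c' (pb h Z) \<cdot>[?S] pa ?pr (pa u' k) = pa (to_pt ?S) (pa ?b k) \<cdot>[?S] ?c' ?Z"
      using DT_nat[of "over_cell u' b" k ?Z "pb h Z"] k b homA[OF _ k(1)] by simp
    have ppf: "pa ?pr (pa g f) \<in> hm ?S (pb ?pr (pb g X)) (pb ?pr (pb g (pb u Z)))"
      using pbA_in[of ?pr "pa g f"] gf by simp
    have fe: "pa ?pr (pa u' k) \<cdot>[?S] pa ?pr ?e = pa ?pr (Cpt (DT D \<alpha>) Z) \<cdot>[?S] pa ?pr (pa g f)"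
      using pbA_mult[of ?pr ?e "pb g X" "pb u' ?Z" "pa u' k" "pb u' (pb h Z)"] uk eH(3)
        pbA_mult[of ?pr "pa g f" "pb g X" "pb g (pb u Z)" "Cpt (DT D \<alpha>) Z" "pb u' (pb h Z)"] gf aZ
        k(2) by (simp add: cmp_def)
    \<comment> \<open>The universal arrow at \<open>h b\<close>, restricted along the final slice
      map, equals the universal arrow at \<open>b\<close> followed by \<open>b^* k\<close>. Both are
      opcartesian, so \<open>b^* k\<close> is invertible.\<close>
    have "pa ?q (?c \<cdot>[?T] pa (over_pr u (FObj h b)) f)
        = (?c' (pb h Z) \<cdot>[?S] pa ?pr (Cpt (DT D \<alpha>) Z)) \<cdot>[?S] pa ?pr (pa g f)"
      using pbA_mult[of ?q "pa (over_pr u (FObj h b)) f" _ _ ?c] q pf cl qf qc by simp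
    also have "\<dots> = ?c' (pb h Z) \<cdot>[?S] (pa ?pr (pa u' k) \<cdot>[?S] pa ?pr ?e)"
      using S.assoc[OF ppf pa c'h[OF hZ]] fe by simp
    also have "\<dots> = (pa (to_pt ?S) (pa ?b k) \<cdot>[?S] ?c' ?Z) \<cdot>[?S] pa ?pr ?e"
      using S.assoc[OF pe puk c'h[OF hZ]] n by simp
    also have "\<dots> = cm (to_pt ?S) (pa ?b k) (?c' ?Z \<cdot>[?S] pa ?pr ?e)"
      using S.assoc[OF pe c'h[OF eH(2)] tbk] by (simp add: cmp_def)
    finally show "isoin pt (pa ?b k)"
      using opc_iso_post[OF 2, of "pa ?b k"] bk 1 dom by simp
  qed (use k(1) homA[OF _ k(1)] in auto)
  then show ?thesis using opc_iso_post[OF e k(1)] k(2) by simp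
qed

end

section \<open>Final functors\<close>

text \<open>Universal arrows \<open>e t : t \<rightarrow> q (L t)\<close> assemble to a left adjoint of \<open>q\<close>.\<close>

locale universal_arrows = big "TYPE('k)" for q :: "'k sfun" and L e :: "'k univ \<Rightarrow> 'k univ" +
  assumes small_q [simp]: "small_functor q"
    and L_in: "t \<in> Obj (Trg q) \<Longrightarrow> L t \<in> Obj (Src q)"
    and e_in: "t \<in> Obj (Trg q) \<Longrightarrow> e t \<in> hom (Trg q) t (FObj q (L t))"
    and univ_ex: "\<lbrakk>t \<in> Obj (Trg q); s \<in> Obj (Src q); f \<in> hom (Trg q) t (FObj q s)\<rbrakk>
      \<Longrightarrow> \<exists>g. g \<in> hom (Src q) (L t) s \<and> FArr q g \<cdot>\<^bsub>Trg q\<^esub> e t = f"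
    and univ_eq: "\<lbrakk>t \<in> Obj (Trg q); g \<in> hom (Src q) (L t) s; g' \<in> hom (Src q) (L t) s;
      FArr q g \<cdot>\<^bsub>Trg q\<^esub> e t = FArr q g' \<cdot>\<^bsub>Trg q\<^esub> e t\<rbrakk> \<Longrightarrow> g = g'"
begin

sublocale S: category "Src q" by simp
sublocale T: category "Trg q" by simp

definition tr :: "'k univ \<Rightarrow> 'k univ \<Rightarrow> 'k univ \<Rightarrow> 'k univ" where
  "tr t s f = (THE g. g \<in> hom (Src q) (L t) s \<and> FArr q g \<cdot>\<^bsub>Trg q\<^esub> e t = f)"

lemma tr:
  assumes "t \<in> Obj (Trg q)" "s \<in> Obj (Src q)" "f \<in> hom (Trg q) t (FObj q s)"
  shows "tr t s f \<in> hom (Src q) (L t) s" "FArr q (tr t s f) \<cdot>\<^bsub>Trg q\<^esub> e t = f"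
proof -
  have "\<exists>!g. g \<in> hom (Src q) (L t) s \<and> FArr q g \<cdot>\<^bsub>Trg q\<^esub> e t = f"
    using univ_ex[OF assms] univ_eq[OF assms(1)] by auto
  from theI'[OF this] show "tr t s f \<in> hom (Src q) (L t) s" "FArr q (tr t s f) \<cdot>\<^bsub>Trg q\<^esub> e t = f"
    unfolding tr_def by auto
qed

definition left :: "'k sfun" where
  "left = mk_fctr (Trg q) (Src q) L (\<lambda>f. tr (Dom (Trg q) f) (L (Cod (Trg q) f)) (e (Cod (Trg q) f) \<cdot>\<^bsub>Trg q\<^esub> f))"

lemma left_simps [simp]: "Src left = Trg q" "Trg left = Src q" "t \<in> Obj (Trg q) \<Longrightarrow> FObj left t = L t"
  by (simp_all add: left_def)

lemma left_arr:
  assumes f: "f \<in> hom (Trg q) t t'"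
  shows "FArr left f \<in> hom (Src q) (L t) (L t')" "FArr q (FArr left f) \<cdot>\<^bsub>Trg q\<^esub> e t = e t' \<cdot>\<^bsub>Trg q\<^esub> f"
  using tr[of t "L t'" "e t' \<cdot>\<^bsub>Trg q\<^esub> f"] T.homD[OF f] L_in T.comp_in[OF f e_in] by (simp_all add: left_def)

lemma small_left [simp]: "small_functor left"
proof (rule small_functorI)
  have id: "FArr left (Idt (Trg q) t) = Idt (Src q) (L t)" if t: "t \<in> Obj (Trg q)" for t
    using univ_eq[OF t left_arr(1)[OF T.id_in[OF t]] S.id_in[OF L_in[OF t]]] left_arr(2)[OF T.id_in[OF t]]
      T.idr[OF e_in[OF t]] T.idl[OF e_in[OF t]] L_in[OF t] by simp
  have comp: "FArr left (g \<cdot>\<^bsub>Trg q\<^esub> f) = FArr left g \<cdot>\<^bsub>Src q\<^esub> FArr left f"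
    if f: "f \<in> hom (Trg q) x y" and g: "g \<in> hom (Trg q) y z" for f g x y z
  proof (rule univ_eq)
    note xyz = T.homD(4,5)[OF f] T.homD(5)[OF g]
    have qf: "FArr q (FArr left f) \<in> hom (Trg q) (FObj q (L x)) (FObj q (L y))"
      and qg: "FArr q (FArr left g) \<in> hom (Trg q) (FObj q (L y)) (FObj q (L z))"
      using small_functor_hom[OF small_q] left_arr(1)[OF f] left_arr(1)[OF g] by auto
    show "x \<in> Obj (Trg q)" by fact
    show "FArr left (g \<cdot>\<^bsub>Trg q\<^esub> f) \<in> hom (Src q) (L x) (L z)" using left_arr(1)[OF T.comp_in[OF f g]] .
    show "FArr left g \<cdot>\<^bsub>Src q\<^esub> FArr left f \<in> hom (Src q) (L x) (L z)"
      using S.comp_in[OF left_arr(1)[OF f] left_arr(1)[OF g]] .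
    have "FArr q (FArr left g \<cdot>\<^bsub>Src q\<^esub> FArr left f) \<cdot>\<^bsub>Trg q\<^esub> e x
      = FArr q (FArr left g) \<cdot>\<^bsub>Trg q\<^esub> (FArr q (FArr left f) \<cdot>\<^bsub>Trg q\<^esub> e x)"
      using small_functor_comp[OF small_q left_arr(1)[OF f] left_arr(1)[OF g]] T.assoc[OF e_in[OF xyz(1)] qf qg] by simp
    also have "\<dots> = e z \<cdot>\<^bsub>Trg q\<^esub> (g \<cdot>\<^bsub>Trg q\<^esub> f)"
      using left_arr(2)[OF f] left_arr(2)[OF g] T.assoc[OF f e_in[OF xyz(2)] qg] T.assoc[OF f g e_in[OF xyz(3)]] by simp
    finally show "FArr q (FArr left (g \<cdot>\<^bsub>Trg q\<^esub> f)) \<cdot>\<^bsub>Trg q\<^esub> e x = FArr q (FArr left g \<cdot>\<^bsub>Src q\<^esub> FArr left f) \<cdot>\<^bsub>Trg q\<^esub> e x"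
      using left_arr(2)[OF T.comp_in[OF f g]] by simp
  qed
  have eq: "left = mk_fctr (Trg q) (Src q) L (FArr left)"
    by (subst left_def, rule mk_fctr_cong) (simp_all add: left_def)
  show "is_functor left"
    by (subst eq, rule mk_fctrI) (auto simp: L_in left_arr id comp S.category_axioms T.category_axioms)
qed simp_all

definition unit :: "'k strans" where
  "unit = mk_ntrans (id_f (Trg q)) (q oo left) e"

definition counit :: "'k strans" where
  "counit = mk_ntrans (left oo q) (id_f (Src q)) (\<lambda>s. tr (FObj q s) s (Idt (Trg q) (FObj q s)))"

lemma unit_simps [simp]: "NSrc unit = id_f (Trg q)" "NTrg unit = q oo left"
  "t \<in> Obj (Trg q) \<Longrightarrow> Cpt unit t = e t"
  by (simp_all add: unit_def)

lemma counit_simps [simp]: "NSrc counit = left oo q" "NTrg counit = id_f (Src q)"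
  by (simp_all add: counit_def)

lemma counit:
  assumes "s \<in> Obj (Src q)"
  shows "Cpt counit s \<in> hom (Src q) (L (FObj q s)) s"
    "FArr q (Cpt counit s) \<cdot>\<^bsub>Trg q\<^esub> e (FObj q s) = Idt (Trg q) (FObj q s)"
  using tr[of "FObj q s" s] assms T.id_in[of "FObj q s"] by (auto simp: counit_def)

lemma small_unit [simp]: "small_trans unit"
  unfolding unit_def
proof (rule small_transI, goal_cases)
  case (6 f x y)
  then have f: "f \<in> hom (Trg q) x y" by simp
  then show ?case using T.homD(1)[OF f] left_arr(2)[OF f] by simp
qed (auto simp: e_in)

lemma small_counit [simp]: "small_trans counit"
  unfolding counit_def
proof (rule small_transI, goal_cases)
  case (5 x)
  then show ?case using tr(1)[of "FObj q x" x] T.id_in[of "FObj q x"] by simp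
next
  case (6 f x y)
  then have f: "f \<in> hom (Src q) x y" by simp
  note xy = S.homD(4,5)[OF f]
  let ?c = "\<lambda>s. tr (FObj q s) s (Idt (Trg q) (FObj q s))"
  have c: "?c s \<in> hom (Src q) (L (FObj q s)) s" "FArr q (?c s) \<cdot>\<^bsub>Trg q\<^esub> e (FObj q s) = Idt (Trg q) (FObj q s)"
    if "s \<in> Obj (Src q)" for s
    using tr[of "FObj q s" s] that T.id_in[of "FObj q s"] by auto
  have qf: "FArr q f \<in> hom (Trg q) (FObj q x) (FObj q y)" using small_functor_hom[OF small_q f] .
  note lf = left_arr[OF qf]
  have qlf: "FArr q (FArr left (FArr q f)) \<in> hom (Trg q) (FObj q (L (FObj q x))) (FObj q (L (FObj q y)))"
    using small_functor_hom[OF small_q lf(1)] .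
  have ex: "e (FObj q s) \<in> hom (Trg q) (FObj q s) (FObj q (L (FObj q s)))" if "s \<in> Obj (Src q)" for s
    using e_in that by simp
  have "?c y \<cdot>\<^bsub>Src q\<^esub> FArr left (FArr q f) = f \<cdot>\<^bsub>Src q\<^esub> ?c x"
  proof (rule univ_eq)
    show "FObj q x \<in> Obj (Trg q)" using xy by simp
    show "?c y \<cdot>\<^bsub>Src q\<^esub> FArr left (FArr q f) \<in> hom (Src q) (L (FObj q x)) y" using S.comp_in[OF lf(1) c(1)[OF xy(2)]] .
    show "f \<cdot>\<^bsub>Src q\<^esub> ?c x \<in> hom (Src q) (L (FObj q x)) y" using S.comp_in[OF c(1)[OF xy(1)] f] .
    have "FArr q (?c y \<cdot>\<^bsub>Src q\<^esub> FArr left (FArr q f)) \<cdot>\<^bsub>Trg q\<^esub> e (FObj q x)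
      = FArr q (?c y) \<cdot>\<^bsub>Trg q\<^esub> (e (FObj q y) \<cdot>\<^bsub>Trg q\<^esub> FArr q f)"
      using small_functor_comp[OF small_q lf(1) c(1)[OF xy(2)]]
        T.assoc[OF ex[OF xy(1)] qlf small_functor_hom[OF small_q c(1)[OF xy(2)]]] lf(2) by simp
    also have "\<dots> = FArr q f"
      using T.assoc[OF qf ex[OF xy(2)] small_functor_hom[OF small_q c(1)[OF xy(2)]]] c(2)[OF xy(2)] T.idl[OF qf] by simp
    also have "\<dots> = FArr q (f \<cdot>\<^bsub>Src q\<^esub> ?c x) \<cdot>\<^bsub>Trg q\<^esub> e (FObj q x)"
      using small_functor_comp[OF small_q c(1)[OF xy(1)] f] T.idr[OF qf] c(2)[OF xy(1)]
        T.assoc[OF ex[OF xy(1)] small_functor_hom[OF small_q c(1)[OF xy(1)]] qf] by simp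
    finally show "FArr q (?c y \<cdot>\<^bsub>Src q\<^esub> FArr left (FArr q f)) \<cdot>\<^bsub>Trg q\<^esub> e (FObj q x)
      = FArr q (f \<cdot>\<^bsub>Src q\<^esub> ?c x) \<cdot>\<^bsub>Trg q\<^esub> e (FObj q x)" .
  qed
  then show ?case using S.homD(1)[OF f] by simp
qed auto

lemma triangle1: "vcomp (hcomp (id_n q) counit) (hcomp unit (id_n q)) = id_n q"
proof (rule small_trans_eqI)
  fix x assume "x \<in> Obj (Src (NSrc (id_n q)))"
  then have x: "x \<in> Obj (Src q)" by simp
  then have x': "FObj q x \<in> Obj (Trg q)" by simp
  have "FArr q (Cpt counit x) \<in> hom (Trg q) (FObj q (L (FObj q x))) (FObj q x)"
    using small_functor_hom[OF small_q counit(1)[OF x]] .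
  then show "Cpt (vcomp (hcomp (id_n q) counit) (hcomp unit (id_n q))) x = Cpt (id_n q) x"
    using x x' counit(2)[OF x] T.idl T.idr[OF e_in[OF x']] T.homD(1)[OF T.id_in[OF x']] by simp
qed simp_all

lemma triangle2: "vcomp (hcomp counit (id_n left)) (hcomp (id_n left) unit) = id_n left"
proof (rule small_trans_eqI)
  fix t assume "t \<in> Obj (Src (NSrc (id_n left)))"
  then have t: "t \<in> Obj (Trg q)" by simp
  note Lt = L_in[OF t] and et = e_in[OF t]
  have qL: "FObj q (L t) \<in> Obj (Trg q)" using Lt by simp
  note c = counit[OF Lt] and l = left_arr[OF et]
  have "Cpt counit (L t) \<cdot>\<^bsub>Src q\<^esub> FArr left (e t) = Idt (Src q) (L t)"
  proof (rule univ_eq[OF t])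
    show "Cpt counit (L t) \<cdot>\<^bsub>Src q\<^esub> FArr left (e t) \<in> hom (Src q) (L t) (L t)" using S.comp_in[OF l(1) c(1)] .
    show "Idt (Src q) (L t) \<in> hom (Src q) (L t) (L t)" using S.id_in[OF Lt] .
    have "FArr q (Cpt counit (L t) \<cdot>\<^bsub>Src q\<^esub> FArr left (e t)) \<cdot>\<^bsub>Trg q\<^esub> e t
      = FArr q (Cpt counit (L t)) \<cdot>\<^bsub>Trg q\<^esub> (e (FObj q (L t)) \<cdot>\<^bsub>Trg q\<^esub> e t)"
      using small_functor_comp[OF small_q l(1) c(1)]
        T.assoc[OF et small_functor_hom[OF small_q l(1)] small_functor_hom[OF small_q c(1)]] l(2) by simp
    also have "\<dots> = e t"
      using T.assoc[OF et e_in[OF qL] small_functor_hom[OF small_q c(1)]] c(2) T.idl[OF et] by simp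
    finally show "FArr q (Cpt counit (L t) \<cdot>\<^bsub>Src q\<^esub> FArr left (e t)) \<cdot>\<^bsub>Trg q\<^esub> e t
      = FArr q (Idt (Src q) (L t)) \<cdot>\<^bsub>Trg q\<^esub> e t" using T.idl[OF et] Lt by simp
  qed
  moreover have "Cpt (hcomp (id_n left) unit) t = FArr left (e t)" using t qL S.idl[OF l(1)] by simp
  moreover have "Cpt (hcomp counit (id_n left)) t = Cpt counit (L t)"
    using t Lt S.idr[OF c(1)] S.homD(1)[OF S.id_in[OF Lt]] small_functor_id[of left "FObj q (L t)"] qL
      small_functor_id[OF small_q Lt] by simp
  ultimately show "Cpt (vcomp (hcomp counit (id_n left)) (hcomp (id_n left) unit)) t = Cpt (id_n left) t"
    using t by simp
qed simp_all

text \<open>The unit becomes trivial over the point; hence transporting a cocone along the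
  adjunction returns the same cocone in \<open>final_universal_arrows\<close>.\<close>

lemma unit_to_pt: "hcomp (id_n (to_pt (Trg q))) unit = id_n (to_pt (Trg q))"
  by (rule small_trans_eqI) (use L_in e_in T.homD(1)[OF e_in] in auto)

end

context ldv
begin

text \<open>\<open>D\<close> reverses functors and keeps the direction of transformations, so
  \<open>left\<close> being left adjoint to \<open>q\<close> makes \<open>q^*\<close> left adjoint
  to \<open>left^*\<close>. Thus \<open>q^*\<close> computes left extension along
  \<open>left\<close>, with the image of the unit as universal arrow.\<close>

lemma opc_unit:
  assumes "universal_arrows q L e" and W: "W \<in> ob (Trg q)"
  shows "opc D (universal_arrows.left q L e) W (pb q W) (Cpt (DT D (universal_arrows.unit q L e)) W)"
proof -
  interpret universal_arrows q L e by fact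
  interpret A: category "DC D (Trg q)" by simp
  interpret B: category "DC D (Src q)" by simp
  let ?u = "\<lambda>W. Cpt (DT D unit) W" and ?c = "\<lambda>W. Cpt (DT D counit) W"
  have u: "?u W \<in> hm (Trg q) W (pb left (pb q W))" if "W \<in> ob (Trg q)" for W
    using DT_in[of unit W] that by simp
  have c: "?c V \<in> hm (Src q) (pb q (pb left V)) V" if "V \<in> ob (Src q)" for V
    using DT_in[of counit V] that by simp
  show ?thesis
  proof (rule opcI)
    show uW: "?u W \<in> H D left W (pb q W)" using u[OF W] W by (auto intro!: HI)
    fix V
    show "\<exists>h. h \<in> hm (Trg left) (pb q W) V \<and> cm left h (?u W) = g" if g: "g \<in> H D left W V" for g
    proof -
      have V: "V \<in> ob (Src q)" and g': "g \<in> hm (Trg q) W (pb left V)" using HD[OF g] by auto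
      have lV: "pb left V \<in> ob (Trg q)" using V by simp
      have qg: "pa q g \<in> hm (Src q) (pb q W) (pb q (pb left V))" using pbA_in[OF small_q g'] .
      note h = B.comp_in[OF qg c[OF V]]
      have lc: "pa left (?c V) \<in> hm (Trg q) (pb left (pb q (pb left V))) (pb left V)"
        and lq: "pa left (pa q g) \<in> hm (Trg q) (pb left (pb q W)) (pb left (pb q (pb left V)))"
        using pbA_in[OF small_left] c[OF V] qg by auto
      have t: "pa left (?c V) \<cdot>[Trg q] ?u (pb left V) = idt (Trg q) (pb left V)"
        using DT_vcomp'[of "hcomp (id_n left) unit" "hcomp counit (id_n left)" V] triangle2 V
          DT_whisker_left[of counit left V] DT_whisker_right[of unit left V] by simp
      have n: "?u (pb left V) \<cdot>[Trg q] g = pa left (pa q g) \<cdot>[Trg q] ?u W"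
        using DT_nat[of unit g W "pb left V"] g' A.homD(1)[OF g'] by simp
      have "cm left (?c V \<cdot>[Src q] pa q g) (?u W)
        = (pa left (?c V) \<cdot>[Trg q] pa left (pa q g)) \<cdot>[Trg q] ?u W"
        using pbA_mult[of left "pa q g" _ _ "?c V"] qg c[OF V] by (simp add: cmp_def)
      also have "\<dots> = pa left (?c V) \<cdot>[Trg q] (?u (pb left V) \<cdot>[Trg q] g)"
        using A.assoc[OF u[OF W] lq lc] n by simp
      also have "\<dots> = g" using A.assoc[OF g' u[OF lV] lc] t A.idl[OF g'] by simp
      finally show ?thesis using h by auto
    qed
    \<comment> \<open>The inverse assignment, by the other triangle identity: \<open>h\<close> is
      recovered from its composite with the unit, which gives uniqueness.\<close>
    have r: "?c V \<cdot>[Src q] pa q (cm left h (?u W)) = h" if "h \<in> hm (Trg left) (pb q W) V" for h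
    proof -
      have h: "h \<in> hm (Src q) (pb q W) V" using that by simp
      note V = B.homD(5)[OF h]
      have lh: "pa left h \<in> hm (Trg q) (pb left (pb q W)) (pb left V)" using pbA_in[of left h] h by simp
      have qlh: "pa q (pa left h) \<in> hm (Src q) (pb q (pb left (pb q W))) (pb q (pb left V))"
        using pbA_in[OF small_q lh] .
      have qu: "pa q (?u W) \<in> hm (Src q) (pb q W) (pb q (pb left (pb q W)))"
        using pbA_in[OF small_q u[OF W]] .
      have qW: "pb q W \<in> ob (Src q)" using W by simp
      have t: "?c (pb q W) \<cdot>[Src q] pa q (?u W) = idt (Src q) (pb q W)"
        using DT_vcomp'[of "hcomp unit (id_n q)" "hcomp (id_n q) counit" W] triangle1 W
          DT_whisker_left[of unit q W] DT_whisker_right[of counit q W] by simp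
      have n: "?c V \<cdot>[Src q] pa q (pa left h) = h \<cdot>[Src q] ?c (pb q W)"
        using DT_nat[of counit h "pb q W" V] h B.homD(1)[OF h] by simp
      have "pa q (cm left h (?u W)) = pa q (pa left h) \<cdot>[Src q] pa q (?u W)"
        using pbA_mult[OF small_q u[OF W] lh] by (simp add: cmp_def)
      then show ?thesis
        using B.assoc[OF qu qlh c[OF V]] n B.assoc[OF qu c[OF qW] h] t B.idr[OF h] by simp
    qed
    fix h h' assume "h \<in> hm (Trg left) (pb q W) V" "h' \<in> hm (Trg left) (pb q W) V"
      "cm left h (?u W) = cm left h' (?u W)"
    then show "h = h'" using r by metis
  qed
qed

text \<open>Right adjoints are final: a colimit arrow \<open>f\<close> factors as the opcartesian
  unit over \<open>left\<close> followed by \<open>q^* f\<close>, so cancellation makes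
  \<open>q^* f\<close> opcartesian.\<close>

lemma final_universal_arrows:
  assumes "universal_arrows q L e"
  shows "final D q"
  unfolding final_def
proof (intro conjI allI impI)
  interpret universal_arrows q L e by fact
  show "small_functor q" by simp
  fix V W f assume f: "opc D (to_pt (Trg q)) V W f"
  note fH = HD[OF opcD[OF f]]
  have V: "V \<in> ob (Trg q)" using fH by simp
  note u = opc_unit[OF assms V]
  have f': "f \<in> hm (Trg q) V (pb (to_pt (Trg q)) W)" using fH by simp
  have qf: "pa q f \<in> H D (to_pt (Src q)) (pb q V) W"
    using pb_H[OF opcD[OF f], of q "id_f pt" "to_pt (Src q)"] fH by simp
  have "cm left (pa q f) (Cpt (DT D unit) V) = Cpt (DT D unit) (pb (to_pt (Trg q)) W) \<cdot>[Trg q] f"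
    using DT_nat[of unit f V "pb (to_pt (Trg q)) W"] f' T.category_axioms fH by (simp add: cmp_def)
  also have "\<dots> = f"
    using DT_whisker_right[of unit "to_pt (Trg q)" W] fH unit_to_pt category.idl[OF DC_cat' f'] by simp
  finally have "opc D (to_pt (Src q) oo left) V W (cm left (pa q f) (Cpt (DT D unit) V))"
    using f by simp
  from opc_cancel[OF u this qf] show "opc D (to_pt (Src q)) (pb q V) W (pa q f)" by simp
qed

text \<open>The comparison of the two colimits along \<open>q\<close> is not changed by restricting
  further along the final functor \<open>k\<close>, and after that restriction it compares two
  universal arrows.\<close>

lemma final_cancel:
  assumes k: "final D k" and q: "small_functor q" "Src q = Trg k" and qk: "final D (q oo k)"
  shows "final D q"
  unfolding final_def
proof (intro conjI allI impI)
  have sk: "small_functor k" using k by (simp add: final_def)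
  show "small_functor q" by fact
  fix V W f assume f: "opc D (to_pt (Trg q)) V W f"
  note fH = HD[OF opcD[OF f]]
  let ?e = "Cpt (lan_unit D (to_pt (Src q))) (pb q V)" and ?Z = "FObj (lan D (to_pt (Src q))) (pb q V)"
  have e: "opc D (to_pt (Src q)) (pb q V) ?Z ?e" using lan_opc[of "to_pt (Src q)" "pb q V"] q sk fH by simp
  note eH = HD[OF opcD[OF e]]
  have qf: "pa q f \<in> H D (to_pt (Src q)) (pb q V) W"
    using pb_H[OF opcD[OF f], of q "id_f pt" "to_pt (Src q)"] fH q sk by simp
  obtain h where h: "h \<in> hm pt ?Z W" "cm (to_pt (Src q)) h ?e = pa q f" using opc_ex[OF e qf] by auto
  have ke: "opc D (to_pt (Src k)) (pb k (pb q V)) ?Z (pa k ?e)" using k e q sk unfolding final_def by simp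
  have "opc D (to_pt (Src k)) (pb k (pb q V)) W (pa k (pa q f))"
  proof -
    have "opc D (to_pt (Src k)) (pb (q oo k) V) W (pa (q oo k) f)" using qk f unfolding final_def by simp
    then show ?thesis using pbO_comp[OF sk q, of V] pbA_comp[OF sk q, of f] fH by simp
  qed
  moreover have "pa k (pa q f) = cm (to_pt (Src k)) h (pa k ?e)"
  proof -
    have th: "pa (to_pt (Src q)) h \<in> hm (Src q) (pb (to_pt (Src q)) ?Z) (pb (to_pt (Src q)) W)"
      using pbA_in[of "to_pt (Src q)" h] h q sk by simp
    have "pa k (pa (to_pt (Src q)) h) = pa (to_pt (Src k)) h"
      using pbA_comp[of k "to_pt (Src q)" h] q sk homA[OF _ h(1)] by simp
    then show ?thesis using h(2)[symmetric] pbA_mult[OF sk, of ?e _ _ "pa (to_pt (Src q)) h"] eH th q sk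
      by (simp add: cmp_def)
  qed
  ultimately have "isoin pt h" using opc_iso_post[OF ke, of h W] h by simp
  then show "opc D (to_pt (Src q)) (pb q V) W (pa q f)" using opc_iso_post[OF e, of h W] h by simp
qed

lemma final_id: "small_cat A \<Longrightarrow> final D (id_f A)"
  unfolding final_def
proof (intro conjI allI impI)
  fix V W f assume a: "small_cat A" and f: "opc D (to_pt (Trg (id_f A))) V W f"
  note fH = HD[OF opcD[OF f]]
  show "opc D (to_pt (Src (id_f A))) (pb (id_f A) V) W (pa (id_f A) f)"
    using f fH a by simp
qed simp

subsection \<open>Base change for product squares\<close>

text \<open>The functor \<open>(n/b) \<rightarrow> (n \<times> I/(b, i))\<close>, \<open>(a, f) \<mapsto> ((a, i), (f, 1))\<close>, is a right adjoint.\<close>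

lemma const_square:
  assumes "small_functor (n :: 'k sfun)" "small_cat I" "i \<in> Obj I"
  shows "square (n *** id_f I) (id_n <|n, const_f (Src n) I i|>) <|id_f (Src n), const_f (Src n) I i|>
    <|id_f (Trg n), const_f (Trg n) I i|> n"
proof -
  have "const_f (Trg n) I i oo n = const_f (Src n) I i"
    using assms by (simp add: const_f_def)
  then show ?thesis using assms by unfold_locales auto
qed

lemma final_const:
  assumes n: "small_functor n" and I: "small_cat I" "i \<in> Obj I" and b: "b \<in> Obj (Trg n)"
  shows "final D (slice_map (n *** id_f I) (id_n <|n, const_f (Src n) I i|>) <|id_f (Src n), const_f (Src n) I i|>
    <|id_f (Trg n), const_f (Trg n) I i|> n b)" (is "final D ?k")
proof -
  let ?h = "<|id_f (Trg n), const_f (Trg n) I i|>" and ?u = "n *** id_f I"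
  interpret square ?u "id_n <|n, const_f (Src n) I i|>" "<|id_f (Src n), const_f (Src n) I i|>" ?h n
    by (rule const_square[OF n I])
  note sq_eqs [simp del]
  interpret A: category "Src n" using n by simp
  interpret B: category "Trg n" using n by simp
  interpret I: category I using I by simp
  have hb: "FObj ?h b = Pr b i" using b by simp
  have kO: "FObj ?k x = Pr (Pr (fs x) i) (Pr (sn x) (Idt I i))" if "x \<in> Obj (slice_over n b)" for x
  proof -
    from that obtain a f where x: "x = Pr a f" "a \<in> Obj (Src n)" "f \<in> hom (Trg n) (FObj n a) b" by auto
    have "Pr f (Idt I i) \<cdot>\<^bsub>Trg n ** I\<^esub> Pr (Idt (Trg n) (FObj n a)) (Idt I i) = Pr f (Idt I i)"
      using x B.homD[OF x(3)] B.idr[OF x(3)] I.idr[OF I.id_in[OF I(2)]] I.homD(1-3)[OF I.id_in[OF I(2)]]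
        B.homD(1-3)[OF B.id_in[OF B.homD(4)[OF x(3)]]] by simp
    then show ?thesis using that x n I B.homD[OF x(3)] by (simp del: over_Obj)
  qed
  have kA: "FArr ?k p = Pr (Pr (FObj ?k (fs (fs p))) (FObj ?k (sn (fs p)))) (Pr (sn p) (Idt I i))"
    if "p \<in> hom (slice_over n b) x y" for p x y
  proof -
    from that obtain g where p: "p = Pr (Pr x y) g" "x \<in> Obj (slice_over n b)" "y \<in> Obj (slice_over n b)" "g \<in> hom (Src n) (fs x) (fs y)"
      unfolding over_hom by auto
    have "p \<in> Arr (slice_over n b)" using category.homD[OF over_category that] n by simp
    then show ?thesis using p A.homD[OF p(4)] n by (simp del: over_Obj)
  qed
  \<comment> \<open>The left adjoint forgets the \<open>I\<close>-component: an object
    \<open>((a, j), (f, m))\<close> goes to \<open>(a, f)\<close>, and the universal arrow consists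
    of the identity of \<open>a\<close> and of \<open>m : j \<rightarrow> i\<close>.\<close>
  define L where "L t = Pr (fs (fs t)) (fs (sn t))" for t :: "'k univ"
  define e where "e t = Pr (Pr t (FObj ?k (L t))) (Pr (Idt (Src n) (fs (fs t))) (sn (sn t)))" for t
  have T: "\<exists>a j f m. t = Pr (Pr a j) (Pr f m) \<and> a \<in> Obj (Src n) \<and> j \<in> Obj I \<and> f \<in> hom (Trg n) (FObj n a) b \<and> m \<in> hom I j i"
    if "t \<in> Obj (Trg ?k)" for t
  proof -
    from that hb obtain p q where "t = Pr p q" "p \<in> Obj (Src n ** I)" "q \<in> hom (Trg n ** I) (FObj ?u p) (Pr b i)" using I by auto
    then show ?thesis using n I by (auto simp: prod_Obj elim!: prod_homE)
  qed
  have "universal_arrows ?k L e"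
  proof (unfold_locales, goal_cases)
    case 1 show ?case using slice_map_small[of b] b by simp
  next
    case (2 t) then show ?case using T[of t] by (auto simp: L_def)
  next
    case (3 t)
    then obtain a j f m where t: "t = Pr (Pr a j) (Pr f m)" "a \<in> Obj (Src n)" "j \<in> Obj I" "f \<in> hom (Trg n) (FObj n a) b" "m \<in> hom I j i"
      using T by blast
    have Lt: "L t \<in> Obj (slice_over n b)" using t by (simp add: L_def)
    have kL: "FObj ?k (L t) = Pr (Pr a i) (Pr f (Idt I i))" using kO[OF Lt] t by (simp add: L_def)
    have kT: "FObj ?k (L t) \<in> Obj (Trg ?k)" using small_functor_obj[OF slice_map_small[of b], of "L t"] Lt b by (simp del: over_Obj)
    have "Pr f (Idt I i) \<cdot>\<^bsub>Trg n ** I\<^esub> Pr (Idt (Trg n) (FObj n a)) m = Pr f m"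
      using B.homD[OF t(4)] B.idr[OF t(4)] I.idl[OF t(5)] I.homD[OF t(5)] I.homD(1-3)[OF I.id_in[OF I(2)]]
        B.homD(1-3)[OF B.id_in[OF B.homD(4)[OF t(4)]]] by simp
    then show ?case unfolding slice_map_simps over_hom hb using 3 kT kL t A.id_in[OF t(2)] A.homD(1)[OF A.id_in[OF t(2)]]
      I.homD(1)[OF t(5)] n I by (simp add: e_def hb del: over_Obj)
  next
    case (4 t s f)
    then obtain a j \<phi> m where t: "t = Pr (Pr a j) (Pr \<phi> m)" "a \<in> Obj (Src n)" "j \<in> Obj I" "\<phi> \<in> hom (Trg n) (FObj n a) b" "m \<in> hom I j i"
      using T by blast
    have s: "s \<in> Obj (slice_over n b)" using 4 by simp
    then obtain a' \<psi> where s': "s = Pr a' \<psi>" "a' \<in> Obj (Src n)" "\<psi> \<in> hom (Trg n) (FObj n a') b" by auto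
    have Lt: "L t \<in> Obj (slice_over n b)" using t by (simp add: L_def)
    have f: "f \<in> hom (slice_over ?u (Pr b i)) t (FObj ?k s)" using 4 hb by simp
    then obtain g where g: "f = Pr (Pr t (FObj ?k s)) g" "g \<in> hom (Src n ** I) (Pr a j) (Pr a' i)"
      "Pr \<psi> (Idt I i) \<cdot>\<^bsub>Trg n ** I\<^esub> FArr ?u g = Pr \<phi> m"
      unfolding over_hom using t s' kO[OF s] by (auto simp del: over_Obj)
    from g(2) obtain \<gamma> \<mu> where \<gamma>: "g = Pr \<gamma> \<mu>" "\<gamma> \<in> hom (Src n) a a'" "\<mu> \<in> hom I j i" by (auto elim: prod_homE)
    have n\<gamma>: "FArr n \<gamma> \<in> hom (Trg n) (FObj n a) (FObj n a')" using small_functor_hom[OF n \<gamma>(2)] .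
    have "Pr \<psi> (Idt I i) \<cdot>\<^bsub>Trg n ** I\<^esub> FArr ?u g = Pr (\<psi> \<cdot>\<^bsub>Trg n\<^esub> FArr n \<gamma>) \<mu>"
      using \<gamma> A.homD[OF \<gamma>(2)] I.homD[OF \<gamma>(3)] B.homD[OF n\<gamma>] B.homD[OF s'(3)] I.idl[OF \<gamma>(3)]
        I.homD(1-3)[OF I.id_in[OF I(2)]] n by simp
    \<comment> \<open>The triangle splits into components. In the \<open>I\<close>-component the
      structure map of the target is an identity, which forces \<mu> to be \<open>m\<close>; what
      remains is an arrow of the slice of \<open>n\<close>.\<close>
    then have eq: "\<psi> \<cdot>\<^bsub>Trg n\<^esub> FArr n \<gamma> = \<phi>" "\<mu> = m" using g(3) by auto
    have G: "Pr (Pr (L t) s) \<gamma> \<in> hom (slice_over n b) (L t) s"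
      unfolding over_hom using Lt s \<gamma> eq t s' by (simp add: L_def del: over_Obj) 
    have kG: "FArr ?k (Pr (Pr (L t) s) \<gamma>) = Pr (Pr (FObj ?k (L t)) (FObj ?k s)) (Pr \<gamma> (Idt I i))" using kA[OF G] by simp
    have e: "e t = Pr (Pr t (FObj ?k (L t))) (Pr (Idt (Src n) a) m)" using t by (simp add: e_def)
    have eA: "e t \<in> Arr (slice_over ?u (Pr b i))"
    proof -
      have kL: "FObj ?k (L t) = Pr (Pr a i) (Pr \<phi> (Idt I i))" using kO[OF Lt] t by (simp add: L_def)
      have kT: "FObj ?k (L t) \<in> Obj (slice_over ?u (Pr b i))" using small_functor_obj[OF slice_map_small[of b], of "L t"] Lt b hb by (simp del: over_Obj)
      have "Pr \<phi> (Idt I i) \<cdot>\<^bsub>Trg n ** I\<^esub> Pr (Idt (Trg n) (FObj n a)) m = Pr \<phi> m"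
        using B.homD[OF t(4)] B.idr[OF t(4)] I.idl[OF t(5)] I.homD[OF t(5)] I.homD(1-3)[OF I.id_in[OF I(2)]]
          B.homD(1-3)[OF B.id_in[OF B.homD(4)[OF t(4)]]] by simp
      then have "e t \<in> hom (slice_over ?u (Pr b i)) t (FObj ?k (L t))" unfolding over_hom using 4 kT kL t A.id_in[OF t(2)]
        A.homD(1)[OF A.id_in[OF t(2)]] I.homD(1)[OF t(5)] n I hb by (simp add: e_def del: over_Obj)
      then show ?thesis by (simp add: hom_def)
    qed
    have kGA: "FArr ?k (Pr (Pr (L t) s) \<gamma>) \<in> Arr (slice_over ?u (Pr b i))"
      using small_functor_arr[OF slice_map_small[of b], of "Pr (Pr (L t) s) \<gamma>"] G b hb by (simp add: hom_def)
    have "Pr \<gamma> (Idt I i) \<cdot>\<^bsub>Src n ** I\<^esub> Pr (Idt (Src n) a) m = Pr \<gamma> m"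
      using A.homD[OF \<gamma>(2)] A.idr[OF \<gamma>(2)] I.idl[OF t(5)] I.homD[OF t(5)] I.homD(1-3)[OF I.id_in[OF I(2)]]
        A.homD(1-3)[OF A.id_in[OF t(2)]] by simp
    then have "FArr ?k (Pr (Pr (L t) s) \<gamma>) \<cdot>\<^bsub>Trg ?k\<^esub> e t = f"
      using over_comp[OF eA[unfolded e] kGA[unfolded kG]] e kG g(1) \<gamma>(1) eq(2) hb n by simp
    then show ?case using G by auto
  next
    case (5 t g s g')
    then obtain a j \<phi> m where t: "t = Pr (Pr a j) (Pr \<phi> m)" "a \<in> Obj (Src n)" "j \<in> Obj I" "\<phi> \<in> hom (Trg n) (FObj n a) b" "m \<in> hom I j i"
      using T by blast
    \<comment> \<open>Composition with \<open>e t\<close> leaves the underlying arrow of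
      \<open>p\<close> visible in the result, so \<open>p\<close> can be read off from the
      composite.\<close>
    have key: "FArr ?k p \<cdot>\<^bsub>Trg ?k\<^esub> e t = Pr (Pr t (FObj ?k s)) (Pr (sn p) m) \<and> p = Pr (Pr (L t) s) (sn p)"
      if p: "p \<in> hom (Src ?k) (L t) s" for p
    proof -
      have p': "p \<in> hom (slice_over n b) (L t) s" using p by simp
      obtain \<gamma> where \<gamma>: "p = Pr (Pr (L t) s) \<gamma>" "\<gamma> \<in> hom (Src n) a (fs s)" "L t \<in> Obj (slice_over n b)" "s \<in> Obj (slice_over n b)"
        using p' t unfolding over_hom by (auto simp: L_def)
      have kL: "FObj ?k (L t) = Pr (Pr a i) (Pr \<phi> (Idt I i))" using kO[OF \<gamma>(3)] t by (simp add: L_def)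
      have kT: "FObj ?k (L t) \<in> Obj (slice_over ?u (Pr b i))" using small_functor_obj[OF slice_map_small[of b], of "L t"] \<gamma>(3) b hb by (simp del: over_Obj)
      have e: "e t = Pr (Pr t (FObj ?k (L t))) (Pr (Idt (Src n) a) m)" using t by (simp add: e_def)
      have "Pr \<phi> (Idt I i) \<cdot>\<^bsub>Trg n ** I\<^esub> Pr (Idt (Trg n) (FObj n a)) m = Pr \<phi> m"
        using B.homD[OF t(4)] B.idr[OF t(4)] I.idl[OF t(5)] I.homD[OF t(5)] I.homD(1-3)[OF I.id_in[OF I(2)]]
          B.homD(1-3)[OF B.id_in[OF B.homD(4)[OF t(4)]]] by simp
      then have "e t \<in> hom (slice_over ?u (Pr b i)) t (FObj ?k (L t))" unfolding over_hom using 5 kT kL t A.id_in[OF t(2)]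
        A.homD(1)[OF A.id_in[OF t(2)]] I.homD(1)[OF t(5)] n I hb by (simp add: e_def del: over_Obj)
      then have eA: "e t \<in> Arr (slice_over ?u (Pr b i))" by (simp add: hom_def)
      have kG: "FArr ?k p = Pr (Pr (FObj ?k (L t)) (FObj ?k s)) (Pr \<gamma> (Idt I i))" using kA[OF p'] \<gamma>(1) by simp
      have kGA: "FArr ?k p \<in> Arr (slice_over ?u (Pr b i))"
        using small_functor_arr[OF slice_map_small[of b], of p] p' b hb by (simp add: hom_def)
      have "Pr \<gamma> (Idt I i) \<cdot>\<^bsub>Src n ** I\<^esub> Pr (Idt (Src n) a) m = Pr \<gamma> m"
        using A.homD[OF \<gamma>(2)] A.idr[OF \<gamma>(2)] I.idl[OF t(5)] I.homD[OF t(5)] I.homD(1-3)[OF I.id_in[OF I(2)]]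
          A.homD(1-3)[OF A.id_in[OF t(2)]] by simp
      then show ?thesis using over_comp[OF eA[unfolded e] kGA[unfolded kG]] e kG \<gamma>(1) hb n by simp
    qed
    from key[OF 5(2)] key[OF 5(3)] 5(4) show ?case by (metis univ.inject(3))
  qed
  then show ?thesis by (rule final_universal_arrows)
qed

text \<open>The slice of \<open>n \<times> 1\<close> at \<open>(b, i)\<close> receives a final
  functor from the slice of \<open>n\<close> at \<open>b\<close>, for \<open>Src v\<close> as well
  as for \<open>Trg v\<close>. The slice map commutes with these two functors, so it is final by
  cancellation.\<close>

theorem product_base_change:
  assumes n: "small_functor n" and v: "small_functor v"
    and f: "opc D (n *** id_f (Trg v)) X Z f"
  shows "opc D (n *** id_f (Src v)) (pb (id_f (Src n) *** v) X) (pb (id_f (Trg n) *** v) Z)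
    (pa (id_f (Src n) *** v) f)"
proof -
  let ?u = "n *** id_f (Trg v)" and ?u' = "n *** id_f (Src v)" and ?g = "id_f (Src n) *** v" and ?h = "id_f (Trg n) *** v"
  have sq: "?u oo ?g = n *** v" "?h oo ?u' = n *** v" using n v by (simp_all add: prod_comp_sf)
  interpret square ?u "id_n (n *** v)" ?g ?h ?u' using n v sq by unfold_locales auto
  note sq_eqs [simp del]
  interpret B: category "Trg n" using n by simp
  have fin: "final D (slice_map ?u (id_n (n *** v)) ?g ?h ?u' c)" if c: "c \<in> Obj (Src ?h)" for c
  proof -
    obtain b i where bi: "c = Pr b i" "b \<in> Obj (Trg n)" "i \<in> Obj (Src v)" using c n v by (auto simp: prod_Obj)
    let ?q = "slice_map ?u (id_n (n *** v)) ?g ?h ?u' c"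
    let ?k = "\<lambda>I i. slice_map (n *** id_f I) (id_n <|n, const_f (Src n) I i|>) <|id_f (Src n), const_f (Src n) I i|>
        <|id_f (Trg n), const_f (Trg n) I i|> n b"
    have vi: "FObj v i \<in> Obj (Trg v)" using bi v by simp
    note k = final_const[OF n small_functor_src[OF v] bi(3,2)] final_const[OF n small_functor_trg[OF v] vi bi(2)]
    have sk: "small_functor (?k (Src v) i)" "small_functor (?k (Trg v) (FObj v i))" using k by (simp_all add: final_def)
    have q: "small_functor ?q" using slice_map_small[OF c] .
    have tk: "Trg (?k (Src v) i) = slice_over ?u' c" using bi by simp
    have tk2: "Trg (?k (Trg v) (FObj v i)) = Trg ?q" using bi n v vi by simp
    \<comment> \<open>Both composites insert an identity in the second component, and
      \<open>v\<close> preserves identities, so the triangle commutes strictly.\<close>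
    have "?q oo ?k (Src v) i = ?k (Trg v) (FObj v i)"
    proof (rule small_eqI)
      interpret J: category "Src v" using v by simp
      interpret J': category "Trg v" using v by simp
      have o: "FObj ?q (FObj (?k (Src v) i) x) = FObj (?k (Trg v) (FObj v i)) x" if x: "x \<in> Obj (slice_over n b)" for x
      proof -
        obtain a \<phi> where a: "x = Pr a \<phi>" "a \<in> Obj (Src n)" "\<phi> \<in> hom (Trg n) (FObj n a) b" using x by auto
        note ids = B.homD(1-3)[OF B.id_in[OF B.homD(4)[OF a(3)]]] J.homD(1-3)[OF J.id_in[OF bi(3)]] J'.homD(1-3)[OF J'.id_in[OF vi]]
           J.idr[OF J.id_in[OF bi(3)]] J'.idr[OF J'.id_in[OF vi]] B.idr[OF a(3)] B.homD[OF a(3)]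
        have k1: "FObj (?k (Src v) i) x = Pr (Pr a i) (Pr \<phi> (Idt (Src v) i))"
          using x a ids n bi v by (simp del: over_Obj)
        have k2: "FObj (?k (Trg v) (FObj v i)) x = Pr (Pr a (FObj v i)) (Pr \<phi> (Idt (Trg v) (FObj v i)))"
          using x a ids n bi v vi by (simp del: over_Obj)
        have "FObj (?k (Src v) i) x \<in> Obj (slice_over ?u' c)" using small_functor_obj[OF sk(1), of x] x tk by (simp del: over_Obj)
        then show ?thesis using k1 k2 a ids n bi v vi by (simp del: over_Obj)
      qed
      fix x assume "x \<in> Obj (Src (?k (Trg v) (FObj v i)))"
      then show "FObj (?q oo ?k (Src v) i) x = FObj (?k (Trg v) (FObj v i)) x" using o by (simp del: over_Obj slice_map_simps(3))
    next
      fix p assume "p \<in> Arr (Src (?k (Trg v) (FObj v i)))"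
      then have p: "p \<in> Arr (slice_over n b)" by simp
      interpret S: category "slice_over n b" using n by (simp add: over_category)
      interpret J: category "Src v" using v by simp
      interpret J': category "Trg v" using v by simp
      have kp: "FArr (?k (Src v) i) p \<in> Arr (slice_over ?u' c)" using small_functor_arr[OF sk(1), of p] p tk by simp
      obtain x y r where r: "p = Pr (Pr x y) r" "x \<in> Obj (slice_over n b)" "y \<in> Obj (slice_over n b)" "r \<in> hom (Src n) (fs x) (fs y)"
        using p unfolding slice_over_def slice_Arr by auto
      obtain a \<phi> where a: "x = Pr a \<phi>" "a \<in> Obj (Src n)" "\<phi> \<in> hom (Trg n) (FObj n a) b" using r(2) by auto
      obtain a' \<psi> where a': "y = Pr a' \<psi>" "a' \<in> Obj (Src n)" "\<psi> \<in> hom (Trg n) (FObj n a') b" using r(3) by auto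
      have ra: "r \<in> Arr (Src n)" using r(4) by (simp add: hom_def)
      note ids = B.homD(1-3)[OF B.id_in[OF B.homD(4)[OF a(3)]]] J.homD(1-3)[OF J.id_in[OF bi(3)]] J'.homD(1-3)[OF J'.id_in[OF vi]]
           J.idr[OF J.id_in[OF bi(3)]] J'.idr[OF J'.id_in[OF vi]] B.idr[OF a(3)] B.homD[OF a(3)]
           B.homD(1-3)[OF B.id_in[OF B.homD(4)[OF a'(3)]]] B.idr[OF a'(3)] B.homD[OF a'(3)]
      have k1: "FArr (?k (Src v) i) p = Pr (Pr (Pr (Pr a i) (Pr \<phi> (Idt (Src v) i))) (Pr (Pr a' i) (Pr \<psi> (Idt (Src v) i)))) (Pr r (Idt (Src v) i))"
        using p r(1) a a' ids n bi v ra by (simp del: over_Obj)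
      have k2: "FArr (?k (Trg v) (FObj v i)) p = Pr (Pr (Pr (Pr a (FObj v i)) (Pr \<phi> (Idt (Trg v) (FObj v i)))) (Pr (Pr a' (FObj v i)) (Pr \<psi> (Idt (Trg v) (FObj v i))))) (Pr r (Idt (Trg v) (FObj v i)))"
        using p r(1) a a' ids n bi v ra vi by (simp del: over_Obj)
      show "FArr (?q oo ?k (Src v) i) p = FArr (?k (Trg v) (FObj v i)) p"
        using kp p k1 k2 a a' ids n bi v vi ra by (simp del: over_Obj)
    qed (use sk q tk tk2 in simp_all)
    then show ?thesis using final_cancel[OF k(1) q] k(2) tk by simp
  qed
  note fH = HD[OF opcD[OF f]]
  have gf: "pa ?g f \<in> hm (Src ?g) (pb ?g X) (pb ?g (pb ?u Z))"
    using pbA_in[of ?g f] fH n v by simp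
  have "Cpt (DT D (id_n (n *** v))) Z = idt (Src ?g) (pb ?g (pb ?u Z))"
    using n v fH pbO_comp[of ?g ?u Z] sq by simp
  then show ?thesis using base_change[OF square_axioms fin f] category.idl[OF DC_cat gf] n v by simp
qed

end

section \<open>Right Kan extensions\<close>

text \<open>The dual notion: \<open>R\<close> is a right Kan extension of \<open>X\<close> along
  \<open>u\<close>, with \<open>g\<close> as its counit.\<close>

definition ropc :: "('k, 'o, 'm) pder \<Rightarrow> 'k sfun \<Rightarrow> 'o \<Rightarrow> 'o \<Rightarrow> 'm \<Rightarrow> bool" where
  "ropc D u R X g \<longleftrightarrow> small_functor u \<and> R \<in> Obj (DC D (Trg u)) \<and> g \<in> hom (DC D (Src u)) (pbO D u R) X \<and>
     (\<forall>R' f. R' \<in> Obj (DC D (Trg u)) \<longrightarrow> f \<in> hom (DC D (Src u)) (pbO D u R') X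
       \<longrightarrow> (\<exists>!h. h \<in> hom (DC D (Trg u)) R' R \<and> g \<cdot>\<^bsub>DC D (Src u)\<^esub> pbA D u h = f))"

lemma adjunction_couniversal:
  assumes a: "adjunction F G \<eta> \<epsilon>" and x: "x \<in> Obj (Src F)" and y: "y \<in> Obj (Trg F)"
  shows "f \<in> hom (Trg F) (FObj F x) y \<Longrightarrow> FArr G f \<cdot>\<^bsub>Src F\<^esub> Cpt \<eta> x \<in> hom (Src F) x (FObj G y)"
    and "f \<in> hom (Trg F) (FObj F x) y \<Longrightarrow> Cpt \<epsilon> y \<cdot>\<^bsub>Trg F\<^esub> FArr F (FArr G f \<cdot>\<^bsub>Src F\<^esub> Cpt \<eta> x) = f"
    and "h \<in> hom (Src F) x (FObj G y) \<Longrightarrow> FArr G (Cpt \<epsilon> y \<cdot>\<^bsub>Trg F\<^esub> FArr F h) \<cdot>\<^bsub>Src F\<^esub> Cpt \<eta> x = h"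
  using adjunction_universal[OF a x y] by auto

lemma ropc_ex:
  assumes "ropc D u R X g" "R' \<in> Obj (DC D (Trg u))" "f \<in> hom (DC D (Src u)) (pbO D u R') X"
  obtains h where "h \<in> hom (DC D (Trg u)) R' R" "g \<cdot>\<^bsub>DC D (Src u)\<^esub> pbA D u h = f"
proof -
  have "\<exists>!h. h \<in> hom (DC D (Trg u)) R' R \<and> g \<cdot>\<^bsub>DC D (Src u)\<^esub> pbA D u h = f" using assms unfolding ropc_def by simp
  then show thesis using that by auto
qed

lemma ropc_eq:
  assumes "ropc D u R X g" "R' \<in> Obj (DC D (Trg u))" "g \<cdot>\<^bsub>DC D (Src u)\<^esub> pbA D u h' \<in> hom (DC D (Src u)) (pbO D u R') X"
    "h \<in> hom (DC D (Trg u)) R' R" "h' \<in> hom (DC D (Trg u)) R' R"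
    "g \<cdot>\<^bsub>DC D (Src u)\<^esub> pbA D u h = g \<cdot>\<^bsub>DC D (Src u)\<^esub> pbA D u h'"
  shows "h = h'"
proof -
  have "\<exists>!k. k \<in> hom (DC D (Trg u)) R' R \<and> g \<cdot>\<^bsub>DC D (Src u)\<^esub> pbA D u k = g \<cdot>\<^bsub>DC D (Src u)\<^esub> pbA D u h'"
    using assms(1-3) unfolding ropc_def by simp
  then show ?thesis using assms(4-6) by auto
qed

context ldv
begin

text \<open>The base change of right extensions conjugate to the given one of left extensions. For a
  test object \<open>Y\<close>, arrows \<open>Y \<rightarrow> u^* R\<close> are arrows
  \<open>u_! Y \<rightarrow> R\<close>, then \<open>h^* u_! Y \<rightarrow> W\<close> since
  \<open>R\<close> is a right extension along \<open>h\<close>, then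
  \<open>u'_! g^* Y \<rightarrow> W\<close> by \<open>left\<close>, and finally
  \<open>g^* Y \<rightarrow> u'^* W\<close>.\<close>

lemma conjugate_base_change:
  assumes "square u \<alpha> g h u'"
    and left: "\<And>Y Z f. opc D u Y Z f \<Longrightarrow> opc D u' (pb g Y) (pb h Z) (Cpt (DT D \<alpha>) Z \<cdot>[Src g] pa g f)"
    and r: "ropc D h R W \<rho>"
  shows "ropc D g (pb u R) (pb u' W) (pa u' \<rho> \<cdot>[Src g] Cpt (DT D \<alpha>) R)"
proof -
  interpret square u \<alpha> g h u' by fact
  note sq_eqs [simp]
  have R: "R \<in> ob (Trg u)" and \<rho>: "\<rho> \<in> hm (Trg u') (pb h R) W" using r by (auto simp: ropc_def)
  interpret A': category "DC D (Src g)" by simp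
  interpret B': category "DC D (Trg u')" by simp
  have W: "W \<in> ob (Trg u')" using B'.homD[OF \<rho>] by simp
  have c: "Cpt (DT D \<alpha>) Y \<in> hm (Src g) (pb g (pb u Y)) (pb u' (pb h Y))" if "Y \<in> ob (Trg u)" for Y
    using DT_in[of \<alpha> Y] that by simp
  have u'\<rho>: "pa u' \<rho> \<in> hm (Src g) (pb u' (pb h R)) (pb u' W)"
    by (rule pbA_in'[OF _ _ _ \<rho>]) simp_all
  note t = A'.comp_in[OF c[OF R] u'\<rho>]
  let ?t = "pa u' \<rho> \<cdot>[Src g] Cpt (DT D \<alpha>) R"
  have "\<exists>!\<psi>. \<psi> \<in> hm (Trg g) Y (pb u R) \<and> ?t \<cdot>[Src g] pa g \<psi> = \<phi>"
    if Y: "Y \<in> ob (Trg g)" and \<phi>: "\<phi> \<in> hm (Src g) (pb g Y) (pb u' W)" for Y \<phi>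
  proof -
    let ?Z = "FObj (lan D u) Y" and ?f = "Cpt (lan_unit D u) Y"
    have f: "opc D u Y ?Z ?f" using lan_opc[of u Y] Y by simp
    note fH = HD[OF opcD[OF f]]
    let ?f' = "Cpt (DT D \<alpha>) ?Z \<cdot>[Src g] pa g ?f"
    note f' = left[OF f]
    \<comment> \<open>This shows that the chain of bijections is composition with the asserted
      counit \<open>?t\<close>; it is naturality of \<alpha> at \<open>\<zeta>\<close>.\<close>
    have key: "?t \<cdot>[Src g] pa g (cm u \<zeta> ?f) = cm u' (\<rho> \<cdot>[Trg u'] pa h \<zeta>) ?f'"
      if \<zeta>: "\<zeta> \<in> hm (Trg u) ?Z R" for \<zeta>
    proof -
      have uz: "pa u \<zeta> \<in> hm (Src u) (pb u ?Z) (pb u R)" by (rule pbA_in'[OF _ _ _ \<zeta>]) simp_all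
      have guz: "pa g (pa u \<zeta>) \<in> hm (Src g) (pb g (pb u ?Z)) (pb g (pb u R))" by (rule pbA_in'[OF _ _ _ uz]) simp_all
      have gf: "pa g ?f \<in> hm (Src g) (pb g Y) (pb g (pb u ?Z))" by (rule pbA_in'[OF _ _ _ fH(3)]) simp_all
      have hz: "pa h \<zeta> \<in> hm (Trg u') (pb h ?Z) (pb h R)" by (rule pbA_in'[OF _ _ _ \<zeta>]) simp_all
      have uhz: "pa u' (pa h \<zeta>) \<in> hm (Src g) (pb u' (pb h ?Z)) (pb u' (pb h R))" by (rule pbA_in'[OF _ _ _ hz]) simp_all
      have 1: "pa g (cm u \<zeta> ?f) = pa g (pa u \<zeta>) \<cdot>[Src g] pa g ?f"
        using pbA_mult[of g ?f Y "pb u ?Z" "pa u \<zeta>" "pb u R"] fH(3) uz by (simp add: cmp_def)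
      have n: "Cpt (DT D \<alpha>) R \<cdot>[Src g] pa g (pa u \<zeta>) = pa u' (pa h \<zeta>) \<cdot>[Src g] Cpt (DT D \<alpha>) ?Z"
        using DT_nat[of \<alpha> \<zeta> ?Z R] \<zeta> homA[OF _ \<zeta>] by simp
      have 2: "pa u' (\<rho> \<cdot>[Trg u'] pa h \<zeta>) = pa u' \<rho> \<cdot>[Src g] pa u' (pa h \<zeta>)"
        using pbA_mult[of u' "pa h \<zeta>" _ _ \<rho>] hz \<rho> by simp
      have "?t \<cdot>[Src g] (pa g (pa u \<zeta>) \<cdot>[Src g] pa g ?f)
        = pa u' \<rho> \<cdot>[Src g] ((Cpt (DT D \<alpha>) R \<cdot>[Src g] pa g (pa u \<zeta>)) \<cdot>[Src g] pa g ?f)"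
        using A'.assoc[OF A'.comp_in[OF gf guz] c[OF R] u'\<rho>] A'.assoc[OF gf guz c[OF R]] by simp
      also have "\<dots> = (pa u' \<rho> \<cdot>[Src g] pa u' (pa h \<zeta>)) \<cdot>[Src g] ?f'"
        using n A'.assoc[OF gf c[OF fH(2)] uhz] A'.assoc[OF A'.comp_in[OF gf c[OF fH(2)]] uhz u'\<rho>] by simp
      finally show ?thesis using 1 2 by (simp add: cmp_def)
    qed
    have hz: "pa h \<zeta> \<in> hm (Trg u') (pb h ?Z) (pb h R)" if "\<zeta> \<in> hm (Trg u) ?Z R" for \<zeta>
      by (rule pbA_in'[OF _ _ _ that]) simp_all
    have hZ: "pb h ?Z \<in> ob (Trg u')" using fH by simp
    have uR: "pb u R \<in> ob (Trg g)" using R by simp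
    have "\<phi> \<in> H D u' (pb g Y) W" using \<phi> W by (auto intro!: HI)
    then obtain \<kappa> where \<kappa>: "\<kappa> \<in> hm (Trg u') (pb h ?Z) W" "cm u' \<kappa> ?f' = \<phi>" using opc_ex[OF f'] by metis
    have "\<exists>!\<zeta>. \<zeta> \<in> hm (Trg h) ?Z R \<and> \<rho> \<cdot>[Src h] pa h \<zeta> = \<kappa>"
      using r \<kappa>(1) fH(2) unfolding ropc_def by simp
    then have U: "\<exists>!\<zeta>. \<zeta> \<in> hm (Trg u) ?Z R \<and> \<rho> \<cdot>[Trg u'] pa h \<zeta> = \<kappa>" by simp
    then obtain \<zeta> where \<zeta>: "\<zeta> \<in> hm (Trg u) ?Z R" "\<rho> \<cdot>[Trg u'] pa h \<zeta> = \<kappa>" by blast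
    show ?thesis
    proof (rule ex1I[of _ "cm u \<zeta> ?f"])
      show "cm u \<zeta> ?f \<in> hm (Trg g) Y (pb u R) \<and> ?t \<cdot>[Src g] pa g (cm u \<zeta> ?f) = \<phi>"
        using HD(3)[OF cmp_in_v[OF opcD[OF f] \<zeta>(1)]] key[OF \<zeta>(1)] \<zeta> \<kappa> by simp
      fix \<psi> assume \<psi>: "\<psi> \<in> hm (Trg g) Y (pb u R) \<and> ?t \<cdot>[Src g] pa g \<psi> = \<phi>"
      then have "\<psi> \<in> H D u Y R" using R by (auto intro!: HI)
      then obtain \<xi> where \<xi>: "\<xi> \<in> hm (Trg u) ?Z R" "cm u \<xi> ?f = \<psi>" using opc_ex[OF f] by metis
      have "cm u' (\<rho> \<cdot>[Trg u'] pa h \<xi>) ?f' = cm u' \<kappa> ?f'" using key[OF \<xi>(1)] \<xi> \<psi> \<kappa> by simp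
      then have "\<rho> \<cdot>[Trg u'] pa h \<xi> = \<kappa>" using opc_eq[OF f' B'.comp_in[OF hz[OF \<xi>(1)] \<rho>] \<kappa>(1)] by simp
      then show "\<psi> = cm u \<zeta> ?f" using U \<xi> \<zeta> by blast
    qed
  qed
  then show ?thesis unfolding ropc_def using t R by simp
qed

text \<open>The square of Der4 for right extensions, turned on its side: left extension is taken
  along the point \<open>b\<close> and along the projection from the slice, while \<open>u\<close>
  becomes the restricting leg.\<close>

lemma under_square:
  assumes "small_functor (u :: 'k sfun)" "b \<in> Obj (Trg u)"
  shows "square (obj_f (Trg u) b) (under_cell b u) (to_pt (slice_under b u)) u (under_pr b u)"
  using assms by unfold_locales auto

text \<open>The target of the slice map is the discrete set of arrows
  \<open>b \<rightarrow> u a\<close>. The slice map has a section \<open>k\<close>, which puts the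
  identity of \<open>a\<close> as second structure map; \<open>k\<close> is a right adjoint, so it
  is final, and cancellation against the identity makes the slice map final.\<close>

lemma final_under:
  assumes u: "small_functor u" and b: "b \<in> Obj (Trg u)" and a: "a \<in> Obj (Src u)"
  shows "final D (slice_map (obj_f (Trg u) b) (under_cell b u) (to_pt (slice_under b u)) u (under_pr b u) a)" (is "final D ?q")
proof -
  interpret A: category "Src u" using u by simp
  interpret B: category "Trg u" using u by simp
  let ?b = "obj_f (Trg u) b" and ?S = "slice_over (obj_f (Trg u) b) (FObj u a)" and ?U = "slice_under b u"
  let ?T = "slice_over (under_pr b u) a"
  have q: "small_functor ?q" using square.slice_map_small[OF under_square[OF u b] a] .
  have b': "Idt (Trg u) b \<in> hom (Trg u) b b" using B.id_in[OF b] .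
  have sS: "small_functor ?b" "small_cat ?S" "small_cat ?T" "small_cat ?U" using u b by simp_all
  interpret S: category ?S using sS by simp
  interpret T: category ?T using sS by simp
  interpret U: category ?U using sS by simp
  have SO: "x \<in> Obj ?S \<longleftrightarrow> (\<exists>\<phi>. x = Pr (Num 0) \<phi> \<and> \<phi> \<in> hom (Trg u) b (FObj u a))" for x by auto
  \<comment> \<open>The source of \<open>?b\<close> is the point, so a slice arrow lies over an
    identity and its endpoints have equal structure maps: the slice is discrete.\<close>
  have SA: "p \<in> hom ?S x y \<longleftrightarrow> x \<in> Obj ?S \<and> x = y \<and> p = Pr (Pr x x) (Num 0)" for p x y
    using B.idr by (auto simp: over_hom)
  have SA': "x \<in> Obj ?S \<and> y = x \<and> fs (fs p) = x" if "p \<in> hom ?S x y" for p x y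
    using that unfolding SA by auto
  have UO: "Pr a \<phi> \<in> Obj ?U" if "\<phi> \<in> hom (Trg u) b (FObj u a)" for \<phi> using that a by simp
  have Uid: "Idt ?U (Pr a \<phi>) = Pr (Pr (Pr a \<phi>) (Pr a \<phi>)) (Idt (Src u) a)" if "\<phi> \<in> hom (Trg u) b (FObj u a)" for \<phi>
    using under_id[OF UO[OF that]] by simp
  have TO: "Pr x \<gamma> \<in> Obj ?T \<longleftrightarrow> x \<in> Obj ?U \<and> \<gamma> \<in> hom (Src u) (fs x) a" for x \<gamma> by auto
  let ?c = "\<lambda>x. Pr (Pr a (sn x)) (Idt (Src u) a)"
  have cO: "?c x \<in> Obj ?T" if "x \<in> Obj ?S" for x using that A.id_in[OF a] a by auto
  have Tid: "Idt ?T (?c x) = Pr (Pr (?c x) (?c x)) (Pr (Pr (Pr a (sn x)) (Pr a (sn x))) (Idt (Src u) a))" if x: "x \<in> Obj ?S" for x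
    using over_id[OF cO[OF x]] under_id[of "Pr a (sn x)" b u] x a by auto
  \<comment> \<open>All arrows of the discrete source are identities, which dictates the arrow
    part.\<close>
  define k where "k = mk_fctr ?S ?T ?c (\<lambda>p. Idt ?T (?c (fs (fs p))))"
  have k: "small_functor k" unfolding k_def
  proof (rule small_mk, goal_cases)
    case (3 x) then show ?case by (rule cO)
  next
    case (4 f)
    then have "f \<in> hom ?S (Dom ?S f) (Cod ?S f)" by (simp add: hom_def)
    then have D: "Dom ?S f \<in> Obj ?S" "Dom ?S f = Cod ?S f" "f = Pr (Pr (Dom ?S f) (Dom ?S f)) (Num 0)" unfolding SA by blast+
    then have f: "Dom ?S f \<in> Obj ?S" "Cod ?S f = Dom ?S f" "fs (fs f) = Dom ?S f" using arg_cong[OF D(3), of "\<lambda>f. fs (fs f)"] by auto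
    show ?case using T.homD[OF T.id_in[OF cO[OF f(1)]]] unfolding f by simp
  next
    case (5 x)
    then have "Idt ?S x \<in> hom ?S x x" using S.id_in by simp
    then have "Idt ?S x = Pr (Pr x x) (Num 0)" by (simp only: SA)
    then show ?case by simp
  next
    case (6 f g)
    have "f \<in> hom ?S (Dom ?S f) (Cod ?S f)" "g \<in> hom ?S (Cod ?S f) (Cod ?S g)" "g \<cdot>\<^bsub>?S\<^esub> f \<in> hom ?S (Dom ?S f) (Cod ?S g)"
      using 6 S.comp_in[of f "Dom ?S f" "Cod ?S f" g "Cod ?S g"] by (auto simp: hom_def)
    from SA'[OF this(1)] SA'[OF this(2)] SA'[OF this(3)]
    have "Dom ?S f \<in> Obj ?S" "fs (fs f) = Dom ?S f" "fs (fs g) = Dom ?S f" "fs (fs (g \<cdot>\<^bsub>?S\<^esub> f)) = Dom ?S f"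
      by auto
    then show ?case using T.idr[OF T.id_in[OF cO]] by simp
  qed (use sS in simp_all)
  have kO: "x \<in> Obj ?S \<Longrightarrow> FObj k x = ?c x" for x by (simp add: k_def del: over_Obj)
  have ksrc: "Src k = ?S" "Trg k = ?T" by (simp_all add: k_def)
  have qk: "?q oo k = id_f ?S"
  proof (rule small_eqI)
    show "small_functor (?q oo k)" using q k ksrc by simp
    have o: "FObj ?q (?c x) = x" if x: "x \<in> Obj ?S" for x
    proof -
      obtain \<phi> where \<phi>: "x = Pr (Num 0) \<phi>" "\<phi> \<in> hom (Trg u) b (FObj u a)" using x SO by blast
      have "Pr a \<phi> \<in> Obj ?U" using UO[OF \<phi>(2)] .
      then show ?thesis using cO[OF x] \<phi> u a B.idl[OF \<phi>(2)] by (simp del: over_Obj under_Obj)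
    qed
    show "FObj (?q oo k) x = FObj (id_f ?S) x" if "x \<in> Obj (Src (id_f ?S))" for x
      using that o[of x] kO[of x] ksrc by (simp del: over_Obj slice_map_simps(3))
    fix p assume "p \<in> Arr (Src (id_f ?S))"
    then have p: "p \<in> Arr ?S" by simp
    then have "p \<in> hom ?S (Dom ?S p) (Cod ?S p)" by (simp add: hom_def)
    then have x: "Dom ?S p \<in> Obj ?S" "p = Pr (Pr (Dom ?S p) (Dom ?S p)) (Num 0)" unfolding SA by blast+
    have "Idt ?S (Dom ?S p) = Pr (Pr (Dom ?S p) (Dom ?S p)) (Num 0)" using S.id_in[OF x(1)] unfolding SA by blast
    then have idS: "Idt ?S (Dom ?S p) = p" using x(2) by (rule trans[OF _ sym])
    have "fs (fs p) = Dom ?S p" using arg_cong[OF x(2), of "\<lambda>p. fs (fs p)"] by simp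
    then have "FArr k p = Idt ?T (?c (Dom ?S p))" using p by (simp add: k_def)
    moreover have "FArr ?q (Idt ?T (?c (Dom ?S p))) = Idt ?S (FObj ?q (?c (Dom ?S p)))"
      using small_functor_id[OF q, of "?c (Dom ?S p)"] cO[OF x(1)] by (simp del: over_Obj slice_map_simps(3,4))
    ultimately have "FArr ?q (FArr k p) = p" using o[OF x(1)] idS by simp
    then show "FArr (?q oo k) p = FArr (id_f ?S) p" using p ksrc by (simp del: slice_map_simps(4))
  qed (use sS ksrc in simp_all)
  \<comment> \<open>The left adjoint of \<open>k\<close> composes the two structure maps:
    \<open>\<phi> : b \<rightarrow> u a'\<close> and \<open>\<gamma> : a' \<rightarrow> a\<close>
    give the arrow \<open>u \<gamma>\<close> after \<phi>.\<close>
  define L where "L t = Pr (Num 0) (FArr u (sn t) \<cdot>\<^bsub>Trg u\<^esub> sn (fs t))" for t :: "'k univ"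
  define e where "e t = Pr (Pr t (?c (L t))) (Pr (Pr (fs t) (Pr a (sn (L t)))) (sn t))" for t
  have LS: "L t \<in> Obj ?S" if t: "t \<in> Obj ?T" for t
    using t B.comp_in small_functor_hom[OF u] unfolding SO L_def by fastforce
  have T: "\<exists>a' \<phi> \<gamma>. t = Pr (Pr a' \<phi>) \<gamma> \<and> a' \<in> Obj (Src u) \<and> \<phi> \<in> hom (Trg u) b (FObj u a') \<and> \<gamma> \<in> hom (Src u) a' a \<and>
     L t = Pr (Num 0) (FArr u \<gamma> \<cdot>\<^bsub>Trg u\<^esub> \<phi>)"
    if t: "t \<in> Obj ?T" for t using t by (auto simp: L_def)
  have eT: "e t \<in> hom ?T t (?c (L t))" if t: "t \<in> Obj ?T" for t
  proof -
    obtain a' \<phi> \<gamma> where t': "t = Pr (Pr a' \<phi>) \<gamma>" "a' \<in> Obj (Src u)" "\<phi> \<in> hom (Trg u) b (FObj u a')" "\<gamma> \<in> hom (Src u) a' a"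
      "L t = Pr (Num 0) (FArr u \<gamma> \<cdot>\<^bsub>Trg u\<^esub> \<phi>)" using T[OF t] by blast
    have U': "Pr (Pr (Pr a' \<phi>) (Pr a (sn (L t)))) \<gamma> \<in> hom ?U (Pr a' \<phi>) (Pr a (sn (L t)))"
      unfolding under_hom using t' B.comp_in[OF t'(3) small_functor_hom[OF u t'(4)]] a by simp
    have "FArr (under_pr b u) (Pr (Pr (Pr a' \<phi>) (Pr a (sn (L t)))) \<gamma>) = \<gamma>"
      using U.homD(1)[OF U'] by simp
    then show ?thesis unfolding over_hom using t cO[OF LS[OF t]] U' A.idl[OF t'(4)] t'(1) by (simp add: e_def del: over_Obj under_Obj)
  qed
  \<comment> \<open>An arrow from \<open>t\<close> into the image of \<open>k\<close> must have
    \<gamma> as underlying arrow, because the structure map of its target is an identity. So both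
    the arrow and its target are determined by \<open>t\<close>.\<close>
  have uniq: "s = L t \<and> p = e t" if t: "t \<in> Obj ?T" and s: "s \<in> Obj ?S" and p: "p \<in> hom ?T t (?c s)" for t s p
  proof -
    obtain a' \<phi> \<gamma> where t': "t = Pr (Pr a' \<phi>) \<gamma>" "a' \<in> Obj (Src u)" "\<phi> \<in> hom (Trg u) b (FObj u a')" "\<gamma> \<in> hom (Src u) a' a"
      "L t = Pr (Num 0) (FArr u \<gamma> \<cdot>\<^bsub>Trg u\<^esub> \<phi>)" using T[OF t] by blast
    obtain r where r: "p = Pr (Pr t (?c s)) r" "r \<in> hom ?U (Pr a' \<phi>) (Pr a (sn s))" "Idt (Src u) a \<cdot>\<^bsub>Src u\<^esub> FArr (under_pr b u) r = \<gamma>"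
      using p t' unfolding over_hom by auto
    obtain \<delta> where \<delta>: "r = Pr (Pr (Pr a' \<phi>) (Pr a (sn s))) \<delta>" "\<delta> \<in> hom (Src u) a' a" "FArr u \<delta> \<cdot>\<^bsub>Trg u\<^esub> \<phi> = sn s"
      using r(2) unfolding under_hom by auto
    have "FArr (under_pr b u) r = \<delta>" using U.homD(1)[OF r(2)] \<delta>(1) by simp
    then have "\<delta> = \<gamma>" using r(3) A.idl[OF \<delta>(2)] by simp
    moreover then have "s = L t" using \<delta>(3) s t'(5) SO by auto
    ultimately show ?thesis using r(1) \<delta>(1) t'(1) by (simp add: e_def)
  qed
  have "universal_arrows k L e"
  proof (unfold_locales, goal_cases)
    case 1 show ?case by (rule k)
  next
    case (2 t) then show ?case using LS ksrc by simp
  next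
    case (3 t) then show ?case using eT kO[OF LS] ksrc by simp
  next
    case (4 t s f)
    then have t: "t \<in> Obj ?T" and s: "s \<in> Obj ?S" using ksrc by simp_all
    have "f \<in> hom ?T t (?c s)" using 4(3) kO[OF s] ksrc by simp
    then have f: "s = L t" "f = e t" using uniq[OF t s] by auto
    have "FArr k (Idt ?S (L t)) = Idt ?T (?c (L t))"
      using small_functor_id[OF k, of "L t"] LS[OF t] kO[OF LS[OF t]] ksrc by simp
    then have "FArr k (Idt ?S (L t)) \<cdot>\<^bsub>?T\<^esub> e t = f" using T.idl[OF eT[OF t]] f by simp
    then show ?case using S.id_in[OF LS[OF t]] f ksrc by auto
  next
    case (5 t g s g')
    have "g \<in> hom ?S (L t) s" "g' \<in> hom ?S (L t) s" using 5(2,3) unfolding ksrc .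
    then have "g = Pr (Pr (L t) (L t)) (Num 0)" "g' = Pr (Pr (L t) (L t)) (Num 0)" unfolding SA by blast+
    then show ?case by simp
  qed
  from final_universal_arrows[OF this] have "final D k" .
  moreover have "final D (?q oo k)" unfolding qk using final_id sS by blast
  ultimately show ?thesis using final_cancel[of k ?q] q ksrc by simp
qed

text \<open>Conjugation turns the left base change over the under-slice square into the statement
  that \<open>b^* u_* X\<close> is a right extension along the projection to the point. The Der4 map
  compares it with the chosen right extension.\<close>

lemma der4_right_of_left:
  assumes R: "\<And>u. small_functor u \<Longrightarrow> \<exists>G \<eta> \<epsilon>. adjunction (DF D u) G \<eta> \<epsilon>"
    and u: "small_functor u" and b: "b \<in> Obj (Trg u)" and X: "X \<in> ob (Src u)"
  shows "isoin pt (der4_right D u b X)"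
proof -
  have adj: "adjunction (DF D v) (ran D v) (ran_unit D v) (ran_counit D v)" if v: "small_functor v" for v
  proof -
    obtain G \<eta> \<epsilon> where "adjunction (DF D v) G \<eta> \<epsilon>" using R[OF v] by blast
    then have "case (G, \<eta>, \<epsilon>) of (G, \<eta>, \<epsilon>) \<Rightarrow> adjunction (DF D v) G \<eta> \<epsilon>" by simp
    then have "case ran_adj D v of (G, \<eta>, \<epsilon>) \<Rightarrow> adjunction (DF D v) G \<eta> \<epsilon>" unfolding ran_adj_def by (rule someI)
    then show ?thesis by (simp add: ran_def ran_unit_def ran_counit_def split: prod.splits)
  qed
  have ranO: "FObj (ran D v) Y \<in> ob (Trg v)" if "small_functor v" "Y \<in> ob (Src v)" for v Y
    using is_functor.obj_in[OF adjunction.right_functor[OF adj[OF that(1)]], of Y] adjunction.src_right[OF adj[OF that(1)]]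
      adjunction.trg_right[OF adj[OF that(1)]] that by simp
  have counit: "ropc D v (FObj (ran D v) Y) Y (Cpt (ran_counit D v) Y)" if v: "small_functor v" and Y: "Y \<in> ob (Src v)" for v Y
    unfolding ropc_def
  proof (intro conjI allI impI)
    note a = adj[OF v]
    show "small_functor v" by fact
    show O: "FObj (ran D v) Y \<in> ob (Trg v)" using ranO v Y by blast
    show "Cpt (ran_counit D v) Y \<in> hm (Src v) (pb v (FObj (ran D v) Y)) Y"
      using adjunction_universal(2)[OF a, of "FObj (ran D v) Y" Y] O Y v by simp
    fix R' f assume R': "R' \<in> ob (Trg v)" and f: "f \<in> hm (Src v) (pb v R') Y"
    note c = adjunction_couniversal[OF a, of R' Y, unfolded DF_src[OF v] DF_trg[OF v], OF R' Y]
    show "\<exists>!h. h \<in> hm (Trg v) R' (FObj (ran D v) Y) \<and> Cpt (ran_counit D v) Y \<cdot>[Src v] pa v h = f"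
      using c(1,2)[OF f] c(3) by (intro ex1I[of _ "FArr (ran D v) f \<cdot>[Trg v] Cpt (ran_unit D v) R'"]) auto
  qed
  let ?S = "slice_under b u" and ?W = "FObj (ran D u) X" and ?b = "obj_f (Trg u) b" and ?pr = "under_pr b u" and ?p = "to_pt (slice_under b u)"
  let ?g = "pa ?pr (Cpt (ran_counit D u) X) \<cdot>[?S] Cpt (DT D (under_cell b u)) ?W"
  have g: "ropc D ?p (pb ?b ?W) (pb ?pr X) ?g"
    using conjugate_base_change[OF under_square[OF u b] _ counit[OF u X]]
      base_change[OF under_square[OF u b] final_under[OF u b]] by simp
  have prX: "pb ?pr X \<in> ob ?S" using u X by simp
  have p: "small_functor ?p" using u by simp
  let ?R = "FObj (ran D ?p) (pb ?pr X)"
  have bW: "pb ?b ?W \<in> ob pt" and gh: "?g \<in> hm ?S (pb ?p (pb ?b ?W)) (pb ?pr X)"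
    using g by (auto simp: ropc_def)
  have cr: "ropc D ?p ?R (pb ?pr X) (Cpt (ran_counit D ?p) (pb ?pr X))" using counit[OF p] prX by simp
  let ?c = "Cpt (ran_counit D ?p) (pb ?pr X)"
  have c: "?c \<in> hm ?S (pb ?p ?R) (pb ?pr X)" and Ro: "?R \<in> ob pt" using cr by (auto simp: ropc_def)
  interpret P: category "DC D pt" by simp
  interpret S: category "DC D ?S" using u by simp
  have t: "der4_right D u b X \<in> hm pt (pb ?b ?W) ?R" "?c \<cdot>[?S] pa ?p (der4_right D u b X) = ?g"
    using adjunction_couniversal(1,2)[OF adj[OF p], of "pb ?b ?W" "pb ?pr X" ?g] bW prX gh p
    by (simp_all add: der4_right_def Let_def ran_transpose_def)
  let ?t = "der4_right D u b X"
  \<comment> \<open>The inverse of the Der4 map comes from the universal property established by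
    conjugation; both composites are identities by uniqueness.\<close>
  obtain s where s: "s \<in> hm pt ?R (pb ?b ?W)" "?g \<cdot>[?S] pa ?p s = ?c"
    using ropc_ex[OF g, of ?R ?c] Ro c by auto
  have pt: "pa ?p h \<in> hm ?S (pb ?p x) (pb ?p y)" "h \<in> hm (Trg ?p) x y" if "h \<in> hm pt x y" for h x y
    using pbA_in'[OF p _ _ that] that by simp_all
  have m: "pa ?p (h' \<cdot>[pt] h) = pa ?p h' \<cdot>[?S] pa ?p h" if "h \<in> hm pt x y" "h' \<in> hm pt y z" for h h' x y z
    using pbA_mult[OF p pt(2)[OF that(1)] pt(2)[OF that(2)]] by simp
  have "?g \<cdot>[?S] pa ?p (s \<cdot>[pt] ?t) = ?g \<cdot>[?S] pa ?p (idt pt (pb ?b ?W))"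
    using m[OF t(1) s(1)] S.assoc[OF pt(1)[OF t(1)] pt(1)[OF s(1)] gh] s(2) t(2) S.idr[OF gh] bW p by simp
  then have st: "s \<cdot>[pt] ?t = idt pt (pb ?b ?W)"
    using ropc_eq[OF g, of "pb ?b ?W" "idt pt (pb ?b ?W)" "s \<cdot>[pt] ?t"]
      bW S.comp_in[OF pt(1)[OF P.id_in[OF bW]] gh] P.comp_in[OF t(1) s(1)] P.id_in[OF bW] by (simp del: pbA_Idt)
  have "?c \<cdot>[?S] pa ?p (?t \<cdot>[pt] s) = ?c \<cdot>[?S] pa ?p (idt pt ?R)"
    using m[OF s(1) t(1)] S.assoc[OF pt(1)[OF s(1)] pt(1)[OF t(1)] c] s(2) t(2) S.idr[OF c] Ro p by simp
  then have ts: "?t \<cdot>[pt] s = idt pt ?R"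
    using ropc_eq[OF cr, of ?R "idt pt ?R" "?t \<cdot>[pt] s"]
      Ro S.comp_in[OF pt(1)[OF P.id_in[OF Ro]] c] P.comp_in[OF s(1) t(1)] P.id_in[OF Ro] by (simp del: pbA_Idt)
  show ?thesis using P.isoI[OF t(1) s(1) st ts] .
qed

end

section \<open>The shifted derivator\<close>

lemma shift_simps [simp]:
  "DC (shift D L) I = DC D (L ** I)" "DF (shift D L) u = DF D (id_f L *** u)"
  "DT (shift D L) \<alpha> = DT D (id_n (id_f L) \<otimes>\<^sub>t \<alpha>)"
  by (simp_all add: shift_def)

text \<open>\<open>lan_adj\<close> depends on the prederivator only through the single functor
  \<open>DF D u\<close>, so the adjoints chosen for the shift are literally those chosen for
  \<open>D\<close>.\<close>

lemma lan_shift [simp]: "lan (shift D L) u = lan D (id_f L *** u)"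
  "lan_unit (shift D L) u = lan_unit D (id_f L *** u)" "lan_counit (shift D L) u = lan_counit D (id_f L *** u)"
  by (simp_all add: lan_def lan_unit_def lan_counit_def lan_adj_def)

lemma lan_transpose_shift: "Trg u = A \<Longrightarrow> lan_transpose (shift D L) u Y f = lan_transpose D (id_f L *** u) Y f"
  by (simp add: lan_transpose_def)

lemma prod_st_simps [simp]:
  "NSrc (\<alpha> \<otimes>\<^sub>t \<beta>) = NSrc \<alpha> *** NSrc \<beta>" "NTrg (\<alpha> \<otimes>\<^sub>t \<beta>) = NTrg \<alpha> *** NTrg \<beta>"
  "\<lbrakk>x \<in> Obj (Src (NSrc \<alpha>)); y \<in> Obj (Src (NSrc \<beta>))\<rbrakk> \<Longrightarrow> Cpt (\<alpha> \<otimes>\<^sub>t \<beta>) (Pr x y) = Pr (Cpt \<alpha> x) (Cpt \<beta> y)"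
  by (simp_all add: prod_st_def)

context big
begin

lemma small_prod_st [simp]:
  assumes "small_trans (\<alpha> :: 'k strans)" "small_trans \<beta>"
  shows "small_trans (\<alpha> \<otimes>\<^sub>t \<beta>)"
proof -
  note a = small_transD[OF assms(1)] and b = small_transD[OF assms(2)]
  interpret a: nat_trans \<alpha> by (rule a)
  interpret b: nat_trans \<beta> by (rule b)
  interpret TA: category "Trg (NSrc \<alpha>)" using a by simp
  interpret TB: category "Trg (NSrc \<beta>)" using b by simp
  interpret SA: category "Src (NSrc \<alpha>)" using a by simp
  interpret SB: category "Src (NSrc \<beta>)" using b by simp
  show ?thesis unfolding prod_st_def
  proof (rule small_transI, goal_cases)
    case (5 x) then show ?case using a b a.cpt_in b.cpt_in by (auto simp: prod_Obj)
  next
    case (6 p x y)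
    then obtain f g where p: "p = Pr f g" "x = Pr (fs x) (sn x)" "y = Pr (fs y) (sn y)"
      "f \<in> hom (Src (NSrc \<alpha>)) (fs x) (fs y)" "g \<in> hom (Src (NSrc \<beta>)) (sn x) (sn y)" by (auto elim: prod_homE)
    note f = SA.homD[OF p(4)] and g = SB.homD[OF p(5)]
    note fa = small_functor_hom[OF a(2) p(4)] small_functor_hom[OF a(3), unfolded a, OF p(4)]
    note ga = small_functor_hom[OF b(2) p(5)] small_functor_hom[OF b(3), unfolded b, OF p(5)]
    have "Pr (Cpt \<alpha> (fs y)) (Cpt \<beta> (sn y)) \<cdot>\<^bsub>Trg (NSrc \<alpha>) ** Trg (NSrc \<beta>)\<^esub> Pr (FArr (NSrc \<alpha>) f) (FArr (NSrc \<beta>) g)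
      = Pr (FArr (NTrg \<alpha>) f) (FArr (NTrg \<beta>) g) \<cdot>\<^bsub>Trg (NSrc \<alpha>) ** Trg (NSrc \<beta>)\<^esub> Pr (Cpt \<alpha> (fs x)) (Cpt \<beta> (sn x))"
      using a.natural[OF p(4)] b.natural[OF p(5)] TA.homD(1-3)[OF fa(1)] TA.homD(1-3)[OF fa(2)]
        TB.homD(1-3)[OF ga(1)] TB.homD(1-3)[OF ga(2)] TA.homD(1-3)[OF a.cpt_in[OF f(4)]] TA.homD(1-3)[OF a.cpt_in[OF f(5)]]
        TB.homD(1-3)[OF b.cpt_in[OF g(4)]] TB.homD(1-3)[OF b.cpt_in[OF g(5)]] by simp
    then show ?case using p(1) f g a b by simp
  qed (use a b in auto)
qed

lemma prod_st_id: "\<lbrakk>small_functor (u :: 'k sfun); small_functor v\<rbrakk> \<Longrightarrow> id_n u \<otimes>\<^sub>t id_n v = id_n (u *** v)"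
  by (rule small_trans_eqI) (auto simp: prod_Obj)

lemma prod_st_vcomp:
  assumes L: "small_cat (L :: 'k scat)" and a: "small_trans \<alpha>" and b: "small_trans \<beta>" and e: "NSrc \<beta> = NTrg \<alpha>"
  shows "id_n (id_f L) \<otimes>\<^sub>t vcomp \<beta> \<alpha> = vcomp (id_n (id_f L) \<otimes>\<^sub>t \<beta>) (id_n (id_f L) \<otimes>\<^sub>t \<alpha>)"
proof (rule small_trans_eqI)
  note a' = small_transD[OF a] and b' = small_transD[OF b]
  interpret L: category L using L by simp
  interpret T: category "Trg (NSrc \<alpha>)" using a' by simp
  fix x assume "x \<in> Obj (Src (NSrc (vcomp (id_n (id_f L) \<otimes>\<^sub>t \<beta>) (id_n (id_f L) \<otimes>\<^sub>t \<alpha>))))"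
  then obtain l y where x: "x = Pr l y" "l \<in> Obj L" "y \<in> Obj (Src (NSrc \<alpha>))" by (auto simp: prod_Obj)
  have ca: "Cpt \<alpha> y \<in> hom (Trg (NSrc \<alpha>)) (FObj (NSrc \<alpha>) y) (FObj (NTrg \<alpha>) y)" using nat_trans.cpt_in[OF a'(1)] x by blast
  have cb: "Cpt \<beta> y \<in> hom (Trg (NSrc \<alpha>)) (FObj (NTrg \<alpha>) y) (FObj (NTrg \<beta>) y)"
    using nat_trans.cpt_in[OF b'(1), of y] x e a' by simp
  show "Cpt (id_n (id_f L) \<otimes>\<^sub>t vcomp \<beta> \<alpha>) x = Cpt (vcomp (id_n (id_f L) \<otimes>\<^sub>t \<beta>) (id_n (id_f L) \<otimes>\<^sub>t \<alpha>)) x"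
    using x e a' L.idl[OF L.id_in[OF x(2)]] L.homD(1-3)[OF L.id_in[OF x(2)]] T.homD(1-3)[OF ca] T.homD(1-3)[OF cb] by simp
qed (use assms in simp_all)

lemma prod_st_hcomp:
  assumes L: "small_cat (L :: 'k scat)" and a: "small_trans \<alpha>" and b: "small_trans \<beta>" and e: "Src (NSrc \<beta>) = Trg (NSrc \<alpha>)"
  shows "id_n (id_f L) \<otimes>\<^sub>t hcomp \<beta> \<alpha> = hcomp (id_n (id_f L) \<otimes>\<^sub>t \<beta>) (id_n (id_f L) \<otimes>\<^sub>t \<alpha>)"
proof (rule small_trans_eqI)
  note a' = small_transD[OF a] and b' = small_transD[OF b]
  interpret L: category L using L by simp
  interpret T: category "Trg (NSrc \<beta>)" using b' by simp
  interpret TA: category "Trg (NSrc \<alpha>)" using a' by simp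
  show "small_trans (hcomp (id_n (id_f L) \<otimes>\<^sub>t \<beta>) (id_n (id_f L) \<otimes>\<^sub>t \<alpha>))" using assms by (intro small_hcomp) simp_all
  show "small_trans (id_n (id_f L) \<otimes>\<^sub>t hcomp \<beta> \<alpha>)" using assms by (intro small_prod_st small_hcomp) simp_all
  show "NSrc (id_n (id_f L) \<otimes>\<^sub>t hcomp \<beta> \<alpha>) = NSrc (hcomp (id_n (id_f L) \<otimes>\<^sub>t \<beta>) (id_n (id_f L) \<otimes>\<^sub>t \<alpha>))"
    "NTrg (id_n (id_f L) \<otimes>\<^sub>t hcomp \<beta> \<alpha>) = NTrg (hcomp (id_n (id_f L) \<otimes>\<^sub>t \<beta>) (id_n (id_f L) \<otimes>\<^sub>t \<alpha>))"
    using L a' b' e by (simp_all add: prod_comp_sf)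
  fix x assume "x \<in> Obj (Src (NSrc (hcomp (id_n (id_f L) \<otimes>\<^sub>t \<beta>) (id_n (id_f L) \<otimes>\<^sub>t \<alpha>))))"
  then obtain l y where x: "x = Pr l y" "l \<in> Obj L" "y \<in> Obj (Src (NSrc \<alpha>))" by (auto simp: prod_Obj)
  have y': "FObj (NTrg \<alpha>) y \<in> Obj (Trg (NSrc \<alpha>))" using small_functor_obj[OF a'(3), of y] a' x by simp
  have ca: "Cpt \<alpha> y \<in> hom (Trg (NSrc \<alpha>)) (FObj (NSrc \<alpha>) y) (FObj (NTrg \<alpha>) y)" using nat_trans.cpt_in[OF a'(1)] x by blast
  have cf: "FArr (NSrc \<beta>) (Cpt \<alpha> y) \<in> hom (Trg (NSrc \<beta>)) (FObj (NSrc \<beta>) (FObj (NSrc \<alpha>) y)) (FObj (NSrc \<beta>) (FObj (NTrg \<alpha>) y))"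
    using small_functor_hom[OF b'(2), unfolded e, OF ca] .
  have cb: "Cpt \<beta> (FObj (NTrg \<alpha>) y) \<in> hom (Trg (NSrc \<beta>)) (FObj (NSrc \<beta>) (FObj (NTrg \<alpha>) y)) (FObj (NTrg \<beta>) (FObj (NTrg \<alpha>) y))"
    using nat_trans.cpt_in[OF b'(1), of "FObj (NTrg \<alpha>) y"] y' e by simp
  show "Cpt (id_n (id_f L) \<otimes>\<^sub>t hcomp \<beta> \<alpha>) x = Cpt (hcomp (id_n (id_f L) \<otimes>\<^sub>t \<beta>) (id_n (id_f L) \<otimes>\<^sub>t \<alpha>)) x"
    using x e a' y' L.idl[OF L.id_in[OF x(2)]] L.homD(1-3)[OF L.id_in[OF x(2)]] T.homD(1-3)[OF cf] T.homD(1-3)[OF cb]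
      TA.homD(1-3)[OF ca] by simp
qed

end

context pd
begin

lemma shift_prederivator:
  assumes L: "small_cat L"
  shows "prederivator (shift D L)"
proof (rule prederivator.intro, goal_cases)
  case (6 u v)
  then have "id_f L *** (v oo u) = (id_f L *** v) oo (id_f L *** u)" using L by (simp add: prod_comp_sf)
  then show ?case using 6 L DF_comp[of "id_f L *** u" "id_f L *** v"] by simp
next
  case (10 u) then show ?case using L prod_st_id[of "id_f L" u] DT_id[of "id_f L *** u"] by simp
next
  case (11 \<alpha> \<beta>)
  then show ?case using L prod_st_vcomp[OF L 11] DT_vcomp[of "id_n (id_f L) \<otimes>\<^sub>t \<alpha>" "id_n (id_f L) \<otimes>\<^sub>t \<beta>"] by simp
next
  case (12 \<alpha> \<beta>)
  then show ?case using L prod_st_hcomp[OF L 12] DT_hcomp[of "id_n (id_f L) \<otimes>\<^sub>t \<alpha>" "id_n (id_f L) \<otimes>\<^sub>t \<beta>"] by simp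
qed (use L in \<open>simp_all add: DF_functor DF_id DT_trans DT_src DT_trg\<close>)

end

context ldv
begin

text \<open>The Der4 square of the shift is \<open>L\<close> times a slice square and is not a slice
  square of \<open>D\<close>. Its slice map at \<open>(l, 0)\<close> only rearranges data: on both
  sides an object consists of an arrow \<open>l' \<rightarrow> l\<close>, an object \<open>a\<close>
  and an arrow \<open>u a \<rightarrow> b\<close>.\<close>

lemma final_shift:
  assumes L: "small_cat L" and u: "small_functor u" and b: "b \<in> Obj (Trg u)" and l: "l \<in> Obj L"
  shows "square (id_f L *** u) (id_n (id_f L) \<otimes>\<^sub>t over_cell u b) (id_f L *** over_pr u b) (id_f L *** obj_f (Trg u) b)
      (id_f L *** to_pt (slice_over u b))" (is "square ?u ?\<alpha> ?g ?h ?u'")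
    and "final D (slice_map (id_f L *** u) (id_n (id_f L) \<otimes>\<^sub>t over_cell u b) (id_f L *** over_pr u b) (id_f L *** obj_f (Trg u) b)
      (id_f L *** to_pt (slice_over u b)) (Pr l (Num 0)))" (is "final D ?q")
proof -
  show sq: "square ?u ?\<alpha> ?g ?h ?u'"
    using L u b by unfold_locales (auto simp: prod_comp_sf)
  interpret square ?u ?\<alpha> ?g ?h ?u' by (rule sq)
  note sq_eqs [simp del]
  interpret L: category L using L by simp
  interpret A: category "Src u" using u by simp
  interpret B: category "Trg u" using u by simp
  interpret S: category "slice_over u b" using u by (simp add: over_category)
  note bid = B.homD(1-3)[OF B.id_in[OF b]]
  have c: "Pr l (Num 0) \<in> Obj (Src ?h)" using l by simp
  note q = slice_map_small[OF c]
  have hb: "FObj ?h (Pr l (Num 0)) = Pr l b" using l by simp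
  let ?S = "slice_over ?u' (Pr l (Num 0))" and ?T = "slice_over ?u (Pr l b)"
  interpret S': category ?S using L u by (simp add: over_category)
  interpret T': category ?T using L u by (simp add: over_category)
  have SO: "s \<in> Obj ?S \<longleftrightarrow> (\<exists>l' a f \<gamma>. s = Pr (Pr l' (Pr a f)) (Pr \<gamma> (Num 0)) \<and> l' \<in> Obj L \<and> a \<in> Obj (Src u) \<and> f \<in> hom (Trg u) (FObj u a) b \<and> \<gamma> \<in> hom L l' l)" for s
    using L u by (auto simp: prod_Obj elim!: prod_homE)
  have TO: "t \<in> Obj ?T \<longleftrightarrow> (\<exists>l' a f \<gamma>. t = Pr (Pr l' a) (Pr \<gamma> f) \<and> l' \<in> Obj L \<and> a \<in> Obj (Src u) \<and> f \<in> hom (Trg u) (FObj u a) b \<and> \<gamma> \<in> hom L l' l)" for t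
    using L u by (auto simp: prod_Obj elim!: prod_homE)
  have qO: "FObj ?q (Pr (Pr l' (Pr a f)) (Pr \<gamma> (Num 0))) = Pr (Pr l' a) (Pr \<gamma> f)"
    if "l' \<in> Obj L" "a \<in> Obj (Src u)" "f \<in> hom (Trg u) (FObj u a) b" "\<gamma> \<in> hom L l' l" for l' a f \<gamma>
  proof -
    have s: "Pr (Pr l' (Pr a f)) (Pr \<gamma> (Num 0)) \<in> Obj ?S" using that SO by blast
    have "Pr a f \<in> Obj (slice_over u b)" using that by simp
    then show ?thesis using s that L.homD[OF that(4)] L.idr[OF that(4)] B.homD[OF that(3)] B.idl[OF that(3)] bid
        L.homD(1-3)[OF L.id_in[OF that(1)]] L u b by (simp del: over_Obj)
  qed
  have SA: "p \<in> hom ?S s s' \<longleftrightarrow> s \<in> Obj ?S \<and> s' \<in> Obj ?S \<and> (\<exists>\<mu> g. p = Pr (Pr s s') (Pr \<mu> (Pr (Pr (sn (fs s)) (sn (fs s'))) g)) \<and>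
      \<mu> \<in> hom L (fs (fs s)) (fs (fs s')) \<and> fs (sn s') \<cdot>\<^bsub>L\<^esub> \<mu> = fs (sn s) \<and>
      g \<in> hom (Src u) (fs (sn (fs s))) (fs (sn (fs s'))) \<and> sn (sn (fs s')) \<cdot>\<^bsub>Trg u\<^esub> FArr u g = sn (sn (fs s)))" (is "_ \<longleftrightarrow> ?R")
    for p s s'
  proof (cases "s \<in> Obj ?S \<and> s' \<in> Obj ?S")
    case True
    obtain l1 a1 f1 \<gamma>1 where s1: "s = Pr (Pr l1 (Pr a1 f1)) (Pr \<gamma>1 (Num 0))" "l1 \<in> Obj L" "a1 \<in> Obj (Src u)"
        "f1 \<in> hom (Trg u) (FObj u a1) b" "\<gamma>1 \<in> hom L l1 l" using conjunct1[OF True] unfolding SO by blast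
    obtain l2 a2 f2 \<gamma>2 where s2: "s' = Pr (Pr l2 (Pr a2 f2)) (Pr \<gamma>2 (Num 0))" "l2 \<in> Obj L" "a2 \<in> Obj (Src u)"
        "f2 \<in> hom (Trg u) (FObj u a2) b" "\<gamma>2 \<in> hom L l2 l" using conjunct2[OF True] unfolding SO by blast
    note s = s1 s2
    have comp: "Pr \<gamma>2 (Num 0) \<cdot>\<^bsub>L ** pt\<^esub> FArr ?u' (Pr \<mu> r) = Pr (\<gamma>2 \<cdot>\<^bsub>L\<^esub> \<mu>) (Num 0)"
      if "\<mu> \<in> hom L l1 l2" "r \<in> Arr (slice_over u b)" for \<mu> r
      using that L.homD[OF that(1)] L.homD[OF s(10)] L u by simp
    show ?thesis
    proof
      assume "p \<in> hom ?S s s'"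
      then obtain x where x: "p = Pr (Pr s s') x" "x \<in> hom (L ** slice_over u b) (fs s) (fs s')" "sn s' \<cdot>\<^bsub>L ** pt\<^esub> FArr ?u' x = sn s"
        unfolding over_hom by auto
      obtain \<mu> r where r: "x = Pr \<mu> r" "\<mu> \<in> hom L l1 l2" "r \<in> hom (slice_over u b) (Pr a1 f1) (Pr a2 f2)"
        using x(2) s by (auto elim!: prod_homE)
      obtain g where g: "r = Pr (Pr (Pr a1 f1) (Pr a2 f2)) g" "g \<in> hom (Src u) a1 a2" "f2 \<cdot>\<^bsub>Trg u\<^esub> FArr u g = f1"
        using r(3) unfolding over_hom by auto
      have "\<gamma>2 \<cdot>\<^bsub>L\<^esub> \<mu> = \<gamma>1" using x(3) comp[OF r(2) S.homD(1)[OF r(3)]] r(1) s by simp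
      then show ?R using True x r g s by (simp del: over_Obj)
    next
      assume ?R
      then obtain \<mu> g where g: "p = Pr (Pr s s') (Pr \<mu> (Pr (Pr (Pr a1 f1) (Pr a2 f2)) g))" "\<mu> \<in> hom L l1 l2" "\<gamma>2 \<cdot>\<^bsub>L\<^esub> \<mu> = \<gamma>1"
        "g \<in> hom (Src u) a1 a2" "f2 \<cdot>\<^bsub>Trg u\<^esub> FArr u g = f1" using s by auto
      have r: "Pr (Pr (Pr a1 f1) (Pr a2 f2)) g \<in> hom (slice_over u b) (Pr a1 f1) (Pr a2 f2)" unfolding over_hom using g s by simp
      show "p \<in> hom ?S s s'" unfolding over_hom using True g r s comp[OF g(2) S.homD(1)[OF r]] by (simp del: over_Obj)
    qed
  next
    case False
    then show ?thesis unfolding over_hom by blast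
  qed
  have TA: "p \<in> hom ?T t t' \<longleftrightarrow> t \<in> Obj ?T \<and> t' \<in> Obj ?T \<and> (\<exists>\<mu> g. p = Pr (Pr t t') (Pr \<mu> g) \<and>
      \<mu> \<in> hom L (fs (fs t)) (fs (fs t')) \<and> fs (sn t') \<cdot>\<^bsub>L\<^esub> \<mu> = fs (sn t) \<and>
      g \<in> hom (Src u) (sn (fs t)) (sn (fs t')) \<and> sn (sn t') \<cdot>\<^bsub>Trg u\<^esub> FArr u g = sn (sn t))" (is "_ \<longleftrightarrow> ?R") for p t t'
  proof (cases "t \<in> Obj ?T \<and> t' \<in> Obj ?T")
    case True
    obtain l1 a1 f1 \<gamma>1 where s1: "t = Pr (Pr l1 a1) (Pr \<gamma>1 f1)" "l1 \<in> Obj L" "a1 \<in> Obj (Src u)"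
        "f1 \<in> hom (Trg u) (FObj u a1) b" "\<gamma>1 \<in> hom L l1 l" using conjunct1[OF True] unfolding TO by blast
    obtain l2 a2 f2 \<gamma>2 where s2: "t' = Pr (Pr l2 a2) (Pr \<gamma>2 f2)" "l2 \<in> Obj L" "a2 \<in> Obj (Src u)"
        "f2 \<in> hom (Trg u) (FObj u a2) b" "\<gamma>2 \<in> hom L l2 l" using conjunct2[OF True] unfolding TO by blast
    note s = s1 s2
    have comp: "Pr \<gamma>2 f2 \<cdot>\<^bsub>L ** Trg u\<^esub> FArr ?u (Pr \<mu> g) = Pr (\<gamma>2 \<cdot>\<^bsub>L\<^esub> \<mu>) (f2 \<cdot>\<^bsub>Trg u\<^esub> FArr u g)"
      if "\<mu> \<in> hom L l1 l2" "g \<in> hom (Src u) a1 a2" for \<mu> g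
      using that L.homD[OF that(1)] L.homD[OF s(10)] A.homD[OF that(2)] B.homD[OF s(9)] u by simp
    show ?thesis unfolding over_hom using s(1,6) True comp by (auto simp del: over_Obj elim!: prod_homE)
  next
    case False
    then show ?thesis unfolding over_hom by blast
  qed
  have qA: "FArr ?q (Pr (Pr s s') (Pr \<mu> (Pr (Pr (sn (fs s)) (sn (fs s'))) g))) = Pr (Pr (FObj ?q s) (FObj ?q s')) (Pr \<mu> g)"
    if p: "Pr (Pr s s') (Pr \<mu> (Pr (Pr (sn (fs s)) (sn (fs s'))) g)) \<in> hom ?S s s'" for s s' \<mu> g
  proof -
    have s: "s \<in> Obj ?S" "s' \<in> Obj ?S" "\<mu> \<in> hom L (fs (fs s)) (fs (fs s'))" using p unfolding SA by auto
    have "Pr (Pr (sn (fs s)) (sn (fs s'))) g \<in> Arr (slice_over u b)"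
      using p unfolding over_hom using S.homD(1) by (auto simp del: over_Obj elim!: prod_homE)
    then have "FArr ?g (Pr \<mu> (Pr (Pr (sn (fs s)) (sn (fs s'))) g)) = Pr \<mu> g" using L.homD[OF s(3)] u L by simp
    then show ?thesis using S'.homD(1)[OF p] s by (simp del: over_Obj)
  qed
  \<comment> \<open>\<open>K\<close> rearranges the encodings back. Since the slice map sends
    \<open>K t\<close> to \<open>t\<close> exactly, identities serve as universal arrows.\<close>
  define K where "K t = Pr (Pr (fs (fs t)) (Pr (sn (fs t)) (sn (sn t)))) (Pr (fs (sn t)) (Num 0))" for t :: "'k univ"
  have KS: "K t \<in> Obj ?S" "FObj ?q (K t) = t" "fs (fs (K t)) = fs (fs t)" "fs (sn (K t)) = fs (sn t)"
    "fs (sn (fs (K t))) = sn (fs t)" "sn (sn (fs (K t))) = sn (sn t)"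
    if "t \<in> Obj ?T" for t
    using that qO unfolding TO SO K_def by fastforce+
  have qs: "fs (fs (FObj ?q s)) = fs (fs s)" "fs (sn (FObj ?q s)) = fs (sn s)"
    "sn (fs (FObj ?q s)) = fs (sn (fs s))" "sn (sn (FObj ?q s)) = sn (sn (fs s))" "FObj ?q s \<in> Obj ?T" if s: "s \<in> Obj ?S" for s
  proof -
    obtain l' a f \<gamma> where "s = Pr (Pr l' (Pr a f)) (Pr \<gamma> (Num 0))" "l' \<in> Obj L" "a \<in> Obj (Src u)" "f \<in> hom (Trg u) (FObj u a) b" "\<gamma> \<in> hom L l' l"
      using s SO by blast
    with qO show "fs (fs (FObj ?q s)) = fs (fs s)" "fs (sn (FObj ?q s)) = fs (sn s)"
      "sn (fs (FObj ?q s)) = fs (sn (fs s))" "sn (sn (FObj ?q s)) = sn (sn (fs s))" "FObj ?q s \<in> Obj ?T" unfolding TO by simp_all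
  qed
  have "universal_arrows ?q K (\<lambda>t. Idt ?T t)"
  proof (unfold_locales, goal_cases)
    case 1 show ?case by (rule q)
  next
    case (2 t) then show ?case using KS(1) hb by simp
  next
    case (3 t)
    then have t: "t \<in> Obj ?T" using hb by simp
    then show ?case using T'.id_in[OF t] KS(2)[OF t] hb by (simp del: over_Obj slice_map_simps(3))
  next
    case (4 t s f)
    have t: "t \<in> Obj ?T" and s: "s \<in> Obj ?S" and f: "f \<in> hom ?T t (FObj ?q s)"
      using 4 unfolding slice_map_simps(1,2) hb by blast+
    obtain \<mu> g where g: "f = Pr (Pr t (FObj ?q s)) (Pr \<mu> g)" "\<mu> \<in> hom L (fs (fs t)) (fs (fs s))" "fs (sn s) \<cdot>\<^bsub>L\<^esub> \<mu> = fs (sn t)"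
      "g \<in> hom (Src u) (sn (fs t)) (fs (sn (fs s)))" "sn (sn (fs s)) \<cdot>\<^bsub>Trg u\<^esub> FArr u g = sn (sn t)"
      using f unfolding TA qs[OF s] by blast
    let ?p = "Pr (Pr (K t) s) (Pr \<mu> (Pr (Pr (sn (fs (K t))) (sn (fs s))) g))"
    have p: "?p \<in> hom ?S (K t) s" unfolding SA using KS[OF t] s g by auto
    have "FArr ?q ?p = f" using qA[OF p] KS(2)[OF t] g(1) by simp
    then have "FArr ?q ?p \<cdot>\<^bsub>?T\<^esub> Idt ?T t = f" using T'.idr[OF f] by simp
    then show ?case using p unfolding slice_map_simps(1,2) hb by blast
  next
    case (5 t p s p')
    have t: "t \<in> Obj ?T" and p: "p \<in> hom ?S (K t) s" and p': "p' \<in> hom ?S (K t) s"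
      and eq: "FArr ?q p \<cdot>\<^bsub>?T\<^esub> Idt ?T t = FArr ?q p' \<cdot>\<^bsub>?T\<^esub> Idt ?T t"
      using 5 unfolding slice_map_simps(1,2) hb by blast+
    have h: "FArr ?q r \<in> hom ?T t (FObj ?q s)" if "r \<in> hom ?S (K t) s" for r
      using small_functor_hom[OF q, of r "K t" s] that KS(2)[OF t] hb by (simp del: over_Obj slice_map_simps(3,4))
    have e2: "FArr ?q p = FArr ?q p'" using eq T'.idr[OF h[OF p]] T'.idr[OF h[OF p']] by simp
    obtain \<mu> g where g: "p = Pr (Pr (K t) s) (Pr \<mu> (Pr (Pr (sn (fs (K t))) (sn (fs s))) g))" using p unfolding SA by blast
    obtain \<mu>' g' where g': "p' = Pr (Pr (K t) s) (Pr \<mu>' (Pr (Pr (sn (fs (K t))) (sn (fs s))) g'))" using p' unfolding SA by blast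
    show ?case using e2 qA[OF p[unfolded g]] qA[OF p'[unfolded g']] g g' by simp
  qed
  then show "final D ?q" by (rule final_universal_arrows)
qed

text \<open>Adjoints are inherited from \<open>D\<close>. Der4 for the shift is base change of
  \<open>D\<close> along \<open>L\<close> times a slice square, whose slice maps are final by
  \<open>final_shift\<close>.\<close>

lemma shift_ldv:
  assumes L: "small_cat L"
  shows "ldv (shift D L)"
proof -
  interpret s: prederivator "shift D L" by (rule shift_prederivator[OF L])
  interpret s: pd "shift D L" by unfold_locales
  show ?thesis
  proof (unfold_locales, goal_cases)
    case (1 B f)
    have LB: "small_cat (L ** B)" using L 1 by simp
    have f: "f \<in> ar (L ** B)" using 1 by simp
    show ?case unfolding shift_simps
    proof (rule L_der2[OF LB f])
      fix c assume "c \<in> Obj (L ** B)"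
      then obtain l b where c: "c = Pr l b" "l \<in> Obj L" "b \<in> Obj B" by (auto simp: prod_Obj)
      \<comment> \<open>A point \<open>(l, b)\<close> of \<open>L ** B\<close> factors through the
        copy of \<open>L\<close> over \<open>b\<close>, so a map that is invertible on every such
        copy is invertible at every point.\<close>
      have o: "(id_f L *** obj_f B b) oo obj_f (L ** pt) (Pr l (Num 0)) = obj_f (L ** B) (Pr l b)"
        using obj_f_comp[of "id_f L *** obj_f B b" "Pr l (Num 0)"] L 1(1) c by simp
      have i: "isoin (L ** pt) (pa (id_f L *** obj_f B b) f)" using 1(3)[OF c(3)] by simp
      have "isoin pt (pa (obj_f (L ** pt) (Pr l (Num 0))) (pa (id_f L *** obj_f B b) f))"
        using pbA_iso[of "obj_f (L ** pt) (Pr l (Num 0))"] i L c by simp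
      then show "isoin pt (pa (obj_f (L ** B) c) f)"
        using pbA_comp[of "obj_f (L ** pt) (Pr l (Num 0))" "id_f L *** obj_f B b" f] o c L 1(1) f by simp
    qed
  next
    case (2 u) then show ?case using L_der3[of "id_f L *** u"] L by simp
  next
    case (3 u b X)
    let ?u = "id_f L *** u" and ?W = "FObj (lan D (id_f L *** u)) X"
    have X: "X \<in> ob (Src ?u)" using 3 by simp
    have o: "opc D ?u X ?W (Cpt (lan_unit D ?u) X)" using lan_opc[OF _ X] L 3 by simp
    have sq: "square ?u (id_n (id_f L) \<otimes>\<^sub>t over_cell u b) (id_f L *** over_pr u b) (id_f L *** obj_f (Trg u) b) (id_f L *** to_pt (slice_over u b))"
      using L 3(1,2) by unfold_locales (auto simp: prod_comp_sf)
    have "opc D (id_f L *** to_pt (slice_over u b)) (pb (id_f L *** over_pr u b) X) (pb (id_f L *** obj_f (Trg u) b) ?W)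
      (Cpt (DT D (id_n (id_f L) \<otimes>\<^sub>t over_cell u b)) ?W \<cdot>[Src (id_f L *** over_pr u b)] pa (id_f L *** over_pr u b) (Cpt (lan_unit D ?u) X))"
    proof (rule base_change[OF sq _ o])
      fix c assume "c \<in> Obj (Src (id_f L *** obj_f (Trg u) b))"
      then obtain l where "c = Pr l (Num 0)" "l \<in> Obj L" by (auto simp: prod_Obj)
      then show "final D (slice_map ?u (id_n (id_f L) \<otimes>\<^sub>t over_cell u b) (id_f L *** over_pr u b) (id_f L *** obj_f (Trg u) b) (id_f L *** to_pt (slice_over u b)) c)"
        using final_shift(2)[OF L 3(1,2)] by simp
    qed
    with lan_transpose_iso[OF opcD[OF this]] show ?case by (simp add: der4_left_def Let_def lan_transpose_def)
  qed
qed

end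

section \<open>Finite coproducts and the derivator axioms for the shift\<close>

lemma equivalence_comp_iso:
  assumes E: "is_equivalence E" and J: "is_functor J" "is_functor J'" "Trg J = Src E" "Src J' = Src E" "Trg J' = Src J"
    "J' oo J = id_f (Src J)" "J oo J' = id_f (Src E)"
  shows "is_equivalence (E oo J)"
proof -
  obtain G \<eta> \<epsilon> where G: "is_functor G" "Src G = Trg E" "Trg G = Src E" and \<eta>: "nat_iso \<eta>" "NSrc \<eta> = id_f (Src E)" "NTrg \<eta> = G oo E"
    and \<epsilon>: "nat_iso \<epsilon>" "NSrc \<epsilon> = E oo G" "NTrg \<epsilon> = id_f (Trg E)" and E': "is_functor E" using E unfolding is_equivalence_def by blast
  interpret J: is_functor J by (rule J)
  interpret J': is_functor J' by (rule J)
  interpret E: is_functor E by (rule E')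
  interpret G: is_functor G by (rule G)
  \<comment> \<open>The unit is conjugated by the isomorphism \<open>J\<close>. The counit can be
    kept as it is, because \<open>J oo J'\<close> cancels in the middle of
    \<open>(E oo J) oo (J' oo G)\<close>.\<close>
  let ?\<eta> = "hcomp (id_n J') (hcomp \<eta> (id_n J))"
  have t: "nat_trans (hcomp \<eta> (id_n J))" "nat_trans ?\<eta>"
    using \<eta> J id_n_trans[OF J(1)] id_n_trans[OF J(2)] by (auto intro!: hcomp_trans simp: nat_iso_def)
  have "nat_iso ?\<eta>" unfolding nat_iso_def
  proof (intro conjI ballI t(2))
    fix x assume "x \<in> Obj (Src (NSrc ?\<eta>))"
    then have x: "x \<in> Obj (Src J)" by simp
    have Jx: "FObj J x \<in> Obj (Src E)" using J.obj_in[OF x] J by simp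
    have c: "Cpt \<eta> (FObj J x) \<in> hom (Src E) (FObj J x) (FObj G (FObj E (FObj J x)))"
      using nat_trans.cpt_in[of \<eta> "FObj J x"] \<eta> Jx by (simp add: nat_iso_def)
    have i: "iso_in (Src E) (Cpt \<eta> (FObj J x))" using \<eta> Jx by (simp add: nat_iso_def)
    have iJ: "Idt (Src E) (FObj J x) \<in> Arr (Src E)" using E.S.homD(1)[OF E.S.id_in[OF Jx]] .
    have 1: "Cpt (hcomp \<eta> (id_n J)) x = Cpt \<eta> (FObj J x)" using x J \<eta> iJ E.S.idr[OF c] by simp
    have o: "FObj G (FObj E (FObj J x)) \<in> Obj (Src J')" using E.S.homD[OF c] J by simp
    have "FArr J' (Cpt \<eta> (FObj J x)) \<in> hom (Src J) (FObj J' (FObj J x)) (FObj J' (FObj G (FObj E (FObj J x))))"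
      using J'.arr_in[of "Cpt \<eta> (FObj J x)"] c J by simp
    then have "Cpt ?\<eta> x = FArr J' (Cpt \<eta> (FObj J x))" using 1 x o J \<eta> Jx J.S.idl by simp
    then show "iso_in (Trg (NSrc ?\<eta>)) (Cpt ?\<eta> x)" using J'.pres_iso[of "Cpt \<eta> (FObj J x)"] i J by simp
  qed
  moreover have "NSrc ?\<eta> = id_f (Src (E oo J))" using \<eta> J comp_f_id_left[OF J(1)] by simp
  moreover have "NTrg ?\<eta> = (J' oo G) oo (E oo J)"
  proof -
    have "(J' oo G) oo (E oo J) = J' oo (G oo (E oo J))"
      by (rule comp_f_assoc) (use J(1-5) G E' in \<open>auto intro!: comp_f_functor\<close>)
    then show ?thesis using \<eta> comp_f_assoc[of J E G] J G E' by simp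
  qed
  moreover have "NSrc \<epsilon> = (E oo J) oo (J' oo G)"
  proof -
    have "(E oo J) oo (J' oo G) = E oo (J oo (J' oo G))"
      by (rule comp_f_assoc) (use J(1-5) G E' in \<open>auto intro!: comp_f_functor\<close>)
    also have "J oo (J' oo G) = (J oo J') oo G" using comp_f_assoc[of G J' J] J G by simp
    finally show ?thesis using \<epsilon> J G comp_f_id_left[OF G(1)] by simp
  qed
  ultimately show ?thesis unfolding is_equivalence_def
    using \<epsilon> J G E' by (intro conjI exI[of _ "J' oo G"] exI[of _ ?\<eta>] exI[of _ \<epsilon>]) (auto intro!: comp_f_functor)
qed

lemma coprod_simps [simp]:
  "Pr (Num k) x \<in> Obj (coprod_s n A) \<longleftrightarrow> k < n \<and> x \<in> Obj (A k)"
  "Pr (Num k) f \<in> Arr (coprod_s n A) \<longleftrightarrow> k < n \<and> f \<in> Arr (A k)"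
  "\<lbrakk>k < n; x \<in> Obj (A k)\<rbrakk> \<Longrightarrow> Idt (coprod_s n A) (Pr (Num k) x) = Pr (Num k) (Idt (A k) x)"
  "\<lbrakk>k < n; f \<in> Arr (A k)\<rbrakk> \<Longrightarrow> Dom (coprod_s n A) (Pr (Num k) f) = Pr (Num k) (Dom (A k) f)"
  "\<lbrakk>k < n; f \<in> Arr (A k)\<rbrakk> \<Longrightarrow> Cod (coprod_s n A) (Pr (Num k) f) = Pr (Num k) (Cod (A k) f)"
  "\<lbrakk>k < n; f \<in> Arr (A k); g \<in> Arr (A k); Dom (A k) g = Cod (A k) f\<rbrakk>
    \<Longrightarrow> Pr (Num k) g \<cdot>\<^bsub>coprod_s n A\<^esub> Pr (Num k) f = Pr (Num k) (g \<cdot>\<^bsub>A k\<^esub> f)"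
  by (auto simp: coprod_s_def)

lemma coprod_Obj: "p \<in> Obj (coprod_s n A) \<longleftrightarrow> (\<exists>k x. p = Pr (Num k) x \<and> k < n \<and> x \<in> Obj (A k))"
  and coprod_Arr: "p \<in> Arr (coprod_s n A) \<longleftrightarrow> (\<exists>k f. p = Pr (Num k) f \<and> k < n \<and> f \<in> Arr (A k))"
  by (auto simp: coprod_s_def)

lemma coprod_inj_simps [simp]:
  "Src (coprod_inj n A k) = A k" "Trg (coprod_inj n A k) = coprod_s n A"
  "x \<in> Obj (A k) \<Longrightarrow> FObj (coprod_inj n A k) x = Pr (Num k) x"
  "f \<in> Arr (A k) \<Longrightarrow> FArr (coprod_inj n A k) f = Pr (Num k) f"
  by (simp_all add: coprod_inj_def)

context big
begin

lemma small_coprod: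
  assumes A: "\<And>k. k < n \<Longrightarrow> small_cat (A k :: 'k scat)"
  shows "small_cat (coprod_s n A)"
proof (rule small_catI)
  have inf: "infinite (UNIV :: 'k set)" using unc countable_finite by blast
  have "m \<le> n \<Longrightarrow> |{Pr (Num k) f | k f. k < m \<and> f \<in> Arr (A k)}| <o |UNIV :: 'k set|" for m
  proof (induction m)
    case 0 then show ?case using small_countable[of "{}"] by simp
  next
    case (Suc m)
    have "{Pr (Num k) f | k f. k < Suc m \<and> f \<in> Arr (A k)} = {Pr (Num k) f | k f. k < m \<and> f \<in> Arr (A k)} \<union> Pr (Num m) ` Arr (A m)"
      by (auto simp: less_Suc_eq)
    moreover have "|Pr (Num m) ` Arr (A m)| <o |UNIV :: 'k set|"
      using small_subset_image[OF small_cat_card[OF A[of m]], of _ "Pr (Num m)"] Suc by simp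
    ultimately show ?case using card_of_Un_ordLess_infinite[OF inf] Suc by simp
  qed
  from this[of n] show "|Arr (coprod_s n A)| <o |UNIV :: 'k set|" by (simp add: coprod_s_def)
  show "category (coprod_s n A)" unfolding coprod_s_def
  proof (rule mk_cat_category, goal_cases)
    case (1 f)
    then obtain k f' where "f = Pr (Num k) f'" "k < n" "f' \<in> Arr (A k)" by auto
    then show ?case using category.dom_in[OF small_cat_category[OF A]] by simp
  next
    case (2 f)
    then obtain k f' where "f = Pr (Num k) f'" "k < n" "f' \<in> Arr (A k)" by auto
    then show ?case using category.cod_in[OF small_cat_category[OF A]] by simp
  next
    case (3 x)
    then obtain k y where x: "x = Pr (Num k) y" "k < n" "y \<in> Obj (A k)" by auto
    interpret category "A k" using A x by simp
    show ?case using x homD(1-3)[OF id_in[OF x(3)]] by auto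
  next
    case (4 f g)
    then obtain k f' g' where x: "f = Pr (Num k) f'" "g = Pr (Num k) g'" "k < n" "f' \<in> Arr (A k)" "g' \<in> Arr (A k)" "Dom (A k) g' = Cod (A k) f'" by auto
    interpret category "A k" using A x by simp
    show ?case using x homD(1-3)[OF comp_in, of f' "Dom (A k) f'" "Cod (A k) f'" g' "Cod (A k) g'"] by (auto simp: hom_def)
  next
    case (5 f)
    then obtain k f' where "f = Pr (Num k) f'" "k < n" "f' \<in> Arr (A k)" by auto
    then show ?case using category.id_right[OF small_cat_category[OF A]] by simp
  next
    case (6 f)
    then obtain k f' where "f = Pr (Num k) f'" "k < n" "f' \<in> Arr (A k)" by auto
    then show ?case using category.id_left[OF small_cat_category[OF A]] by simp
  next
    case (7 f g h)
    then obtain k f' g' h' where x: "f = Pr (Num k) f'" "g = Pr (Num k) g'" "h = Pr (Num k) h'" "k < n" "f' \<in> Arr (A k)" "g' \<in> Arr (A k)" "h' \<in> Arr (A k)"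
      "Dom (A k) g' = Cod (A k) f'" "Dom (A k) h' = Cod (A k) g'" by auto
    interpret category "A k" using A x by simp
    show ?case using x assoc[of f' "Dom (A k) f'" "Cod (A k) f'" g' "Cod (A k) g'" h' "Cod (A k) h'"] by (auto simp: hom_def)
  qed
qed

lemma small_coprod_inj: "\<lbrakk>\<And>k. k < n \<Longrightarrow> small_cat (A k :: 'k scat); k < n\<rbrakk> \<Longrightarrow> small_functor (coprod_inj n A k)"
  unfolding coprod_inj_def
  by (rule small_mk) (auto intro!: small_coprod simp: category.dom_in category.cod_in)

text \<open>Products distribute over coproducts. The index and the \<open>L\<close>-component are
  exchanged, and the same formula \<open>?i\<close> on encodings describes both directions.\<close>

lemma coprod_distrib:
  assumes L: "small_cat (L :: 'k scat)" and A: "\<And>k. k < n \<Longrightarrow> small_cat (A k)"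
  obtains J J' where "small_functor J" "small_functor J'" "Src J = coprod_s n (\<lambda>k. L ** A k)" "Trg J = L ** coprod_s n A"
    "Src J' = L ** coprod_s n A" "Trg J' = coprod_s n (\<lambda>k. L ** A k)"
    "J oo J' = id_f (L ** coprod_s n A)" "J' oo J = id_f (coprod_s n (\<lambda>k. L ** A k))"
    "\<forall>k<n. J oo coprod_inj n (\<lambda>k. L ** A k) k = id_f L *** coprod_inj n A k"
proof -
  let ?C = "coprod_s n (\<lambda>k. L ** A k)" and ?D = "L ** coprod_s n A"
  let ?i = "\<lambda>x. Pr (fs (sn x)) (Pr (fs x) (sn (sn x)))"
  define J where "J = mk_fctr ?C ?D ?i ?i"
  define J' where "J' = mk_fctr ?D ?C ?i ?i"
  have LA: "small_cat (L ** A k)" if "k < n" for k using L A that by simp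
  have C: "small_cat ?C" "small_cat (coprod_s n A)" using small_coprod[of n "\<lambda>k. L ** A k"] small_coprod[of n A] LA A by auto
  then have D: "small_cat ?D" using L by simp
  have J: "small_functor J" unfolding J_def
  proof (rule small_mk)
    fix f g assume "f \<in> Arr ?C" "g \<in> Arr ?C" "Dom ?C g = Cod ?C f"
    then show "?i (g \<cdot>\<^bsub>?C\<^esub> f) = ?i g \<cdot>\<^bsub>?D\<^esub> ?i f"
      by (auto simp: coprod_Arr prod_Arr) 
  qed (use C D in \<open>auto simp: coprod_Obj coprod_Arr prod_Obj prod_Arr\<close>)
  have J': "small_functor J'" unfolding J'_def
  proof (rule small_mk)
    fix f g assume "f \<in> Arr ?D" "g \<in> Arr ?D" "Dom ?D g = Cod ?D f"
    then show "?i (g \<cdot>\<^bsub>?D\<^esub> f) = ?i g \<cdot>\<^bsub>?C\<^esub> ?i f"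
      by (auto simp: coprod_Arr prod_Arr)
  qed (use C D in \<open>auto simp: coprod_Obj coprod_Arr prod_Obj prod_Arr\<close>)
  have s: "Src J = ?C" "Trg J = ?D" "Src J' = ?D" "Trg J' = ?C" by (simp_all add: J_def J'_def)
  show thesis
  proof (rule that[OF J J' s])
    show "J oo J' = id_f ?D" using J J' s C D L
      by (intro small_eqI) (auto simp: J_def J'_def coprod_Obj coprod_Arr prod_Obj prod_Arr)
    show "J' oo J = id_f ?C" using J J' s C D L
      by (intro small_eqI) (auto simp: J_def J'_def coprod_Obj coprod_Arr prod_Obj prod_Arr)
    show "\<forall>k<n. J oo coprod_inj n (\<lambda>k. L ** A k) k = id_f L *** coprod_inj n A k"
    proof (intro allI impI)
    fix k assume k: "k < n"
    have ik: "small_functor (coprod_inj n (\<lambda>k. L ** A k) k)" "small_functor (coprod_inj n A k)"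
      using small_coprod_inj[of n "\<lambda>k. L ** A k" k] small_coprod_inj[of n A k] LA A k by auto
    then show "J oo coprod_inj n (\<lambda>k. L ** A k) k = id_f L *** coprod_inj n A k" using J s L k
      by (intro small_eqI) (auto simp: J_def prod_Obj prod_Arr)
    qed
  qed
qed

end

locale dv = derivator D + big "TYPE('k)" for D :: "('k, 'o, 'm) pder"
begin

sublocale ldv D
proof
  fix B f assume "small_cat B" "f \<in> Arr (DC D B)" "\<And>b. b \<in> Obj B \<Longrightarrow> iso_in (DC D pt) (pbA D (obj_f B b) f)"
  then show "iso_in (DC D B) f" using der2 by blast
qed (fact der3_left der4_left)+

text \<open>Der1 reduces to that of \<open>D\<close> by distributivity, the left half is
  \<open>shift_ldv\<close>, right adjoints are inherited, and Der4 on the right follows by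
  conjugation inside the shift.\<close>

theorem shift_derivator:
  assumes L: "small_cat L"
  shows "derivator (shift D L)"
proof -
  interpret s: ldv "shift D L" by (rule shift_ldv[OF L])
  have R: "\<exists>G \<eta> \<epsilon>. adjunction (DF (shift D L) u) G \<eta> \<epsilon>" if "small_functor u" for u
    using der3_right[of "id_f L *** u"] that L by simp
  show ?thesis
  proof (unfold_locales, goal_cases)
    case (1 n A)
    obtain J J' where J: "small_functor J" "small_functor J'" "Src J = coprod_s n (\<lambda>k. L ** A k)" "Trg J = L ** coprod_s n A"
      "Src J' = L ** coprod_s n A" "Trg J' = coprod_s n (\<lambda>k. L ** A k)"
      "J oo J' = id_f (L ** coprod_s n A)" "J' oo J = id_f (coprod_s n (\<lambda>k. L ** A k))"
      and Ji': "\<forall>k<n. J oo coprod_inj n (\<lambda>k. L ** A k) k = id_f L *** coprod_inj n A k"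
    proof -
      assume that: "\<And>J J'. \<lbrakk>small_functor J; small_functor J'; Src J = coprod_s n (\<lambda>k. L ** A k); Trg J = L ** coprod_s n A;
        Src J' = L ** coprod_s n A; Trg J' = coprod_s n (\<lambda>k. L ** A k);
        J oo J' = id_f (L ** coprod_s n A); J' oo J = id_f (coprod_s n (\<lambda>k. L ** A k));
        \<forall>k<n. J oo coprod_inj n (\<lambda>k. L ** A k) k = id_f L *** coprod_inj n A k\<rbrakk> \<Longrightarrow> thesis"
      show thesis by (rule coprod_distrib[OF L 1]) (assumption | rule that)+
    qed
    have Ji: "J oo coprod_inj n (\<lambda>k. L ** A k) k = id_f L *** coprod_inj n A k" if "k < n" for k using Ji' that by simp
    have LA: "small_cat (L ** A k)" if "k < n" for k using L 1 that by simp
    note inj = small_coprod_inj[of n "\<lambda>k. L ** A k", OF LA]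
    let ?E = "coprod_comparison D n (\<lambda>k. L ** A k)"
    have E: "is_equivalence ?E" using der1[of n "\<lambda>k. L ** A k"] LA by blast
    have sE: "Src ?E = DC D (Src J)" using J by (simp add: coprod_comparison_def)
    have "is_equivalence (?E oo DF D J)"
    proof (rule equivalence_comp_iso[OF E])
      have "DF D J' oo DF D J = DF D (J oo J')" using DF_comp[of J' J] J by simp
      then show "DF D J' oo DF D J = id_f (Src (DF D J))" using J DF_id small_functor_src[OF J(2)] by simp
      have "DF D J oo DF D J' = DF D (J' oo J)" using DF_comp[of J J'] J by simp
      then show "DF D J oo DF D J' = id_f (Src ?E)" using J DF_id small_functor_src[OF J(1)] sE by simp
    qed (use J sE in \<open>simp_all add: DF_functor\<close>)
    \<comment> \<open>On the k-th summand \<open>J\<close> turns the injection into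
      \<open>id_f L *** coprod_inj n A k\<close>, so the composite is literally the comparison
      functor of the shift.\<close>
    moreover have "?E oo DF D J = coprod_comparison (shift D L) n A"
      unfolding comp_f_def coprod_comparison_def[of "shift D L"]
    proof (rule mk_fctr_cong)
      show "Src (DF D J) = DC (shift D L) (coprod_s n A)" using J by simp
      show "Trg ?E = fam_prod_cat n (\<lambda>k. DC (shift D L) (A k))" by (simp add: coprod_comparison_def)
      fix X assume "X \<in> Obj (Src (DF D J))"
      then have X: "X \<in> ob (Trg J)" using J by simp
      have "pb J X \<in> ob (coprod_s n (\<lambda>k. L ** A k))" using X J by simp
      then have "FObj ?E (pb J X) = (\<lambda>k\<in>{..<n}. pb (coprod_inj n (\<lambda>k. L ** A k) k) (pb J X))"
        by (simp add: coprod_comparison_def)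
      moreover have "pb (coprod_inj n (\<lambda>k. L ** A k) k) (pb J X) = pbO (shift D L) (coprod_inj n A k) X" if k: "k < n" for k
        using pbO_comp[of "coprod_inj n (\<lambda>k. L ** A k) k" J X] inj[OF _ k] Ji[OF k] X J by simp
      ultimately show "FObj ?E (pb J X) = (\<lambda>k\<in>{..<n}. pbO (shift D L) (coprod_inj n A k) X)" by auto
    next
      fix f assume "f \<in> Arr (Src (DF D J))"
      then have X: "f \<in> ar (Trg J)" using J by simp
      have "pa J f \<in> ar (coprod_s n (\<lambda>k. L ** A k))" using pbA_Arr[OF J(1) X] J by simp
      then have "FArr ?E (pa J f) = (\<lambda>k\<in>{..<n}. pa (coprod_inj n (\<lambda>k. L ** A k) k) (pa J f))"
        by (simp add: coprod_comparison_def)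
      moreover have "pa (coprod_inj n (\<lambda>k. L ** A k) k) (pa J f) = pbA (shift D L) (coprod_inj n A k) f" if k: "k < n" for k
        using pbA_comp[of "coprod_inj n (\<lambda>k. L ** A k) k" J f] inj[OF _ k] Ji[OF k] X J by simp
      ultimately show "FArr ?E (pa J f) = (\<lambda>k\<in>{..<n}. pbA (shift D L) (coprod_inj n A k) f)" by auto
    qed
    ultimately show ?case by simp
  next
    case (2 B f)
    show ?case
    proof
      assume i: "iso_in (DC (shift D L) B) f"
      then show "\<forall>b\<in>Obj B. iso_in (DC (shift D L) pt) (pbA (shift D L) (obj_f B b) f)"
        using s.pbA_iso[of "obj_f B b" f for b] 2 by simp
    qed (use s.L_der2[OF 2] in blast)
  next
    case (3 u) then show ?case by (rule s.L_der3)
  next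
    case (4 u) then show ?case by (rule R)
  next
    case (5 u b X) then show ?case by (rule s.L_der4)
  next
    case (6 u b X) then show ?case using s.der4_right_of_left R by blast
  qed
qed

end

section \<open>Products of arrows over a functor\<close>

lemma prod_cat_simps [simp]:
  "(x, y) \<in> Obj (prod_cat A B) \<longleftrightarrow> x \<in> Obj A \<and> y \<in> Obj B"
  "(f, g) \<in> Arr (prod_cat A B) \<longleftrightarrow> f \<in> Arr A \<and> g \<in> Arr B"
  "\<lbrakk>x \<in> Obj A; y \<in> Obj B\<rbrakk> \<Longrightarrow> Idt (prod_cat A B) (x, y) = (Idt A x, Idt B y)"
  "\<lbrakk>f \<in> Arr A; f' \<in> Arr A; g \<in> Arr B; g' \<in> Arr B; Dom A f' = Cod A f; Dom B g' = Cod B g\<rbrakk>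
    \<Longrightarrow> (f', g') \<cdot>\<^bsub>prod_cat A B\<^esub> (f, g) = (f' \<cdot>\<^bsub>A\<^esub> f, g' \<cdot>\<^bsub>B\<^esub> g)"
  by (auto simp: prod_cat_def)

lemma prod_cat_hom [simp]: "(f, g) \<in> hom (prod_cat A B) (x, y) (x', y') \<longleftrightarrow> f \<in> hom A x x' \<and> g \<in> hom B y y'"
  by (auto simp: prod_cat_def mk_cat_hom hom_def)

context monoidal_category
begin

lemma tenO_in: "\<lbrakk>x \<in> Obj C; y \<in> Obj C\<rbrakk> \<Longrightarrow> tenO S x y \<in> Obj C"
  using is_functor.obj_in[OF ten_functor(1), of "(x, y)"] ten_functor by simp

lemma tenA_in: "\<lbrakk>f \<in> hom C x x'; g \<in> hom C y y'\<rbrakk> \<Longrightarrow> tenA S f g \<in> hom C (tenO S x y) (tenO S x' y')"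
  using is_functor.arr_in[OF ten_functor(1), of "(f, g)" "(x, y)" "(x', y')"] ten_functor by simp

lemma tenA_id: "\<lbrakk>x \<in> Obj C; y \<in> Obj C\<rbrakk> \<Longrightarrow> tenA S (Idt C x) (Idt C y) = Idt C (tenO S x y)"
  using is_functor.pres_id[OF ten_functor(1), of "(x, y)"] ten_functor by simp

lemma tenA_comp: "\<lbrakk>f \<in> hom C x x'; g \<in> hom C y y'; f' \<in> hom C x' x''; g' \<in> hom C y' y''\<rbrakk>
    \<Longrightarrow> tenA S (f' \<cdot>\<^bsub>C\<^esub> f) (g' \<cdot>\<^bsub>C\<^esub> g) = tenA S f' g' \<cdot>\<^bsub>C\<^esub> tenA S f g"
  using is_functor.pres_comp[OF ten_functor(1), of "(f, g)" "(x, y)" "(x', y')" "(f', g')" "(x'', y'')"]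
    ten_functor homD[of f x x'] homD[of g y y'] homD[of f' x' x''] homD[of g' y' y''] by simp

lemma tenA_iso:
  assumes f: "f \<in> hom C x x'" "iso_in C f" and g: "g \<in> hom C y y'" "iso_in C g"
  shows "iso_in C (tenA S f g)"
proof -
  obtain f' where f': "f' \<in> hom C x' x" "f' \<cdot>\<^bsub>C\<^esub> f = Idt C x" "f \<cdot>\<^bsub>C\<^esub> f' = Idt C x'" using isoE[OF f(2,1)] by metis
  obtain g' where g': "g' \<in> hom C y' y" "g' \<cdot>\<^bsub>C\<^esub> g = Idt C y" "g \<cdot>\<^bsub>C\<^esub> g' = Idt C y'" using isoE[OF g(2,1)] by metis
  show ?thesis
    using isoI[OF tenA_in[OF f(1) g(1)] tenA_in[OF f'(1) g'(1)]] tenA_comp[OF f(1) g(1) f'(1) g'(1)]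
      tenA_comp[OF f'(1) g'(1) f(1) g(1)] f' g' tenA_id homD(4,5)[OF f(1)] homD(4,5)[OF g(1)] by simp
qed

end

text \<open>The tensor on the Grothendieck construction over a common base functor: tensor in the
  fibre, then correct the target by the isomorphism \<open>Mu\<close>.\<close>

definition ten :: "('k, 'o, 'm) pder \<Rightarrow> ('k, 'o, 'm) mon_pder \<Rightarrow> 'k sfun \<Rightarrow> 'o \<Rightarrow> 'o \<Rightarrow> 'm \<Rightarrow> 'm \<Rightarrow> 'm" where
  "ten D M u X Y f g = Mu M u X Y \<cdot>\<^bsub>DC D (Src u)\<^esub> tenA (MS M (Src u)) f g"

locale mpd = monoidal_prederivator D M + big "TYPE('k)" for D :: "('k, 'o, 'm) pder" and M :: "('k, 'o, 'm) mon_pder"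
begin

sublocale pd D by unfold_locales

abbreviation tO :: "'k scat \<Rightarrow> 'o \<Rightarrow> 'o \<Rightarrow> 'o" where "tO A X Y \<equiv> tenO (MS M A) X Y"
abbreviation tA :: "'k scat \<Rightarrow> 'm \<Rightarrow> 'm \<Rightarrow> 'm" where "tA A f g \<equiv> tenA (MS M A) f g"
abbreviation un :: "'k scat \<Rightarrow> 'o" where "un A \<equiv> Unt (MS M A)"

lemma tO_in [simp]: "\<lbrakk>small_cat A; X \<in> ob A; Y \<in> ob A\<rbrakk> \<Longrightarrow> tO A X Y \<in> ob A"
  using monoidal_category.tenO_in[OF monoidal] .

lemma un_in [simp]: "small_cat A \<Longrightarrow> un A \<in> ob A"
  using monoidal_category.unt_in[OF monoidal] .

lemmas tA_in = monoidal_category.tenA_in[OF monoidal]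
lemmas tA_id = monoidal_category.tenA_id[OF monoidal]
lemmas tA_comp = monoidal_category.tenA_comp[OF monoidal]
lemmas tA_iso = monoidal_category.tenA_iso[OF monoidal]

lemma Mu_in: "\<lbrakk>small_functor u; X \<in> ob (Trg u); Y \<in> ob (Trg u)\<rbrakk>
    \<Longrightarrow> Mu M u X Y \<in> hm (Src u) (tO (Src u) (pb u X) (pb u Y)) (pb u (tO (Trg u) X Y))"
  using strong_monoidal.mu_in[OF pb_strong, of u X Y] by simp

lemma Mu_iso: "\<lbrakk>small_functor u; X \<in> ob (Trg u); Y \<in> ob (Trg u)\<rbrakk> \<Longrightarrow> isoin (Src u) (Mu M u X Y)"
  using strong_monoidal.mu_iso[OF pb_strong, of u X Y] by simp

lemma Ep_in: "small_functor u \<Longrightarrow> Ep M u \<in> H D u (un (Src u)) (un (Trg u))"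
  using strong_monoidal.ep_in[OF pb_strong, of u] by (auto intro!: HI)

lemma Ep_iso: "small_functor u \<Longrightarrow> isoin (Src u) (Ep M u)"
  using strong_monoidal.ep_iso[OF pb_strong, of u] by simp

lemma ten_in: "\<lbrakk>f \<in> H D u X X'; g \<in> H D u Y Y'\<rbrakk> \<Longrightarrow> ten D M u X' Y' f g \<in> H D u (tO (Src u) X Y) (tO (Trg u) X' Y')"
proof -
  assume f: "f \<in> H D u X X'" and g: "g \<in> H D u Y Y'"
  note fH = HD[OF f] and gH = HD[OF g]
  have "small_cat (Src u)" "small_cat (Trg u)" using fH by simp_all
  then show ?thesis
    using category.comp_in[OF DC_cat tA_in[OF _ fH(3) gH(3)] Mu_in[OF fH(1,2) gH(2)]] fH gH
    by (auto intro!: HI simp: ten_def)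
qed

lemma ten_iso:
  assumes f: "f \<in> H D u X X'" "isoin (Src u) f" and g: "g \<in> H D u Y Y'" "isoin (Src u) g"
  shows "isoin (Src u) (ten D M u X' Y' f g)"
  unfolding ten_def using HD[OF f(1)] HD[OF g(1)]
    category.iso_comp[OF DC_cat tA_in[OF _ HD(3)[OF f(1)] HD(3)[OF g(1)]] Mu_in tA_iso[OF _ HD(3)[OF f(1)] f(2) HD(3)[OF g(1)] g(2)] Mu_iso]
  by simp

text \<open>Functoriality of the total tensor: \<open>Mu_comp\<close> splits the structure map of
  the composite functor, and naturality of \<open>Mu\<close> moves it past the second pair of
  arrows.\<close>

lemma ten_cmp:
  assumes f: "f \<in> H D u X X'" and g: "g \<in> H D u Y Y'" and f': "f' \<in> H D v X' X''" and g': "g' \<in> H D v Y' Y''" and e: "Src v = Trg u"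
  shows "ten D M (v oo u) X'' Y'' (cm u f' f) (cm u g' g) = cm u (ten D M v X'' Y'' f' g') (ten D M u X' Y' f g)"
proof -
  note fH = HD[OF f] and gH = HD[OF g] and f'H = HD[OF f'] and g'H = HD[OF g']
  interpret A: category "DC D (Src u)" using fH by simp
  let ?A = "DC D (Src u)" and ?tA = "tA (Src u)"
  have uf': "pa u f' \<in> hom ?A (pb u X') (pb u (pb v X''))" and ug': "pa u g' \<in> hom ?A (pb u Y') (pb u (pb v Y''))"
    using pbA_in[OF fH(1)] f'H(3) g'H(3) e by auto
  note t1 = tA_in[OF _ fH(3) gH(3)] and t2 = tA_in[OF _ uf' ug']
  have S: "small_cat (Src u)" "small_cat (Trg u)" using fH by simp_all
  have vX: "pb v X'' \<in> ob (Trg u)" "pb v Y'' \<in> ob (Trg u)" using f'H g'H e by simp_all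
  note m1 = Mu_in[OF fH(1) vX] and m0 = Mu_in[OF fH(1) fH(2) gH(2)]
  have mv: "Mu M v X'' Y'' \<in> hm (Trg u) (tO (Trg u) (pb v X'') (pb v Y'')) (pb v (tO (Trg v) X'' Y''))"
    using Mu_in[OF f'H(1,2) g'H(2)] e by simp
  note umv = pbA_in[OF fH(1) mv]
  have f'h: "f' \<in> hm (Trg u) X' (pb v X'')" and g'h: "g' \<in> hm (Trg u) Y' (pb v Y'')" using f'H g'H e by simp_all
  note tv = tA_in[OF S(2) f'h g'h]
  note utv = pbA_in[OF fH(1) tv]
  have nat: "Mu M u (pb v X'') (pb v Y'') \<cdot>\<^bsub>?A\<^esub> ?tA (pa u f') (pa u g') = pa u (tA (Trg u) f' g') \<cdot>\<^bsub>?A\<^esub> Mu M u X' Y'"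
    using strong_monoidal.mu_nat[OF pb_strong[OF fH(1)], of f' X' "pb v X''" g' Y' "pb v Y''"] f'h g'h fH by simp
  have "ten D M (v oo u) X'' Y'' (cm u f' f) (cm u g' g)
    = (pa u (Mu M v X'' Y'') \<cdot>\<^bsub>?A\<^esub> Mu M u (pb v X'') (pb v Y'')) \<cdot>\<^bsub>?A\<^esub> (?tA (pa u f') (pa u g') \<cdot>\<^bsub>?A\<^esub> ?tA f g)"
    using Mu_comp[OF fH(1) f'H(1) e f'H(2) g'H(2)] tA_comp[OF S(1) fH(3) gH(3) uf' ug'] by (simp add: ten_def cmp_def)
  also have "\<dots> = pa u (Mu M v X'' Y'') \<cdot>\<^bsub>?A\<^esub> ((Mu M u (pb v X'') (pb v Y'') \<cdot>\<^bsub>?A\<^esub> ?tA (pa u f') (pa u g')) \<cdot>\<^bsub>?A\<^esub> ?tA f g)"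
    using A.assoc[OF A.comp_in[OF t1[OF S(1)] t2[OF S(1)]] m1 umv] A.assoc[OF t1[OF S(1)] t2[OF S(1)] m1] by simp
  also have "\<dots> = pa u (Mu M v X'' Y'') \<cdot>\<^bsub>?A\<^esub> (pa u (tA (Trg u) f' g') \<cdot>\<^bsub>?A\<^esub> (Mu M u X' Y' \<cdot>\<^bsub>?A\<^esub> ?tA f g))"
    unfolding nat using A.assoc[OF t1[OF S(1)] m0 utv] by simp
  also have "\<dots> = cm u (ten D M v X'' Y'' f' g') (ten D M u X' Y' f g)"
    using A.assoc[OF A.comp_in[OF t1[OF S(1)] m0] utv umv] pbA_mult[OF fH(1) tv mv] e by (simp add: ten_def cmp_def)
  finally show ?thesis .
qed

lemma ten_id:
  assumes A: "small_cat A" and f: "f \<in> hm A X X'" and g: "g \<in> hm A Y Y'"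
  shows "ten D M (id_f A) X' Y' f g = tA A f g"
  using Mu_id[OF A, of X' Y'] category.idl[OF DC_cat[OF A] tA_in[OF A f g]] homO[OF A f] homO[OF A g] by (simp add: ten_def)

lemma ten_post:
  assumes f: "f \<in> H D u X X'" and g: "g \<in> H D u Y Y'" and f': "f' \<in> hm (Trg u) X' X''" and g': "g' \<in> hm (Trg u) Y' Y''"
  shows "ten D M u X'' Y'' (cm u f' f) (cm u g' g) = cm u (tA (Trg u) f' g') (ten D M u X' Y' f g)"
  using ten_cmp[OF f g, of f' "id_f (Trg u)" X'' g' Y''] f' g' HD[OF f] H_id ten_id[OF _ f' g'] by simp

text \<open>Naturality of the associator along arrows over \<open>u\<close>: compatibility of
  \<open>Mu\<close> with associators combined with naturality of the associator inside the fibre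
  over the source.\<close>

lemma ten_asc:
  assumes f: "f \<in> H D u X X'" and g: "g \<in> H D u Y Y'" and h: "h \<in> H D u Z Z'"
  shows "cm u (Asc (MS M (Trg u)) X' Y' Z') (ten D M u (tO (Trg u) X' Y') Z' (ten D M u X' Y' f g) h)
    = ten D M u X' (tO (Trg u) Y' Z') f (ten D M u Y' Z' g h) \<cdot>[Src u] Asc (MS M (Src u)) X Y Z"
proof -
  note fH = HD[OF f] and gH = HD[OF g] and hH = HD[OF h]
  have S: "small_cat (Src u)" "small_cat (Trg u)" using fH by simp_all
  interpret m: monoidal_category "DC D (Src u)" "MS M (Src u)" by (rule monoidal[OF S(1)])
  interpret t: monoidal_category "DC D (Trg u)" "MS M (Trg u)" by (rule monoidal[OF S(2)])
  let ?A = "DC D (Src u)" and ?tA = "tA (Src u)" and ?u = "pb u"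
  have XY: "tO (Trg u) X' Y' \<in> ob (Trg u)" "tO (Trg u) Y' Z' \<in> ob (Trg u)" using S fH gH hH by simp_all
  have uX: "?u X' \<in> Obj ?A" "?u Y' \<in> Obj ?A" "?u Z' \<in> Obj ?A" using fH gH hH by simp_all
  note mXY = Mu_in[OF fH(1,2) gH(2)] and mYZ = Mu_in[OF gH(1,2) hH(2)]
  note mXYZ = Mu_in[OF fH(1) XY(1) hH(2)] and mXYZ' = Mu_in[OF fH(1,2) XY(2)]
  note tfg = m.tenA_in[OF fH(3) gH(3)] and tgh = m.tenA_in[OF gH(3) hH(3)]
  note tfgh = m.tenA_in[OF tfg hH(3)] and tfgh' = m.tenA_in[OF fH(3) tgh]
  note as = t.asc_in[OF fH(2) gH(2) hH(2)]
  note uas = pbA_in[OF fH(1) as]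
  note mi = m.tenA_in[OF mXY m.id_in[OF uX(3)]] and im = m.tenA_in[OF m.id_in[OF uX(1)] mYZ]
  note a1 = m.asc_in[OF uX] and a0 = m.asc_in[OF fH(4) gH(4) hH(4)]
  have 1: "?tA (ten D M u X' Y' f g) h = ?tA (Mu M u X' Y') (Idt ?A (?u Z')) \<cdot>\<^bsub>?A\<^esub> ?tA (?tA f g) h"
    using m.tenA_comp[OF tfg hH(3) mXY m.id_in[OF uX(3)]] m.idl[OF hH(3)] by (simp add: ten_def)
  have 2: "?tA f (ten D M u Y' Z' g h) = ?tA (Idt ?A (?u X')) (Mu M u Y' Z') \<cdot>\<^bsub>?A\<^esub> ?tA f (?tA g h)"
    using m.tenA_comp[OF fH(3) tgh m.id_in[OF uX(1)] mYZ] m.idl[OF fH(3)] by (simp add: ten_def)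
  have as2: "pa u (Asc (MS M (Trg u)) X' Y' Z') \<cdot>\<^bsub>?A\<^esub> (Mu M u (tO (Trg u) X' Y') Z' \<cdot>\<^bsub>?A\<^esub> ?tA (Mu M u X' Y') (Idt ?A (?u Z')))
    = Mu M u X' (tO (Trg u) Y' Z') \<cdot>\<^bsub>?A\<^esub> (?tA (Idt ?A (?u X')) (Mu M u Y' Z') \<cdot>\<^bsub>?A\<^esub> Asc (MS M (Src u)) (?u X') (?u Y') (?u Z'))"
    using strong_monoidal.mu_assoc[OF pb_strong[OF fH(1)], of X' Y' Z'] fH gH hH by simp
  have "cm u (Asc (MS M (Trg u)) X' Y' Z') (ten D M u (tO (Trg u) X' Y') Z' (ten D M u X' Y' f g) h)
    = (pa u (Asc (MS M (Trg u)) X' Y' Z') \<cdot>\<^bsub>?A\<^esub> (Mu M u (tO (Trg u) X' Y') Z' \<cdot>\<^bsub>?A\<^esub> ?tA (Mu M u X' Y') (Idt ?A (?u Z')))) \<cdot>\<^bsub>?A\<^esub> ?tA (?tA f g) h"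
    using m.assoc[OF tfgh mi mXYZ] m.assoc[OF tfgh m.comp_in[OF mi mXYZ] uas] 1
    unfolding cmp_def ten_def[of D M u "tO (Trg u) X' Y'"] by simp
  also have "\<dots> = Mu M u X' (tO (Trg u) Y' Z') \<cdot>\<^bsub>?A\<^esub> (?tA (Idt ?A (?u X')) (Mu M u Y' Z') \<cdot>\<^bsub>?A\<^esub> (Asc (MS M (Src u)) (?u X') (?u Y') (?u Z') \<cdot>\<^bsub>?A\<^esub> ?tA (?tA f g) h))"
    unfolding as2 using m.assoc[OF tfgh m.comp_in[OF a1 im] mXYZ'] m.assoc[OF tfgh a1 im] by simp
  also have "\<dots> = Mu M u X' (tO (Trg u) Y' Z') \<cdot>\<^bsub>?A\<^esub> ((?tA (Idt ?A (?u X')) (Mu M u Y' Z') \<cdot>\<^bsub>?A\<^esub> ?tA f (?tA g h)) \<cdot>\<^bsub>?A\<^esub> Asc (MS M (Src u)) X Y Z)"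
    using m.asc_nat[OF fH(3) gH(3) hH(3)] m.assoc[OF a0 tfgh' im] by simp
  also have "\<dots> = ten D M u X' (tO (Trg u) Y' Z') f (ten D M u Y' Z' g h) \<cdot>\<^bsub>?A\<^esub> Asc (MS M (Src u)) X Y Z"
    using m.assoc[OF a0 m.comp_in[OF tfgh' im] mXYZ'] 2 unfolding ten_def[of D M u X' "tO (Trg u) Y' Z'"] by simp
  finally show ?thesis .
qed

lemma ten_lun:
  assumes g: "g \<in> H D u Y Y'"
  shows "cm u (LUn (MS M (Trg u)) Y') (ten D M u (un (Trg u)) Y' (Ep M u) g) = g \<cdot>[Src u] LUn (MS M (Src u)) Y"
proof -
  note gH = HD[OF g]
  have S: "small_cat (Src u)" "small_cat (Trg u)" using gH by simp_all
  interpret m: monoidal_category "DC D (Src u)" "MS M (Src u)" by (rule monoidal[OF S(1)])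
  interpret t: monoidal_category "DC D (Trg u)" "MS M (Trg u)" by (rule monoidal[OF S(2)])
  let ?A = "DC D (Src u)" and ?tA = "tA (Src u)" and ?u = "pb u"
  note ep = HD(3)[OF Ep_in[OF gH(1)]]
  have uY: "?u Y' \<in> Obj ?A" using gH by simp
  note mu = Mu_in[OF gH(1) t.unt_in gH(2)] and ei = m.tenA_in[OF ep m.id_in[OF uY]] and ig = m.tenA_in[OF m.id_in[OF m.unt_in] gH(3)]
  note ul = pbA_in[OF gH(1) t.lun_in[OF gH(2)]]
  have 1: "?tA (Ep M u) g = ?tA (Ep M u) (Idt ?A (?u Y')) \<cdot>\<^bsub>?A\<^esub> ?tA (Idt ?A (un (Src u))) g"
    using m.tenA_comp[OF m.id_in[OF m.unt_in] gH(3) ep m.id_in[OF uY]] m.idl[OF gH(3)] m.idr[OF ep] by simp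
  have "cm u (LUn (MS M (Trg u)) Y') (ten D M u (un (Trg u)) Y' (Ep M u) g)
    = (pa u (LUn (MS M (Trg u)) Y') \<cdot>\<^bsub>?A\<^esub> (Mu M u (un (Trg u)) Y' \<cdot>\<^bsub>?A\<^esub> ?tA (Ep M u) (Idt ?A (?u Y')))) \<cdot>\<^bsub>?A\<^esub> ?tA (Idt ?A (un (Src u))) g"
    using m.assoc[OF ig ei mu] m.assoc[OF ig m.comp_in[OF ei mu] ul] 1 by (simp add: cmp_def ten_def)
  then show ?thesis using strong_monoidal.mu_lun[OF pb_strong[OF gH(1)], of Y'] m.lun_nat[OF gH(3)] gH by simp
qed

lemma ten_run:
  assumes g: "g \<in> H D u Y Y'"
  shows "cm u (RUn (MS M (Trg u)) Y') (ten D M u Y' (un (Trg u)) g (Ep M u)) = g \<cdot>[Src u] RUn (MS M (Src u)) Y"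
proof -
  note gH = HD[OF g]
  have S: "small_cat (Src u)" "small_cat (Trg u)" using gH by simp_all
  interpret m: monoidal_category "DC D (Src u)" "MS M (Src u)" by (rule monoidal[OF S(1)])
  interpret t: monoidal_category "DC D (Trg u)" "MS M (Trg u)" by (rule monoidal[OF S(2)])
  let ?A = "DC D (Src u)" and ?tA = "tA (Src u)" and ?u = "pb u"
  note ep = HD(3)[OF Ep_in[OF gH(1)]]
  have uY: "?u Y' \<in> Obj ?A" using gH by simp
  note mu = Mu_in[OF gH(1,2) t.unt_in] and ei = m.tenA_in[OF m.id_in[OF uY] ep] and ig = m.tenA_in[OF gH(3) m.id_in[OF m.unt_in]]
  note ul = pbA_in[OF gH(1) t.run_in[OF gH(2)]]
  have 1: "?tA g (Ep M u) = ?tA (Idt ?A (?u Y')) (Ep M u) \<cdot>\<^bsub>?A\<^esub> ?tA g (Idt ?A (un (Src u)))"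
    using m.tenA_comp[OF gH(3) m.id_in[OF m.unt_in] m.id_in[OF uY] ep] m.idl[OF gH(3)] m.idr[OF ep] by simp
  have "cm u (RUn (MS M (Trg u)) Y') (ten D M u Y' (un (Trg u)) g (Ep M u))
    = (pa u (RUn (MS M (Trg u)) Y') \<cdot>\<^bsub>?A\<^esub> (Mu M u Y' (un (Trg u)) \<cdot>\<^bsub>?A\<^esub> ?tA (Idt ?A (?u Y')) (Ep M u))) \<cdot>\<^bsub>?A\<^esub> ?tA g (Idt ?A (un (Src u)))"
    using m.assoc[OF ig ei mu] m.assoc[OF ig m.comp_in[OF ei mu] ul] 1 by (simp add: cmp_def ten_def)
  then show ?thesis using strong_monoidal.mu_run[OF pb_strong[OF gH(1)], of Y'] m.run_nat[OF gH(3)] gH by simp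
qed

text \<open>Transformations act monoidally: this is \<open>Mu_trans\<close> together with
  functoriality of the fibre tensor.\<close>

lemma ten_trans:
  assumes a: "small_trans \<alpha>" "NSrc \<alpha> = u" "NTrg \<alpha> = v" and f: "f \<in> H D u X X'" and g: "g \<in> H D u Y Y'"
  shows "Cpt (DT D \<alpha>) (tO (Trg u) X' Y') \<cdot>[Src u] ten D M u X' Y' f g
    = ten D M v X' Y' (Cpt (DT D \<alpha>) X' \<cdot>[Src u] f) (Cpt (DT D \<alpha>) Y' \<cdot>[Src u] g)"
proof -
  note fH = HD[OF f] and gH = HD[OF g]
  have S: "small_cat (Src u)" "small_cat (Trg u)" "Src v = Src u" "Trg v = Trg u" "small_functor v"
    using fH small_transD[OF a(1)] a by auto
  interpret m: monoidal_category "DC D (Src u)" "MS M (Src u)" by (rule monoidal[OF S(1)])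
  have c: "Cpt (DT D \<alpha>) Z \<in> hm (Src u) (pb u Z) (pb v Z)" if "Z \<in> ob (Trg u)" for Z
    using DT_in[OF a(1), of Z] that a by simp
  have t: "tO (Trg u) X' Y' \<in> ob (Trg u)" using S fH gH by simp
  note tfg = m.tenA_in[OF fH(3) gH(3)] and mu = Mu_in[OF fH(1,2) gH(2)]
  have mv: "Mu M v X' Y' \<in> hm (Src u) (tO (Src u) (pb v X') (pb v Y')) (pb v (tO (Trg u) X' Y'))"
    using Mu_in[of v X' Y'] S fH gH by simp
  show ?thesis
    using m.assoc[OF tfg mu c[OF t]] Mu_trans[OF a(1) a(2)[symmetric] a(3)[symmetric] fH(2) gH(2)]
      m.assoc[OF tfg m.tenA_in[OF c[OF fH(2)] c[OF gH(2)]] mv] m.tenA_comp[OF fH(3) gH(3) c[OF fH(2)] c[OF gH(2)]] S(3)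
    by (simp add: ten_def)
qed

end

locale mdv = monoidal_derivator D M + big "TYPE('k)" for D :: "('k, 'o, 'm) pder" and M :: "('k, 'o, 'm) mon_pder"
begin

sublocale mpd D M by unfold_locales
sublocale dv D by unfold_locales

subsection \<open>External products of opcartesian arrows\<close>

definition exO :: "'k scat \<Rightarrow> 'k scat \<Rightarrow> 'o \<Rightarrow> 'o \<Rightarrow> 'o" where
  "exO A B X Y = tO (A ** B) (pb (prj1 A B) X) (pb (prj2 A B) Y)"

definition exA :: "'k scat \<Rightarrow> 'k scat \<Rightarrow> 'm \<Rightarrow> 'm \<Rightarrow> 'm" where
  "exA A B f g = tA (A ** B) (pa (prj1 A B) f) (pa (prj2 A B) g)"

text \<open>The external product of arrows over two different functors: both are restricted to the
  product of the sources, where they lie over the common functor \<open>u *** v\<close> and can be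
  tensored.\<close>

definition exH :: "'k sfun \<Rightarrow> 'k sfun \<Rightarrow> 'o \<Rightarrow> 'o \<Rightarrow> 'm \<Rightarrow> 'm \<Rightarrow> 'm" where
  "exH u v X Y x y = ten D M (u *** v) (pb (prj1 (Trg u) (Trg v)) X) (pb (prj2 (Trg u) (Trg v)) Y)
     (pa (prj1 (Src u) (Src v)) x) (pa (prj2 (Src u) (Src v)) y)"

lemma prod_f_simps:
  "Src (prod_f F G) = prod_cat (Src F) (Src G)" "Trg (prod_f F G) = prod_cat (Trg F) (Trg G)"
  "\<lbrakk>x \<in> Obj (Src F); y \<in> Obj (Src G)\<rbrakk> \<Longrightarrow> FObj (prod_f F G) (x, y) = (FObj F x, FObj G y)"
  "\<lbrakk>f \<in> Arr (Src F); g \<in> Arr (Src G)\<rbrakk> \<Longrightarrow> FArr (prod_f F G) (f, g) = (FArr F f, FArr G g)"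
  by (simp_all add: prod_f_def)

lemma ext_prod_simps:
  assumes "small_cat A" "small_cat B"
  shows "Src (ext_prod D M A B) = prod_cat (DC D A) (DC D B)" "Trg (ext_prod D M A B) = DC D (A ** B)"
    "\<lbrakk>X \<in> ob A; Y \<in> ob B\<rbrakk> \<Longrightarrow> FObj (ext_prod D M A B) (X, Y) = exO A B X Y"
    "\<lbrakk>f \<in> ar A; g \<in> ar B\<rbrakk> \<Longrightarrow> FArr (ext_prod D M A B) (f, g) = exA A B f g"
  using assms monoidal_category.ten_functor(3)[OF monoidal, of "A ** B"]
  by (simp_all add: ext_prod_def prod_f_simps exO_def exA_def)

lemma exO_in [simp]: "\<lbrakk>small_cat A; small_cat B; X \<in> ob A; Y \<in> ob B\<rbrakk> \<Longrightarrow> exO A B X Y \<in> ob (A ** B)"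
  by (simp add: exO_def)

lemma prj1_H: "\<lbrakk>x \<in> H D u P X; small_functor v\<rbrakk>
    \<Longrightarrow> pa (prj1 (Src u) (Src v)) x \<in> H D (u *** v) (pb (prj1 (Src u) (Src v)) P) (pb (prj1 (Trg u) (Trg v)) X)"
  using pb_H[of x u P X "prj1 (Src u) (Src v)" "prj1 (Trg u) (Trg v)" "u *** v"] HD[of x u P X] by simp

lemma prj2_H: "\<lbrakk>x \<in> H D v P X; small_functor u\<rbrakk>
    \<Longrightarrow> pa (prj2 (Src u) (Src v)) x \<in> H D (u *** v) (pb (prj2 (Src u) (Src v)) P) (pb (prj2 (Trg u) (Trg v)) X)"
  using pb_H[of x v P X "prj2 (Src u) (Src v)" "prj2 (Trg u) (Trg v)" "u *** v"] HD[of x v P X] by simp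

lemma exH_in: "\<lbrakk>x \<in> H D u P X; y \<in> H D v Q Y\<rbrakk>
    \<Longrightarrow> exH u v X Y x y \<in> H D (u *** v) (exO (Src u) (Src v) P Q) (exO (Trg u) (Trg v) X Y)"
  using ten_in[OF prj1_H[of x u P X v] prj2_H[of y v Q Y u]] HD(1)[of x u] HD(1)[of y v] by (simp add: exH_def exO_def)

lemma exH_post:
  assumes x: "x \<in> H D u P X" and y: "y \<in> H D v Q Y" and f: "f \<in> hm (Trg u) X X'" and g: "g \<in> hm (Trg v) Y Y'"
  shows "exH u v X' Y' (cm u f x) (cm v g y) = cm (u *** v) (exA (Trg u) (Trg v) f g) (exH u v X Y x y)"
proof -
  note xH = HD[OF x] and yH = HD[OF y]
  let ?p = "prj1 (Src u) (Src v)" and ?q = "prj2 (Src u) (Src v)" and ?p' = "prj1 (Trg u) (Trg v)" and ?q' = "prj2 (Trg u) (Trg v)"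
  have S: "small_functor ?p" "small_functor ?q" "small_functor ?p'" "small_functor ?q'" "small_functor (u *** v)" using xH yH by simp_all
  have uf: "pa u f \<in> hm (Src u) (pb u X) (pb u X')" and vg: "pa v g \<in> hm (Src v) (pb v Y) (pb v Y')"
    using pbA_in[OF xH(1) f] pbA_in[OF yH(1) g] by auto
  have 1: "pa ?p (cm u f x) = cm (u *** v) (pa ?p' f) (pa ?p x)"
    using pbA_mult[OF S(1), of x _ _ "pa u f"] uf xH pbA_comp[of ?p u f] pbA_comp[of "u *** v" ?p' f] S yH homA[OF _ f]
    by (simp add: cmp_def)
  have 2: "pa ?q (cm v g y) = cm (u *** v) (pa ?q' g) (pa ?q y)"
    using pbA_mult[OF S(2), of y _ _ "pa v g"] vg yH pbA_comp[of ?q v g] pbA_comp[of "u *** v" ?q' g] S xH homA[OF _ g]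
    by (simp add: cmp_def)
  have pf: "pa ?p' f \<in> hm (Trg (u *** v)) (pb ?p' X) (pb ?p' X')"
    and qg: "pa ?q' g \<in> hm (Trg (u *** v)) (pb ?q' Y) (pb ?q' Y')"
    using pbA_in[OF S(3), of f] pbA_in[OF S(4), of g] f g by simp_all
  show ?thesis unfolding exH_def 1 2 using ten_post[OF prj1_H[OF x yH(1)] prj2_H[OF y xH(1)] pf qg] by (simp add: exA_def)
qed

lemma exA_iso:
  assumes f: "f \<in> hm A X X'" "isoin A f" and g: "g \<in> hm B Y Y'" "isoin B g" and S: "small_cat A" "small_cat B"
  shows "exA A B f g \<in> hm (A ** B) (exO A B X Y) (exO A B X' Y')" "isoin (A ** B) (exA A B f g)"
  unfolding exA_def exO_def
  using tA_in[of "A ** B", OF _ pbA_in'[of "prj1 A B" _ A f] pbA_in'[of "prj2 A B" _ B g]]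
    tA_iso[of "A ** B", OF _ pbA_in'[of "prj1 A B" _ A f] _ pbA_in'[of "prj2 A B" _ B g]]
    pbA_iso[of "prj1 A B" f] pbA_iso[of "prj2 A B" g] assms by simp_all

text \<open>For the chosen extension this is the cocontinuity axiom read through
  \<open>lan_transpose_iso\<close>. Another opcartesian arrow differs by an isomorphism
  \<open>k\<close>, and the external product of \<open>k\<close> with an identity is again
  invertible.\<close>

lemma exH_left:
  assumes x: "opc D u P X x" and C: "small_cat C" and Y: "Y \<in> ob C"
  shows "opc D (u *** id_f C) (exO (Src u) C P Y) (exO (Trg u) C X Y) (exH u (id_f C) X Y x (idt C Y))"
proof -
  note xH = HD[OF opcD[OF x]]
  interpret C: category "DC D C" using C by simp
  let ?W = "FObj (lan D u) P" and ?e = "Cpt (lan_unit D u) P"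
  have e: "opc D u P ?W ?e" using lan_opc xH by simp
  have iY: "idt C Y \<in> H D (id_f C) Y Y" using H_id C.id_in[OF Y] C by simp
  have ex: "exH u (id_f C) ?W Y ?e (idt C Y)
    = ext_mu D M u (id_f C) ?W Y \<cdot>[Src u ** C] FArr (ext_prod D M (Src u) C) (?e, idt C Y)"
    using xH C HD[OF opcD[OF e]] C.homD(1)[OF C.id_in[OF Y]] by (simp add: exH_def ten_def ext_mu_def ext_prod_simps exA_def)
  have H1: "exH u (id_f C) ?W Y ?e (idt C Y) \<in> H D (u *** id_f C) (exO (Src u) C P Y) (exO (Trg u) C ?W Y)"
    using exH_in[OF opcD[OF e] iY] by simp
  have o: "opc D (u *** id_f C) (exO (Src u) C P Y) (exO (Trg u) C ?W Y) (exH u (id_f C) ?W Y ?e (idt C Y))"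
    using cocont_left[OF xH(1) C xH(4) Y] lan_transpose_iso[OF H1] ex xH C Y HD[OF opcD[OF e]]
    by (simp add: cocont_left_def Let_def ext_prod_simps)
  obtain k where k: "k \<in> hm (Trg u) ?W X" "cm u k ?e = x" using opc_ex[OF e opcD[OF x]] by metis
  then have ki: "isoin (Trg u) k" using opc_iso_post[OF e k(1)] x by simp
  have SS: "small_cat (Trg u)" using xH by simp
  note kk = exA_iso[OF k(1) ki C.id_in[OF Y] C.iso_id[OF Y] SS C]
  have "exH u (id_f C) X Y x (idt C Y) = cm (u *** id_f C) (exA (Trg u) C k (idt C Y)) (exH u (id_f C) ?W Y ?e (idt C Y))"
    using exH_post[OF opcD[OF e] iY k(1), of "idt C Y" Y] k C.id_in[OF Y] C.idl[OF C.id_in[OF Y]] C C.homD(1)[OF C.id_in[OF Y]] by simp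
  then show ?thesis using opc_iso_post[OF o, of "exA (Trg u) C k (idt C Y)"] kk by simp
qed

lemma exH_right:
  assumes y: "opc D v Q Y y" and A: "small_cat A" and X: "X \<in> ob A"
  shows "opc D (id_f A *** v) (exO A (Src v) X Q) (exO A (Trg v) X Y) (exH (id_f A) v X Y (idt A X) y)"
proof -
  note yH = HD[OF opcD[OF y]]
  interpret A: category "DC D A" using A by simp
  let ?W = "FObj (lan D v) Q" and ?e = "Cpt (lan_unit D v) Q"
  have e: "opc D v Q ?W ?e" using lan_opc yH by simp
  have iX: "idt A X \<in> H D (id_f A) X X" using H_id A.id_in[OF X] A by simp
  have ex: "exH (id_f A) v X ?W (idt A X) ?e
    = ext_mu D M (id_f A) v X ?W \<cdot>[A ** Src v] FArr (ext_prod D M A (Src v)) (idt A X, ?e)"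
    using yH A HD[OF opcD[OF e]] A.homD(1)[OF A.id_in[OF X]] by (simp add: exH_def ten_def ext_mu_def ext_prod_simps exA_def)
  have H1: "exH (id_f A) v X ?W (idt A X) ?e \<in> H D (id_f A *** v) (exO A (Src v) X Q) (exO A (Trg v) X ?W)"
    using exH_in[OF iX opcD[OF e]] by simp
  have o: "opc D (id_f A *** v) (exO A (Src v) X Q) (exO A (Trg v) X ?W) (exH (id_f A) v X ?W (idt A X) ?e)"
    using cocont_right[OF A yH(1) X yH(4)] lan_transpose_iso[OF H1] ex yH A X HD[OF opcD[OF e]]
    by (simp add: cocont_right_def Let_def ext_prod_simps)
  obtain k where k: "k \<in> hm (Trg v) ?W Y" "cm v k ?e = y" using opc_ex[OF e opcD[OF y]] by metis
  then have ki: "isoin (Trg v) k" using opc_iso_post[OF e k(1)] y by simp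
  have SS: "small_cat (Trg v)" using yH by simp
  note kk = exA_iso[OF A.id_in[OF X] A.iso_id[OF X] k(1) ki A SS]
  have "exH (id_f A) v X Y (idt A X) y = cm (id_f A *** v) (exA A (Trg v) (idt A X) k) (exH (id_f A) v X ?W (idt A X) ?e)"
    using exH_post[OF iX opcD[OF e] _ k(1), of "idt A X" X] k A.id_in[OF X] A.idl[OF A.id_in[OF X]] A A.homD(1)[OF A.id_in[OF X]] by simp
  then show ?thesis using opc_iso_post[OF o, of "exA A (Trg v) (idt A X) k"] kk by simp
qed

text \<open>Factor through the external product of \<open>P\<close> and \<open>Y\<close>: first
  extend in the second variable, then in the first, and use that opcartesian arrows compose.\<close>

theorem exH_opc:
  assumes x: "opc D u P X x" and y: "opc D v Q Y y"
  shows "opc D (u *** v) (exO (Src u) (Src v) P Q) (exO (Trg u) (Trg v) X Y) (exH u v X Y x y)"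
proof -
  note xH = HD[OF opcD[OF x]] and yH = HD[OF opcD[OF y]]
  let ?A = "Src u" and ?B = "Src v" and ?I = "Trg u" and ?J = "Trg v"
  have S: "small_cat ?A" "small_cat ?B" "small_cat ?I" "small_cat ?J" using xH yH by simp_all
  let ?r = "exH (id_f ?A) v P Y (idt ?A P) y" and ?l = "exH u (id_f ?J) X Y x (idt ?J Y)"
  let ?w = "id_f ?A *** v"
  have w: "small_functor ?w" using xH yH by simp
  have iP: "idt ?A P \<in> H D (id_f ?A) P P" "idt ?J Y \<in> H D (id_f ?J) Y Y"
    using H_id category.id_in[OF DC_cat] S xH yH by simp_all
  have comp: "(u *** id_f ?J) oo ?w = u *** v" using xH yH by (simp add: prod_comp_sf)
  have "opc D ((u *** id_f ?J) oo ?w) (exO ?A ?B P Q) (exO ?I ?J X Y) (cm ?w ?l ?r)"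
    by (rule opc_comp[OF exH_right[OF y S(1) xH(4)] exH_left[OF x S(4) yH(2)]]) simp
  \<comment> \<open>By functoriality of the tensor the two factors combine, and the identity legs
    disappear.\<close>
  moreover have "cm ?w ?l ?r = exH u v X Y x y"
  proof -
    have f: "pa (prj1 ?A ?B) (idt ?A P) \<in> H D ?w (pb (prj1 ?A ?B) P) (pb (prj1 ?A ?J) P)"
      and g: "pa (prj2 ?A ?B) y \<in> H D ?w (pb (prj2 ?A ?B) Q) (pb (prj2 ?A ?J) Y)"
      using prj1_H[OF iP(1) yH(1)] prj2_H[OF opcD[OF y], of "id_f ?A"] S by simp_all
    have f': "pa (prj1 ?A ?J) x \<in> H D (u *** id_f ?J) (pb (prj1 ?A ?J) P) (pb (prj1 ?I ?J) X)"
      and g': "pa (prj2 ?A ?J) (idt ?J Y) \<in> H D (u *** id_f ?J) (pb (prj2 ?A ?J) Y) (pb (prj2 ?I ?J) Y)"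
      using prj1_H[OF opcD[OF x], of "id_f ?J"] prj2_H[OF iP(2) xH(1)] S by simp_all
    have "pb (prj1 ?A ?B) P = pb ?w (pb (prj1 ?A ?J) P)"
      using pbO_comp[OF w, of "prj1 ?A ?J" P] S xH yH by simp
    then have 1: "cm ?w (pa (prj1 ?A ?J) x) (pa (prj1 ?A ?B) (idt ?A P)) = pa (prj1 ?A ?B) x"
      using cmp_Idt[OF f' w] S xH yH pbA_comp[OF w, of "prj1 ?A ?J" x] by simp
    have "pa (prj2 ?A ?J) (idt ?J Y) = idt (?A ** ?J) (pb (prj2 ?A ?J) Y)"
      using S yH by simp
    then have 2: "cm ?w (pa (prj2 ?A ?J) (idt ?J Y)) (pa (prj2 ?A ?B) y) = pa (prj2 ?A ?B) y"
      using cmp_crt[OF g] by simp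
    show ?thesis using ten_cmp[OF f g f' g'] 1 2 comp by (simp add: exH_def)
  qed
  ultimately show ?thesis using comp by simp
qed

end

section \<open>The multiplication of generalized elements\<close>

text \<open>A functor \<open>A \<rightarrow> N \<times> I\<close> is kept as its two components,
  since the degree is added under multiplication while the point of \<open>I\<close> is not.\<close>

definition bs :: "'k scat \<Rightarrow> 'k scat \<Rightarrow> 'k sfun \<Rightarrow> 'k sfun \<Rightarrow> bool" where
  "bs A I n i \<longleftrightarrow> small_functor n \<and> small_functor i \<and> Src n = A \<and> Src i = A \<and> Trg n = NN \<and> Trg i = I"

lemma bsD: "bs A I n i \<Longrightarrow> small_functor n" "bs A I n i \<Longrightarrow> small_functor i" "bs A I n i \<Longrightarrow> Src n = A"
  "bs A I n i \<Longrightarrow> Src i = A" "bs A I n i \<Longrightarrow> Trg n = NN" "bs A I n i \<Longrightarrow> Trg i = I"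
  by (simp_all add: bs_def)

lemma bs_small: "bs A I n i \<Longrightarrow> small_cat A" "bs A I n i \<Longrightarrow> small_cat I"
  using small_functor_src[of i] small_functor_trg[of i] by (auto simp: bs_def)

lemma plus_I_simps [simp]: "Src (plus_I K) = (NN ** NN) ** K" "Trg (plus_I K) = NN ** K"
  by (simp_all add: plus_I_def)

lemma (in big) small_plus_I [simp]: "small_cat (K :: 'k scat) \<Longrightarrow> small_functor (plus_I K)"
  by (simp add: plus_I_def)

lemma (in big) plus_I_pair [simp]:
  assumes "small_functor (n :: 'k sfun)" "small_functor m" "small_functor k" "Src m = Src n" "Src k = Src n" "Trg n = NN" "Trg m = NN" "Trg k = K"
  shows "plus_I K oo <|<|n, m|>, k|> = <|nadd n m, k|>"
  using assms small_functor_trg[of k] by (simp add: plus_I_def)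

lemma (in big) bs_nadd: "\<lbrakk>bs (A :: 'k scat) I n i; bs A J m j\<rbrakk> \<Longrightarrow> bs A I (nadd n m) i"
  and bs_comp: "\<lbrakk>bs (A :: 'k scat) I n i; small_functor k; Trg k = A\<rbrakk> \<Longrightarrow> bs (Src k) I (n oo k) (i oo k)"
  by (simp_all add: bs_def)

context mdv
begin

text \<open>Elements over \<open>a\<close> and \<open>b\<close> at the same stage need no
  restriction before being tensored: an arrow to \<open>X\<close> over \<open>a\<close> is also an
  arrow over the pairing to the pulled-back object, with the same underlying arrow.\<close>

definition elt :: "'k sfun \<Rightarrow> 'k sfun \<Rightarrow> 'o \<Rightarrow> 'o \<Rightarrow> 'm \<Rightarrow> 'm \<Rightarrow> 'm" where
  "elt a b X Y x y = ten D M <|a, b|> (pb (prj1 (Trg a) (Trg b)) X) (pb (prj2 (Trg a) (Trg b)) Y) x y"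

lemma H_pair1: "\<lbrakk>x \<in> H D u P X; small_functor v; Src v = Src u; Trg u = B; Trg v = C\<rbrakk>
    \<Longrightarrow> x \<in> H D <|u, v|> P (pb (prj1 B C) X)"
  and H_pair2: "\<lbrakk>x \<in> H D v P X; small_functor u; Src v = Src u; Trg u = B; Trg v = C\<rbrakk>
    \<Longrightarrow> x \<in> H D <|u, v|> P (pb (prj2 B C) X)"
  using H_comp[of "<|u, v|>" "prj1 B C" X x P] H_comp[of "<|u, v|>" "prj2 B C" X x P] HD[of x u P X] HD[of x v P X]
    small_functor_trg[of u] small_functor_trg[of v] by auto

lemma elt_in:
  assumes x: "x \<in> H D a P X" and y: "y \<in> H D b Q Y" and e: "Src b = Src a"
  shows "elt a b X Y x y \<in> H D <|a, b|> (tO (Src a) P Q) (exO (Trg a) (Trg b) X Y)"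
  using ten_in[OF H_pair1[OF x HD(1)[OF y] e] H_pair2[OF y HD(1)[OF x] e]] by (simp add: elt_def exO_def)

lemma elt_pre:
  assumes x: "x \<in> H D a P X" and y: "y \<in> H D b Q Y" and e: "Src b = Src a"
    and f: "f \<in> H D k P' P" and g: "g \<in> H D k Q' Q" and k: "Trg k = Src a"
  shows "elt (a oo k) (b oo k) X Y (cm k x f) (cm k y g) = cm k (elt a b X Y x y) (ten D M k P Q f g)"
  using ten_cmp[OF f g H_pair1[OF x HD(1)[OF y] e] H_pair2[OF y HD(1)[OF x] e]] k HD[OF x] HD[OF y] HD[OF f] e
  by (simp add: elt_def)

lemma elt_post:
  assumes x: "x \<in> H D a P X" and y: "y \<in> H D b Q Y" and e: "Src b = Src a"
    and f: "f \<in> hm (Trg a) X X'" and g: "g \<in> hm (Trg b) Y Y'"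
  shows "elt a b X' Y' (cm a f x) (cm b g y) = cm <|a, b|> (exA (Trg a) (Trg b) f g) (elt a b X Y x y)"
proof -
  note xH = HD[OF x] and yH = HD[OF y]
  let ?p = "prj1 (Trg a) (Trg b)" and ?q = "prj2 (Trg a) (Trg b)"
  have S: "small_functor ?p" "small_functor ?q" "small_functor <|a, b|>" using xH yH e by simp_all
  have 1: "cm <|a, b|> (pa ?p f) x = cm a f x" "cm <|a, b|> (pa ?q g) y = cm b g y"
    using pbA_comp[OF S(3), of ?p f] pbA_comp[OF S(3), of ?q g] S xH yH e homA[OF _ f] homA[OF _ g] by (simp_all add: cmp_def)
  have pf: "pa ?p f \<in> hm (Trg <|a, b|>) (pb ?p X) (pb ?p X')"
    and qg: "pa ?q g \<in> hm (Trg <|a, b|>) (pb ?q Y) (pb ?q Y')"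
    using pbA_in[OF S(1), of f] pbA_in[OF S(2), of g] f g by simp_all
  show ?thesis using ten_post[OF H_pair1[OF x HD(1)[OF y] e] H_pair2[OF y HD(1)[OF x] e] pf qg] 1 by (simp add: elt_def exA_def)
qed

text \<open>Written as a tensor of cartesian arrows, the comparison becomes accessible to
  \<open>ten_cmp\<close>.\<close>

lemma ext_mu_eq:
  assumes "small_functor U" "small_functor V" "X \<in> ob (Trg U)" "Y \<in> ob (Trg V)"
  shows "ext_mu D M U V X Y = ten D M (U *** V) (pb (prj1 (Trg U) (Trg V)) X) (pb (prj2 (Trg U) (Trg V)) Y)
     (idt (Src U ** Src V) (pb (U *** V) (pb (prj1 (Trg U) (Trg V)) X)))
     (idt (Src U ** Src V) (pb (U *** V) (pb (prj2 (Trg U) (Trg V)) Y)))"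
  using assms category.idr[OF DC_cat Mu_in[of "U *** V" "pb (prj1 (Trg U) (Trg V)) X" "pb (prj2 (Trg U) (Trg V)) Y"]]
  by (simp add: ext_mu_def ten_def tA_id)

lemma ext_mu_in:
  assumes "small_functor U" "small_functor V" "X \<in> ob (Trg U)" "Y \<in> ob (Trg V)"
  shows "ext_mu D M U V X Y \<in> hm (Src U ** Src V) (exO (Src U) (Src V) (pb U X) (pb V Y)) (pb (U *** V) (exO (Trg U) (Trg V) X Y))"
    and "isoin (Src U ** Src V) (ext_mu D M U V X Y)"
proof -
  let ?p = "prj1 (Trg U) (Trg V)" and ?q = "prj2 (Trg U) (Trg V)" and ?p' = "prj1 (Src U) (Src V)" and ?q' = "prj2 (Src U) (Src V)"
  have "pb (U *** V) (pb ?p X) = pb ?p' (pb U X)" "pb (U *** V) (pb ?q Y) = pb ?q' (pb V Y)"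
    using assms pbO_comp[of "U *** V" ?p X] pbO_comp[of ?p' U X] pbO_comp[of "U *** V" ?q Y] pbO_comp[of ?q' V Y] by simp_all
  then show "ext_mu D M U V X Y \<in> hm (Src U ** Src V) (exO (Src U) (Src V) (pb U X) (pb V Y)) (pb (U *** V) (exO (Trg U) (Trg V) X Y))"
    and "isoin (Src U ** Src V) (ext_mu D M U V X Y)"
    using Mu_in[of "U *** V" "pb ?p X" "pb ?q Y"] Mu_iso[of "U *** V" "pb ?p X" "pb ?q Y"] assms
    by (simp_all add: ext_mu_def exO_def)
qed

text \<open>The comparison of external products with restriction only re-reads elements of
  \<open>U^* X\<close> and \<open>V^* Y\<close> as elements of \<open>X\<close> and
  \<open>Y\<close>: composing with cartesian arrows keeps the underlying arrows.\<close>

lemma elt_mu: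
  assumes x: "x \<in> H D a P (pb U X)" and y: "y \<in> H D b Q (pb V Y)" and e: "Src b = Src a"
    and U: "small_functor U" "Src U = Trg a" "X \<in> ob (Trg U)" and V: "small_functor V" "Src V = Trg b" "Y \<in> ob (Trg V)"
  shows "cm <|a, b|> (ext_mu D M U V X Y) (elt a b (pb U X) (pb V Y) x y) = elt (U oo a) (V oo b) X Y x y"
proof -
  note xH = HD[OF x] and yH = HD[OF y]
  let ?p = "prj1 (Trg U) (Trg V)" and ?q = "prj2 (Trg U) (Trg V)" and ?p' = "prj1 (Trg a) (Trg b)" and ?q' = "prj2 (Trg a) (Trg b)"
  have S: "small_cat (Trg a)" "small_cat (Trg b)" "small_functor (U *** V)" using xH yH U V by simp_all
  have e1: "pb (U *** V) (pb ?p X) = pb ?p' (pb U X)" "pb (U *** V) (pb ?q Y) = pb ?q' (pb V Y)"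
    using U V S pbO_comp[of "U *** V" ?p X] pbO_comp[of ?p' U X] pbO_comp[of "U *** V" ?q Y] pbO_comp[of ?q' V Y] by simp_all
  have p: "pb ?p X \<in> ob (Trg (U *** V))" "pb ?q Y \<in> ob (Trg (U *** V))" using U V by simp_all
  note x1 = H_pair1[OF x yH(1) e refl refl] and y1 = H_pair2[OF y xH(1) e refl refl]
  have f': "idt (Trg a ** Trg b) (pb (U *** V) (pb ?p X)) \<in> H D (U *** V) (pb ?p' (pb U X)) (pb ?p X)"
    and g': "idt (Trg a ** Trg b) (pb (U *** V) (pb ?q Y)) \<in> H D (U *** V) (pb ?q' (pb V Y)) (pb ?q Y)"
    using crt_in[OF S(3) p(1)] crt_in[OF S(3) p(2)] e1 U V by simp_all
  have c: "cm <|a, b|> (idt (Trg a ** Trg b) (pb (U *** V) (pb ?p X))) x = x"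
    "cm <|a, b|> (idt (Trg a ** Trg b) (pb (U *** V) (pb ?q Y))) y = y"
    using cmp_crt[OF x1] cmp_crt[OF y1] e1 by simp_all
  have "(U *** V) oo <|a, b|> = <|U oo a, V oo b|>" using U V xH yH e by simp
  then show ?thesis using ten_cmp[OF x1 y1 f' g'] c ext_mu_eq[OF U(1) V(1) U(3) V(3)] U(2) V(2) by (simp add: elt_def)
qed

text \<open>The external product with the degrees collected, before they are added;
  \<open>axO\<close> is its left extension along addition and \<open>eta\<close> the universal
  arrow.\<close>

definition axZ :: "'k scat \<Rightarrow> 'k scat \<Rightarrow> 'o \<Rightarrow> 'o \<Rightarrow> 'o" where
  "axZ I J X Y = pb (interchange NN NN I J) (exO (NN ** I) (NN ** J) X Y)"

definition axO :: "'k scat \<Rightarrow> 'k scat \<Rightarrow> 'o \<Rightarrow> 'o \<Rightarrow> 'o" where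
  "axO I J X Y = FObj (lan D (plus_I (I ** J))) (axZ I J X Y)"

definition axA :: "'k scat \<Rightarrow> 'k scat \<Rightarrow> 'm \<Rightarrow> 'm \<Rightarrow> 'm" where
  "axA I J f g = FArr (lan D (plus_I (I ** J))) (pa (interchange NN NN I J) (exA (NN ** I) (NN ** J) f g))"

definition eta :: "'k scat \<Rightarrow> 'k scat \<Rightarrow> 'o \<Rightarrow> 'o \<Rightarrow> 'm" where
  "eta I J X Y = Cpt (lan_unit D (plus_I (I ** J))) (axZ I J X Y)"

text \<open>The product of \<open>x : P \<rightarrow> X\<close> over \<open><|n, i|>\<close> and \<open>y : Q \<rightarrow> Y\<close> over \<open><|m, j|>\<close> lies over \<open><|n + m, <|i, j|>|>\<close>.\<close>

definition mul :: "'k sfun \<Rightarrow> 'k sfun \<Rightarrow> 'k sfun \<Rightarrow> 'k sfun \<Rightarrow> 'o \<Rightarrow> 'o \<Rightarrow> 'm \<Rightarrow> 'm \<Rightarrow> 'm" where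
  "mul i j n m X Y x y = cm <|<|n, m|>, <|i, j|>|> (eta (Trg i) (Trg j) X Y) (elt <|n, i|> <|m, j|> X Y x y)"

lemma exA_in: "\<lbrakk>small_cat A; small_cat B; f \<in> hm A X X'; g \<in> hm B Y Y'\<rbrakk>
    \<Longrightarrow> exA A B f g \<in> hm (A ** B) (exO A B X Y) (exO A B X' Y')"
  unfolding exA_def exO_def by (intro tA_in pbA_in'[of "prj1 A B"] pbA_in'[of "prj2 A B"]) simp_all

lemma exA_Arr: "\<lbrakk>small_cat A; small_cat B; f \<in> ar A; g \<in> ar B\<rbrakk> \<Longrightarrow> exA A B f g \<in> ar (A ** B)"
  using exA_in[of A B f "Dom (DC D A) f" "Cod (DC D A) f" g "Dom (DC D B) g" "Cod (DC D B) g"] by (simp add: hom_def)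

lemma interchange_nat:
  assumes "small_functor (u :: 'k sfun)" "small_functor v"
  shows "((id_f NN *** u) *** (id_f NN *** v)) oo interchange NN NN (Src u) (Src v)
    = interchange NN NN (Trg u) (Trg v) oo (id_f (NN ** NN) *** u *** v)"
  using assms by (intro small_eqI) (auto simp: prod_Obj prod_Arr)

lemma axZ_in [simp]: "\<lbrakk>small_cat I; small_cat J; X \<in> ob (NN ** I); Y \<in> ob (NN ** J)\<rbrakk>
    \<Longrightarrow> axZ I J X Y \<in> ob ((NN ** NN) ** (I ** J))"
  by (simp add: axZ_def)

lemma axO_in [simp]: "\<lbrakk>small_cat I; small_cat J; X \<in> ob (NN ** I); Y \<in> ob (NN ** J)\<rbrakk>
    \<Longrightarrow> axO I J X Y \<in> ob (NN ** (I ** J))"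
  using lan_obj[of "plus_I (I ** J)" "axZ I J X Y"] by (simp add: axO_def)

lemma eta_opc: "\<lbrakk>small_cat I; small_cat J; X \<in> ob (NN ** I); Y \<in> ob (NN ** J)\<rbrakk>
    \<Longrightarrow> opc D (plus_I (I ** J)) (axZ I J X Y) (axO I J X Y) (eta I J X Y)"
  using lan_opc[of "plus_I (I ** J)" "axZ I J X Y"] by (simp add: axO_def eta_def)

lemma affine_ext_prod_simps:
  assumes S: "small_cat I" "small_cat J"
  shows "Src (affine_ext_prod D M I J) = prod_cat (DC D (NN ** I)) (DC D (NN ** J))"
    "Trg (affine_ext_prod D M I J) = DC D (NN ** (I ** J))"
    "\<lbrakk>X \<in> ob (NN ** I); Y \<in> ob (NN ** J)\<rbrakk> \<Longrightarrow> FObj (affine_ext_prod D M I J) (X, Y) = axO I J X Y"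
    "\<lbrakk>f \<in> ar (NN ** I); g \<in> ar (NN ** J)\<rbrakk> \<Longrightarrow> FArr (affine_ext_prod D M I J) (f, g) = axA I J f g"
  using S by (simp_all add: affine_ext_prod_def ext_prod_simps axO_def axA_def axZ_def exA_Arr)

lemma axA_in:
  assumes S: "small_cat I" "small_cat J" and f: "f \<in> hm (NN ** I) X X'" and g: "g \<in> hm (NN ** J) Y Y'"
  shows "axA I J f g \<in> hm (NN ** (I ** J)) (axO I J X Y) (axO I J X' Y')"
    and "cm (plus_I (I ** J)) (axA I J f g) (eta I J X Y)
      = eta I J X' Y' \<cdot>[(NN ** NN) ** (I ** J)] pa (interchange NN NN I J) (exA (NN ** I) (NN ** J) f g)"
proof -
  have z: "pa (interchange NN NN I J) (exA (NN ** I) (NN ** J) f g) \<in> hm (Src (plus_I (I ** J))) (axZ I J X Y) (axZ I J X' Y')"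
    unfolding axZ_def by (rule pbA_in'[OF _ _ _ exA_in[OF _ _ f g]]) (use S in simp_all)
  show "axA I J f g \<in> hm (NN ** (I ** J)) (axO I J X Y) (axO I J X' Y')"
    and "cm (plus_I (I ** J)) (axA I J f g) (eta I J X Y)
      = eta I J X' Y' \<cdot>[(NN ** NN) ** (I ** J)] pa (interchange NN NN I J) (exA (NN ** I) (NN ** J) f g)"
    using lan_arr[OF _ z] S by (simp_all add: axA_def axO_def eta_def)
qed

context
  fixes A I J :: "'k scat" and n m i j :: "'k sfun"
  assumes b: "bs A I n i" "bs A J m j"
begin

lemma sm: "small_functor n" "small_functor i" "small_functor m" "small_functor j" "Src n = A" "Src i = A" "Src m = A" "Src j = A"
  "Trg n = NN" "Trg m = NN" "Trg i = I" "Trg j = J" "small_cat A" "small_cat I" "small_cat J"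
  using bsD[OF b(1)] bsD[OF b(2)] bs_small[OF b(1)] bs_small[OF b(2)] by auto

lemma elt_in_c:
  assumes x: "x \<in> H D <|n, i|> P X" and y: "y \<in> H D <|m, j|> Q Y"
  shows "elt <|n, i|> <|m, j|> X Y x y \<in> H D <|<|n, m|>, <|i, j|>|> (tO A P Q) (axZ I J X Y)"
  unfolding axZ_def using elt_in[OF x y] H_comp[of "<|<|n, m|>, <|i, j|>|>" "interchange NN NN I J" "exO (NN ** I) (NN ** J) X Y"]
    HD[OF x] HD[OF y] sm by simp

lemma mul_in:
  assumes x: "x \<in> H D <|n, i|> P X" and y: "y \<in> H D <|m, j|> Q Y"
  shows "mul i j n m X Y x y \<in> H D <|nadd n m, <|i, j|>|> (tO A P Q) (axO I J X Y)"
  unfolding mul_def using cmp_in[OF elt_in_c[OF x y] opcD[OF eta_opc]] HD[OF x] HD[OF y] sm by simp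

text \<open>Naturality in the stage. The product of the restricted elements is the product composed
  with \<open>ten\<close> of the restricting arrows; \<open>ten\<close> involves \<open>Mu\<close>,
  and hence strict restriction is not preserved.\<close>

lemma mul_pre:
  assumes x: "x \<in> H D <|n, i|> P X" and y: "y \<in> H D <|m, j|> Q Y" and f: "f \<in> H D k P' P" and g: "g \<in> H D k Q' Q" and k: "Trg k = A"
  shows "mul (i oo k) (j oo k) (n oo k) (m oo k) X Y (cm k x f) (cm k y g) = cm k (mul i j n m X Y x y) (ten D M k P Q f g)"
proof -
  have k': "small_functor k" using HD[OF f] by simp
  have XY: "X \<in> ob (NN ** I)" "Y \<in> ob (NN ** J)" using HD[OF x] HD[OF y] sm by simp_all
  have "elt (<|n, i|> oo k) (<|m, j|> oo k) X Y (cm k x f) (cm k y g) = cm k (elt <|n, i|> <|m, j|> X Y x y) (ten D M k P Q f g)"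
    using elt_pre[OF x y _ f g] k sm by simp
  then have e: "elt <|n oo k, i oo k|> <|m oo k, j oo k|> X Y (cm k x f) (cm k y g) = cm k (elt <|n, i|> <|m, j|> X Y x y) (ten D M k P Q f g)"
    using sm k k' by simp
  have t: "ten D M k P Q f g \<in> H D k (tO (Src k) P' Q') (tO A P Q)" using ten_in[OF f g] k by simp
  show ?thesis unfolding mul_def e
    using cmp_assoc[OF t elt_in_c[OF x y] opcD[OF eta_opc[OF sm(14,15) XY]]] sm k k' by simp
qed

text \<open>Naturality in \<open>X\<close> and \<open>Y\<close>: the extended arrow
  \<open>axA\<close> is moved past \<open>eta\<close> by its defining equation, and then past the
  tensor of the elements.\<close>

lemma mul_post:
  assumes x: "x \<in> H D <|n, i|> P X" and y: "y \<in> H D <|m, j|> Q Y" and f: "f \<in> hm (NN ** I) X X'" and g: "g \<in> hm (NN ** J) Y Y'"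
  shows "cm <|nadd n m, <|i, j|>|> (axA I J f g) (mul i j n m X Y x y) = mul i j n m X' Y' (cm <|n, i|> f x) (cm <|m, j|> g y)"
proof -
  let ?c = "<|<|n, m|>, <|i, j|>|>" and ?P = "plus_I (I ** J)" and ?s = "interchange NN NN I J" and ?t = "elt <|n, i|> <|m, j|> X Y x y"
  have NS: "small_cat (NN ** I)" "small_cat (NN ** J)" using sm by simp_all
  note fo = homO[OF NS(1) f] and go = homO[OF NS(2) g]
  note t = elt_in_c[OF x y]
  have e: "opc D ?P (axZ I J X Y) (axO I J X Y) (eta I J X Y)" "opc D ?P (axZ I J X' Y') (axO I J X' Y') (eta I J X' Y')"
    using eta_opc sm fo go by simp_all
  note a = axA_in[OF sm(14,15) f g]
  have xx: "exA (NN ** I) (NN ** J) f g \<in> hm ((NN ** I) ** (NN ** J)) (exO (NN ** I) (NN ** J) X Y) (exO (NN ** I) (NN ** J) X' Y')"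
    using exA_in[OF NS f g] .
  have z: "pa ?s (exA (NN ** I) (NN ** J) f g) \<in> hm (Trg ?c) (axZ I J X Y) (axZ I J X' Y')"
    unfolding axZ_def by (rule pbA_in'[OF _ _ _ xx]) (use sm in simp_all)
  have c: "small_functor ?c" using sm by simp
  have "cm <|nadd n m, <|i, j|>|> (axA I J f g) (mul i j n m X Y x y) = cm ?c (cm ?P (axA I J f g) (eta I J X Y)) ?t"
    using cmp_assoc[OF t opcD[OF e(1)], of "axA I J f g" "id_f (NN ** (I ** J))" "axO I J X' Y'"] a(1) sm H_id by (simp add: mul_def)
  also have "\<dots> = cm ?c (eta I J X' Y') (cm ?c (pa ?s (exA (NN ** I) (NN ** J) f g)) ?t)"
    using a(2) cmp_assoc_v[OF t z opcD[OF e(2)]] sm by simp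
  also have "cm ?c (pa ?s (exA (NN ** I) (NN ** J) f g)) ?t = cm <|<|n, i|>, <|m, j|>|> (exA (NN ** I) (NN ** J) f g) ?t"
    using pbA_comp[OF c, of ?s "exA (NN ** I) (NN ** J) f g"] homA[OF _ xx] sm by (simp add: cmp_def)
  also have "\<dots> = elt <|n, i|> <|m, j|> X' Y' (cm <|n, i|> f x) (cm <|m, j|> g y)"
    using elt_post[OF x y] f g sm by simp
  finally show ?thesis using sm by (simp add: mul_def)
qed

end

text \<open>The arrow that \<open>affine_ext_mu\<close> is adjoint to.\<close>

definition preaem :: "'k sfun \<Rightarrow> 'k sfun \<Rightarrow> 'o \<Rightarrow> 'o \<Rightarrow> 'm" where
  "preaem u v X Y = pa (id_f (NN ** NN) *** u *** v) (eta (Trg u) (Trg v) X Y)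
      \<cdot>[(NN ** NN) ** Src u ** Src v]
      pa (interchange NN NN (Src u) (Src v)) (ext_mu D M (id_f NN *** u) (id_f NN *** v) X Y)"

lemma aem_eq:
  assumes "small_functor u" "small_functor v" "X \<in> ob (NN ** Trg u)" "Y \<in> ob (NN ** Trg v)"
  shows "affine_ext_mu D M u v X Y = lan_transpose D (plus_I (Src u ** Src v)) (pb (id_f NN *** u *** v) (axO (Trg u) (Trg v) X Y)) (preaem u v X Y)"
  using assms by (simp add: affine_ext_mu_def Let_def preaem_def axO_def axZ_def eta_def ext_prod_simps)

text \<open>Base change along \<open>u \<times> v\<close> keeps \<open>eta\<close> opcartesian, and
  the remaining factor is a restriction of the isomorphism \<open>ext_mu\<close>. This is what makes
  \<open>affine_ext_mu\<close> invertible.\<close>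

lemma preaem_opc:
  assumes u: "small_functor u" and v: "small_functor v" and X: "X \<in> ob (NN ** Trg u)" and Y: "Y \<in> ob (NN ** Trg v)"
  shows "opc D (plus_I (Src u ** Src v)) (axZ (Src u) (Src v) (pb (id_f NN *** u) X) (pb (id_f NN *** v) Y))
    (pb (id_f NN *** u *** v) (axO (Trg u) (Trg v) X Y)) (preaem u v X Y)"
proof -
  let ?w = "id_f (NN ** NN) *** u *** v" and ?s = "interchange NN NN (Src u) (Src v)" and ?s' = "interchange NN NN (Trg u) (Trg v)"
  let ?U = "id_f NN *** u" and ?V = "id_f NN *** v" and ?ex = "exO (NN ** Trg u) (NN ** Trg v) X Y"
  have S: "small_cat (Src u)" "small_cat (Src v)" "small_cat (Trg u)" "small_cat (Trg v)" using u v by simp_all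
  have 1: "opc D (plus_I (Src u ** Src v)) (pb ?w (axZ (Trg u) (Trg v) X Y)) (pb (id_f NN *** u *** v) (axO (Trg u) (Trg v) X Y))
      (pa ?w (eta (Trg u) (Trg v) X Y))"
    using product_base_change[of plus_f "u *** v" "axZ (Trg u) (Trg v) X Y" "axO (Trg u) (Trg v) X Y" "eta (Trg u) (Trg v) X Y"]
      eta_opc[OF S(3,4) X Y] u v by (simp add: plus_I_def)
  have m: "ext_mu D M ?U ?V X Y \<in> hm ((NN ** Src u) ** (NN ** Src v)) (exO (NN ** Src u) (NN ** Src v) (pb ?U X) (pb ?V Y)) (pb (?U *** ?V) ?ex)"
    "isoin ((NN ** Src u) ** (NN ** Src v)) (ext_mu D M ?U ?V X Y)"
    using ext_mu_in[of ?U ?V X Y] u v X Y by simp_all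
  have fe: "(?U *** ?V) oo ?s = ?s' oo ?w"
    using interchange_nat[OF u v] .
  have "pb ?s (pb (?U *** ?V) ?ex) = pb ?w (axZ (Trg u) (Trg v) X Y)"
    using pbO_comp[of ?s "?U *** ?V" ?ex] pbO_comp[of ?w ?s' ?ex] fe u v S X Y by (simp add: axZ_def)
  then have h: "pa ?s (ext_mu D M ?U ?V X Y) \<in> hm ((NN ** NN) ** Src u ** Src v)
      (axZ (Src u) (Src v) (pb ?U X) (pb ?V Y)) (pb ?w (axZ (Trg u) (Trg v) X Y))"
    using pbA_in'[OF _ _ _ m(1), of ?s] S by (simp add: axZ_def)
  have i: "isoin ((NN ** NN) ** Src u ** Src v) (pa ?s (ext_mu D M ?U ?V X Y))"
    using pbA_iso[of ?s] m(2) S by simp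
  show ?thesis using opc_pre[OF 1] h i by (simp add: preaem_def)
qed

lemma aem:
  assumes u: "small_functor u" and v: "small_functor v" and X: "X \<in> ob (NN ** Trg u)" and Y: "Y \<in> ob (NN ** Trg v)"
  shows "affine_ext_mu D M u v X Y \<in> hm (NN ** (Src u ** Src v))
      (axO (Src u) (Src v) (pb (id_f NN *** u) X) (pb (id_f NN *** v) Y)) (pb (id_f NN *** u *** v) (axO (Trg u) (Trg v) X Y))"
    and "isoin (NN ** (Src u ** Src v)) (affine_ext_mu D M u v X Y)"
    and "cm (plus_I (Src u ** Src v)) (affine_ext_mu D M u v X Y) (eta (Src u) (Src v) (pb (id_f NN *** u) X) (pb (id_f NN *** v) Y)) = preaem u v X Y"
  using lan_transpose[OF opcD[OF preaem_opc[OF assms]]] lan_transpose_iso[OF opcD[OF preaem_opc[OF assms]]] preaem_opc[OF assms]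
  by (simp_all add: aem_eq[OF assms] axO_def eta_def)

text \<open>The comparison carries the product of elements of the restricted objects to the product
  of the same arrows read as elements of \<open>X\<close> and \<open>Y\<close>. Through this rule
  the comparison is handled without computing it.\<close>

lemma mul_mu:
  assumes b: "bs A I n i" "bs A J m j" and u: "small_functor u" "Src u = I" and v: "small_functor v" "Src v = J"
    and X: "X \<in> ob (NN ** Trg u)" and Y: "Y \<in> ob (NN ** Trg v)"
    and x: "x \<in> H D <|n, i|> P (pb (id_f NN *** u) X)" and y: "y \<in> H D <|m, j|> Q (pb (id_f NN *** v) Y)"
  shows "cm <|nadd n m, <|i, j|>|> (affine_ext_mu D M u v X Y) (mul i j n m (pb (id_f NN *** u) X) (pb (id_f NN *** v) Y) x y)
    = mul (u oo i) (v oo j) n m X Y x y"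
proof -
  note sm = sm[OF b]
  let ?U = "id_f NN *** u" and ?V = "id_f NN *** v" and ?c = "<|<|n, m|>, <|i, j|>|>" and ?P = "plus_I (I ** J)" and ?s = "interchange NN NN I J"
    and ?w = "id_f (NN ** NN) *** u *** v"
  let ?t = "elt <|n, i|> <|m, j|> (pb ?U X) (pb ?V Y) x y" and ?M = "ext_mu D M ?U ?V X Y" and ?e = "eta (Trg u) (Trg v) X Y"
  note aem = aem[OF u(1) v(1) X Y, unfolded u(2) v(2)]
  note t = elt_in_c[OF b x y]
  have UX: "pb ?U X \<in> ob (NN ** I)" "pb ?V Y \<in> ob (NN ** J)" using u v X Y by simp_all
  note e = eta_opc[OF sm(14,15) UX]
  have c: "small_functor ?c" "small_functor ?w" "small_functor ?s" using sm u v by simp_all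
  have S: "small_cat (Trg u)" "small_cat (Trg v)" using u v by simp_all
  have m: "?M \<in> hm ((NN ** I) ** (NN ** J)) (exO (NN ** I) (NN ** J) (pb ?U X) (pb ?V Y)) (pb (?U *** ?V) (exO (NN ** Trg u) (NN ** Trg v) X Y))"
    using ext_mu_in(1)[of ?U ?V X Y] u v X Y by simp
  have ms: "pa ?s ?M \<in> hm (Trg ?c) (axZ I J (pb ?U X) (pb ?V Y)) (pb ?s (pb (?U *** ?V) (exO (NN ** Trg u) (NN ** Trg v) X Y)))"
    unfolding axZ_def by (rule pbA_in'[OF _ _ _ m]) (use sm in simp_all)
  have fe: "(?U *** ?V) oo ?s = interchange NN NN (Trg u) (Trg v) oo ?w"
    using interchange_nat[OF u(1) v(1)] u(2) v(2) by simp
  have Z: "pb ?s (pb (?U *** ?V) (exO (NN ** Trg u) (NN ** Trg v) X Y)) = pb ?w (axZ (Trg u) (Trg v) X Y)"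
    using pbO_comp[of ?s "?U *** ?V" "exO (NN ** Trg u) (NN ** Trg v) X Y"] pbO_comp[of ?w "interchange NN NN (Trg u) (Trg v)" "exO (NN ** Trg u) (NN ** Trg v) X Y"]
      fe u v sm S X Y by (simp add: axZ_def)
  note e' = eta_opc[OF S X Y]
  have we: "pa ?w ?e \<in> H D (plus_I (I ** J)) (pb ?w (axZ (Trg u) (Trg v) X Y)) (pb (id_f NN *** u *** v) (axO (Trg u) (Trg v) X Y))"
    using pb_H[OF opcD[OF e'] c(2), of "id_f NN *** u *** v" "plus_I (I ** J)"] u v sm S by (simp add: plus_I_def prod_comp_sf)
  have aH: "affine_ext_mu D M u v X Y \<in> H D (id_f (NN ** (I ** J))) (axO I J (pb ?U X) (pb ?V Y)) (pb (id_f NN *** u *** v) (axO (Trg u) (Trg v) X Y))"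
    using aem(1) H_id sm by simp
  have "cm <|nadd n m, <|i, j|>|> (affine_ext_mu D M u v X Y) (mul i j n m (pb ?U X) (pb ?V Y) x y)
    = cm ?c (preaem u v X Y) ?t"
    using cmp_assoc[OF t opcD[OF e] aH] aem(3) sm by (simp add: mul_def)
  also have "\<dots> = cm ?c (pa ?w ?e) (cm ?c (pa ?s ?M) ?t)"
    unfolding preaem_def u(2) v(2) using cmp_assoc_v[OF t ms[unfolded Z] we] sm by simp
  also have "cm ?c (pa ?s ?M) ?t = cm <|<|n, i|>, <|m, j|>|> ?M ?t"
    using pbA_comp[OF c(1), of ?s ?M] homA[OF _ m] sm by (simp add: cmp_def)
  also have "\<dots> = elt (?U oo <|n, i|>) (?V oo <|m, j|>) X Y x y"
    using elt_mu[OF x y] u v sm X Y by simp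
  also have "\<dots> = elt <|n, u oo i|> <|m, v oo j|> X Y x y" using u v sm by simp
  also have "cm ?c (pa ?w ?e) (elt <|n, u oo i|> <|m, v oo j|> X Y x y) = cm (?w oo ?c) ?e (elt <|n, u oo i|> <|m, v oo j|> X Y x y)"
    using pbA_comp[OF c(1,2), of ?e] HD(5)[OF opcD[OF e']] sm u v S by (simp add: cmp_def)
  also have "\<dots> = mul (u oo i) (v oo j) n m X Y x y" using sm u v S by (simp add: mul_def)
  finally show ?thesis .
qed

subsection \<open>Products of opcartesian elements\<close>

lemma interchange_inverse: "\<lbrakk>small_cat A; small_cat B; small_cat C; small_cat E\<rbrakk>
    \<Longrightarrow> interchange A C B E oo interchange A B C E = id_f ((A ** B) ** (C ** (E :: 'k scat)))"
  by (rule small_eqI) (auto simp: prod_Obj prod_Arr)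

text \<open>The external product of the two arrows is opcartesian, the reordering is an isomorphism,
  and \<open>eta\<close> is opcartesian; their composite is the multiplication of the two arrows
  restricted to the product of the stages.\<close>

theorem mul_opc_ext:
  assumes x: "opc D a P X x" and y: "opc D b Q Y y" and a: "Trg a = NN ** I" and b: "Trg b = NN ** J" and S: "small_cat I" "small_cat J"
  defines "p \<equiv> prj1 (Src a) (Src b)" and "q \<equiv> prj2 (Src a) (Src b)"
  shows "opc D <|nadd (prj1 NN I oo a oo p) (prj1 NN J oo b oo q), <|prj2 NN I oo a oo p, prj2 NN J oo b oo q|>|>
    (exO (Src a) (Src b) P Q) (axO I J X Y)
    (mul (prj2 NN I oo a oo p) (prj2 NN J oo b oo q) (prj1 NN I oo a oo p) (prj1 NN J oo b oo q) X Y (pa p x) (pa q y))"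
proof -
  note xH = HD[OF opcD[OF x]] and yH = HD[OF opcD[OF y]]
  let ?t = "interchange NN I NN J" and ?s = "interchange NN NN I J" and ?E = "exO (NN ** I) (NN ** J) X Y"
  have XY: "X \<in> ob (NN ** I)" "Y \<in> ob (NN ** J)" using xH yH a b by simp_all
  have E: "?E \<in> ob ((NN ** I) ** (NN ** J))" using XY S by simp
  have ts: "?t oo ?s = id_f ((NN ** NN) ** (I ** J))" "?s oo ?t = id_f ((NN ** I) ** (NN ** J))"
    using interchange_inverse[of NN NN I J] interchange_inverse[of NN I NN J] S by simp_all
  have tZ: "pb ?t (axZ I J X Y) = ?E" using pbO_comp[of ?t ?s ?E] ts E S by (simp add: axZ_def)
  \<comment> \<open>The reordering is traversed from the grouped product to the one with degrees
    collected, so the opcartesian identity arrow lies over \<open>?t\<close>, the inverse of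
    \<open>?s\<close>.\<close>
  have t: "opc D ?t ?E (axZ I J X Y) (idt ((NN ** I) ** (NN ** J)) ?E)"
    using opc_iso_functor[of ?t ?s "axZ I J X Y"] ts tZ S XY by simp
  note e = eta_opc[OF S XY]
  have te: "opc D (plus_I (I ** J) oo ?t) ?E (axO I J X Y) (pa ?t (eta I J X Y))"
    using opc_comp[OF t e] cmp_Idt[OF opcD[OF e], of ?t] tZ S by simp
  have ex: "opc D (a *** b) (exO (Src a) (Src b) P Q) ?E (exH a b X Y x y)" using exH_opc[OF x y] a b by simp
  have 1: "opc D ((plus_I (I ** J) oo ?t) oo (a *** b)) (exO (Src a) (Src b) P Q) (axO I J X Y) (cm (a *** b) (pa ?t (eta I J X Y)) (exH a b X Y x y))"
    using opc_comp[OF ex te] S a b by simp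
  let ?n = "prj1 NN I oo a oo p" and ?m = "prj1 NN J oo b oo q" and ?i = "prj2 NN I oo a oo p" and ?j = "prj2 NN J oo b oo q"
  have sp: "small_functor p" "small_functor q" "Src p = Src a ** Src b" "Src q = Src a ** Src b" "Trg p = Src a" "Trg q = Src b"
    using xH yH by (simp_all add: p_def q_def)
  \<comment> \<open>Splitting \<open>a\<close> and \<open>b\<close> into degree and parameter brings
    the base into the form required by \<open>mul\<close>.\<close>
  have ni: "<|?n, ?i|> = a oo p" "<|?m, ?j|> = b oo q"
    using pair_eta[of "a oo p" NN I] pair_eta[of "b oo q" NN J] sp a b S xH yH by simp_all
  have ab: "a *** b = <|<|?n, ?i|>, <|?m, ?j|>|>" using ni xH yH by (simp add: prod_sf_eq p_def q_def)
  have sab: "small_functor (a *** b)" using xH yH by simp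
  have c: "?t oo (a *** b) = <|<|?n, ?m|>, <|?i, ?j|>|>" unfolding ab using sp xH yH a b S by simp
  have base: "(plus_I (I ** J) oo ?t) oo (a *** b) = <|nadd ?n ?m, <|?i, ?j|>|>"
  proof -
    have "(plus_I (I ** J) oo ?t) oo (a *** b) = plus_I (I ** J) oo (?t oo (a *** b))" using sab S a b by simp
    then show ?thesis unfolding c using sp xH yH a b S by simp
  qed
  have "exH a b X Y x y = elt <|?n, ?i|> <|?m, ?j|> X Y (pa p x) (pa q y)"
    unfolding exH_def elt_def ab[symmetric] p_def[symmetric] q_def[symmetric] using a b S by simp
  moreover have "cm (a *** b) (pa ?t (eta I J X Y)) z = cm <|<|?n, ?m|>, <|?i, ?j|>|> (eta I J X Y) z" for z
    using pbA_comp[OF sab, of ?t "eta I J X Y"] c HD(5)[OF opcD[OF e]] S a b sp xH by (simp add: cmp_def)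
  moreover have "Trg ?i = I" "Trg ?j = J" by simp_all
  ultimately show ?thesis using 1 unfolding base mul_def by simp
qed

end

section \<open>The internal product and its universal elements\<close>

lemma diag_apply [simp]: "x \<in> Obj A \<Longrightarrow> FObj (diag A) x = Pr x x" "f \<in> Arr A \<Longrightarrow> FArr (diag A) f = Pr f f"
  by (simp_all add: diag_def)

lemma (in big) pair_prod_id: "\<lbrakk>small_functor (n :: 'k sfun); small_cat I; Src n = B\<rbrakk> \<Longrightarrow> n *** id_f I = <|n oo prj1 B I, prj2 B I|>"
  using small_functor_src[of n] by (simp add: prod_sf_eq)

context mdv
begin

definition dd :: "'k scat \<Rightarrow> 'k sfun" where "dd I = id_f NN *** diag I"

definition ito :: "'k scat \<Rightarrow> 'o \<Rightarrow> 'o \<Rightarrow> 'o" where "ito I X Y = pb (dd I) (axO I I X Y)"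

definition ita :: "'k scat \<Rightarrow> 'm \<Rightarrow> 'm \<Rightarrow> 'm" where "ita I f g = pa (dd I) (axA I I f g)"

definition iMu :: "'k sfun \<Rightarrow> 'o \<Rightarrow> 'o \<Rightarrow> 'm" where "iMu u X Y = pa (dd (Src u)) (affine_ext_mu D M u u X Y)"

abbreviation mm :: "'k sfun \<Rightarrow> 'k sfun \<Rightarrow> 'k sfun \<Rightarrow> 'o \<Rightarrow> 'o \<Rightarrow> 'm \<Rightarrow> 'm \<Rightarrow> 'm" where
  "mm i n m X Y x y \<equiv> mul i i n m X Y x y"

text \<open>A generalized element \<open>x\<close> of \<open>X \<in> D (N \<times> I)\<close> with stage \<open>A\<close> and domain \<open>P \<in> D A\<close>. The internal product
  of elements over \<open><|n, i|>\<close> and \<open><|m, i|>\<close> has the underlying arrow of \<open>mul\<close>, restricted along the diagonal.\<close>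

definition el :: "'k scat \<Rightarrow> 'k scat \<Rightarrow> 'k sfun \<Rightarrow> 'k sfun \<Rightarrow> 'o \<Rightarrow> 'o \<Rightarrow> 'm \<Rightarrow> bool" where
  "el A I n i P X x \<longleftrightarrow> bs A I n i \<and> x \<in> H D <|n, i|> P X"

lemma dd_simps [simp]: "Src (dd I) = NN ** I" "Trg (dd I) = NN ** (I ** I)" "small_cat I \<Longrightarrow> small_functor (dd I)"
  by (simp_all add: dd_def)

lemma dd_pair [simp]: "bs A I n i \<Longrightarrow> dd I oo <|n, i|> = <|n, <|i, i|>|>"
  using bs_small[of A I n i] by (simp add: bs_def dd_def)

lemma dd_nat: "small_functor u \<Longrightarrow> (id_f NN *** u *** u) oo dd (Src u) = dd (Trg u) oo (id_f NN *** u)"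
  by (intro small_eqI) (auto simp: dd_def prod_Obj prod_Arr)

lemma ito_in [simp]: "\<lbrakk>small_cat I; X \<in> ob (NN ** I); Y \<in> ob (NN ** I)\<rbrakk> \<Longrightarrow> ito I X Y \<in> ob (NN ** I)"
  by (simp add: ito_def)

lemma ita_in: "\<lbrakk>small_cat I; f \<in> hm (NN ** I) X X'; g \<in> hm (NN ** I) Y Y'\<rbrakk>
    \<Longrightarrow> ita I f g \<in> hm (NN ** I) (ito I X Y) (ito I X' Y')"
  unfolding ita_def ito_def by (rule pbA_in'[OF _ _ _ axA_in(1)]) simp_all

text \<open>This lets internal products be computed by \<open>mul\<close>: restricting along the
  diagonal and then along the base of an element is restricting along the base with its parameter
  doubled.\<close>

lemma cmp_dd:
  assumes b: "bs A I n i" and h: "h \<in> ar (NN ** (I ** I))"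
  shows "cm <|n, i|> (pa (dd I) h) z = cm <|n, <|i, i|>|> h z"
  using pbA_comp[of "<|n, i|>" "dd I" h] dd_pair[OF b] bsD[OF b] bs_small[OF b] h by (simp add: cmp_def)

lemma elD: assumes "el A I n i P X x"
  shows "bs A I n i" "x \<in> H D <|n, i|> P X" "small_functor n" "small_functor i" "Src n = A" "Src i = A" "Trg n = NN" "Trg i = I"
    "small_cat A" "small_cat I" "X \<in> ob (NN ** I)" "P \<in> ob A"
  using assms bsD[of A I n i] bs_small[of A I n i] HD[of x "<|n, i|>" P X] unfolding el_def by auto

lemma elI: "\<lbrakk>bs A I n i; x \<in> H D <|n, i|> P X\<rbrakk> \<Longrightarrow> el A I n i P X x"
  by (simp add: el_def)

lemma el_mul:
  assumes x: "el A I n i P X x" and y: "el A I m i Q Y y"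
  shows "el A I (nadd n m) i (tO A P Q) (ito I X Y) (mm i n m X Y x y)"
proof (rule elI)
  note x' = elD[OF x] and y' = elD[OF y]
  show b: "bs A I (nadd n m) i" using bs_nadd x' y' by blast
  show "mm i n m X Y x y \<in> H D <|nadd n m, i|> (tO A P Q) (ito I X Y)"
    unfolding ito_def using mul_in[OF x'(1) y'(1) x'(2) y'(2)] H_comp[of "<|nadd n m, i|>" "dd I" "axO I I X Y"] dd_pair[OF b] x' y' by simp
qed

lemma el_cmp: "\<lbrakk>el A I n i P X x; h \<in> hm (NN ** I) X X'\<rbrakk> \<Longrightarrow> el A I n i P X' (cm <|n, i|> h x)"
  using cmp_in_v[of x "<|n, i|>" P X h X'] elD[of A I n i P X x] by (intro elI) simp_all

lemma el_pre: "\<lbrakk>el A I n i P X x; k \<in> hm A P' P\<rbrakk> \<Longrightarrow> el A I n i P' X (x \<cdot>[A] k)"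
  using H_pre[of x "<|n, i|>" P X k P'] elD[of A I n i P X x] by (intro elI) simp_all

lemma el_base: "\<lbrakk>el A I n i P (pb (id_f NN *** u) X) x; small_functor u; Src u = I; X \<in> ob (NN ** Trg u)\<rbrakk>
    \<Longrightarrow> el A (Trg u) n (u oo i) P X x"
  using H_comp[of "<|n, i|>" "id_f NN *** u" X x P] elD[of A I n i P "pb (id_f NN *** u) X" x]
  by (intro elI) (simp_all add: bs_def)

lemma mm_pre:
  assumes x: "el A I n i P X x" and y: "el A I m i Q Y y" and f: "f \<in> H D k P' P" and g: "g \<in> H D k Q' Q" and k: "Trg k = A"
  shows "mm (i oo k) (n oo k) (m oo k) X Y (cm k x f) (cm k y g) = cm k (mm i n m X Y x y) (ten D M k P Q f g)"
  using mul_pre[OF elD(1)[OF x] elD(1)[OF y] elD(2)[OF x] elD(2)[OF y] f g k] .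

lemma mm_pre_v:
  assumes x: "el A I n i P X x" and y: "el A I m i Q Y y" and f: "f \<in> hm A P' P" and g: "g \<in> hm A Q' Q"
  shows "mm i n m X Y (x \<cdot>[A] f) (y \<cdot>[A] g) = mm i n m X Y x y \<cdot>[A] tA A f g"
proof -
  note x' = elD[OF x] and y' = elD[OF y]
  have "f \<in> H D (id_f A) P' P" "g \<in> H D (id_f A) Q' Q" using f g H_id x' by simp_all
  from mm_pre[OF x y this] show ?thesis
    using x' y' ten_id[OF x'(9) f g] HD(5)[OF x'(2)] HD(5)[OF y'(2)] HD(5)[OF elD(2)[OF el_mul[OF x y]]] by simp
qed

lemma mm_post:
  assumes x: "el A I n i P X x" and y: "el A I m i Q Y y" and f: "f \<in> hm (NN ** I) X X'" and g: "g \<in> hm (NN ** I) Y Y'"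
  shows "cm <|nadd n m, i|> (ita I f g) (mm i n m X Y x y) = mm i n m X' Y' (cm <|n, i|> f x) (cm <|m, i|> g y)"
proof -
  note x' = elD[OF x] and y' = elD[OF y]
  have "axA I I f g \<in> ar (NN ** (I ** I))" using homA[OF _ axA_in(1)[OF x'(10) x'(10) f g]] x' by simp
  then show ?thesis unfolding ita_def using cmp_dd[OF elD(1)[OF el_mul[OF x y]]] mul_post[OF x'(1) y'(1) x'(2) y'(2) f g] by simp
qed

lemma iMu_in:
  assumes u: "small_functor u" and X: "X \<in> ob (NN ** Trg u)" and Y: "Y \<in> ob (NN ** Trg u)"
  shows "iMu u X Y \<in> hm (NN ** Src u) (ito (Src u) (pb (id_f NN *** u) X) (pb (id_f NN *** u) Y)) (pb (id_f NN *** u) (ito (Trg u) X Y))"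
    and "isoin (NN ** Src u) (iMu u X Y)"
proof -
  note a = aem[OF u u X Y]
  have S: "small_cat (Src u)" "small_cat (Trg u)" using u by simp_all
  have "pb (dd (Src u)) (pb (id_f NN *** u *** u) (axO (Trg u) (Trg u) X Y)) = pb (id_f NN *** u) (ito (Trg u) X Y)"
    using pbO_comp[of "dd (Src u)" "id_f NN *** u *** u" "axO (Trg u) (Trg u) X Y"] pbO_comp[of "id_f NN *** u" "dd (Trg u)" "axO (Trg u) (Trg u) X Y"]
      dd_nat[OF u] u S X Y by (simp add: ito_def)
  then show "iMu u X Y \<in> hm (NN ** Src u) (ito (Src u) (pb (id_f NN *** u) X) (pb (id_f NN *** u) Y)) (pb (id_f NN *** u) (ito (Trg u) X Y))"
    using pbA_in'[OF _ _ _ a(1), of "dd (Src u)" "NN ** Src u"] S by (simp add: iMu_def ito_def)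
  show "isoin (NN ** Src u) (iMu u X Y)"
    using pbA_iso[of "dd (Src u)"] a(2) S by (simp add: iMu_def)
qed

lemma mm_mu:
  assumes x: "el A I n i P (pb (id_f NN *** u) X) x" and y: "el A I m i Q (pb (id_f NN *** u) Y) y" and u: "small_functor u" "Src u = I"
    and X: "X \<in> ob (NN ** Trg u)" and Y: "Y \<in> ob (NN ** Trg u)"
  shows "cm <|nadd n m, i|> (iMu u X Y) (mm i n m (pb (id_f NN *** u) X) (pb (id_f NN *** u) Y) x y) = mm (u oo i) n m X Y x y"
proof -
  note x' = elD[OF x] and y' = elD[OF y]
  have "affine_ext_mu D M u u X Y \<in> ar (NN ** (I ** I))" using homA[OF _ aem(1)[OF u(1) u(1) X Y]] x' u by simp
  then show ?thesis unfolding iMu_def using cmp_dd[OF elD(1)[OF el_mul[OF x y]]] mul_mu[OF x'(1) y'(1) u u X Y x'(2) y'(2)] u by simp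
qed

subsection \<open>Base change of elements up to isomorphism\<close>

text \<open>\<open>x'\<close> is the restriction of \<open>x\<close> along \<open>r\<close>, up to an isomorphism \<open>P' \<cong> r\<^sup>* P\<close> of domains; products of strict
  restrictions are restrictions only in this weaker sense.\<close>

definition ipb :: "'k sfun \<Rightarrow> 'o \<Rightarrow> 'm \<Rightarrow> 'o \<Rightarrow> 'm \<Rightarrow> bool" where
  "ipb r P x P' x' \<longleftrightarrow> (\<exists>k. k \<in> H D r P' P \<and> isoin (Src r) k \<and> x' = cm r x k)"

text \<open>The domain isomorphisms of the two factors are combined by \<open>ten\<close>, which is
  again invertible because \<open>Mu\<close> is.\<close>

lemma ipb_mul:
  assumes x: "el A I n i P X x" and y: "el A I m i Q Y y" and r: "Trg r = A" and px: "ipb r P x P' x'" and py: "ipb r Q y Q' y'"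
  shows "ipb r (tO A P Q) (mm i n m X Y x y) (tO (Src r) P' Q') (mm (i oo r) (n oo r) (m oo r) X Y x' y')"
proof -
  obtain k l where k: "k \<in> H D r P' P" "isoin (Src r) k" "x' = cm r x k"
    and l: "l \<in> H D r Q' Q" "isoin (Src r) l" "y' = cm r y l" using px py unfolding ipb_def by blast
  show ?thesis unfolding ipb_def using mm_pre[OF x y k(1) l(1) r] ten_in[OF k(1) l(1)] ten_iso[OF k(1,2) l(1,2)] k(3) l(3) r by auto
qed

lemma ipb_crt:
  assumes "small_functor u" "small_functor r" "Trg r = Src u" "X \<in> ob (Trg u)"
  shows "ipb r (pb u X) (idt (Src u) (pb u X)) (pb (u oo r) X) (idt (Src r) (pb (u oo r) X))"
proof -
  interpret R: category "DC D (Src r)" using assms by simp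
  have X: "pb r (pb u X) \<in> ob (Src r)" "pb u X \<in> ob (Trg r)" using assms by simp_all
  have "cm r (idt (Src u) (pb u X)) (idt (Src r) (pb r (pb u X))) = idt (Src r) (pb r (pb u X))"
    using cmp_crt[OF crt_in[OF assms(2) X(2) refl]] assms(3) by simp
  then show ?thesis unfolding ipb_def using crt_in[OF assms(2) X(2) refl] R.iso_id[OF X(1)] assms by auto
qed

text \<open>A change of stage along an isomorphism prepends an opcartesian arrow and an isomorphism
  of domains. It serves to regroup products of copies of \<open>NN\<close>.\<close>

lemma ipb_opc_iso:
  assumes f: "opc D u P Z f" and p: "ipb r P f P' f'" and r: "small_functor r" "small_functor r'" "Trg r = Src r'" "Trg r' = Src r"
    "r' oo r = id_f (Src r)" "r oo r' = id_f (Src r')" and e: "Src u = Trg r"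
  shows "opc D (u oo r) P' Z f'"
proof -
  obtain k where k: "k \<in> H D r P' P" "isoin (Src r) k" "f' = cm r f k" using p unfolding ipb_def by blast
  note kH = HD[OF k(1)]
  have "opc D r P' P (idt (Src r) (pb r P) \<cdot>[Src r] k)"
    by (rule opc_pre[OF opc_iso_functor[OF r kH(2)] kH(3) k(2)])
  then have "opc D r P' P k" using category.idl[OF DC_cat kH(3)] r by simp
  from opc_comp[OF this f e] show ?thesis using k(3) by simp
qed

text \<open>Opcartesian elements \<open>x\<close> over \<open>n \<times> 1 : B \<times> I \<rightarrow> N \<times> I\<close>: these generate \<open>X\<close>, in that arrows out of \<open>X\<close> correspond
  to elements over \<open>n \<times> 1\<close>.\<close>

definition uni :: "'k scat \<Rightarrow> 'k scat \<Rightarrow> 'k sfun \<Rightarrow> 'o \<Rightarrow> 'o \<Rightarrow> 'm \<Rightarrow> bool" where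
  "uni B I n P X x \<longleftrightarrow> small_functor n \<and> Src n = B \<and> Trg n = NN \<and> small_cat I \<and> opc D <|n oo prj1 B I, prj2 B I|> P X x"

lemma uniD:
  assumes "uni B I n P X x"
  shows "small_functor n" "Src n = B" "Trg n = NN" "small_cat I" "small_cat B" "opc D <|n oo prj1 B I, prj2 B I|> P X x"
    "el (B ** I) I (n oo prj1 B I) (prj2 B I) P X x"
proof -
  show "small_functor n" "Src n = B" "Trg n = NN" "small_cat I" and o: "opc D <|n oo prj1 B I, prj2 B I|> P X x"
    using assms by (simp_all add: uni_def)
  then show "small_cat B" using small_functor_src by blast
  then show "el (B ** I) I (n oo prj1 B I) (prj2 B I) P X x" using opcD[OF o] assms by (simp add: el_def bs_def uni_def)
qed

lemma uni_eq:
  assumes "uni B I n P X x" "h \<in> hm (NN ** I) X V" "h' \<in> hm (NN ** I) X V"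
    "cm <|n oo prj1 B I, prj2 B I|> h x = cm <|n oo prj1 B I, prj2 B I|> h' x"
  shows "h = h'"
  using opc_eq[OF uniD(6)[OF assms(1)], of h V h'] assms(2-4) uniD(3)[OF assms(1)] by simp

text \<open>The external product of generating elements is opcartesian over a functor of the form
  \<open>N \<times> 1\<close> on \<open>I ** I\<close>. Base change along the diagonal of
  \<open>I\<close> makes it an internal product, and the isomorphisms in \<open>px\<close> and
  \<open>py\<close> adjust its domain.\<close>

theorem uni_mul:
  assumes x: "uni B I n P X x" and y: "uni C I m Q Y y"
    and px: "ipb <|prj1 B C oo prj1 (B ** C) I, prj2 (B ** C) I|> P x P' x'"
    and py: "ipb <|prj2 B C oo prj1 (B ** C) I, prj2 (B ** C) I|> Q y Q' y'"
  shows "uni (B ** C) I (nadd (n oo prj1 B C) (m oo prj2 B C)) (tO ((B ** C) ** I) P' Q') (ito I X Y)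
    (mm (prj2 (B ** C) I) (n oo (prj1 B C oo prj1 (B ** C) I)) (m oo (prj2 B C oo prj1 (B ** C) I)) X Y x' y')"
proof -
  note x0 = uniD[OF x] and y0 = uniD[OF y]
  note S = x0(4,5) y0(5)
  let ?a = "n *** id_f I" and ?b = "m *** id_f I" and ?A = "(B ** I) ** (C ** I)" and ?BC = "B ** C"
  let ?p = "prj1 (B ** I) (C ** I)" and ?q = "prj2 (B ** I) (C ** I)"
  let ?n = "n oo (prj1 B I oo ?p)" and ?m = "m oo (prj1 C I oo ?q)" and ?i = "prj2 B I oo ?p" and ?j = "prj2 C I oo ?q"
  let ?N = "nadd (n oo prj1 B C) (m oo prj2 B C)" and ?g = "interchange B C I I"
  let ?f = "mul ?i ?j ?n ?m X Y (pa ?p x) (pa ?q y)"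
  let ?E = "exO (B ** I) (C ** I) P Q"
  have xo: "opc D ?a P X x" "opc D ?b Q Y y" using x0 y0 pair_prod_id[of n I B] pair_prod_id[of m I C] by simp_all
  note xH = HD[OF opcD[OF xo(1)]] and yH = HD[OF opcD[OF xo(2)]]
  have N: "small_functor ?N" "Src ?N = ?BC" "Trg ?N = NN" using x0 y0 by simp_all
  have fo: "opc D <|nadd ?n ?m, <|?i, ?j|>|> ?E (axO I I X Y) ?f"
    using mul_opc_ext[OF xo, of I I] x0 y0 by simp
  note fH = HD[OF opcD[OF fo]]
  have gi: "interchange B I C I oo ?g = id_f (?BC ** (I ** I))" "?g oo interchange B I C I = id_f ?A"
    using interchange_inverse[of B C I I] interchange_inverse[of B I C I] S by simp_all
  have E: "?E \<in> ob (Trg ?g)" using fH(4) x0 y0 by simp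
  have go: "opc D ?g (pb ?g ?E) ?E (idt (Src ?g) (pb ?g ?E))"
    using opc_iso_functor[of ?g "interchange B I C I" ?E] gi S E by simp
  have base: "<|nadd ?n ?m, <|?i, ?j|>|> oo ?g = ?N *** id_f (I ** I)"
  proof -
    have "<|prj1 I I oo prj2 ?BC (I ** I), prj2 I I oo prj2 ?BC (I ** I)|> = prj2 ?BC (I ** I)"
      by (rule pair_eta) (use S in simp_all)
    then show ?thesis using x0 y0 by (simp add: interchange_eq[of B C I I] prod_sf_eq)
  qed
  \<comment> \<open>After reordering, the base is a degree functor times the identity of
    \<open>I ** I\<close>, which is the form required by \<open>product_base_change\<close>.\<close>
  have go2: "opc D (?N *** id_f (Trg (diag I))) (pb ?g ?E) (axO I I X Y) (pa ?g ?f)"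
    using opc_comp[OF go fo] cmp_Idt[OF opcD[OF fo], of ?g] base x0 y0 by simp
  let ?d = "id_f ?BC *** diag I"
  have o3: "opc D (?N *** id_f I) (pb ?d (pb ?g ?E)) (ito I X Y) (pa ?d (pa ?g ?f))"
    using product_base_change[OF N(1) small_diag[OF S(1)] go2] N by (simp add: ito_def dd_def)
  let ?r1 = "<|prj1 B C oo prj1 ?BC I, prj2 ?BC I|>" and ?r2 = "<|prj2 B C oo prj1 ?BC I, prj2 ?BC I|>"
  \<comment> \<open>Reordering after the diagonal repeats the parameter: both factors see their own
    degree stage and the same point of \<open>I\<close>.\<close>
  have dg: "?g oo ?d = <|?r1, ?r2|>"
    using S by (intro small_eqI) (auto simp: prod_Obj prod_Arr)
  let ?w = "<|?r1, ?r2|>"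
  have sw: "small_functor ?w" "Src ?w = ?BC ** I" "Trg ?w = ?A" "small_functor ?d" "small_functor ?g" using S by simp_all
  have o4: "opc D (?N *** id_f I) (pb ?w ?E) (ito I X Y) (pa ?w ?f)"
    using o3 dg pbO_comp[of ?d ?g ?E] pbA_comp[of ?d ?g ?f] sw E fH(5) S x0 y0 by simp
  obtain k l where k: "k \<in> H D ?r1 P' P" "isoin (?BC ** I) k" "x' = cm ?r1 x k"
    and l: "l \<in> H D ?r2 Q' Q" "isoin (?BC ** I) l" "y' = cm ?r2 y l" using px py S unfolding ipb_def by auto
  have PQ: "P \<in> ob (B ** I)" "Q \<in> ob (C ** I)" using xH yH x0 y0 by simp_all
  have kw: "k \<in> H D ?w P' (pb ?p P)" and lw: "l \<in> H D ?w Q' (pb ?q Q)"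
    using H_comp[of ?w ?p P k P'] H_comp[of ?w ?q Q l Q'] k(1) l(1) S PQ by simp_all
  note t = ten_in[OF kw lw] and ti = ten_iso[OF kw _ lw]
  have "x \<in> H D ?a P X" "y \<in> H D ?b Q Y" using opcD xo by blast+
  then have px': "pa ?p x \<in> H D <|?n, ?i|> (pb ?p P) X" and qy': "pa ?q y \<in> H D <|?m, ?j|> (pb ?q Q) Y"
    using pb_H[of x ?a P X ?p "id_f (NN ** I)" "?a oo ?p"] pb_H[of y ?b Q Y ?q "id_f (NN ** I)" "?b oo ?q"] x0 y0 xH(2) yH(2)
    by (simp_all add: prod_sf_eq)
  have b: "bs ?A I ?n ?i" "bs ?A I ?m ?j" using x0 y0 by (simp_all add: bs_def)
  have c1: "cm ?w (pa ?p x) k = x'" "cm ?w (pa ?q y) l = y'"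
    using pbA_comp[of ?w ?p x] pbA_comp[of ?w ?q y] sw S xH(5) yH(5) x0 y0 k(3) l(3) by (simp_all add: cmp_def)
  \<comment> \<open>The prescribed restrictions \<open>x'\<close> and \<open>y'\<close> differ from
    the strict ones by \<open>k\<close> and \<open>l\<close>, so their product differs by the
    invertible \<open>ten\<close> of the two.\<close>
  have "mul (?i oo ?w) (?j oo ?w) (?n oo ?w) (?m oo ?w) X Y x' y' = cm ?w ?f (ten D M ?w (pb ?p P) (pb ?q Q) k l)"
    using mul_pre[OF b px' qy' kw lw] c1 by simp
  moreover have "opc D (?N *** id_f I) (tO (?BC ** I) P' Q') (ito I X Y) (cm ?w ?f (ten D M ?w (pb ?p P) (pb ?q Q) k l))"
  proof -
    have "ten D M ?w (pb ?p P) (pb ?q Q) k l \<in> hm (?BC ** I) (tO (?BC ** I) P' Q') (pb ?w ?E)"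
      using HD(3)[OF t] S by (simp add: exO_def)
    moreover have "isoin (?BC ** I) (ten D M ?w (pb ?p P) (pb ?q Q) k l)" using ti k(2) l(2) by simp
    ultimately show ?thesis using opc_pre[OF o4, of "ten D M ?w (pb ?p P) (pb ?q Q) k l"] N S by (simp add: cmp_def)
  qed
  ultimately have "opc D (?N *** id_f I) (tO (?BC ** I) P' Q') (ito I X Y)
     (mm (prj2 ?BC I) (n oo (prj1 B C oo prj1 ?BC I)) (m oo (prj2 B C oo prj1 ?BC I)) X Y x' y')"
    using S x0 y0 by simp
  then show ?thesis unfolding uni_def using N S pair_prod_id[OF N(1) S(1) N(2)] by simp
qed

subsection \<open>Universal elements\<close>

text \<open>The tautological element of \<open>X\<close> over \<open><|n, i|>\<close>: its domain is
  the restriction of \<open>X\<close>, and \<open>ue\<close> is the cartesian arrow.\<close>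

definition uo :: "'k sfun \<Rightarrow> 'k sfun \<Rightarrow> 'o \<Rightarrow> 'o" where "uo n i X = pb <|n, i|> X"

definition ue :: "'k sfun \<Rightarrow> 'k sfun \<Rightarrow> 'o \<Rightarrow> 'm" where "ue n i X = idt (Src i) (uo n i X)"

lemma ue_el: "\<lbrakk>bs A I n i; X \<in> ob (NN ** I)\<rbrakk> \<Longrightarrow> el A I n i (uo n i X) X (ue n i X)"
  unfolding ue_def uo_def using crt_in[of "<|n, i|>" X A] bsD[of A I n i] by (intro elI) simp_all

lemma ue_ipb: "\<lbrakk>bs A I n i; X \<in> ob (NN ** I); small_functor r; Trg r = A\<rbrakk>
    \<Longrightarrow> ipb r (uo n i X) (ue n i X) (uo (n oo r) (i oo r) X) (ue (n oo r) (i oo r) X)"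
  using ipb_crt[of "<|n, i|>" r X] bsD[of A I n i] by (simp add: uo_def ue_def)

text \<open>A Yoneda argument: an element over a base factoring through \<open>c\<close> is the
  tautological element composed over \<open>c\<close> with that very arrow.\<close>

lemma ue_crt:
  assumes b: "bs A I n i" and x: "x \<in> H D <|n oo c, i oo c|> P X" and c: "small_functor c" "Trg c = A" and X: "X \<in> ob (NN ** I)"
  shows "x \<in> H D c P (uo n i X)" "cm c (ue n i X) x = x"
proof -
  note b' = bsD[OF b] and b'' = bs_small[OF b]
  show 1: "x \<in> H D c P (uo n i X)" using x H_comp[of c "<|n, i|>" X x P] b' b'' c X by (simp add: uo_def)
  show "cm c (ue n i X) x = x" unfolding ue_def using cmp_crt[OF 1] b' c by simp
qed

text \<open>For the identity degree the base is the identity of \<open>NN ** I\<close>, so the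
  tautological element is an identity arrow and every object generates itself.\<close>

lemma uni_ue: "\<lbrakk>small_cat I; X \<in> ob (NN ** I)\<rbrakk> \<Longrightarrow> uni NN I (id_f NN) X X (ue (prj1 NN I) (prj2 NN I) X)"
  unfolding uni_def ue_def uo_def
  using opc_iso_id[of "NN ** I" "idt (NN ** I) X" X X] category.id_in[OF DC_cat, of "NN ** I" X]
    category.iso_id[OF DC_cat, of "NN ** I" X] by simp

lemma uni_ue_ipb:
  assumes "small_cat I" "X \<in> ob (NN ** I)" "bs A I n i"
  shows "ipb <|n, i|> X (ue (prj1 NN I) (prj2 NN I) X) (uo n i X) (ue n i X)"
  using ue_ipb[of "NN ** I" I "prj1 NN I" "prj2 NN I" X "<|n, i|>"] assms bsD[OF assms(3)]
  by (simp add: bs_def uo_def)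

end

section \<open>Generating elements of iterated products\<close>

context mdv
begin

abbreviation hN :: "'k scat \<Rightarrow> 'o \<Rightarrow> 'o \<Rightarrow> 'm set" where "hN I X Y \<equiv> hm (NN ** I) X Y"

text \<open>Two independent degrees and one point of \<open>I\<close> form the stage; the product of
  the tautological elements for the two degree projections generates the tensor.\<close>

lemma uni2:
  assumes I: "small_cat I" and X: "X \<in> ob (NN ** I)" and Y: "Y \<in> ob (NN ** I)"
  defines "A \<equiv> NN ** NN"
  defines "n \<equiv> prj1 NN NN oo prj1 A I" and "m \<equiv> prj2 NN NN oo prj1 A I" and "i \<equiv> prj2 A I"
  shows "uni A I (nadd (prj1 NN NN) (prj2 NN NN)) (tO (A ** I) (uo n i X) (uo m i Y)) (ito I X Y) (mm i n m X Y (ue n i X) (ue m i Y))"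
    and "bs (A ** I) I n i" "bs (A ** I) I m i"
proof -
  show b: "bs (A ** I) I n i" "bs (A ** I) I m i" using I by (simp_all add: bs_def A_def n_def m_def i_def)
  show "uni A I (nadd (prj1 NN NN) (prj2 NN NN)) (tO (A ** I) (uo n i X) (uo m i Y)) (ito I X Y) (mm i n m X Y (ue n i X) (ue m i Y))"
    using uni_mul[OF uni_ue[OF I X] uni_ue[OF I Y], of "uo n i X" "ue n i X" "uo m i Y" "ue m i Y"]
      uni_ue_ipb[OF I X b(1)] uni_ue_ipb[OF I Y b(2)] I by (simp add: A_def n_def m_def i_def)
qed

lemma uni3:
  assumes I: "small_cat I" and X: "X \<in> ob (NN ** I)" and Y: "Y \<in> ob (NN ** I)" and Z: "Z \<in> ob (NN ** I)"
  defines "A \<equiv> (NN ** NN) ** NN"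
  defines "n \<equiv> prj1 NN NN oo (prj1 (NN ** NN) NN oo prj1 A I)" and "m \<equiv> prj2 NN NN oo (prj1 (NN ** NN) NN oo prj1 A I)"
    and "l \<equiv> prj2 (NN ** NN) NN oo prj1 A I" and "i \<equiv> prj2 A I"
  shows "uni A I (nadd (nadd (prj1 NN NN) (prj2 NN NN) oo prj1 (NN ** NN) NN) (prj2 (NN ** NN) NN))
      (tO (A ** I) (tO (A ** I) (uo n i X) (uo m i Y)) (uo l i Z)) (ito I (ito I X Y) Z)
      (mm i (nadd n m) l (ito I X Y) Z (mm i n m X Y (ue n i X) (ue m i Y)) (ue l i Z))"
    and "bs (A ** I) I n i" "bs (A ** I) I m i" "bs (A ** I) I l i"
proof -
  show b: "bs (A ** I) I n i" "bs (A ** I) I m i" "bs (A ** I) I l i" using I by (simp_all add: bs_def A_def n_def m_def l_def i_def)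
  note u = uni2[OF I X Y]
  let ?B = "NN ** NN"
  let ?n = "prj1 NN NN oo prj1 ?B I" and ?m = "prj2 NN NN oo prj1 ?B I" and ?i = "prj2 ?B I"
  let ?r = "<|prj1 ?B NN oo prj1 A I, prj2 A I|>"
  have "ipb ?r (tO (?B ** I) (uo ?n ?i X) (uo ?m ?i Y)) (mm ?i ?n ?m X Y (ue ?n ?i X) (ue ?m ?i Y))
     (tO (Src ?r) (uo (?n oo ?r) (?i oo ?r) X) (uo (?m oo ?r) (?i oo ?r) Y))
     (mm (?i oo ?r) (?n oo ?r) (?m oo ?r) X Y (ue (?n oo ?r) (?i oo ?r) X) (ue (?m oo ?r) (?i oo ?r) Y))"
    by (rule ipb_mul[OF ue_el[OF u(2) X] ue_el[OF u(3) Y] _ ue_ipb[OF u(2) X] ue_ipb[OF u(3) Y]]) (use I in \<open>simp_all add: A_def\<close>)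
  \<comment> \<open>The binary generator must be restricted to the larger stage before it is
    multiplied by the third element; the restriction is known only up to an isomorphism of
    domains.\<close>
  then have p: "ipb ?r (tO (?B ** I) (uo ?n ?i X) (uo ?m ?i Y)) (mm ?i ?n ?m X Y (ue ?n ?i X) (ue ?m ?i Y))
     (tO (A ** I) (uo n i X) (uo m i Y)) (mm i n m X Y (ue n i X) (ue m i Y))"
    using I by (simp add: A_def n_def m_def i_def)
  show "uni A I (nadd (nadd (prj1 NN NN) (prj2 NN NN) oo prj1 (NN ** NN) NN) (prj2 (NN ** NN) NN))
      (tO (A ** I) (tO (A ** I) (uo n i X) (uo m i Y)) (uo l i Z)) (ito I (ito I X Y) Z)
      (mm i (nadd n m) l (ito I X Y) Z (mm i n m X Y (ue n i X) (ue m i Y)) (ue l i Z))"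
    using uni_mul[OF u(1) uni_ue[OF I Z], of "tO (A ** I) (uo n i X) (uo m i Y)" "mm i n m X Y (ue n i X) (ue m i Y)" "uo l i Z" "ue l i Z"]
      p uni_ue_ipb[OF I Z b(3)] I by (simp add: A_def n_def m_def l_def i_def)
qed

text \<open>The other bracketing, on the stage whose degrees are grouped to the right. It is
  compared with \<open>uni3\<close> by regrouping when the associator is constructed.\<close>

lemma uni3':
  assumes I: "small_cat I" and X: "X \<in> ob (NN ** I)" and Y: "Y \<in> ob (NN ** I)" and Z: "Z \<in> ob (NN ** I)"
  defines "A \<equiv> NN ** (NN ** NN)"
  defines "n \<equiv> prj1 NN (NN ** NN) oo prj1 A I" and "m \<equiv> prj1 NN NN oo (prj2 NN (NN ** NN) oo prj1 A I)"
    and "l \<equiv> prj2 NN NN oo (prj2 NN (NN ** NN) oo prj1 A I)" and "i \<equiv> prj2 A I"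
  shows "uni A I (nadd (prj1 NN (NN ** NN)) (nadd (prj1 NN NN) (prj2 NN NN) oo prj2 NN (NN ** NN)))
      (tO (A ** I) (uo n i X) (tO (A ** I) (uo m i Y) (uo l i Z))) (ito I X (ito I Y Z))
      (mm i n (nadd m l) X (ito I Y Z) (ue n i X) (mm i m l Y Z (ue m i Y) (ue l i Z)))"
    and "bs (A ** I) I n i" "bs (A ** I) I m i" "bs (A ** I) I l i"
proof -
  show b: "bs (A ** I) I n i" "bs (A ** I) I m i" "bs (A ** I) I l i" using I by (simp_all add: bs_def A_def n_def m_def l_def i_def)
  note u = uni2[OF I Y Z]
  let ?B = "NN ** NN"
  let ?n = "prj1 NN NN oo prj1 ?B I" and ?m = "prj2 NN NN oo prj1 ?B I" and ?i = "prj2 ?B I"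
  let ?r = "<|prj2 NN ?B oo prj1 A I, prj2 A I|>"
  have "ipb ?r (tO (?B ** I) (uo ?n ?i Y) (uo ?m ?i Z)) (mm ?i ?n ?m Y Z (ue ?n ?i Y) (ue ?m ?i Z))
     (tO (Src ?r) (uo (?n oo ?r) (?i oo ?r) Y) (uo (?m oo ?r) (?i oo ?r) Z))
     (mm (?i oo ?r) (?n oo ?r) (?m oo ?r) Y Z (ue (?n oo ?r) (?i oo ?r) Y) (ue (?m oo ?r) (?i oo ?r) Z))"
    by (rule ipb_mul[OF ue_el[OF u(2) Y] ue_el[OF u(3) Z] _ ue_ipb[OF u(2) Y] ue_ipb[OF u(3) Z]]) (use I in \<open>simp_all add: A_def\<close>)
  then have p: "ipb ?r (tO (?B ** I) (uo ?n ?i Y) (uo ?m ?i Z)) (mm ?i ?n ?m Y Z (ue ?n ?i Y) (ue ?m ?i Z))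
     (tO (A ** I) (uo m i Y) (uo l i Z)) (mm i m l Y Z (ue m i Y) (ue l i Z))"
    using I by (simp add: A_def m_def l_def i_def)
  show "uni A I (nadd (prj1 NN (NN ** NN)) (nadd (prj1 NN NN) (prj2 NN NN) oo prj2 NN (NN ** NN)))
      (tO (A ** I) (uo n i X) (tO (A ** I) (uo m i Y) (uo l i Z))) (ito I X (ito I Y Z))
      (mm i n (nadd m l) X (ito I Y Z) (ue n i X) (mm i m l Y Z (ue m i Y) (ue l i Z)))"
    using uni_mul[OF uni_ue[OF I X] u(1), of "uo n i X" "ue n i X" "tO (A ** I) (uo m i Y) (uo l i Z)" "mm i m l Y Z (ue m i Y) (ue l i Z)"]
      p uni_ue_ipb[OF I X b(1)] I by (simp add: A_def n_def m_def l_def i_def)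
qed

text \<open>Only the shape of the generator matters for cancellation, so the explicit stage and
  domain are hidden by the \<open>obtains\<close>.\<close>

lemma uni4:
  assumes I: "small_cat I" and W: "W \<in> ob (NN ** I)" and X: "X \<in> ob (NN ** I)" and Y: "Y \<in> ob (NN ** I)" and Z: "Z \<in> ob (NN ** I)"
  obtains A k n m l k' i P where "uni A I k P (ito I (ito I (ito I W X) Y) Z)
      (mm i (nadd (nadd n m) l) k' (ito I (ito I W X) Y) Z (mm i (nadd n m) l (ito I W X) Y (mm i n m W X (ue n i W) (ue m i X)) (ue l i Y)) (ue k' i Z))"
    "bs (A ** I) I n i" "bs (A ** I) I m i" "bs (A ** I) I l i" "bs (A ** I) I k' i"
    "nadd (nadd (nadd n m) l) k' = k oo prj1 A I" "i = prj2 A I"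
proof -
  let ?A3 = "(NN ** NN) ** NN"
  let ?A = "?A3 ** NN"
  note u = uni3[OF I W X Y]
  let ?n3 = "prj1 NN NN oo (prj1 (NN ** NN) NN oo prj1 ?A3 I)" and ?m3 = "prj2 NN NN oo (prj1 (NN ** NN) NN oo prj1 ?A3 I)"
    and ?l3 = "prj2 (NN ** NN) NN oo prj1 ?A3 I" and ?i3 = "prj2 ?A3 I"
  let ?r = "<|prj1 ?A3 NN oo prj1 ?A I, prj2 ?A I|>"
  let ?n = "?n3 oo ?r" and ?m = "?m3 oo ?r" and ?l = "?l3 oo ?r" and ?i = "?i3 oo ?r" and ?k = "prj2 ?A3 NN oo prj1 ?A I"
  have r: "small_functor ?r" "Trg ?r = ?A3 ** I" "Src ?r = ?A ** I" using I by simp_all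
  have b: "bs (?A ** I) I ?n ?i" "bs (?A ** I) I ?m ?i" "bs (?A ** I) I ?l ?i"
    using bs_comp[OF u(2) r(1,2)] bs_comp[OF u(3) r(1,2)] bs_comp[OF u(4) r(1,2)] by (simp_all only: r(3))
  have i: "?i = prj2 ?A I" using I by simp
  have bk: "bs (?A ** I) I ?k ?i" unfolding i using I by (simp add: bs_def)
  note e = ue_el[OF u(2) W] ue_el[OF u(3) X] ue_el[OF u(4) Y]
  have p: "ipb ?r (tO (?A3 ** I) (tO (?A3 ** I) (uo ?n3 ?i3 W) (uo ?m3 ?i3 X)) (uo ?l3 ?i3 Y))
      (mm ?i3 (nadd ?n3 ?m3) ?l3 (ito I W X) Y (mm ?i3 ?n3 ?m3 W X (ue ?n3 ?i3 W) (ue ?m3 ?i3 X)) (ue ?l3 ?i3 Y))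
      (tO (Src ?r) (tO (Src ?r) (uo ?n ?i W) (uo ?m ?i X)) (uo ?l ?i Y))
      (mm ?i (nadd ?n3 ?m3 oo ?r) ?l (ito I W X) Y (mm ?i ?n ?m W X (ue ?n ?i W) (ue ?m ?i X)) (ue ?l ?i Y))"
    by (rule ipb_mul[OF el_mul[OF e(1,2)] e(3) r(2) ipb_mul[OF e(1,2) r(2) ue_ipb[OF u(2) W r(1,2)] ue_ipb[OF u(3) X r(1,2)]] ue_ipb[OF u(4) Y r(1,2)]])
  have nm: "nadd ?n3 ?m3 oo ?r = nadd ?n ?m" using I by simp
  let ?k' = "nadd ((nadd (nadd (prj1 NN NN) (prj2 NN NN) oo prj1 (NN ** NN) NN) (prj2 (NN ** NN) NN)) oo prj1 ?A3 NN) (id_f NN oo prj2 ?A3 NN)"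
  have "ipb <|?k, prj2 ?A I|> Z (ue (prj1 NN I) (prj2 NN I) Z) (uo ?k ?i Z) (ue ?k ?i Z)"
    using uni_ue_ipb[OF I Z bk] unfolding i .
  note uu = uni_mul[OF u(1) uni_ue[OF I Z] p this]
  show thesis
  proof (rule that)
    show "uni ?A I ?k' (tO (?A ** I) (tO (Src ?r) (tO (Src ?r) (uo ?n ?i W) (uo ?m ?i X)) (uo ?l ?i Y)) (uo ?k ?i Z)) (ito I (ito I (ito I W X) Y) Z)
      (mm ?i (nadd (nadd ?n ?m) ?l) ?k (ito I (ito I W X) Y) Z (mm ?i (nadd ?n ?m) ?l (ito I W X) Y (mm ?i ?n ?m W X (ue ?n ?i W) (ue ?m ?i X)) (ue ?l ?i Y)) (ue ?k ?i Z))"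
      using uu I by simp
    show "nadd (nadd (nadd ?n ?m) ?l) ?k = ?k' oo prj1 ?A I" using I by simp
  qed (rule b bk i)+
qed

text \<open>Arrows out of a tensor are separated by one product, that of the tautological elements.
  The hypothesis ranges over all elements so that calculations can be made with variables.\<close>

lemma cancel2:
  assumes I: "small_cat I" and X: "X \<in> ob (NN ** I)" and Y: "Y \<in> ob (NN ** I)"
    and h: "h \<in> hN I (ito I X Y) V" "h' \<in> hN I (ito I X Y) V"
    and eq: "\<And>A n m i P Q x y. \<lbrakk>el A I n i P X x; el A I m i Q Y y\<rbrakk>
      \<Longrightarrow> cm <|nadd n m, i|> h (mm i n m X Y x y) = cm <|nadd n m, i|> h' (mm i n m X Y x y)"
  shows "h = h'"
  by (rule uni_eq[OF uni2(1)[OF I X Y] h]) (use eq[OF ue_el[OF uni2(2)[OF I X Y] X] ue_el[OF uni2(3)[OF I X Y] Y]] I in simp)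

lemma cancel3:
  assumes I: "small_cat I" and X: "X \<in> ob (NN ** I)" and Y: "Y \<in> ob (NN ** I)" and Z: "Z \<in> ob (NN ** I)"
    and h: "h \<in> hN I (ito I (ito I X Y) Z) V" "h' \<in> hN I (ito I (ito I X Y) Z) V"
    and eq: "\<And>A n m l i P Q R x y z. \<lbrakk>el A I n i P X x; el A I m i Q Y y; el A I l i R Z z\<rbrakk>
      \<Longrightarrow> cm <|nadd n (nadd m l), i|> h (mm i (nadd n m) l (ito I X Y) Z (mm i n m X Y x y) z)
        = cm <|nadd n (nadd m l), i|> h' (mm i (nadd n m) l (ito I X Y) Z (mm i n m X Y x y) z)"
  shows "h = h'"
  by (rule uni_eq[OF uni3(1)[OF I X Y Z] h])
    (use eq[OF ue_el[OF uni3(2)[OF I X Y Z] X] ue_el[OF uni3(3)[OF I X Y Z] Y] ue_el[OF uni3(4)[OF I X Y Z] Z]] I in simp)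

lemma cancel4:
  assumes I: "small_cat I" and W: "W \<in> ob (NN ** I)" and X: "X \<in> ob (NN ** I)" and Y: "Y \<in> ob (NN ** I)" and Z: "Z \<in> ob (NN ** I)"
    and h: "h \<in> hN I (ito I (ito I (ito I W X) Y) Z) V" "h' \<in> hN I (ito I (ito I (ito I W X) Y) Z) V"
    and eq: "\<And>A n m l k i U P Q R w x y z. \<lbrakk>el A I n i U W w; el A I m i P X x; el A I l i Q Y y; el A I k i R Z z\<rbrakk>
      \<Longrightarrow> cm <|nadd (nadd (nadd n m) l) k, i|> h (mm i (nadd (nadd n m) l) k (ito I (ito I W X) Y) Z (mm i (nadd n m) l (ito I W X) Y (mm i n m W X w x) y) z)
        = cm <|nadd (nadd (nadd n m) l) k, i|> h' (mm i (nadd (nadd n m) l) k (ito I (ito I W X) Y) Z (mm i (nadd n m) l (ito I W X) Y (mm i n m W X w x) y) z)"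
  shows "h = h'"
proof (rule uni4[OF I W X Y Z])
  fix A k n m l k' i P
  assume u: "uni A I k P (ito I (ito I (ito I W X) Y) Z)
      (mm i (nadd (nadd n m) l) k' (ito I (ito I W X) Y) Z (mm i (nadd n m) l (ito I W X) Y (mm i n m W X (ue n i W) (ue m i X)) (ue l i Y)) (ue k' i Z))"
    and b: "bs (A ** I) I n i" "bs (A ** I) I m i" "bs (A ** I) I l i" "bs (A ** I) I k' i"
    and e: "nadd (nadd (nadd n m) l) k' = k oo prj1 A I" "i = prj2 A I"
  show "h = h'"
    using uni_eq[OF u h] eq[OF ue_el[OF b(1) W] ue_el[OF b(2) X] ue_el[OF b(3) Y] ue_el[OF b(4) Z]] unfolding e(1) e(2) by blast
qed

subsection \<open>The associator\<close>

text \<open>The choice by \<open>SOME\<close> below is unique, as the rule determines the arrow on opcartesian elements.\<close>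

definition asc_rule :: "'k scat \<Rightarrow> 'o \<Rightarrow> 'o \<Rightarrow> 'o \<Rightarrow> 'm \<Rightarrow> bool" where
  "asc_rule I X Y Z a \<longleftrightarrow> a \<in> hN I (ito I (ito I X Y) Z) (ito I X (ito I Y Z)) \<and> isoin (NN ** I) a \<and>
     (\<forall>A n m l i P Q R x y z. el A I n i P X x \<longrightarrow> el A I m i Q Y y \<longrightarrow> el A I l i R Z z \<longrightarrow>
       cm <|nadd n (nadd m l), i|> a (mm i (nadd n m) l (ito I X Y) Z (mm i n m X Y x y) z)
         = mm i n (nadd m l) X (ito I Y Z) x (mm i m l Y Z y z) \<cdot>[A] Asc (MS M A) P Q R)"

text \<open>On tautological elements both bracketings are opcartesian over the same base once the
  fibre associator is inserted, and this induces an invertible \<open>a\<close>. The rule for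
  arbitrary elements follows because they are obtained from the tautological ones by
  composition.\<close>

lemma asc_exists:
  assumes I: "small_cat I" and X: "X \<in> ob (NN ** I)" and Y: "Y \<in> ob (NN ** I)" and Z: "Z \<in> ob (NN ** I)"
  shows "\<exists>a. asc_rule I X Y Z a"
proof -
  \<comment> \<open>The generic stage: three degrees and a point of \<open>I\<close>.\<close>
  define B where "B = ((NN ** NN) ** NN) ** I"
  define n' where "n' = prj1 NN NN oo (prj1 (NN ** NN) NN oo prj1 ((NN ** NN) ** NN) I)"
  define m' where "m' = prj2 NN NN oo (prj1 (NN ** NN) NN oo prj1 ((NN ** NN) ** NN) I)"
  define l' where "l' = prj2 (NN ** NN) NN oo prj1 ((NN ** NN) ** NN) I"
  define i' where "i' = prj2 ((NN ** NN) ** NN) I"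
  note u = uni3[OF I X Y Z, folded n'_def m'_def l'_def i'_def B_def]
  note b = u(2-4)
  note sm = bsD[OF b(1)] bsD[OF b(2)] bsD[OF b(3)]
  have SB: "small_cat B" using I by (simp add: B_def)
  interpret mB: monoidal_category "DC D B" "MS M B" by (rule monoidal[OF SB])
  note ex = ue_el[OF b(1) X] and ey = ue_el[OF b(2) Y] and ez = ue_el[OF b(3) Z]
  let ?xy = "mm i' n' m' X Y (ue n' i' X) (ue m' i' Y)" and ?yz = "mm i' m' l' Y Z (ue m' i' Y) (ue l' i' Z)"
  let ?T = "mm i' (nadd n' m') l' (ito I X Y) Z ?xy (ue l' i' Z)"
  let ?K = "mm i' n' (nadd m' l') X (ito I Y Z) (ue n' i' X) ?yz"
  let ?P = "uo n' i' X" and ?Q = "uo m' i' Y" and ?R = "uo l' i' Z"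
  let ?as = "Asc (MS M B) ?P ?Q ?R"
  let ?base = "<|nadd n' (nadd m' l'), i'|>"
  have T: "opc D ?base (tO B (tO B ?P ?Q) ?R) (ito I (ito I X Y) Z) ?T"
    using uniD(6)[OF u(1)] I by (simp add: n'_def m'_def l'_def i'_def)
  have PQR: "?P \<in> ob B" "?Q \<in> ob B" "?R \<in> ob B" using elD(12)[OF ex] elD(12)[OF ey] elD(12)[OF ez] by simp_all
  \<comment> \<open>The generator for the right bracketing is transported to \<open>B\<close> along
    the isomorphism \<open>?r\<close> that regroups the three degrees.\<close>
  have G0: "opc D ?base (tO B ?P (tO B ?Q ?R)) (ito I X (ito I Y Z)) ?K"
  proof -
    let ?NN2 = "NN ** NN"
    let ?C = "NN ** ?NN2"
    let ?n = "prj1 NN ?NN2 oo prj1 ?C I" and ?m = "prj1 NN NN oo (prj2 NN ?NN2 oo prj1 ?C I)"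
      and ?l = "prj2 NN NN oo (prj2 NN ?NN2 oo prj1 ?C I)" and ?i = "prj2 ?C I"
    note v = uni3'[OF I X Y Z]
    let ?r = "<|<|n', <|m', l'|>|>, i'|>" and ?r' = "<|<|<|?n, ?m|>, ?l|>, ?i|>"
    have r: "small_functor ?r" "small_functor ?r'" "Src ?r = B" "Trg ?r = ?C ** I" "Src ?r' = ?C ** I" "Trg ?r' = B"
      using sm SB I by (simp_all add: B_def)
    have rr: "?r' oo ?r = id_f B" "?r oo ?r' = id_f (?C ** I)"
      unfolding n'_def m'_def l'_def i'_def B_def using I by (intro small_eqI; auto simp: prod_Obj prod_Arr)+
    have e: "?n oo ?r = n'" "?m oo ?r = m'" "?l oo ?r = l'" "?i oo ?r = i'" using sm I by simp_all
    note f = ue_el[OF v(2) X] ue_el[OF v(3) Y] ue_el[OF v(4) Z]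
    have p: "ipb ?r (tO (?C ** I) (uo ?n ?i X) (tO (?C ** I) (uo ?m ?i Y) (uo ?l ?i Z)))
      (mm ?i ?n (nadd ?m ?l) X (ito I Y Z) (ue ?n ?i X) (mm ?i ?m ?l Y Z (ue ?m ?i Y) (ue ?l ?i Z)))
      (tO (Src ?r) (uo (?n oo ?r) (?i oo ?r) X) (tO (Src ?r) (uo (?m oo ?r) (?i oo ?r) Y) (uo (?l oo ?r) (?i oo ?r) Z)))
      (mm (?i oo ?r) (?n oo ?r) (nadd ?m ?l oo ?r) X (ito I Y Z) (ue (?n oo ?r) (?i oo ?r) X)
        (mm (?i oo ?r) (?m oo ?r) (?l oo ?r) Y Z (ue (?m oo ?r) (?i oo ?r) Y) (ue (?l oo ?r) (?i oo ?r) Z)))"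
      by (rule ipb_mul[OF f(1) el_mul[OF f(2,3)] r(4) ue_ipb[OF v(2) X r(1,4)] ipb_mul[OF f(2,3) r(4) ue_ipb[OF v(3) Y r(1,4)] ue_ipb[OF v(4) Z r(1,4)]]])
    have nl: "nadd ?m ?l oo ?r = nadd m' l'" using nadd_comp[of ?m ?l ?r] r e I by simp
    let ?N = "nadd (prj1 NN ?NN2) (nadd (prj1 NN NN) (prj2 NN NN) oo prj2 NN ?NN2)"
    note p = p[unfolded e nl r(3)]
    note o = ipb_opc_iso[OF uniD(6)[OF v(1)] p r(1,2) _ _ _ _]
    have "<|?N oo prj1 ?C I, prj2 ?C I|> oo ?r = ?base" using sm I by simp
    then show ?thesis using o r rr by simp
  qed
  have as: "?as \<in> hm B (tO B (tO B ?P ?Q) ?R) (tO B ?P (tO B ?Q ?R))" "isoin B ?as"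
    using mB.asc_in[OF PQR] mB.asc_iso[OF PQR] by auto
  have base: "Src ?base = B" "Trg ?base = NN ** I" "small_functor ?base" using sm by simp_all
  \<comment> \<open>With the fibre associator in front, the right-bracketed product has the same
    domain and base as \<open>?T\<close>, so the comparison of two opcartesian arrows
    applies.\<close>
  let ?G = "?K \<cdot>[B] ?as"
  have G: "opc D ?base (tO B (tO B ?P ?Q) ?R) (ito I X (ito I Y Z)) ?G"
    using opc_pre[OF G0, unfolded base, OF as] .
  obtain a where a: "a \<in> hN I (ito I (ito I X Y) Z) (ito I X (ito I Y Z))" "cm ?base a ?T = ?G"
    using opc_ex[OF T opcD[OF G]] unfolding base by metis
  have ai: "isoin (NN ** I) a" using opc_iso_post[OF T, unfolded base, OF a(1)] G a(2) by simp
  have "asc_rule I X Y Z a" unfolding asc_rule_def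
  proof (intro conjI allI impI a(1) ai)
    fix A n m l i P Q R x y z
    assume x: "el A I n i P X x" and y: "el A I m i Q Y y" and z: "el A I l i R Z z"
    note x' = elD[OF x] and y' = elD[OF y] and z' = elD[OF z]
    interpret mA: monoidal_category "DC D A" "MS M A" by (rule monoidal[OF x'(9)])
    \<comment> \<open>The functor classifying the given degrees and parameter; by
      \<open>ue_crt\<close> the three elements are the tautological ones composed over
      \<open>c\<close>.\<close>
    define c where "c = <|<|<|n, m|>, l|>, i|>"
    have c: "small_functor c" "Trg c = B" "Src c = A" using x' y' z' by (simp_all add: c_def B_def)
    have nc: "n' oo c = n" "m' oo c = m" "l' oo c = l" "i' oo c = i"
      using x' y' z' by (simp_all add: c_def n'_def m'_def l'_def i'_def)
    have nmc: "nadd n' m' oo c = nadd n m" "nadd m' l' oo c = nadd m l" "nadd n' (nadd m' l') oo c = nadd n (nadd m l)"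
      using nadd_comp[of n' m' c] nadd_comp[of m' l' c] nadd_comp[of n' "nadd m' l'" c] sm c nc by simp_all
    have xc: "x \<in> H D c P ?P" "cm c (ue n' i' X) x = x" using ue_crt[OF b(1) _ c(1,2) X, of x P] x'(2) nc by simp_all
    have yc: "y \<in> H D c Q ?Q" "cm c (ue m' i' Y) y = y" using ue_crt[OF b(2) _ c(1,2) Y, of y Q] y'(2) nc by simp_all
    have zc: "z \<in> H D c R ?R" "cm c (ue l' i' Z) z = z" using ue_crt[OF b(3) _ c(1,2) Z, of z R] z'(2) nc by simp_all
    note txy = ten_in[OF xc(1) yc(1)] and tyz = ten_in[OF yc(1) zc(1)]
    have e1: "mm i n m X Y x y = cm c ?xy (ten D M c ?P ?Q x y)" using mm_pre[OF ex ey xc(1) yc(1) c(2)] xc yc nc by simp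
    have e2: "mm i m l Y Z y z = cm c ?yz (ten D M c ?Q ?R y z)" using mm_pre[OF ey ez yc(1) zc(1) c(2)] zc yc nc by simp
    have e3: "mm i (nadd n m) l (ito I X Y) Z (mm i n m X Y x y) z = cm c ?T (ten D M c (tO B ?P ?Q) ?R (ten D M c ?P ?Q x y) z)"
      using mm_pre[OF el_mul[OF ex ey] ez txy[unfolded c] zc(1) c(2)] zc nc nmc e1 by simp
    have e4: "mm i n (nadd m l) X (ito I Y Z) x (mm i m l Y Z y z) = cm c ?K (ten D M c ?P (tO B ?Q ?R) x (ten D M c ?Q ?R y z))"
      using mm_pre[OF ex el_mul[OF ey ez] xc(1) tyz[unfolded c] c(2)] xc nc nmc e2 by simp
    let ?t = "ten D M c (tO B ?P ?Q) ?R (ten D M c ?P ?Q x y) z" and ?t' = "ten D M c ?P (tO B ?Q ?R) x (ten D M c ?Q ?R y z)"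
    have t: "?t \<in> H D c (tO A (tO A P Q) R) (tO B (tO B ?P ?Q) ?R)" using ten_in[OF txy[unfolded c] zc(1)] c by simp
    have t': "?t' \<in> H D c (tO A P (tO A Q R)) (tO B ?P (tO B ?Q ?R))" using ten_in[OF xc(1) tyz[unfolded c]] c by simp
    have aH: "a \<in> H D (id_f (NN ** I)) (ito I (ito I X Y) Z) (ito I X (ito I Y Z))" using a(1) H_id I by simp
    have bc: "?base oo c = <|nadd n (nadd m l), i|>" using sm c nc nmc by simp
    have as0: "Asc (MS M A) P Q R \<in> hm A (tO A (tO A P Q) R) (tO A P (tO A Q R))"
      using mA.asc_in x' y' z' by simp
    have "cm <|nadd n (nadd m l), i|> a (mm i (nadd n m) l (ito I X Y) Z (mm i n m X Y x y) z) = cm c (cm ?base a ?T) ?t"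
      unfolding e3 using cmp_assoc[OF t opcD[OF T] aH] base c bc by simp
    also have "\<dots> = cm c ?K (cm c ?as ?t)"
      unfolding a(2) using cmp_assoc_v[OF t _ opcD[OF G0], of ?as] as(1) base c by simp
    \<comment> \<open>The associator of the generic domains is moved across the composition over
      \<open>c\<close> and becomes the associator of the given domains.\<close>
    also have "cm c ?as ?t = ?t' \<cdot>[A] Asc (MS M A) P Q R" using ten_asc[OF xc(1) yc(1) zc(1)] c by simp
    also have "cm c ?K (?t' \<cdot>[A] Asc (MS M A) P Q R) = cm c ?K ?t' \<cdot>[A] Asc (MS M A) P Q R"
      using cmp_pre[OF t' opcD[OF G0], of "Asc (MS M A) P Q R"] as0 base c by simp
    finally show "cm <|nadd n (nadd m l), i|> a (mm i (nadd n m) l (ito I X Y) Z (mm i n m X Y x y) z)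
      = mm i n (nadd m l) X (ito I Y Z) x (mm i m l Y Z y z) \<cdot>[A] Asc (MS M A) P Q R" unfolding e4 .
  qed
  then show ?thesis by blast
qed

definition asc' :: "'k scat \<Rightarrow> 'o \<Rightarrow> 'o \<Rightarrow> 'o \<Rightarrow> 'm" where "asc' I X Y Z = (SOME a. asc_rule I X Y Z a)"

lemma asc':
  assumes "small_cat I" "X \<in> ob (NN ** I)" "Y \<in> ob (NN ** I)" "Z \<in> ob (NN ** I)"
  shows "asc' I X Y Z \<in> hN I (ito I (ito I X Y) Z) (ito I X (ito I Y Z))" "isoin (NN ** I) (asc' I X Y Z)"
  using someI_ex[OF asc_exists[OF assms]] by (auto simp: asc'_def asc_rule_def)

lemma mm_asc:
  assumes "el A I n i P X x" "el A I m i Q Y y" "el A I l i R Z z"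
  shows "cm <|nadd n (nadd m l), i|> (asc' I X Y Z) (mm i (nadd n m) l (ito I X Y) Z (mm i n m X Y x y) z)
    = mm i n (nadd m l) X (ito I Y Z) x (mm i m l Y Z y z) \<cdot>[A] Asc (MS M A) P Q R"
  using someI_ex[OF asc_exists[OF elD(10,11)[OF assms(1)] elD(11)[OF assms(2)] elD(11)[OF assms(3)]]] assms
  unfolding asc'_def asc_rule_def by blast

subsection \<open>The unit\<close>

text \<open>The universal arrow of \<open>i_! 1\<close> at stage \<open>A\<close>, with domain
  corrected by \<open>Ep\<close> to the unit of \<open>D A\<close>. It mentions neither
  \<open>I\<close> nor a parameter, so one arrow serves all parameters.\<close>

definition eu :: "'k scat \<Rightarrow> 'm" where
  "eu A = cm (to_pt A) (Cpt (lan_unit D (obj_f NN (Num 0))) (un pt)) (Ep M (to_pt A))"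

text \<open>Every unit is a strict restriction of the one over \<open>pt\<close>, so restrictions of
  units are equal and the unit comparison can be an identity.\<close>

definition uI :: "'k scat \<Rightarrow> 'o" where "uI I = pb (id_f NN *** to_pt I) (affine_unit D M)"

lemma lan_un: "FObj (lan D (obj_f NN (Num 0))) (un pt) \<in> ob NN"
  "opc D (obj_f NN (Num 0)) (un pt) (FObj (lan D (obj_f NN (Num 0))) (un pt)) (Cpt (lan_unit D (obj_f NN (Num 0))) (un pt))"
  using lan_obj[of "obj_f NN (Num 0)" "un pt"] lan_opc[of "obj_f NN (Num 0)" "un pt"] by simp_all

lemma uI_eq: "small_cat I \<Longrightarrow> uI I = pb (prj1 NN I) (FObj (lan D (obj_f NN (Num 0))) (un pt))"
  using pbO_comp[of "id_f NN *** to_pt I" "prj1 NN pt"] lan_un by (simp add: uI_def affine_unit_def)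

lemma uI_in [simp]: "small_cat I \<Longrightarrow> uI I \<in> ob (NN ** I)"
  using lan_un by (simp add: uI_eq)

lemma uI_pb: "small_functor u \<Longrightarrow> pb (id_f NN *** u) (uI (Trg u)) = uI (Src u)"
  using pbO_comp[of "id_f NN *** u" "prj1 NN (Trg u)"] lan_un by (simp add: uI_eq)

lemma uI_pt: "uI pt = affine_unit D M"
  using lan_un by (simp add: uI_def affine_unit_def)

lemma eu_el: "\<lbrakk>small_functor i; Src i = A; Trg i = I\<rbrakk> \<Longrightarrow> el A I (nzero A) i (un A) (uI I) (eu A)"
proof -
  assume i: "small_functor i" "Src i = A" "Trg i = I"
  then have S: "small_cat A" "small_cat I" using small_functor_src small_functor_trg by blast+
  have b: "bs A I (nzero A) i" using i S by (simp add: bs_def)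
  have "eu A \<in> H D (obj_f NN (Num 0) oo to_pt A) (un A) (FObj (lan D (obj_f NN (Num 0))) (un pt))"
    unfolding eu_def using cmp_in[OF Ep_in[of "to_pt A"] , of "Cpt (lan_unit D (obj_f NN (Num 0))) (un pt)" "obj_f NN (Num 0)"] opcD[OF lan_un(2)] S by simp
  then have "eu A \<in> H D (prj1 NN I oo <|nzero A, i|>) (un A) (FObj (lan D (obj_f NN (Num 0))) (un pt))"
    using i S nzero_eq[of A] by simp
  then have "eu A \<in> H D <|nzero A, i|> (un A) (uI I)"
    using H_comp[of "<|nzero A, i|>" "prj1 NN I"] i S lan_un(1) uI_eq[OF S(2)] by simp
  then show ?thesis using b by (rule elI[rotated])
qed

lemma eu_pre: "small_functor k \<Longrightarrow> eu (Src k) = cm k (eu (Trg k)) (Ep M k)"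
proof -
  assume k: "small_functor k"
  have "Ep M (to_pt (Src k)) = cm k (Ep M (to_pt (Trg k))) (Ep M k)"
    using Ep_comp[of k "to_pt (Trg k)"] k by (simp add: cmp_def)
  moreover have "Ep M (to_pt (Trg k)) \<in> H D (to_pt (Trg k)) (un (Trg k)) (un pt)" using Ep_in[of "to_pt (Trg k)"] k by simp
  ultimately show ?thesis unfolding eu_def
    using cmp_assoc[OF Ep_in[OF k] _ opcD[OF lan_un(2)]] k by simp
qed

lemma eu_ipb: "small_functor r \<Longrightarrow> ipb r (un (Trg r)) (eu (Trg r)) (un (Src r)) (eu (Src r))"
  unfolding ipb_def using eu_pre[of r] Ep_in[of r] Ep_iso[of r] by blast

text \<open>The universal arrow for \<open>i_! 1\<close> is first moved to \<open>NN ** pt\<close>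
  along an isomorphism, then base changed along \<open>I \<rightarrow> e\<close>; the isomorphism
  \<open>Ep\<close> corrects the domain. So the unit element generates the unit.\<close>

lemma uni_eu:
  assumes I: "small_cat I"
  shows "uni pt I (nzero pt) (un (pt ** I)) (uI I) (eu (pt ** I))"
proof -
  let ?o = "obj_f NN (Num 0)" and ?L = "FObj (lan D (obj_f NN (Num 0))) (un pt)" and ?e = "Cpt (lan_unit D (obj_f NN (Num 0))) (un pt)"
  have o0: "obj_f NN (Num 0) = (nzero pt :: 'k sfun)" using nzero_eq[of "pt :: 'k scat"] by simp
  have c1: "<|id_f pt, id_f pt|> oo prj1 pt pt = id_f (pt ** (pt :: 'k scat))"
    by (intro small_eqI) (auto simp: prod_Obj prod_Arr)
  have c2: "<|id_f NN, to_pt NN|> oo prj1 NN pt = id_f (NN ** (pt :: 'k scat))"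
    by (intro small_eqI) (auto simp: prod_Obj prod_Arr)
  note c = c1 c2
  have "opc D (?o *** id_f pt) (pb (prj1 pt pt) (un pt)) (pb (prj1 NN pt) ?L) (pa (prj1 pt pt) ?e)"
    by (rule opc_iso_square[OF lan_un(2), of "prj1 pt pt" "<|id_f pt, id_f pt|>" "prj1 NN pt" "<|id_f NN, to_pt NN|>"]) (use c in simp_all)
  then have "opc D (?o *** id_f (Trg (to_pt I))) (pb (prj1 pt pt) (un pt)) (pb (prj1 NN pt) ?L) (pa (prj1 pt pt) ?e)" by simp
  from product_base_change[OF _ _ this] have
    "opc D (?o *** id_f I) (pb (id_f pt *** to_pt I) (pb (prj1 pt pt) (un pt))) (pb (id_f NN *** to_pt I) (pb (prj1 NN pt) ?L))
      (pa (id_f pt *** to_pt I) (pa (prj1 pt pt) ?e))" using I by simp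
  moreover have f: "prj1 pt pt oo (id_f pt *** to_pt I) = to_pt (pt ** I)" using to_pt_unique[of "prj1 pt pt oo (id_f pt *** to_pt I)"] I by simp
  have "pb (id_f pt *** to_pt I) (pb (prj1 pt pt) (un pt)) = pb (to_pt (pt ** I)) (un pt)"
    using pbO_comp[of "id_f pt *** to_pt I" "prj1 pt pt" "un pt"] f I by simp
  moreover have "pa (id_f pt *** to_pt I) (pa (prj1 pt pt) ?e) = pa (to_pt (pt ** I)) ?e"
    using pbA_comp[of "id_f pt *** to_pt I" "prj1 pt pt" ?e] f I HD(5)[OF opcD[OF lan_un(2)]] by simp
  ultimately have 1: "opc D (?o *** id_f I) (pb (to_pt (pt ** I)) (un pt)) (uI I) (pa (to_pt (pt ** I)) ?e)"
    by (simp add: uI_def affine_unit_def)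
  have e: "Ep M (to_pt (pt ** I)) \<in> hm (pt ** I) (un (pt ** I)) (pb (to_pt (pt ** I)) (un pt))"
    "isoin (pt ** I) (Ep M (to_pt (pt ** I)))"
    using HD(3)[OF Ep_in[of "to_pt (pt ** I)"]] Ep_iso[of "to_pt (pt ** I)"] I by simp_all
  have "opc D (nzero pt *** id_f I) (un (pt ** I)) (uI I) (eu (pt ** I))"
    using opc_pre[OF 1] e o0 by (simp add: eu_def cmp_def)
  then show ?thesis unfolding uni_def using I pair_prod_id[of "nzero pt" I pt] by simp
qed

end

section \<open>The unitors\<close>

context mdv
begin

lemma crt_el: "\<lbrakk>small_cat I; X \<in> ob (NN ** I)\<rbrakk> \<Longrightarrow> el (NN ** I) I (prj1 NN I) (prj2 NN I) X X (idt (NN ** I) X)"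
  using ue_el[of "NN ** I" I "prj1 NN I" "prj2 NN I" X] by (simp add: bs_def uo_def ue_def)

lemma opc_id_iso: "\<lbrakk>opc D (id_f A) X Y f; small_cat A\<rbrakk> \<Longrightarrow> isoin A f"
proof -
  assume o: "opc D (id_f A) X Y f" and A: "small_cat A"
  interpret A: category "DC D A" using A by simp
  have f: "f \<in> hm A X Y" using opcD[OF o] H_id A by simp
  note X = A.homD(4)[OF f]
  have "opc D (id_f A) X X (idt A X)" using opc_iso_id[OF A A.id_in[OF X] A.iso_id[OF X]] .
  from opc_iso_post[OF this, of f Y] show ?thesis using f o A A.idr[OF f] A.homD(1)[OF f] by simp
qed

text \<open>The unit element times the tautological element of \<open>X\<close>. Since
  \<open>0 + n = n\<close>, it lies over the identity of \<open>NN ** I\<close>, so it is a fibre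
  arrow from the old tensor with the old unit to the new one.\<close>

definition lel :: "'k scat \<Rightarrow> 'o \<Rightarrow> 'm" where
  "lel I X = mm (prj2 NN I) (nzero (NN ** I)) (prj1 NN I) (uI I) X (eu (NN ** I)) (idt (NN ** I) X)"

text \<open>The unit element and \<open>x\<close> are both composites over \<open><|n, i|>\<close>
  of the corresponding elements at stage \<open>NN ** I\<close>, so all products with the unit
  element come from \<open>lel\<close>.\<close>

lemma lel_pre:
  assumes x: "el A I n i P X x"
  shows "ten D M <|n, i|> (un (NN ** I)) X (Ep M <|n, i|>) x \<in> H D <|n, i|> (tO A (un A) P) (tO (NN ** I) (un (NN ** I)) X)"
    and "mm i (nzero A) n (uI I) X (eu A) x = cm <|n, i|> (lel I X) (ten D M <|n, i|> (un (NN ** I)) X (Ep M <|n, i|>) x)"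
proof -
  note x' = elD[OF x]
  have e: "Ep M <|n, i|> \<in> H D <|n, i|> (un A) (un (NN ** I))" "eu A = cm <|n, i|> (eu (NN ** I)) (Ep M <|n, i|>)"
    using Ep_in[of "<|n, i|>"] eu_pre[of "<|n, i|>"] x' by simp_all
  then show "ten D M <|n, i|> (un (NN ** I)) X (Ep M <|n, i|>) x \<in> H D <|n, i|> (tO A (un A) P) (tO (NN ** I) (un (NN ** I)) X)"
    using ten_in[OF e(1) x'(2)] x' by simp
  show "mm i (nzero A) n (uI I) X (eu A) x = cm <|n, i|> (lel I X) (ten D M <|n, i|> (un (NN ** I)) X (Ep M <|n, i|>) x)"
    unfolding e(2) lel_def
    using mm_pre[OF eu_el[of "prj2 NN I"] crt_el[OF x'(10,11)] e(1) x'(2)] cmp_crt[OF x'(2), of "NN ** I"] x' by simp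
qed

text \<open>A product of generators is opcartesian; here it lies over an identity, and an
  opcartesian arrow over an identity is invertible.\<close>

lemma lel:
  assumes I: "small_cat I" and X: "X \<in> ob (NN ** I)"
  shows "lel I X \<in> hN I (tO (NN ** I) (un (NN ** I)) X) (ito I (uI I) X)" "isoin (NN ** I) (lel I X)"
proof -
  show "lel I X \<in> hN I (tO (NN ** I) (un (NN ** I)) X) (ito I (uI I) X)"
    unfolding lel_def using elD(2)[OF el_mul[OF eu_el[of "prj2 NN I"] crt_el[OF I X]]] I H_id by simp
  let ?C = "pt ** NN"
  \<comment> \<open>The generic product lives on the stage \<open>(pt ** NN) ** I\<close>;
    \<open>?r\<close> and \<open>?r'\<close> identify it with \<open>NN ** I\<close>.\<close>
  let ?r = "<|<|to_pt (NN ** I), prj1 NN I|>, prj2 NN I|>" and ?r' = "<|prj2 pt NN oo prj1 ?C I, prj2 ?C I|>"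
  have r: "small_functor ?r" "small_functor ?r'" "Src ?r = NN ** I" "Trg ?r = ?C ** I" "Src ?r' = ?C ** I" "Trg ?r' = NN ** I"
    using I by simp_all
  have rr: "?r' oo ?r = id_f (NN ** I)" using I by simp
  have rr': "?r oo ?r' = id_f (?C ** I)" using I by (intro small_eqI) (auto simp: prod_Obj prod_Arr)
  have b: "bs (?C ** I) I (prj2 pt NN oo prj1 ?C I) (prj2 ?C I)" using I by (simp add: bs_def)
  have pe: "ipb <|prj1 pt NN oo prj1 ?C I, prj2 ?C I|> (un (pt ** I)) (eu (pt ** I)) (un (?C ** I)) (eu (?C ** I))"
    using eu_ipb[of "<|prj1 pt NN oo prj1 ?C I, prj2 ?C I|>"] I by simp
  note u = uni_mul[OF uni_eu[OF I] uni_ue[OF I X] pe uni_ue_ipb[OF I X b]]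
  have p: "ipb ?r (tO (?C ** I) (un (?C ** I)) (uo (prj2 pt NN oo prj1 ?C I) (prj2 ?C I) X))
      (mm (prj2 ?C I) (nzero (?C ** I)) (prj2 pt NN oo prj1 ?C I) (uI I) X (eu (?C ** I)) (ue (prj2 pt NN oo prj1 ?C I) (prj2 ?C I) X))
      (tO (NN ** I) (un (NN ** I)) X) (lel I X)"
    using ipb_mul[OF eu_el[of "prj2 ?C I"] ue_el[OF b X] r(4) eu_ipb[OF r(1), unfolded r(3,4)] ue_ipb[OF b X r(1,4)]] r I X
    by (simp add: lel_def uo_def ue_def)
  have "opc D (id_f (NN ** I)) (tO (NN ** I) (un (NN ** I)) X) (ito I (uI I) X) (lel I X)"
    using ipb_opc_iso[OF uniD(6)[OF u] _ r(1,2), of "tO (NN ** I) (un (NN ** I)) X" "lel I X"] p rr rr' I by simp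
  then show "isoin (NN ** I) (lel I X)" using opc_id_iso I by simp
qed

text \<open>The rule is imposed only at the tautological element, where it says that the new unitor
  after \<open>lel\<close> is the old one; \<open>mm_lun\<close> extends it to all elements.\<close>

definition lun_rule :: "'k scat \<Rightarrow> 'o \<Rightarrow> 'm \<Rightarrow> bool" where
  "lun_rule I X a \<longleftrightarrow> a \<in> hN I (ito I (uI I) X) X \<and> isoin (NN ** I) a \<and>
     a \<cdot>[NN ** I] lel I X = LUn (MS M (NN ** I)) X"

definition lun' :: "'k scat \<Rightarrow> 'o \<Rightarrow> 'm" where "lun' I X = (SOME a. lun_rule I X a)"

lemma lun'_rule: 
  assumes I: "small_cat I" and X: "X \<in> ob (NN ** I)"
  shows "lun_rule I X (lun' I X)"
  unfolding lun'_def
proof (rule someI_ex)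
  interpret m: monoidal_category "DC D (NN ** I)" "MS M (NN ** I)" using monoidal[of "NN ** I"] I by simp
  note l = lel[OF I X]
  obtain e where e: "e \<in> hN I (ito I (uI I) X) (tO (NN ** I) (un (NN ** I)) X)" "e \<cdot>[NN ** I] lel I X = idt (NN ** I) (tO (NN ** I) (un (NN ** I)) X)"
    "isoin (NN ** I) e" using m.isoE[OF l(2,1)] by metis
  have "lun_rule I X (LUn (MS M (NN ** I)) X \<cdot>[NN ** I] e)"
    unfolding lun_rule_def
    using m.comp_in[OF e(1) m.lun_in[OF X]] m.iso_comp[OF e(1) m.lun_in[OF X] e(3) m.lun_iso[OF X]] m.assoc[OF l(1) e(1) m.lun_in[OF X]]
      e(2) m.idr[OF m.lun_in[OF X]] I m.homD(1)[OF m.comp_in[OF e(1) m.lun_in[OF X]]] by simp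
  then show "\<exists>a. lun_rule I X a" by blast
qed

lemma lun':
  assumes "small_cat I" "X \<in> ob (NN ** I)"
  shows "lun' I X \<in> hN I (ito I (uI I) X) X" "isoin (NN ** I) (lun' I X)"
  using lun'_rule[OF assms] by (simp_all add: lun_rule_def)

lemma mm_lun:
  assumes x: "el A I n i P X x"
  shows "cm <|n, i|> (lun' I X) (mm i (nzero A) n (uI I) X (eu A) x) = x \<cdot>[A] LUn (MS M A) P"
proof -
  note x' = elD[OF x] and r = lun'_rule[OF elD(10,11)[OF x]] and l = lel(1)[OF elD(10,11)[OF x]]
  have "cm <|n, i|> (lun' I X) (mm i (nzero A) n (uI I) X (eu A) x)
    = cm <|n, i|> (lun' I X \<cdot>[NN ** I] lel I X) (ten D M <|n, i|> (un (NN ** I)) X (Ep M <|n, i|>) x)"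
    unfolding lel_pre(2)[OF x] using cmp_mult[OF lel_pre(1)[OF x], of "lel I X" "ito I (uI I) X" "lun' I X" X] l r x'
    by (simp add: lun_rule_def)
  then show ?thesis using r ten_lun[OF x'(2)] x' by (simp add: lun_rule_def)
qed

text \<open>Arrows out of the tensor with the unit are determined by their composite with the
  isomorphism \<open>lel\<close>, which is itself a product with the unit element.\<close>

lemma cancel_l:
  assumes I: "small_cat I" and X: "X \<in> ob (NN ** I)" and h: "h \<in> hN I (ito I (uI I) X) V" "h' \<in> hN I (ito I (uI I) X) V"
    and eq: "\<And>A n i P x. el A I n i P X x
      \<Longrightarrow> cm <|n, i|> h (mm i (nzero A) n (uI I) X (eu A) x) = cm <|n, i|> h' (mm i (nzero A) n (uI I) X (eu A) x)"
  shows "h = h'"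
proof -
  interpret C: category "DC D (NN ** I)" using I by simp
  note l = lel[OF I X]
  have "h \<cdot>[NN ** I] lel I X = h' \<cdot>[NN ** I] lel I X"
    using eq[OF crt_el[OF I X]] C.homD(1)[OF h(1)] C.homD(1)[OF h(2)] I by (simp add: lel_def)
  then show ?thesis using C.iso_epic[OF h l] by simp
qed

text \<open>The mirror image of \<open>lel\<close>, using \<open>n + 0 = n\<close>.\<close>

definition rel :: "'k scat \<Rightarrow> 'o \<Rightarrow> 'm" where
  "rel I X = mm (prj2 NN I) (prj1 NN I) (nzero (NN ** I)) X (uI I) (idt (NN ** I) X) (eu (NN ** I))"

lemma rel_pre:
  assumes x: "el A I n i P X x"
  shows "ten D M <|n, i|> X (un (NN ** I)) x (Ep M <|n, i|>) \<in> H D <|n, i|> (tO A P (un A)) (tO (NN ** I) X (un (NN ** I)))"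
    and "mm i n (nzero A) X (uI I) x (eu A) = cm <|n, i|> (rel I X) (ten D M <|n, i|> X (un (NN ** I)) x (Ep M <|n, i|>))"
proof -
  note x' = elD[OF x]
  have e: "Ep M <|n, i|> \<in> H D <|n, i|> (un A) (un (NN ** I))" "eu A = cm <|n, i|> (eu (NN ** I)) (Ep M <|n, i|>)"
    using Ep_in[of "<|n, i|>"] eu_pre[of "<|n, i|>"] x' by simp_all
  then show "ten D M <|n, i|> X (un (NN ** I)) x (Ep M <|n, i|>) \<in> H D <|n, i|> (tO A P (un A)) (tO (NN ** I) X (un (NN ** I)))"
    using ten_in[OF x'(2) e(1)] x' by simp
  show "mm i n (nzero A) X (uI I) x (eu A) = cm <|n, i|> (rel I X) (ten D M <|n, i|> X (un (NN ** I)) x (Ep M <|n, i|>))"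
    unfolding e(2) rel_def
    using mm_pre[OF crt_el[OF x'(10,11)] eu_el[of "prj2 NN I"] x'(2) e(1)] cmp_crt[OF x'(2), of "NN ** I"] x' by simp
qed

lemma rel:
  assumes I: "small_cat I" and X: "X \<in> ob (NN ** I)"
  shows "rel I X \<in> hN I (tO (NN ** I) X (un (NN ** I))) (ito I X (uI I))" "isoin (NN ** I) (rel I X)"
proof -
  show "rel I X \<in> hN I (tO (NN ** I) X (un (NN ** I))) (ito I X (uI I))"
    unfolding rel_def using elD(2)[OF el_mul[OF crt_el[OF I X] eu_el[of "prj2 NN I"]]] I H_id by simp
  let ?C = "NN ** pt"
  let ?r = "<|<|prj1 NN I, to_pt (NN ** I)|>, prj2 NN I|>" and ?r' = "<|prj1 NN pt oo prj1 ?C I, prj2 ?C I|>"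
  have r: "small_functor ?r" "small_functor ?r'" "Src ?r = NN ** I" "Trg ?r = ?C ** I" "Src ?r' = ?C ** I" "Trg ?r' = NN ** I"
    using I by simp_all
  have rr: "?r' oo ?r = id_f (NN ** I)" using I by simp
  have rr': "?r oo ?r' = id_f (?C ** I)" using I by (intro small_eqI) (auto simp: prod_Obj prod_Arr)
  have b: "bs (?C ** I) I (prj1 NN pt oo prj1 ?C I) (prj2 ?C I)" using I by (simp add: bs_def)
  have pe: "ipb <|prj2 NN pt oo prj1 ?C I, prj2 ?C I|> (un (pt ** I)) (eu (pt ** I)) (un (?C ** I)) (eu (?C ** I))"
    using eu_ipb[of "<|prj2 NN pt oo prj1 ?C I, prj2 ?C I|>"] I by simp
  note u = uni_mul[OF uni_ue[OF I X] uni_eu[OF I] uni_ue_ipb[OF I X b] pe]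
  have p: "ipb ?r (tO (?C ** I) (uo (prj1 NN pt oo prj1 ?C I) (prj2 ?C I) X) (un (?C ** I)))
      (mm (prj2 ?C I) (prj1 NN pt oo prj1 ?C I) (nzero (?C ** I)) X (uI I) (ue (prj1 NN pt oo prj1 ?C I) (prj2 ?C I) X) (eu (?C ** I)))
      (tO (NN ** I) X (un (NN ** I))) (rel I X)"
    using ipb_mul[OF ue_el[OF b X] eu_el[of "prj2 ?C I"] r(4) ue_ipb[OF b X r(1,4)] eu_ipb[OF r(1), unfolded r(3,4)]] r I X
    by (simp add: rel_def uo_def ue_def)
  have "opc D (id_f (NN ** I)) (tO (NN ** I) X (un (NN ** I))) (ito I X (uI I)) (rel I X)"
    using ipb_opc_iso[OF uniD(6)[OF u] _ r(1,2), of "tO (NN ** I) X (un (NN ** I))" "rel I X"] p rr rr' I by simp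
  then show "isoin (NN ** I) (rel I X)" using opc_id_iso I by simp
qed

definition run_rule :: "'k scat \<Rightarrow> 'o \<Rightarrow> 'm \<Rightarrow> bool" where
  "run_rule I X a \<longleftrightarrow> a \<in> hN I (ito I X (uI I)) X \<and> isoin (NN ** I) a \<and>
     a \<cdot>[NN ** I] rel I X = RUn (MS M (NN ** I)) X"

definition run' :: "'k scat \<Rightarrow> 'o \<Rightarrow> 'm" where "run' I X = (SOME a. run_rule I X a)"

lemma run'_rule: 
  assumes I: "small_cat I" and X: "X \<in> ob (NN ** I)"
  shows "run_rule I X (run' I X)"
  unfolding run'_def
proof (rule someI_ex)
  interpret m: monoidal_category "DC D (NN ** I)" "MS M (NN ** I)" using monoidal[of "NN ** I"] I by simp
  note l = rel[OF I X]
  obtain e where e: "e \<in> hN I (ito I X (uI I)) (tO (NN ** I) X (un (NN ** I)))" "e \<cdot>[NN ** I] rel I X = idt (NN ** I) (tO (NN ** I) X (un (NN ** I)))"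
    "isoin (NN ** I) e" using m.isoE[OF l(2,1)] by metis
  have "run_rule I X (RUn (MS M (NN ** I)) X \<cdot>[NN ** I] e)"
    unfolding run_rule_def
    using m.comp_in[OF e(1) m.run_in[OF X]] m.iso_comp[OF e(1) m.run_in[OF X] e(3) m.run_iso[OF X]] m.assoc[OF l(1) e(1) m.run_in[OF X]]
      e(2) m.idr[OF m.run_in[OF X]] I m.homD(1)[OF m.comp_in[OF e(1) m.run_in[OF X]]] by simp
  then show "\<exists>a. run_rule I X a" by blast
qed

lemma run':
  assumes "small_cat I" "X \<in> ob (NN ** I)"
  shows "run' I X \<in> hN I (ito I X (uI I)) X" "isoin (NN ** I) (run' I X)"
  using run'_rule[OF assms] by (simp_all add: run_rule_def)

lemma mm_run:
  assumes x: "el A I n i P X x"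
  shows "cm <|n, i|> (run' I X) (mm i n (nzero A) X (uI I) x (eu A)) = x \<cdot>[A] RUn (MS M A) P"
proof -
  note x' = elD[OF x] and r = run'_rule[OF elD(10,11)[OF x]] and l = rel(1)[OF elD(10,11)[OF x]]
  have "cm <|n, i|> (run' I X) (mm i n (nzero A) X (uI I) x (eu A))
    = cm <|n, i|> (run' I X \<cdot>[NN ** I] rel I X) (ten D M <|n, i|> X (un (NN ** I)) x (Ep M <|n, i|>))"
    unfolding rel_pre(2)[OF x] using cmp_mult[OF rel_pre(1)[OF x], of "rel I X" "ito I X (uI I)" "run' I X" X] l r x'
    by (simp add: run_rule_def)
  then show ?thesis using r ten_run[OF x'(2)] x' by (simp add: run_rule_def)
qed

lemma cancel_r:
  assumes I: "small_cat I" and X: "X \<in> ob (NN ** I)" and h: "h \<in> hN I (ito I X (uI I)) V" "h' \<in> hN I (ito I X (uI I)) V"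
    and eq: "\<And>A n i P x. el A I n i P X x
      \<Longrightarrow> cm <|n, i|> h (mm i n (nzero A) X (uI I) x (eu A)) = cm <|n, i|> h' (mm i n (nzero A) X (uI I) x (eu A))"
  shows "h = h'"
proof -
  interpret C: category "DC D (NN ** I)" using I by simp
  note l = rel[OF I X]
  have "h \<cdot>[NN ** I] rel I X = h' \<cdot>[NN ** I] rel I X"
    using eq[OF crt_el[OF I X]] C.homD(1)[OF h(1)] C.homD(1)[OF h(2)] I by (simp add: rel_def)
  then show ?thesis using C.iso_epic[OF h l] by simp
qed

text \<open>Arrows out of \<open>(X 1) Y\<close> are tested on products \<open>z y\<close>. Every
  element \<open>z\<close> of \<open>X 1\<close> is a product \<open>x e\<close> up to an
  isomorphism of domains, where \<open>x\<close> is the image of \<open>z\<close> under the right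
  unitor.\<close>

lemma cancel_t:
  assumes I: "small_cat I" and X: "X \<in> ob (NN ** I)" and Y: "Y \<in> ob (NN ** I)"
    and h: "h \<in> hN I (ito I (ito I X (uI I)) Y) V" "h' \<in> hN I (ito I (ito I X (uI I)) Y) V"
    and eq: "\<And>A n m i P Q x y. \<lbrakk>el A I n i P X x; el A I m i Q Y y\<rbrakk>
      \<Longrightarrow> cm <|nadd n m, i|> h (mm i n m (ito I X (uI I)) Y (mm i n (nzero A) X (uI I) x (eu A)) y)
        = cm <|nadd n m, i|> h' (mm i n m (ito I X (uI I)) Y (mm i n (nzero A) X (uI I) x (eu A)) y)"
  shows "h = h'"
proof (rule cancel2[OF I _ Y h])
  show "ito I X (uI I) \<in> ob (NN ** I)" using I X by simp
next
  fix A n m i P Q z y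
  let ?Z = "ito I X (uI I)"
  assume z: "el A I n i P ?Z z" and y: "el A I m i Q Y y"
  note z' = elD[OF z] and y' = elD[OF y]
  interpret A: monoidal_category "DC D A" "MS M A" by (rule monoidal[OF z'(9)])
  note ru = run'[OF I X]
  have zx: "el A I n i P X (cm <|n, i|> (run' I X) z)" (is "el _ _ _ _ _ _ ?x") using el_cmp[OF z ru(1)] .
  have ue: "el A I n i (tO A P (un A)) ?Z (mm i n (nzero A) X (uI I) ?x (eu A))" (is "el _ _ _ _ _ _ ?w")
    using el_mul[OF zx eu_el[of i A I]] z' by simp
  \<comment> \<open>\<open>s\<close> is a right inverse of the fibre unitor and makes up for the
    extra unit in the domain of \<open>x e\<close>.\<close>
  obtain s where s: "s \<in> hm A P (tO A P (un A))" "RUn (MS M A) P \<cdot>[A] s = idt A P"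
    using A.isoE[OF A.run_iso[OF z'(12)] A.run_in[OF z'(12)]] by metis
  have zA: "z \<in> hm A P (pb <|n, i|> ?Z)" using HD(3)[OF z'(2)] z' by simp
  have ws: "?w \<cdot>[A] s \<in> hm A P (pb <|n, i|> ?Z)" using HD(3)[OF elD(2)[OF el_pre[OF ue s(1)]]] z' by simp
  have c: "cm <|n, i|> (run' I X) z = cm <|n, i|> (run' I X) (?w \<cdot>[A] s)"
  proof -
    have "cm <|n, i|> (run' I X) (?w \<cdot>[A] s) = cm <|n, i|> (run' I X) ?w \<cdot>[A] s"
      using cmp_pre_v[OF elD(2)[OF ue], of "run' I X" X s P] ru s z' by simp
    also have "\<dots> = (?x \<cdot>[A] RUn (MS M A) P) \<cdot>[A] s" unfolding mm_run[OF zx] ..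
    also have "\<dots> = ?x"
      using A.assoc[OF s(1) A.run_in[OF z'(12)], of ?x] HD(3)[OF elD(2)[OF zx]] A.idr[of ?x P] s(2) z' by simp
    finally show ?thesis by simp
  qed
  have pr: "pa <|n, i|> (run' I X) \<in> hm A (pb <|n, i|> ?Z) (pb <|n, i|> X)" "isoin A (pa <|n, i|> (run' I X))"
    using pbA_in[of "<|n, i|>" "run' I X" ?Z X] pbA_iso[of "<|n, i|>" "run' I X"] ru z' by simp_all
  \<comment> \<open>\<open>z\<close> and the product agree after applying the right unitor, which is
    invertible.\<close>
  have zw: "z = ?w \<cdot>[A] s"
    using A.iso_monic[OF zA ws pr] c z' by (simp add: cmp_def)
  have yi: "y \<cdot>[A] idt A Q = y" using A.idr[of y Q] HD(3)[OF y'(2)] y' by simp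
  note iQ = A.id_in[OF y'(12)]
  have mz: "mm i n m ?Z Y z y = mm i n m ?Z Y ?w y \<cdot>[A] tA A s (idt A Q)"
    using mm_pre_v[OF ue y s(1) iQ] yi zw by simp
  note t = tA_in[OF z'(9) s(1) iQ] and wy = elD[OF el_mul[OF ue y]]
  show "cm <|nadd n m, i|> h (mm i n m ?Z Y z y) = cm <|nadd n m, i|> h' (mm i n m ?Z Y z y)"
    unfolding mz using cmp_pre_v[OF wy(2), of h V] cmp_pre_v[OF wy(2), of h' V] t h eq[OF zx y] z' y' by simp
qed

end

section \<open>Multiplication of elements and natural transformations\<close>

context pd
begin

text \<open>Naturality of the action of \<gamma> at \<open>g\<close>: acting before composing with
  \<open>g\<close> is acting by the whiskered transformation afterwards.\<close>

lemma cmp_trans: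
  assumes a: "small_trans \<gamma>" and f: "f \<in> H D (NSrc \<gamma>) X Y" and g: "g \<in> H D w Y Z" and e: "Src w = Trg (NSrc \<gamma>)"
  shows "cm (NTrg \<gamma>) g (Cpt (DT D \<gamma>) Y \<cdot>[Src (NSrc \<gamma>)] f)
    = Cpt (DT D (hcomp (id_n w) \<gamma>)) Z \<cdot>[Src (NSrc \<gamma>)] cm (NSrc \<gamma>) g f"
proof -
  note fH = HD[OF f] and gH = HD[OF g] and a' = small_transD[OF a]
  interpret A: category "DC D (Src (NSrc \<gamma>))" using fH by simp
  have gh: "g \<in> hm (Trg (NSrc \<gamma>)) Y (pb w Z)" using gH e by simp
  have Y: "Y \<in> ob (Trg (NSrc \<gamma>))" "pb w Z \<in> ob (Trg (NSrc \<gamma>))" using gH e by simp_all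
  have g': "pa (NTrg \<gamma>) g \<in> hm (Src (NSrc \<gamma>)) (pb (NTrg \<gamma>) Y) (pb (NTrg \<gamma>) (pb w Z))"
    by (rule pbA_in'[OF a'(3) _ _ gh]) (use a' in simp_all)
  have gs: "pa (NSrc \<gamma>) g \<in> hm (Src (NSrc \<gamma>)) (pb (NSrc \<gamma>) Y) (pb (NSrc \<gamma>) (pb w Z))"
    by (rule pbA_in'[OF a'(2) _ _ gh]) simp_all
  show ?thesis
    using A.assoc[OF fH(3) DT_in[OF a Y(1)] g'] A.assoc[OF fH(3) gs DT_in[OF a Y(2)]] DT_nat[OF a gh] DT_whisker_right[OF a gH(1) e gH(2)] a'
    by (simp add: cmp_def)
qed

end

context mdv
begin

text \<open>The action of \<open>\<alpha>\<close> in the shifted derivator.\<close>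

definition sh :: "'k strans \<Rightarrow> 'o \<Rightarrow> 'm" where "sh \<alpha> X = Cpt (DT D (id_n (id_f NN) \<otimes>\<^sub>t \<alpha>)) X"

lemma sh_in:
  assumes a: "small_trans \<alpha>" and X: "X \<in> ob (NN ** Trg (NSrc \<alpha>))"
  shows "sh \<alpha> X \<in> hm (NN ** Src (NSrc \<alpha>)) (pb (id_f NN *** NSrc \<alpha>) X) (pb (id_f NN *** NTrg \<alpha>) X)"
  unfolding sh_def using DT_in[of "id_n (id_f NN) \<otimes>\<^sub>t \<alpha>" X] a X small_transD[OF a] by simp

text \<open>The shifted transformation is the identity on degrees, so it can be followed through the
  construction: it is monoidal on fibres, commutes with the reordering, and passes the universal
  arrow by naturality.\<close>

lemma mm_trans:
  assumes a: "small_trans \<alpha>"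
    and x: "el A (Src (NSrc \<alpha>)) n i P (pb (id_f NN *** NSrc \<alpha>) X) x" and y: "el A (Src (NSrc \<alpha>)) m i Q (pb (id_f NN *** NSrc \<alpha>) Y) y"
    and X: "X \<in> ob (NN ** Trg (NSrc \<alpha>))" and Y: "Y \<in> ob (NN ** Trg (NSrc \<alpha>))"
  shows "cm <|nadd n m, i|> (sh \<alpha> (ito (Trg (NSrc \<alpha>)) X Y)) (mm (NSrc \<alpha> oo i) n m X Y x y)
    = mm (NTrg \<alpha> oo i) n m X Y (cm <|n, i|> (sh \<alpha> X) x) (cm <|m, i|> (sh \<alpha> Y) y)"
proof -
  define u v I J where uv: "u = NSrc \<alpha>" "v = NTrg \<alpha>" "I = Src u" "J = Trg u"
  note x' = elD[OF x[folded uv]] and y' = elD[OF y[folded uv]]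
  note a' = small_transD[OF a]
  have s: "small_functor u" "small_functor v" "Src u = I" "Trg u = J" "Src v = I" "Trg v = J" "small_cat I" "small_cat J"
    using a' by (simp_all add: uv)
  let ?\<alpha> = "id_n (id_f NN) \<otimes>\<^sub>t \<alpha>"
  have a2: "small_trans ?\<alpha>" using a by simp
  \<comment> \<open>\<gamma> lets \<alpha> act on both parameters over the base along which
    \<open>eta\<close> is restricted; \<delta> is the same action seen on the base of
    \<open>elt\<close>.\<close>
  define \<gamma> where "\<gamma> = hcomp (id_n (id_f (NN ** NN)) \<otimes>\<^sub>t (\<alpha> \<otimes>\<^sub>t \<alpha>)) (id_n <|<|n, m|>, <|i, i|>|>)"
  define \<delta> where "\<delta> = hcomp (id_n (interchange NN NN J J)) \<gamma>"
  have g: "small_trans \<gamma>" "NSrc \<gamma> = <|<|n, m|>, <|u oo i, u oo i|>|>" "NTrg \<gamma> = <|<|n, m|>, <|v oo i, v oo i|>|>"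
    using a s x' y' by (simp_all add: \<gamma>_def uv)
  have d: "small_trans \<delta>" "NSrc \<delta> = <|<|n, u oo i|>, <|m, u oo i|>|>" "NTrg \<delta> = <|<|n, v oo i|>, <|m, v oo i|>|>"
    using g s x' y' by (simp_all add: \<delta>_def)
  have ca: "Cpt \<alpha> (FObj i z) \<in> hom J (FObj u (FObj i z)) (FObj v (FObj i z))" if "z \<in> Obj A" for z
    using nat_trans.cpt_in[OF a'(1), of "FObj i z"] small_functor_obj[OF x'(4)] that x' s by (simp add: uv)
  interpret J: category J using s by simp
  have n0: "FObj n z = Num 0" "FObj m z = Num 0" if "z \<in> Obj A" for z using NN_obj[of n z] NN_obj[of m z] x' y' that by simp_all
  have gt: "Src (NSrc \<gamma>) = A" "Trg (NSrc \<gamma>) = (NN ** NN) ** (J ** J)" "Trg (NTrg \<gamma>) = (NN ** NN) ** (J ** J)"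
    and dt: "Src (NSrc \<delta>) = A" "Trg (NSrc \<delta>) = (NN ** J) ** (NN ** J)" "Trg (NTrg \<delta>) = (NN ** J) ** (NN ** J)"
    using g d s x' y' by simp_all
  interpret I: category I using s by simp
  have oz: "FObj i z \<in> Obj I" "FObj u (FObj i z) \<in> Obj J" "FObj v (FObj i z) \<in> Obj J" if "z \<in> Obj A" for z
    using small_functor_obj[OF x'(4), of z] small_functor_obj[OF s(1), of "FObj i z"] small_functor_obj[OF s(2), of "FObj i z"] that x' s by simp_all
  define c where "c z = Cpt \<alpha> (FObj i z)" for z
  have as: "NSrc \<alpha> = u" "NTrg \<alpha> = v" by (simp_all add: uv)
  have cz: "c z \<in> Arr J" "Dom J (c z) = FObj u (FObj i z)" "Cod J (c z) = FObj v (FObj i z)" "c z \<cdot>\<^bsub>J\<^esub> Idt J (FObj u (FObj i z)) = c z"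
    "Idt J (FObj v (FObj i z)) \<cdot>\<^bsub>J\<^esub> c z = c z" if "z \<in> Obj A" for z
    using J.homD[OF ca[OF that]] J.idr[OF ca[OF that]] J.idl[OF ca[OF that]] by (simp_all add: c_def)
  have ui: "FArr u (Idt I (FObj i z)) = Idt J (FObj u (FObj i z))" if "z \<in> Obj A" for z
    using small_functor_id[OF s(1), of "FObj i z"] oz[OF that] s by simp
  have gz: "Cpt \<gamma> z = Pr (Pr (Num 0) (Num 0)) (Pr (c z) (c z))" if z: "z \<in> Obj A" for z
    using z cz[OF z] oz[OF z] n0[OF z] ui[OF z] s x' y' as I.homD(1-3)[OF I.id_in[OF oz(1)[OF z]]] J.homD(1-3)[OF J.id_in[OF oz(2)[OF z]]]
    by (simp add: \<gamma>_def c_def)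
  have dz: "Cpt \<delta> z = Pr (Pr (Num 0) (c z)) (Pr (Num 0) (c z))" if z: "z \<in> Obj A" for z
    using z gz[OF z] g gt cz[OF z] oz[OF z] n0[OF z] s x' y' J.homD(1-3)[OF J.id_in[OF oz(3)[OF z]]] by (simp add: \<delta>_def)
  have kz: "Cpt (hcomp ?\<alpha> (id_n <|k, i|>)) z = Pr (Num 0) (c z)" if z: "z \<in> Obj A" and k: "small_functor k" "Src k = A" "Trg k = NN" for k z
    using z k cz[OF z] oz[OF z] ui[OF z] NN_obj[OF k(1,3), of z] s x' as I.homD(1-3)[OF I.id_in[OF oz(1)[OF z]]] J.homD(1-3)[OF J.id_in[OF oz(2)[OF z]]]
    by (simp add: c_def)
  have nm: "small_functor (nadd n m)" "Src (nadd n m) = A" "Trg (nadd n m) = NN" using x' y' by simp_all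
  have ks: "small_trans (hcomp ?\<alpha> (id_n <|k, i|>))" "NSrc (hcomp ?\<alpha> (id_n <|k, i|>)) = <|k, u oo i|>" "NTrg (hcomp ?\<alpha> (id_n <|k, i|>)) = <|k, v oo i|>"
    if k: "small_functor k" "Src k = A" "Trg k = NN" for k
    using a2 k s x' as by simp_all
  \<comment> \<open>Projecting \<delta> to one factor gives the action of \<alpha> on that element
    alone.\<close>
  have e1: "hcomp (id_n (prj1 (NN ** J) (NN ** J))) \<delta> = hcomp ?\<alpha> (id_n <|n, i|>)" (is "?l = ?r")
  proof (rule small_trans_eqI)
    show "small_trans ?l" using d(1) dt s by simp
    show "small_trans ?r" by (rule ks(1)[OF x'(3,5,7)])
    show "NSrc ?l = NSrc ?r" unfolding ks(2)[OF x'(3,5,7)] using d(2) s x' y' by simp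
    show "NTrg ?l = NTrg ?r" unfolding ks(3)[OF x'(3,5,7)] using d(3) s x' y' by simp
    fix z assume "z \<in> Obj (Src (NSrc ?r))"
    then have z: "z \<in> Obj A" using s x' y' by simp
    show "Cpt ?l z = Cpt ?r z"
      using z d dt dz[OF z] kz[OF z x'(3,5,7)] cz[OF z] oz[OF z] n0[OF z] s x' y' J.homD(1-3)[OF J.id_in[OF oz(3)[OF z]]] by (simp)
  qed
  have e2: "hcomp (id_n (prj2 (NN ** J) (NN ** J))) \<delta> = hcomp ?\<alpha> (id_n <|m, i|>)" (is "?l = ?r")
  proof (rule small_trans_eqI)
    show "small_trans ?l" using d(1) dt s by simp
    show "small_trans ?r" by (rule ks(1)[OF y'(3,5,7)])
    show "NSrc ?l = NSrc ?r" unfolding ks(2)[OF y'(3,5,7)] using d(2) s x' y' by simp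
    show "NTrg ?l = NTrg ?r" unfolding ks(3)[OF y'(3,5,7)] using d(3) s x' y' by simp
    fix z assume "z \<in> Obj (Src (NSrc ?r))"
    then have z: "z \<in> Obj A" using s x' y' by simp
    show "Cpt ?l z = Cpt ?r z"
      using z d dt dz[OF z] kz[OF z y'(3,5,7)] cz[OF z] oz[OF z] n0[OF z] s x' y' J.homD(1-3)[OF J.id_in[OF oz(3)[OF z]]] by (simp)
  qed
  \<comment> \<open>The degree components of \<gamma> are 0 and add up to 0, so after adding degrees
    \<gamma> is the diagonal of the action at degree \<open>nadd n m\<close>.\<close>
  have e3: "hcomp (id_n (plus_I (J ** J))) \<gamma> = hcomp (id_n (dd J)) (hcomp ?\<alpha> (id_n <|nadd n m, i|>))" (is "?l = ?r")
  proof (rule small_trans_eqI)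
    show "small_trans ?l" using g(1) gt s by simp
    show "small_trans ?r" by (rule small_hcomp[OF ks(1)[OF nm]]) (use ks(2)[OF nm] s x' nm in \<open>simp_all del: hcomp_simps\<close>)
    show "NSrc ?l = NSrc ?r" unfolding hcomp_simps(1)[of "id_n (dd J)"] ks(2)[OF nm] using g(2) nm s x' y' by (simp add: dd_def)
    show "NTrg ?l = NTrg ?r" unfolding hcomp_simps(2)[of "id_n (dd J)"] ks(3)[OF nm] using g(3) nm s x' y' by (simp add: dd_def)
    fix z assume "z \<in> Obj (Src (NSrc ?r))"
    then have z: "z \<in> Obj A" using s x' y' by simp
    have zs: "z \<in> Obj (Src (NSrc (hcomp ?\<alpha> (id_n <|nadd n m, i|>))))" unfolding ks(2)[OF nm] using z nm by simp
    show "Cpt ?l z = Cpt ?r z"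
      unfolding hcomp_simps(3)[OF zs, of "id_n (dd J)"] kz[OF z nm] ks(3)[OF nm]
      using z g gt gz[OF z] cz[OF z] oz[OF z] n0[OF z] NN_obj[OF nm(1,3), of z] nm s x' y' J.homD(1-3)[OF J.id_in[OF oz(3)[OF z]]]
      by (simp add: dd_def plus_I_def)
  qed
  have XY: "X \<in> ob (NN ** J)" "Y \<in> ob (NN ** J)" using X Y by (simp_all add: uv)
  have xu: "el A J n (u oo i) P X x" and yu: "el A J m (u oo i) Q Y y"
    using el_base[OF x[folded uv]] el_base[OF y[folded uv]] s XY by (simp_all add: uv)
  note xu' = elD[OF xu] and yu' = elD[OF yu]
  let ?p = "prj1 (NN ** J) (NN ** J)" and ?q = "prj2 (NN ** J) (NN ** J)" and ?E = "exO (NN ** J) (NN ** J) X Y"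
  let ?t = "elt <|n, u oo i|> <|m, u oo i|> X Y x y" and ?c = "<|<|n, m|>, <|u oo i, u oo i|>|>" and ?c' = "<|<|n, m|>, <|v oo i, v oo i|>|>"
  have d1: "Cpt (DT D \<delta>) (pb ?p X) = pa <|n, i|> (sh \<alpha> X)"
    using DT_whisker_right[OF d(1), of ?p X] DT_whisker_left[OF a2, of "<|n, i|>" X] e1 dt s x' XY as by (simp add: sh_def)
  have d2: "Cpt (DT D \<delta>) (pb ?q Y) = pa <|m, i|> (sh \<alpha> Y)"
    using DT_whisker_right[OF d(1), of ?q Y] DT_whisker_left[OF a2, of "<|m, i|>" Y] e2 dt s y' XY as by (simp add: sh_def)
  have d3: "Cpt (DT D \<delta>) ?E = Cpt (DT D \<gamma>) (axZ J J X Y)"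
    using DT_whisker_right[OF g(1), of "interchange NN NN J J" ?E] gt s XY by (simp add: \<delta>_def axZ_def)
  have d4: "Cpt (DT D (hcomp (id_n (plus_I (J ** J))) \<gamma>)) (axO J J X Y) = pa <|nadd n m, i|> (sh \<alpha> (ito J X Y))"
    unfolding e3 using DT_whisker_right[OF ks(1)[OF nm], of "dd J" "axO J J X Y"] DT_whisker_left[OF a2, of "<|nadd n m, i|>" "ito J X Y"] nm s x' XY as ks(2)[OF nm]
    by (simp add: sh_def ito_def del: hcomp_simps)
  have hx: "x \<in> H D <|<|n, u oo i|>, <|m, u oo i|>|> P (pb ?p X)" and hy: "y \<in> H D <|<|n, u oo i|>, <|m, u oo i|>|> Q (pb ?q Y)"
    using H_pair1[OF xu'(2), of "<|m, u oo i|>"] H_pair2[OF yu'(2), of "<|n, u oo i|>"] xu' yu' by simp_all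
  have 1: "Cpt (DT D \<gamma>) (axZ J J X Y) \<cdot>[A] ?t = elt <|n, v oo i|> <|m, v oo i|> X Y (cm <|n, i|> (sh \<alpha> X) x) (cm <|m, i|> (sh \<alpha> Y) y)"
    using ten_trans[OF d hx hy] d1 d2 d3 s xu' yu' x' y' by (simp add: elt_def exO_def cmp_def)
  note t = elt_in_c[OF xu'(1) yu'(1) xu'(2) yu'(2)]
  have t: "?t \<in> H D (NSrc \<gamma>) (tO A P Q) (axZ J J X Y)" using t g(2) xu' by simp
  have e: "eta J J X Y \<in> H D (plus_I (J ** J)) (axZ J J X Y) (axO J J X Y)" using opcD[OF eta_opc[OF s(8,8) XY]] .
  have "mm (v oo i) n m X Y (cm <|n, i|> (sh \<alpha> X) x) (cm <|m, i|> (sh \<alpha> Y) y) = cm ?c' (eta J J X Y) (Cpt (DT D \<gamma>) (axZ J J X Y) \<cdot>[A] ?t)"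
    unfolding 1 mul_def using s by simp
  also have "\<dots> = pa <|nadd n m, i|> (sh \<alpha> (ito J X Y)) \<cdot>[A] cm ?c (eta J J X Y) ?t"
    using cmp_trans[OF g(1) t e] gt d4 g by simp
  also have "\<dots> = cm <|nadd n m, i|> (sh \<alpha> (ito J X Y)) (mm (u oo i) n m X Y x y)"
    using s nm x' by (simp add: cmp_def mul_def)
  finally show ?thesis by (simp add: uv)
qed

end

section \<open>Naturality and coherence of the associator and the unitors\<close>

context mdv
begin

lemma el_mult: "\<lbrakk>el A I n i P X w; k \<in> hN I X Y; h \<in> hN I Y Z\<rbrakk>
    \<Longrightarrow> cm <|n, i|> (h \<cdot>[NN ** I] k) w = cm <|n, i|> h (cm <|n, i|> k w)"
  using cmp_mult[of w "<|n, i|>" P X k Y h Z] elD[of A I n i P X w] by simp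

lemma el_prec: "\<lbrakk>el A I n i P X w; h \<in> hN I X Y; k \<in> hm A P' P\<rbrakk>
    \<Longrightarrow> cm <|n, i|> h (w \<cdot>[A] k) = cm <|n, i|> h w \<cdot>[A] k"
  using cmp_pre_v[of w "<|n, i|>" P X h Y k P'] elD[of A I n i P X w] by simp

lemma el_crt: "el A I n i P X w \<Longrightarrow> cm <|n, i|> (idt (NN ** I) X) w = w"
  using cmp_crt[of w "<|n, i|>" P X] elD[of A I n i P X w] by simp

lemma el_base_iff: "\<lbrakk>small_functor u; Src u = I; small_functor i; Trg i = I; X \<in> ob (NN ** Trg u)\<rbrakk>
    \<Longrightarrow> el A I n i P (pb (id_f NN *** u) X) x \<longleftrightarrow> el A (Trg u) n (u oo i) P X x"
  using H_comp[of "<|n, i|>" "id_f NN *** u" X x P] by (auto simp: el_def bs_def)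

lemma cmp_base: "\<lbrakk>bs A I n i; small_functor u; Src u = I; h \<in> ar (NN ** Trg u)\<rbrakk>
    \<Longrightarrow> cm <|n, i|> (pa (id_f NN *** u) h) z = cm <|n, u oo i|> h z"
  using pbA_comp[of "<|n, i|>" "id_f NN *** u" h] bsD[of A I n i] bs_small[of A I n i] by (simp add: cmp_def)

lemma el_idr: "el A I n i P X w \<Longrightarrow> w \<cdot>[A] idt A P = w"
  using category.idr[OF DC_cat[of A], of w P "pb <|n, i|> X"] elD[of A I n i P X w] HD(3)[of w "<|n, i|>" P X] by simp

lemma el_assoc: "\<lbrakk>el A I n i P X w; k \<in> hm A P' P; l \<in> hm A P'' P'\<rbrakk>
    \<Longrightarrow> (w \<cdot>[A] k) \<cdot>[A] l = w \<cdot>[A] (k \<cdot>[A] l)"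
  using category.assoc[OF DC_cat[of A], of l P'' P' k P w "pb <|n, i|> X"] elD[of A I n i P X w] HD(3)[of w "<|n, i|>" P X] by simp

lemma mm_pre_l: "\<lbrakk>el A I n i P X x; el A I m i Q Y y; f \<in> hm A P' P\<rbrakk>
    \<Longrightarrow> mm i n m X Y (x \<cdot>[A] f) y = mm i n m X Y x y \<cdot>[A] tA A f (idt A Q)"
  using mm_pre_v[of A I n i P X x m Q Y y f P' "idt A Q" Q] el_idr[of A I m i Q Y y] elD[of A I m i Q Y y]
    category.id_in[OF DC_cat[of A], of Q] by simp

lemma mm_pre_r: "\<lbrakk>el A I n i P X x; el A I m i Q Y y; g \<in> hm A Q' Q\<rbrakk>
    \<Longrightarrow> mm i n m X Y x (y \<cdot>[A] g) = mm i n m X Y x y \<cdot>[A] tA A (idt A P) g"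
  using mm_pre_v[of A I n i P X x m Q Y y "idt A P" P g Q'] el_idr[of A I n i P X x] elD[of A I n i P X x]
    category.id_in[OF DC_cat[of A], of P] by simp

lemma mm_post_l: "\<lbrakk>el A I n i P X x; el A I m i Q Y y; f \<in> hN I X X'\<rbrakk>
    \<Longrightarrow> cm <|nadd n m, i|> (ita I f (idt (NN ** I) Y)) (mm i n m X Y x y) = mm i n m X' Y (cm <|n, i|> f x) y"
  using mm_post[of A I n i P X x m Q Y y f X' "idt (NN ** I) Y" Y] el_crt[of A I m i Q Y y] elD[of A I m i Q Y y]
    category.id_in[OF DC_cat[of "NN ** I"], of Y] by simp

lemma mm_post_r: "\<lbrakk>el A I n i P X x; el A I m i Q Y y; g \<in> hN I Y Y'\<rbrakk>
    \<Longrightarrow> cm <|nadd n m, i|> (ita I (idt (NN ** I) X) g) (mm i n m X Y x y) = mm i n m X Y' x (cm <|m, i|> g y)"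
  using mm_post[of A I n i P X x m Q Y y "idt (NN ** I) X" X g Y'] el_crt[of A I n i P X x] elD[of A I n i P X x]
    category.id_in[OF DC_cat[of "NN ** I"], of X] by simp

text \<open>On \<open>(x y) z\<close> both sides give \<open>(f x) ((g y) (h z))\<close> precomposed
  with the fibre associator.\<close>

lemma asc'_nat:
  assumes I: "small_cat I" and f: "f \<in> hN I X X'" and g: "g \<in> hN I Y Y'" and h: "h \<in> hN I Z Z'"
  shows "asc' I X' Y' Z' \<cdot>[NN ** I] ita I (ita I f g) h = ita I f (ita I g h) \<cdot>[NN ** I] asc' I X Y Z"
proof -
  interpret C: category "DC D (NN ** I)" using I by simp
  note X = C.homD(4,5)[OF f] and Y = C.homD(4,5)[OF g] and Z = C.homD(4,5)[OF h]
  note a = asc'(1)[OF I X(1) Y(1) Z(1)] and a' = asc'(1)[OF I X(2) Y(2) Z(2)]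
  note fg = ita_in[OF I f g] and gh = ita_in[OF I g h]
  note l = ita_in[OF I fg h] and r = ita_in[OF I f gh]
  show ?thesis
  proof (rule cancel3[OF I X(1) Y(1) Z(1) C.comp_in[OF l a'] C.comp_in[OF a r]], goal_cases)
    case (1 A n m l i P Q R x y z)
    note x = 1(1) and y = 1(2) and z = 1(3)
    note x' = elD[OF x] and y' = elD[OF y] and z' = elD[OF z]
    note xy = el_mul[OF x y] and yz = el_mul[OF y z]
    note xyz = el_mul[OF xy z] and xyz' = el_mul[OF x yz]
    have as: "Asc (MS M A) P Q R \<in> hm A (tO A (tO A P Q) R) (tO A P (tO A Q R))"
      using monoidal_category.asc_in[OF monoidal[OF x'(9)]] x' y' z' by simp
    have e: "nadd (nadd n m) l = nadd n (nadd m l)" using x' y' z' by simp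
    show ?case
      using el_mult[OF xyz[unfolded e] l a'] el_mult[OF xyz[unfolded e] a r] mm_post[OF xy z fg h, unfolded e] mm_post[OF x y f g]
        mm_asc[OF el_cmp[OF x f] el_cmp[OF y g] el_cmp[OF z h]] mm_asc[OF x y z] el_prec[OF xyz' r as] mm_post[OF x yz f gh] mm_post[OF y z g h]
      by simp
  qed
qed

lemma lun'_nat:
  assumes I: "small_cat I" and f: "f \<in> hN I X Y"
  shows "lun' I Y \<cdot>[NN ** I] ita I (idt (NN ** I) (uI I)) f = f \<cdot>[NN ** I] lun' I X"
proof -
  interpret C: category "DC D (NN ** I)" using I by simp
  note X = C.homD(4,5)[OF f]
  note l = ita_in[OF I C.id_in[OF uI_in[OF I]] f] and a = lun'(1)[OF I X(1)] and a' = lun'(1)[OF I X(2)]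
  show ?thesis
  proof (rule cancel_l[OF I X(1) C.comp_in[OF l a'] C.comp_in[OF a f]], goal_cases)
    case (1 A n i P x)
    note x = 1(1)
    note x' = elD[OF x]
    note e = eu_el[OF x'(4,6,8)]
    have n: "nadd (nzero A) n = n" using x' by simp
    have L: "LUn (MS M A) P \<in> hm A (tO A (un A) P) P"
      using monoidal_category.lun_in[OF monoidal[OF x'(9)]] x' by simp
    note ex = el_mul[OF e x, unfolded n]
    show ?case
      using el_mult[OF ex l a'] el_mult[OF ex a f] mm_post_r[OF e x f, unfolded n] mm_lun[OF x] mm_lun[OF el_cmp[OF x f]] el_prec[OF x f L] by simp
  qed
qed

lemma run'_nat:
  assumes I: "small_cat I" and f: "f \<in> hN I X Y"
  shows "run' I Y \<cdot>[NN ** I] ita I f (idt (NN ** I) (uI I)) = f \<cdot>[NN ** I] run' I X"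
proof -
  interpret C: category "DC D (NN ** I)" using I by simp
  note X = C.homD(4,5)[OF f]
  note l = ita_in[OF I f C.id_in[OF uI_in[OF I]]] and a = run'(1)[OF I X(1)] and a' = run'(1)[OF I X(2)]
  show ?thesis
  proof (rule cancel_r[OF I X(1) C.comp_in[OF l a'] C.comp_in[OF a f]], goal_cases)
    case (1 A n i P x)
    note x = 1(1)
    note x' = elD[OF x]
    note e = eu_el[OF x'(4,6,8)]
    have n: "nadd n (nzero A) = n" using x' by simp
    have L: "RUn (MS M A) P \<in> hm A (tO A P (un A)) P"
      using monoidal_category.run_in[OF monoidal[OF x'(9)]] x' by simp
    note ex = el_mul[OF x e, unfolded n]
    show ?case
      using el_mult[OF ex l a'] el_mult[OF ex a f] mm_post_l[OF x e f, unfolded n] mm_run[OF x] mm_run[OF el_cmp[OF x f]] el_prec[OF x f L] by simp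
  qed
qed

text \<open>Tested on \<open>(x e) y\<close>, the rules for associator and unitors leave
  \<open>x y\<close> precomposed with the two sides of the triangle in the fibre
  \<open>D A\<close>.\<close>

lemma triangle':
  assumes I: "small_cat I" and X: "X \<in> ob (NN ** I)" and Y: "Y \<in> ob (NN ** I)"
  shows "ita I (idt (NN ** I) X) (lun' I Y) \<cdot>[NN ** I] asc' I X (uI I) Y = ita I (run' I X) (idt (NN ** I) Y)"
proof -
  interpret C: category "DC D (NN ** I)" using I by simp
  note l = lun'(1)[OF I Y] and r = run'(1)[OF I X] and a = asc'(1)[OF I X uI_in[OF I] Y]
  note il = ita_in[OF I C.id_in[OF X] l] and ri = ita_in[OF I r C.id_in[OF Y]]
  show ?thesis
  proof (rule cancel_t[OF I X Y C.comp_in[OF a il] ri], goal_cases)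
    case (1 A n m i P Q x y)
    note x = 1(1) and y = 1(2)
    note x' = elD[OF x] and y' = elD[OF y]
    interpret A: monoidal_category "DC D A" "MS M A" by (rule monoidal[OF x'(9)])
    note e = eu_el[OF x'(4,6,8)]
    have n: "nadd n (nzero A) = n" "nadd (nzero A) m = m" using x' y' by simp_all
    note xe = el_mul[OF x e, unfolded n] and ey = el_mul[OF e y, unfolded n]
    note xey = el_mul[OF xe y] and xey' = el_mul[OF x ey]
    note L = A.lun_in[OF y'(12)] and R = A.run_in[OF x'(12)] and as = A.asc_in[OF x'(12) A.unt_in y'(12)]
    note iL = A.tenA_in[OF A.id_in[OF x'(12)] L]
    have "cm <|nadd n m, i|> (ita I (idt (NN ** I) X) (lun' I Y) \<cdot>[NN ** I] asc' I X (uI I) Y)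
        (mm i n m (ito I X (uI I)) Y (mm i n (nzero A) X (uI I) x (eu A)) y)
      = mm i n m X Y x (y \<cdot>[A] LUn (MS M A) Q) \<cdot>[A] Asc (MS M A) P (un A) Q"
      using el_mult[OF xey a il] mm_asc[OF x e y, unfolded n] el_prec[OF xey' il as] mm_post_r[OF x ey l] mm_lun[OF y] by simp
    also have "\<dots> = mm i n m X Y x y \<cdot>[A] (tA A (idt A P) (LUn (MS M A) Q) \<cdot>[A] Asc (MS M A) P (un A) Q)"
      using mm_pre_r[OF x y L] el_assoc[OF el_mul[OF x y] iL as] by simp
    also have "\<dots> = mm i n m X Y (x \<cdot>[A] RUn (MS M A) P) y"
      using mm_pre_l[OF x y R] A.triangle[OF x'(12) y'(12)] by simp
    also have "\<dots> = cm <|nadd n m, i|> (ita I (run' I X) (idt (NN ** I) Y)) (mm i n m (ito I X (uI I)) Y (mm i n (nzero A) X (uI I) x (eu A)) y)"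
      using mm_post_l[OF xe y r] mm_run[OF x] by simp
    finally show ?case .
  qed
qed

text \<open>On \<open>((w x) y) z\<close> each path ends in \<open>w (x (y z))\<close> precomposed
  with associators of the domains, and these agree by the pentagon in \<open>D A\<close>.\<close>

lemma pentagon':
  assumes I: "small_cat I" and W: "W \<in> ob (NN ** I)" and X: "X \<in> ob (NN ** I)" and Y: "Y \<in> ob (NN ** I)" and Z: "Z \<in> ob (NN ** I)"
  shows "ita I (idt (NN ** I) W) (asc' I X Y Z) \<cdot>[NN ** I]
      (asc' I W (ito I X Y) Z \<cdot>[NN ** I] ita I (asc' I W X Y) (idt (NN ** I) Z))
    = asc' I W X (ito I Y Z) \<cdot>[NN ** I] asc' I (ito I W X) Y Z"
proof -
  interpret C: category "DC D (NN ** I)" using I by simp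
  note WX = ito_in[OF I W X] and XY = ito_in[OF I X Y] and YZ = ito_in[OF I Y Z]
  note a1 = asc'(1)[OF I X Y Z] and a2 = asc'(1)[OF I W XY Z] and a3 = asc'(1)[OF I W X Y] and a4 = asc'(1)[OF I W X YZ] and a5 = asc'(1)[OF I WX Y Z]
  note b1 = ita_in[OF I C.id_in[OF W] a1] and b3 = ita_in[OF I a3 C.id_in[OF Z]]
  show ?thesis
  proof (rule cancel4[OF I W X Y Z C.comp_in[OF C.comp_in[OF b3 a2] b1] C.comp_in[OF a5 a4]], goal_cases)
    case (1 A n m l k i U P Q R w x y z)
    note w = 1(1) and x = 1(2) and y = 1(3) and z = 1(4)
    note w' = elD[OF w] and x' = elD[OF x] and y' = elD[OF y] and z' = elD[OF z]
    interpret A: monoidal_category "DC D A" "MS M A" by (rule monoidal[OF x'(9)])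
    note o = w'(12) x'(12) y'(12) z'(12)
    note wx = el_mul[OF w x] and xy = el_mul[OF x y] and yz = el_mul[OF y z]
    note wxy = el_mul[OF wx y] and wxy' = el_mul[OF w xy] and xyz = el_mul[OF xy z] and xyz' = el_mul[OF x yz]
    note t = el_mul[OF wxy z] and t2 = el_mul[OF wxy' z] and t3 = el_mul[OF w xyz] and t4 = el_mul[OF wx yz] and t5 = el_mul[OF w xyz']
    have n: "nadd (nadd n m) l = nadd n (nadd m l)" "nadd (nadd m l) k = nadd m (nadd l k)" "nadd (nadd n m) (nadd l k) = nadd n (nadd m (nadd l k))"
      "nadd (nadd n (nadd m l)) k = nadd n (nadd m (nadd l k))"
      using w' x' y' z' by simp_all
    note WX = A.tenO_in[OF o(1,2)] and XY = A.tenO_in[OF o(2,3)] and YZ = A.tenO_in[OF o(3,4)]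
    note s1 = A.asc_in[OF o(2-4)] and s2 = A.asc_in[OF o(1) XY o(4)] and s3 = A.asc_in[OF o(1-3)] and s4 = A.asc_in[OF o(1,2) YZ] and s5 = A.asc_in[OF WX o(3,4)]
    note r1 = A.tenA_in[OF A.id_in[OF o(1)] s1] and r3 = A.tenA_in[OF s3 A.id_in[OF o(4)]]
    note t = t[unfolded n] and t2 = t2[unfolded n] and t3 = t3[unfolded n] and t4 = t4[unfolded n] and t5 = t5[unfolded n]
    let ?b = "<|nadd n (nadd m (nadd l k)), i|>" and ?A = "DC D A"
    let ?T = "mm i (nadd n (nadd m l)) k (ito I (ito I W X) Y) Z (mm i (nadd n m) l (ito I W X) Y (mm i n m W X w x) y) z"
    let ?T5 = "mm i n (nadd m (nadd l k)) W (ito I X (ito I Y Z)) w (mm i m (nadd l k) X (ito I Y Z) x (mm i l k Y Z y z))"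
    \<comment> \<open>The facts 1 to 5 evaluate the five edges; each one exposes a fibre associator
      at the domain side.\<close>
    have 1: "cm ?b (ita I (asc' I W X Y) (idt (NN ** I) Z)) ?T
      = mm i (nadd n (nadd m l)) k (ito I W (ito I X Y)) Z (mm i n (nadd m l) W (ito I X Y) w (mm i m l X Y x y)) z \<cdot>\<^bsub>?A\<^esub> tA A (Asc (MS M A) U P Q) (Idt ?A R)"
      using mm_post_l[OF wxy z a3, unfolded n] mm_asc[OF w x y] mm_pre_l[OF wxy' z s3] by simp
    have 2: "cm ?b (asc' I W (ito I X Y) Z) (mm i (nadd n (nadd m l)) k (ito I W (ito I X Y)) Z (mm i n (nadd m l) W (ito I X Y) w (mm i m l X Y x y)) z)
      = mm i n (nadd m (nadd l k)) W (ito I (ito I X Y) Z) w (mm i (nadd m l) k (ito I X Y) Z (mm i m l X Y x y) z) \<cdot>\<^bsub>?A\<^esub> Asc (MS M A) U (tO A P Q) R"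
      using mm_asc[OF w xy z, unfolded n] by simp
    have 3: "cm ?b (ita I (idt (NN ** I) W) (asc' I X Y Z)) (mm i n (nadd m (nadd l k)) W (ito I (ito I X Y) Z) w (mm i (nadd m l) k (ito I X Y) Z (mm i m l X Y x y) z))
      = ?T5 \<cdot>\<^bsub>?A\<^esub> tA A (Idt ?A U) (Asc (MS M A) P Q R)"
      using mm_post_r[OF w xyz a1, unfolded n] mm_asc[OF x y z] mm_pre_r[OF w xyz' s1] by simp
    have 4: "cm ?b (asc' I (ito I W X) Y Z) ?T
      = mm i (nadd n m) (nadd l k) (ito I W X) (ito I Y Z) (mm i n m W X w x) (mm i l k Y Z y z) \<cdot>\<^bsub>?A\<^esub> Asc (MS M A) (tO A U P) Q R"
      using mm_asc[OF wx y z, unfolded n] by simp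
    have 5: "cm ?b (asc' I W X (ito I Y Z)) (mm i (nadd n m) (nadd l k) (ito I W X) (ito I Y Z) (mm i n m W X w x) (mm i l k Y Z y z))
      = ?T5 \<cdot>\<^bsub>?A\<^esub> Asc (MS M A) U P (tO A Q R)"
      using mm_asc[OF w x yz] by simp
    have "cm ?b (ita I (idt (NN ** I) W) (asc' I X Y Z) \<cdot>[NN ** I]
        (asc' I W (ito I X Y) Z \<cdot>[NN ** I] ita I (asc' I W X Y) (idt (NN ** I) Z))) ?T
      = ((?T5 \<cdot>\<^bsub>?A\<^esub> tA A (Idt ?A U) (Asc (MS M A) P Q R)) \<cdot>\<^bsub>?A\<^esub> Asc (MS M A) U (tO A P Q) R) \<cdot>\<^bsub>?A\<^esub> tA A (Asc (MS M A) U P Q) (Idt ?A R)"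
      using el_mult[OF t C.comp_in[OF b3 a2] b1] el_mult[OF t b3 a2] 1 2 3 el_prec[OF t2 a2 r3] el_prec[OF el_pre[OF t3 s2] b1 r3] el_prec[OF t3 b1 s2] by simp
    also have "\<dots> = ?T5 \<cdot>\<^bsub>?A\<^esub> (tA A (Idt ?A U) (Asc (MS M A) P Q R) \<cdot>\<^bsub>?A\<^esub> (Asc (MS M A) U (tO A P Q) R \<cdot>\<^bsub>?A\<^esub> tA A (Asc (MS M A) U P Q) (Idt ?A R)))"
      using el_assoc[OF el_pre[OF t5 r1] s2 r3] el_assoc[OF t5 r1 A.comp_in[OF r3 s2]] by simp
    also have "\<dots> = (?T5 \<cdot>\<^bsub>?A\<^esub> Asc (MS M A) U P (tO A Q R)) \<cdot>\<^bsub>?A\<^esub> Asc (MS M A) (tO A U P) Q R"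
      using A.pentagon[OF o] el_assoc[OF t5 s4 s5] by simp
    also have "\<dots> = cm ?b (asc' I W X (ito I Y Z) \<cdot>[NN ** I] asc' I (ito I W X) Y Z) ?T"
      using el_mult[OF t a5 a4] 4 5 el_prec[OF t4 a4 s5] by simp
    finally show ?case
      unfolding n .
  qed
qed

end

context mdv
begin

subsection \<open>The monoidal prederivator\<close>

lemma ita_id: "\<lbrakk>small_cat I; X \<in> ob (NN ** I); Y \<in> ob (NN ** I)\<rbrakk>
    \<Longrightarrow> ita I (idt (NN ** I) X) (idt (NN ** I) Y) = idt (NN ** I) (ito I X Y)"
proof -
  assume I: "small_cat I" and X: "X \<in> ob (NN ** I)" and Y: "Y \<in> ob (NN ** I)"
  interpret C: category "DC D (NN ** I)" using I by simp
  show ?thesis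
  proof (rule cancel2[OF I X Y ita_in[OF I C.id_in[OF X] C.id_in[OF Y]] C.id_in[OF ito_in[OF I X Y]]], goal_cases)
    case (1 A n m i P Q x y)
    note x = 1(1) and y = 1(2)
    show ?case
      using mm_post_l[OF x y C.id_in[OF X]] el_crt[OF x] el_crt[OF el_mul[OF x y]] by simp
  qed
qed

lemma ita_comp:
  assumes I: "small_cat I" and f: "f \<in> hN I X X'" and g: "g \<in> hN I Y Y'" and f': "f' \<in> hN I X' X''" and g': "g' \<in> hN I Y' Y''"
  shows "ita I (f' \<cdot>[NN ** I] f) (g' \<cdot>[NN ** I] g) = ita I f' g' \<cdot>[NN ** I] ita I f g"
proof -
  interpret C: category "DC D (NN ** I)" using I by simp
  note ff = C.comp_in[OF f f'] and gg = C.comp_in[OF g g'] and fg = ita_in[OF I f g] and fg' = ita_in[OF I f' g']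
  show ?thesis
  proof (rule cancel2[OF I C.homD(4)[OF f] C.homD(4)[OF g] ita_in[OF I ff gg] C.comp_in[OF fg fg']], goal_cases)
    case (1 A n m i P Q x y)
    note x = 1(1) and y = 1(2)
    show ?case
      using mm_post[OF x y ff gg] el_mult[OF x f f'] el_mult[OF y g g'] el_mult[OF el_mul[OF x y] fg fg'] mm_post[OF x y f g]
        mm_post[OF el_cmp[OF x f] el_cmp[OF y g] f' g'] by simp
  qed
qed

text \<open>\<open>Ten\<close> and \<open>Mu\<close> are given by the formulas of the specification,
  so that these hold by definition. \<open>Ep\<close> can be an identity because the units restrict
  strictly.\<close>

definition affine_mon :: "('k, 'o, 'm) mon_pder" where
  "affine_mon = \<lparr>MS = (\<lambda>A. \<lparr>Ten = DF (affine_line D) (diag A) oo affine_ext_prod D M A A, Unt = uI A, Asc = asc' A, LUn = lun' A, RUn = run' A\<rparr>),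
     Mu = (\<lambda>u X Y. pbA (affine_line D) (diag (Src u)) (affine_ext_mu D M u u X Y)),
     Ep = (\<lambda>u. idt (NN ** Src u) (uI (Src u)))\<rparr>"

lemma affine_mon_simps [simp]:
  "Unt (MS affine_mon A) = uI A" "Asc (MS affine_mon A) = asc' A" "LUn (MS affine_mon A) = lun' A" "RUn (MS affine_mon A) = run' A"
  "Mu affine_mon u X Y = iMu u X Y" "Ep affine_mon u = idt (NN ** Src u) (uI (Src u))"
  by (simp_all add: affine_mon_def iMu_def dd_def)

lemma affine_mon_ten:
  assumes I: "small_cat I"
  shows "Src (Ten (MS affine_mon I)) = prod_cat (DC D (NN ** I)) (DC D (NN ** I))" "Trg (Ten (MS affine_mon I)) = DC D (NN ** I)"
    and "\<lbrakk>X \<in> ob (NN ** I); Y \<in> ob (NN ** I)\<rbrakk> \<Longrightarrow> tenO (MS affine_mon I) X Y = ito I X Y"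
    and "\<lbrakk>f \<in> ar (NN ** I); g \<in> ar (NN ** I)\<rbrakk> \<Longrightarrow> tenA (MS affine_mon I) f g = ita I f g"
    and "FObj (Ten (MS affine_mon I)) \<in> extensional (Obj (Src (Ten (MS affine_mon I))))" "FArr (Ten (MS affine_mon I)) \<in> extensional (Arr (Src (Ten (MS affine_mon I))))"
  using I affine_ext_prod_simps[OF I I] by (simp_all add: affine_mon_def ito_def ita_def dd_def) (simp_all add: comp_f_def mk_fctr_def)

lemma affine_mon_ten_h: "\<lbrakk>small_cat I; f \<in> hN I X X'; g \<in> hN I Y Y'\<rbrakk> \<Longrightarrow> tenA (MS affine_mon I) f g = ita I f g"
  using affine_mon_ten(4)[of I f g] homA[of "NN ** I" f X X'] homA[of "NN ** I" g Y Y'] by simp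

lemma affine_mon_monoidal:
  assumes I: "small_cat I"
  shows "monoidal_category (DC D (NN ** I)) (MS affine_mon I)"
proof -
  interpret C: category "DC D (NN ** I)" using I by simp
  note t = affine_mon_ten[OF I] and th = affine_mon_ten_h[OF I]
  interpret m: monoidal_category "DC D (NN ** I)" "MS M (NN ** I)" using monoidal[of "NN ** I"] I by simp
  have "is_functor (Ten (MS affine_mon I))"
  proof (rule is_functor.intro, goal_cases)
    case 1 show ?case using is_functor.src_cat[OF m.ten_functor(1)] t(1) m.ten_functor(2) by simp
  next
    case 2 show ?case unfolding t(2) by (rule C.category_axioms)
  next
    case (3 x) then show ?case using t I by (cases x) simp
  next
    case (4 f x y) then show ?case unfolding t(1,2)
      using ita_in[OF I, of "fst f" "fst x" "fst y" "snd f" "snd x" "snd y"] th[of "fst f" "fst x" "fst y" "snd f" "snd x" "snd y"]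
        C.homD(4,5)[of "fst f" "fst x" "fst y"] C.homD(4,5)[of "snd f" "snd x" "snd y"] t(3)
      by (cases f; cases x; cases y) simp
  next
    case (5 x) then show ?case unfolding t(1,2)
      using t(3,4) ita_id[OF I, of "fst x" "snd x"] C.homD(1)[OF C.id_in[of "fst x"]] C.homD(1)[OF C.id_in[of "snd x"]] by (cases x) simp
  next
    case (6 f x y g z)
    obtain f1 f2 g1 g2 x1 x2 y1 y2 z1 z2 where e: "f = (f1, f2)" "g = (g1, g2)" "x = (x1, x2)" "y = (y1, y2)" "z = (z1, z2)"
      by (cases f; cases g; cases x; cases y; cases z) auto
    have h: "f1 \<in> hN I x1 y1" "f2 \<in> hN I x2 y2" "g1 \<in> hN I y1 z1" "g2 \<in> hN I y2 z2" using 6 e t(1) by simp_all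
    show ?case unfolding t(1,2) e
      using ita_comp[OF I h] th[OF h(1,2)] th[OF h(3,4)] th[OF C.comp_in[OF h(1,3)] C.comp_in[OF h(2,4)]]
        C.homD(1-3)[OF h(1)] C.homD(1-3)[OF h(2)] C.homD(1-3)[OF h(3)] C.homD(1-3)[OF h(4)] by simp
  qed (fact t(5,6))+
  note ten = this
  show ?thesis
  proof (rule monoidal_category.intro[OF C.category_axioms monoidal_category_axioms.intro], goal_cases)
    case 1 show ?case by (rule ten)
  next
    case 2 show ?case by (rule t(1))
  next
    case 3 show ?case by (rule t(2))
  next
    case 4 show ?case using I by simp
  next
    case (5 x y z) then show ?case using asc'(1)[OF I 5] I t(3) by simp
  next
    case (6 x y z) then show ?case using asc'(2)[OF I 6] by simp
  next
    case (7 f x x' g y y' h z z')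
    then show ?case using asc'_nat[OF I 7] th[OF 7(1,2)] th[OF 7(2,3)] th[OF ita_in[OF I 7(1,2)] 7(3)] th[OF 7(1) ita_in[OF I 7(2,3)]] by simp
  next
    case (8 x) then show ?case using lun'(1)[OF I 8] I t(3) by simp
  next
    case (9 x) then show ?case using lun'(2)[OF I 9] by simp
  next
    case (10 f x y) then show ?case using lun'_nat[OF I 10] th[OF C.id_in[OF uI_in[OF I]] 10] by simp
  next
    case (11 x) then show ?case using run'(1)[OF I 11] I t(3) by simp
  next
    case (12 x) then show ?case using run'(2)[OF I 12] by simp
  next
    case (13 f x y) then show ?case using run'_nat[OF I 13] th[OF 13 C.id_in[OF uI_in[OF I]]] by simp
  next
    case (14 w x y z)
    then show ?case using pentagon'[OF I 14] th[OF C.id_in[OF 14(1)] asc'(1)[OF I 14(2-4)]] th[OF asc'(1)[OF I 14(1-3)] C.id_in[OF 14(4)]]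
      t(3) I by simp
  next
    case (15 x y)
    then show ?case using triangle'[OF I 15] th[OF C.id_in[OF 15(1)] lun'(1)[OF I 15(2)]] th[OF run'(1)[OF I 15(1)] C.id_in[OF 15(2)]] by simp
  qed
qed

text \<open>On \<open>x y\<close> both sides give \<open>(f x) (g y)\<close>, since the comparison
  only re-reads elements over the target of \<open>u\<close>.\<close>

lemma iMu_nat:
  assumes u: "small_functor u" and f: "f \<in> hN (Trg u) X X'" and g: "g \<in> hN (Trg u) Y Y'"
  defines "U \<equiv> id_f NN *** u"
  shows "iMu u X' Y' \<cdot>[NN ** Src u] ita (Src u) (pa U f) (pa U g) = pa U (ita (Trg u) f g) \<cdot>[NN ** Src u] iMu u X Y"
proof -
  have S: "small_cat (Src u)" "small_cat (Trg u)" using u by simp_all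
  have U: "small_functor U" "Src U = NN ** Src u" "Trg U = NN ** Trg u" using u by (simp_all add: U_def)
  interpret C: category "DC D (NN ** Src u)" using S by simp
  interpret T: category "DC D (NN ** Trg u)" using S by simp
  note X = T.homD(4,5)[OF f] and Y = T.homD(4,5)[OF g]
  have uf: "pa U f \<in> hN (Src u) (pb U X) (pb U X')" and ug: "pa U g \<in> hN (Src u) (pb U Y) (pb U Y')"
    using pbA_in'[OF U f] pbA_in'[OF U g] by simp_all
  note fg = ita_in[OF S(2) f g]
  have ufg: "pa U (ita (Trg u) f g) \<in> hN (Src u) (pb U (ito (Trg u) X Y)) (pb U (ito (Trg u) X' Y'))"
    using pbA_in'[OF U fg] .
  note l = ita_in[OF S(1) uf ug] and m = iMu_in(1)[OF u X(1) Y(1), folded U_def] and m' = iMu_in(1)[OF u X(2) Y(2), folded U_def]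
  have UX: "pb U X \<in> ob (NN ** Src u)" "pb U Y \<in> ob (NN ** Src u)" using U X Y by simp_all
  show ?thesis
  proof (rule cancel2[OF S(1) UX C.comp_in[OF l m'] C.comp_in[OF m ufg]], goal_cases)
    case (1 A n m i P Q x y)
    note x = 1(1) and y = 1(2)
    note x' = elD[OF x] and y' = elD[OF y]
    note xy = el_mul[OF x y]
    have xu: "el A (Trg u) n (u oo i) P X x" and yu: "el A (Trg u) m (u oo i) Q Y y"
      using x y el_base_iff[of u "Src u" i X] el_base_iff[of u "Src u" i Y] u x' X Y by (simp_all add: U_def)
    have c: "cm <|n, i|> (pa U f) x = cm <|n, u oo i|> f x" "cm <|m, i|> (pa U g) y = cm <|m, u oo i|> g y"
      "cm <|nadd n m, i|> (pa U (ita (Trg u) f g)) z = cm <|nadd n m, u oo i|> (ita (Trg u) f g) z" for z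
      unfolding U_def using cmp_base[OF x'(1) u refl T.homD(1)[OF f]] cmp_base[OF y'(1) u refl T.homD(1)[OF g]]
        cmp_base[OF elD(1)[OF xy] u refl T.homD(1)[OF fg]] by simp_all
    note fx = el_cmp[OF x uf] and gy = el_cmp[OF y ug]
    show ?case
      using el_mult[OF xy l m'] el_mult[OF xy m ufg] mm_post[OF x y uf ug] mm_post[OF xu yu f g] c
        mm_mu[OF x[unfolded U_def] y[unfolded U_def] u refl X(1) Y(1), folded U_def] mm_mu[OF fx[unfolded U_def] gy[unfolded U_def] u refl X(2) Y(2), folded U_def] by simp
  qed
qed

end

section \<open>Restriction functors are strong monoidal\<close>

context mdv
begin

lemma iMu_el:
  assumes u: "small_functor u" and X: "X \<in> ob (NN ** Trg u)" and Y: "Y \<in> ob (NN ** Trg u)"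
    and x: "el A (Src u) n i P (pb (id_f NN *** u) X) x" and y: "el A (Src u) m i Q (pb (id_f NN *** u) Y) y"
  shows "el A (Trg u) n (u oo i) P X x" "el A (Trg u) m (u oo i) Q Y y"
    and "el A (Src u) (nadd n m) i (tO A P Q) (pb (id_f NN *** u) (ito (Trg u) X Y)) (mm (u oo i) n m X Y x y)"
    and "cm <|nadd n m, i|> (iMu u X Y) (mm i n m (pb (id_f NN *** u) X) (pb (id_f NN *** u) Y) x y) = mm (u oo i) n m X Y x y"
proof -
  note x' = elD[OF x]
  show c: "cm <|nadd n m, i|> (iMu u X Y) (mm i n m (pb (id_f NN *** u) X) (pb (id_f NN *** u) Y) x y) = mm (u oo i) n m X Y x y"
    by (rule mm_mu[OF x y u refl X Y])
  show "el A (Trg u) n (u oo i) P X x" "el A (Trg u) m (u oo i) Q Y y"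
    using x y el_base_iff[of u "Src u" i X] el_base_iff[of u "Src u" i Y] u x' X Y by simp_all
  show "el A (Src u) (nadd n m) i (tO A P Q) (pb (id_f NN *** u) (ito (Trg u) X Y)) (mm (u oo i) n m X Y x y)"
    using el_cmp[OF el_mul[OF x y] iMu_in(1)[OF u X Y]] c by simp
qed

text \<open>The associators over \<open>I\<close> and over \<open>J\<close> obey the same rule with
  the same fibre associator, as the stage and the domains of the elements do not change under
  re-reading.\<close>

lemma iMu_assoc:
  assumes u: "small_functor u" and X: "X \<in> ob (NN ** Trg u)" and Y: "Y \<in> ob (NN ** Trg u)" and Z: "Z \<in> ob (NN ** Trg u)"
  defines "U \<equiv> id_f NN *** u" and "I \<equiv> Src u" and "J \<equiv> Trg u"
  shows "pa U (asc' J X Y Z) \<cdot>[NN ** I] (iMu u (ito J X Y) Z \<cdot>[NN ** I] ita I (iMu u X Y) (idt (NN ** I) (pb U Z)))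
    = iMu u X (ito J Y Z) \<cdot>[NN ** I] (ita I (idt (NN ** I) (pb U X)) (iMu u Y Z) \<cdot>[NN ** I] asc' I (pb U X) (pb U Y) (pb U Z))"
proof -
  have S: "small_cat I" "small_cat J" using u by (simp_all add: I_def J_def)
  have U: "small_functor U" "Src U = NN ** I" "Trg U = NN ** J" using u by (simp_all add: U_def I_def J_def)
  note X = X[folded J_def] and Y = Y[folded J_def] and Z = Z[folded J_def]
  interpret C: category "DC D (NN ** I)" using S by simp
  interpret T: category "DC D (NN ** J)" using S by simp
  have UX: "pb U X \<in> ob (NN ** I)" "pb U Y \<in> ob (NN ** I)" "pb U Z \<in> ob (NN ** I)"
    using U X Y Z by simp_all
  note XY = ito_in[OF S(2) X Y] and YZ = ito_in[OF S(2) Y Z]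
  note in' = iMu_in(1)[OF u, folded U_def I_def J_def]
  note a = asc'(1)[OF S(2) X Y Z] and b = asc'(1)[OF S(1) UX]
  note ua = pbA_in'[OF U a]
  note l1 = ita_in[OF S(1) in'[OF X Y] C.id_in[OF UX(3)]] and r1 = ita_in[OF S(1) C.id_in[OF UX(1)] in'[OF Y Z]]
  show ?thesis
  proof (rule cancel3[OF S(1) UX C.comp_in[OF C.comp_in[OF l1 in'[OF XY Z]] ua] C.comp_in[OF C.comp_in[OF b r1] in'[OF X YZ]]], goal_cases)
    case (1 A n m l i P Q R x y z)
    note x = 1(1) and y = 1(2) and z = 1(3)
    note x' = elD[OF x] and y' = elD[OF y] and z' = elD[OF z]
    note E = iMu_el[OF u, folded U_def I_def J_def]
    note exy = E[OF X Y x y] and eyz = E[OF Y Z y z]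
    note exy_z = E[OF XY Z exy(3) z] and ex_yz = E[OF X YZ x eyz(3)]
    note xyz = el_mul[OF el_mul[OF x y] z] and xyz' = el_mul[OF x el_mul[OF y z]]
    have n: "nadd (nadd n m) l = nadd n (nadd m l)" using x' y' z' by simp
    have as: "Asc (MS M A) P Q R \<in> hm A (tO A (tO A P Q) R) (tO A P (tO A Q R))"
      using monoidal_category.asc_in[OF monoidal[OF x'(9)]] x' y' z' by simp
    have c: "cm <|nadd n (nadd m l), i|> (pa U (asc' J X Y Z)) w = cm <|nadd n (nadd m l), u oo i|> (asc' J X Y Z) w" for w
      unfolding U_def using cmp_base[OF elD(1)[OF xyz'] u I_def[symmetric, THEN meta_eq_to_obj_eq], of "asc' J X Y Z"] T.homD(1)[OF a] by (simp add: J_def)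
    note xyz = xyz[unfolded n]
    show ?case
      using el_mult[OF xyz C.comp_in[OF l1 in'[OF XY Z]] ua] el_mult[OF xyz l1 in'[OF XY Z]] el_mult[OF xyz C.comp_in[OF b r1] in'[OF X YZ]] el_mult[OF xyz b r1]
        mm_post_l[OF el_mul[OF x y] z in'[OF X Y], unfolded n] exy(4) exy_z(4)[unfolded n] c mm_asc[OF exy(1,2) eyz(2)]
        mm_asc[OF x y z] el_prec[OF xyz' r1 as] mm_post_r[OF x el_mul[OF y z] in'[OF Y Z]] eyz(4) ex_yz(4)
        el_prec[OF el_mul[OF x eyz(3)] in'[OF X YZ] as] by simp
  qed
qed

text \<open>The unit of \<open>J\<close> restricts strictly to the unit of \<open>I\<close> and has
  the same unit element, so both sides follow the rule \<open>e x \<mapsto> x\<close>.\<close>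

lemma iMu_lun:
  assumes u: "small_functor u" and X: "X \<in> ob (NN ** Trg u)"
  defines "U \<equiv> id_f NN *** u" and "I \<equiv> Src u" and "J \<equiv> Trg u"
  shows "pa U (lun' J X) \<cdot>[NN ** I] iMu u (uI J) X = lun' I (pb U X)"
proof -
  have S: "small_cat I" "small_cat J" using u by (simp_all add: I_def J_def)
  have U: "small_functor U" "Src U = NN ** I" "Trg U = NN ** J" using u by (simp_all add: U_def I_def J_def)
  note X = X[folded J_def] and uI = uI_in[OF S(2)]
  interpret C: category "DC D (NN ** I)" using S by simp
  interpret T: category "DC D (NN ** J)" using S by simp
  have UX: "pb U X \<in> ob (NN ** I)" using U X by simp
  have uu: "pb U (uI J) = uI I" using uI_pb[OF u] by (simp add: U_def I_def J_def)
  note in' = iMu_in(1)[OF u, folded U_def I_def J_def, OF uI X, unfolded uu]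
  note a = lun'(1)[OF S(2) X] and b = lun'(1)[OF S(1) UX]
  note ua = pbA_in'[OF U a]
  show ?thesis
  proof (rule cancel_l[OF S(1) UX C.comp_in[OF in' ua] b], goal_cases)
    case (1 A n i P x)
    note x = 1(1)
    note x' = elD[OF x]
    have n: "nadd (nzero A) n = n" using x' by simp
    note e = eu_el[OF x'(4,6,8)]
    note E = iMu_el[OF u, folded U_def I_def J_def, OF uI X, unfolded uu, OF e x, unfolded n]
    have c: "cm <|n, i|> (pa U (lun' J X)) w = cm <|n, u oo i|> (lun' J X) w" for w
      unfolding U_def using cmp_base[OF x'(1) u I_def[symmetric, THEN meta_eq_to_obj_eq], of "lun' J X"] T.homD(1)[OF a] by (simp add: J_def)
    show ?case
      using el_mult[OF el_mul[OF e x, unfolded n] in' ua] E(4) c mm_lun[OF E(2)] mm_lun[OF x] by simp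
  qed
qed

lemma iMu_run:
  assumes u: "small_functor u" and X: "X \<in> ob (NN ** Trg u)"
  defines "U \<equiv> id_f NN *** u" and "I \<equiv> Src u" and "J \<equiv> Trg u"
  shows "pa U (run' J X) \<cdot>[NN ** I] iMu u X (uI J) = run' I (pb U X)"
proof -
  have S: "small_cat I" "small_cat J" using u by (simp_all add: I_def J_def)
  have U: "small_functor U" "Src U = NN ** I" "Trg U = NN ** J" using u by (simp_all add: U_def I_def J_def)
  note X = X[folded J_def] and uI = uI_in[OF S(2)]
  interpret C: category "DC D (NN ** I)" using S by simp
  interpret T: category "DC D (NN ** J)" using S by simp
  have UX: "pb U X \<in> ob (NN ** I)" using U X by simp
  have uu: "pb U (uI J) = uI I" using uI_pb[OF u] by (simp add: U_def I_def J_def)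
  note in' = iMu_in(1)[OF u, folded U_def I_def J_def, OF X uI, unfolded uu]
  note a = run'(1)[OF S(2) X] and b = run'(1)[OF S(1) UX]
  note ua = pbA_in'[OF U a]
  show ?thesis
  proof (rule cancel_r[OF S(1) UX C.comp_in[OF in' ua] b], goal_cases)
    case (1 A n i P x)
    note x = 1(1)
    note x' = elD[OF x]
    have n: "nadd n (nzero A) = n" using x' by simp
    note e = eu_el[OF x'(4,6,8)]
    note E = iMu_el[OF u, folded U_def I_def J_def, OF X uI, unfolded uu, OF x e, unfolded n]
    have c: "cm <|n, i|> (pa U (run' J X)) w = cm <|n, u oo i|> (run' J X) w" for w
      unfolding U_def using cmp_base[OF x'(1) u I_def[symmetric, THEN meta_eq_to_obj_eq], of "run' J X"] T.homD(1)[OF a] by (simp add: J_def)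
    show ?case
      using el_mult[OF el_mul[OF x e, unfolded n] in' ua] E(4) c mm_run[OF E(1)] mm_run[OF x] by simp
  qed
qed

lemma affine_mon_strong:
  assumes u: "small_functor u"
  shows "strong_monoidal (DF D (id_f NN *** u)) (MS affine_mon (Trg u)) (MS affine_mon (Src u)) (Mu affine_mon u) (Ep affine_mon u)"
proof -
  define U where "U = id_f NN *** u"
  have S: "small_cat (Src u)" "small_cat (Trg u)" using u by simp_all
  have U: "small_functor U" "Src U = NN ** Src u" "Trg U = NN ** Trg u" using u by (simp_all add: U_def)
  interpret C: category "DC D (NN ** Src u)" using S by simp
  interpret T: category "DC D (NN ** Trg u)" using S by simp
  note t = affine_mon_ten(3)[OF S(2)] affine_mon_ten(3)[OF S(1)] and th = affine_mon_ten_h[OF S(1)] affine_mon_ten_h[OF S(2)]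
  note in' = iMu_in[OF u, folded U_def]
  have pO: "X \<in> ob (NN ** Trg u) \<Longrightarrow> pb U X \<in> ob (NN ** Src u)" for X using U by simp
  have uu: "pb U (uI (Trg u)) = uI (Src u)" using uI_pb[OF u] by (simp add: U_def)
  note iu = C.id_in[OF uI_in[OF S(1)]]
  show ?thesis unfolding U_def[symmetric]
  proof (rule strong_monoidal.intro, goal_cases)
    case 1 show ?case using DF_functor[OF U(1)] .
  next
    case 2 show ?case using affine_mon_monoidal[OF S(2)] U by simp
  next
    case 3 show ?case using affine_mon_monoidal[OF S(1)] U by simp
  next
    case (4 x y) then show ?case using in'(1)[of x y] U t pO by simp
  next
    case (5 x y) then show ?case using in'(2)[of x y] U by simp
  next
    case (6 f x x' g y y')
    then have f: "f \<in> hN (Trg u) x x'" and g: "g \<in> hN (Trg u) y y'" using U by simp_all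
    show ?case using iMu_nat[OF u f g, folded U_def] th(1)[OF pbA_in'[OF U f] pbA_in'[OF U g]] th(2)[OF f g] U by simp
  next
    case 7 show ?case using iu uu U by simp
  next
    case 8 show ?case using C.iso_id[OF uI_in[OF S(1)]] U by simp
  next
    case (9 x y z)
    then have o: "x \<in> ob (NN ** Trg u)" "y \<in> ob (NN ** Trg u)" "z \<in> ob (NN ** Trg u)" using U by simp_all
    show ?case using iMu_assoc[OF u o, folded U_def] th(1)[OF in'(1)[OF o(1,2)] C.id_in[OF pO[OF o(3)]]]
        th(1)[OF C.id_in[OF pO[OF o(1)]] in'(1)[OF o(2,3)]] t(1)[OF o(1,2)] t(1)[OF o(2,3)] U by simp
  next
    case (10 x)
    then have o: "x \<in> ob (NN ** Trg u)" using U by simp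
    show ?case using iMu_lun[OF u o, folded U_def] th(1)[OF iu C.id_in[OF pO[OF o]]] ita_id[OF S(1) uI_in[OF S(1)] pO[OF o]]
        C.idr[OF in'(1)[OF uI_in[OF S(2)] o]] uu U by simp
  next
    case (11 x)
    then have o: "x \<in> ob (NN ** Trg u)" using U by simp
    show ?case using iMu_run[OF u o, folded U_def] th(1)[OF C.id_in[OF pO[OF o]] iu] ita_id[OF S(1) pO[OF o] uI_in[OF S(1)]]
        C.idr[OF in'(1)[OF o uI_in[OF S(2)]]] uu U by simp
  qed
qed

text \<open>The unit is restricted along the projection to \<open>NN\<close>, where the product of
  the identity transformation with \<alpha> becomes trivial.\<close>

lemma sh_uI:
  assumes a: "small_trans \<alpha>"
  shows "sh \<alpha> (uI (Trg (NSrc \<alpha>))) = idt (NN ** Src (NSrc \<alpha>)) (uI (Src (NSrc \<alpha>)))"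
proof -
  note a' = small_transD[OF a]
  let ?\<alpha> = "id_n (id_f NN) \<otimes>\<^sub>t \<alpha>" and ?I = "Src (NSrc \<alpha>)" and ?J = "Trg (NSrc \<alpha>)"
  have s: "small_cat ?I" "small_cat ?J" "small_trans ?\<alpha>" using a' a by simp_all
  interpret J: category ?J using s by simp
  have "hcomp (id_n (prj1 NN ?J)) ?\<alpha> = id_n (prj1 NN ?I)"
  proof (rule small_trans_eqI)
    fix z assume "z \<in> Obj (Src (NSrc (id_n (prj1 NN ?I))))"
    then obtain x where z: "z = Pr (Num 0) x" "x \<in> Obj ?I" by (auto simp: prod_Obj)
    have c: "Cpt \<alpha> x \<in> hom ?J (FObj (NSrc \<alpha>) x) (FObj (NTrg \<alpha>) x)" using nat_trans.cpt_in[OF a'(1) z(2)] .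
    note o = J.homD(5)[OF c]
    show "Cpt (hcomp (id_n (prj1 NN ?J)) ?\<alpha>) z = Cpt (id_n (prj1 NN ?I)) z"
      using z o J.homD(1)[OF c] small_functor_obj[OF a'(3), of x] s a' by simp
  qed (use a' s in simp_all)
  then show ?thesis
    using DT_whisker_right[OF s(3), of "prj1 NN ?J" "FObj (lan D (obj_f NN (Num 0))) (un pt)"] DT_id_n[of "prj1 NN ?I" "FObj (lan D (obj_f NN (Num 0))) (un pt)"]
      uI_eq[OF s(2)] uI_eq[OF s(1)] s a' lan_un(1) by (simp add: sh_def)
qed

text \<open>The laws for \<open>Mu\<close> are tested on products of elements. There the comparisons
  merely re-read elements, so their functoriality in \<open>u\<close> holds by inspection, and
  compatibility with transformations is \<open>mm_trans\<close>.\<close>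

theorem affine_monoidal_prederivator: "monoidal_prederivator (affine_line D) affine_mon"
proof -
  have el_id: "(id_f I) oo i = i" if "small_functor i" "Trg i = I" for i I using that by simp
  show ?thesis
  proof (rule monoidal_prederivator.intro[OF shift_prederivator[OF small_NN] monoidal_prederivator_axioms.intro], goal_cases)
    case (1 A) then show ?case using affine_mon_monoidal by simp
  next
    case (2 u) then show ?case using affine_mon_strong by simp
  next
    case (3 A X Y)
    then have o: "X \<in> ob (NN ** A)" "Y \<in> ob (NN ** A)" by simp_all
    interpret C: category "DC D (NN ** A)" using 3 by simp
    have pX: "pb (id_f NN *** id_f A) X = X" "pb (id_f NN *** id_f A) Y = Y" "pb (id_f NN *** id_f A) (ito A X Y) = ito A X Y"
      using 3(1) o ito_in[OF 3(1) o] by simp_all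
    have m: "iMu (id_f A) X Y \<in> hN A (ito A X Y) (ito A X Y)" using iMu_in(1)[of "id_f A" X Y] pX 3 o by simp
    have "iMu (id_f A) X Y = idt (NN ** A) (ito A X Y)"
    proof (rule cancel2[OF 3(1) o m C.id_in[OF ito_in[OF 3(1) o]]], goal_cases)
      case (1 B n m i P Q x y)
      note x = 1(1) and y = 1(2)
      show ?case
        using mm_mu[of B A n i P "id_f A" X x m Q Y y] x y pX 3 o el_crt[OF el_mul[OF x y]] elD[OF x] by simp
    qed
    then show ?case using affine_mon_ten(3)[OF 3(1) o] by simp
  next
    case (4 A) then show ?case by simp
  next
    case (5 u v X Y)
    define U V where "U = id_f NN *** u" and "V = id_f NN *** v"
    note u = 5(1) and v = 5(2) and e = 5(3)
    have o: "X \<in> ob (NN ** Trg v)" "Y \<in> ob (NN ** Trg v)" using 5 by simp_all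
    have S: "small_cat (Src u)" "small_cat (Trg u)" "small_cat (Trg v)" using u v by simp_all
    interpret C: category "DC D (NN ** Src u)" using S by simp
    interpret T: category "DC D (NN ** Trg u)" using S by simp
    have UV: "small_functor U" "Src U = NN ** Src u" "Trg U = NN ** Trg u" "small_functor V" "Src V = NN ** Trg u" "Trg V = NN ** Trg v"
      using u v e by (simp_all add: U_def V_def)
    have vu: "small_functor (v oo u)" "id_f NN *** (v oo u) = V oo U" using u v e prod_comp_sf[of "id_f NN" u "id_f NN" v] by (simp_all add: U_def V_def)
    have VX: "pb V X \<in> ob (NN ** Trg u)" "pb V Y \<in> ob (NN ** Trg u)" using UV o by simp_all
    have UVX: "pb U (pb V X) \<in> ob (NN ** Src u)" "pb U (pb V Y) \<in> ob (NN ** Src u)" using UV VX by simp_all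
    note mv = iMu_in(1)[OF v o, folded V_def, unfolded e] and mu = iMu_in(1)[OF u VX, folded U_def]
    note umv = pbA_in'[OF UV(1-3) mv]
    have mvu: "iMu (v oo u) X Y \<in> hN (Src u) (ito (Src u) (pb U (pb V X)) (pb U (pb V Y))) (pb U (pb V (ito (Trg v) X Y)))"
      using iMu_in(1)[OF vu(1), of X Y] vu(2) UV o S ito_in[OF S(3) o] u v e by simp
    have "iMu (v oo u) X Y = pa U (iMu v X Y) \<cdot>[NN ** Src u] iMu u (pb V X) (pb V Y)"
    proof (rule cancel2[OF S(1) UVX mvu C.comp_in[OF mu umv]], goal_cases)
      case (1 B n m i P Q x y)
      note x = 1(1) and y = 1(2)
      note x' = elD[OF x]
      note E = iMu_el[OF u VX, folded U_def, OF x y]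
      note E2 = iMu_el[OF v o, folded V_def, unfolded e, OF E(1,2)]
      have c: "cm <|nadd n m, i|> (pa U (iMu v X Y)) w = cm <|nadd n m, u oo i|> (iMu v X Y) w" for w
        unfolding U_def using cmp_base[OF elD(1)[OF el_mul[OF x y]] u refl T.homD(1)[OF mv]] .
      have "x \<in> H D <|n, i|> P (pb (id_f NN *** (v oo u)) X)" "y \<in> H D <|m, i|> Q (pb (id_f NN *** (v oo u)) Y)"
        using elD(2)[OF x] elD(2)[OF y] vu UV o by simp_all
      then have "el B (Src (v oo u)) n i P (pb (id_f NN *** (v oo u)) X) x" "el B (Src (v oo u)) m i Q (pb (id_f NN *** (v oo u)) Y) y"
        using elI elD(1)[OF x] elD(1)[OF y] u v e by simp_all
      note E3 = iMu_el(4)[OF vu(1) _ _ this]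
      show ?case
        using E3 el_mult[OF el_mul[OF x y] mu umv] E(4) E2(4) c vu(2) UV o u v e x' by simp
    qed
    then show ?case by (simp add: U_def V_def)
  next
    case (6 u v)
    have S: "small_cat (Src u)" using 6 by simp
    have "pa (id_f NN *** u) (idt (NN ** Src v) (uI (Src v))) = idt (NN ** Src u) (uI (Src u))"
      using uI_pb[OF 6(1)] 6 pbA_Idt[of "id_f NN *** u" "uI (Src v)" "NN ** Src v"] by simp
    then show ?case using category.idl[OF DC_cat category.id_in[OF DC_cat uI_in[OF S]]] S by simp
  next
    case (7 \<alpha> u v X Y)
    note a = 7(1) and a' = small_transD[OF 7(1)]
    have uv: "u = NSrc \<alpha>" "v = NTrg \<alpha>" by fact+
    define U V where "U = id_f NN *** u" and "V = id_f NN *** v"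
    have u: "small_functor u" "small_functor v" "Src v = Src u" "Trg v = Trg u" using a' uv by simp_all
    have o: "X \<in> ob (NN ** Trg u)" "Y \<in> ob (NN ** Trg u)" using 7 by simp_all
    have o': "X \<in> ob (NN ** Trg v)" "Y \<in> ob (NN ** Trg v)" using o u by simp_all
    have S: "small_cat (Src u)" "small_cat (Trg u)" using u by simp_all
    interpret C: category "DC D (NN ** Src u)" using S by simp
    note sh = sh_in[OF a, folded uv, folded U_def V_def]
    have UX: "pb U X \<in> ob (NN ** Src u)" "pb U Y \<in> ob (NN ** Src u)" using u S o by (simp_all add: U_def)
    note mu = iMu_in(1)[OF u(1) o, folded U_def] and mv = iMu_in(1)[OF u(2) o', folded V_def, unfolded u(3,4)]
    note ss = ita_in[OF S(1) sh[OF o(1)] sh[OF o(2)]]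
    have "sh \<alpha> (ito (Trg u) X Y) \<cdot>[NN ** Src u] iMu u X Y = iMu v X Y \<cdot>[NN ** Src u] ita (Src u) (sh \<alpha> X) (sh \<alpha> Y)"
    proof (rule cancel2[OF S(1) UX C.comp_in[OF mu sh[OF ito_in[OF S(2) o]]] C.comp_in[OF ss mv]], goal_cases)
      case (1 B n m i P Q x y)
      note x = 1(1) and y = 1(2)
      note E = iMu_el[OF u(1) o, folded U_def, OF x y]
      note E2 = iMu_el[OF u(2) o', folded V_def, unfolded u(3,4), OF el_cmp[OF x sh[OF o(1)]] el_cmp[OF y sh[OF o(2)]]]
      show ?case
        using el_mult[OF el_mul[OF x y] mu sh[OF ito_in[OF S(2) o]]] E(4) el_mult[OF el_mul[OF x y] ss mv] mm_post[OF x y sh[OF o(1)] sh[OF o(2)]]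
          E2(4) mm_trans[OF a, folded uv, OF x[unfolded U_def] y[unfolded U_def] o] by simp
    qed
    then show ?case using affine_mon_ten(3)[OF S(2) o] affine_mon_ten_h[OF S(1) sh[OF o(1)] sh[OF o(2)]] by (simp add: sh_def)
  next
    case (8 \<alpha> u v)
    have S: "small_cat (Src u)" "Src v = Src u" using small_transD[OF 8(1)] 8 by simp_all
    show ?case using sh_uI[OF 8(1)] category.idl[OF DC_cat category.id_in[OF DC_cat uI_in[OF S(1)]]] S 8 by (simp add: sh_def)
  qed
qed

end

section \<open>The induced external product and its cocontinuity\<close>

context mdv
begin

definition ixO :: "'k scat \<Rightarrow> 'k scat \<Rightarrow> 'o \<Rightarrow> 'o \<Rightarrow> 'o" where
  "ixO I J X Y = ito (I ** J) (pb (id_f NN *** prj1 I J) X) (pb (id_f NN *** prj2 I J) Y)"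

text \<open>The comparison of the external product induced by the internal one with \<open>affine_ext_prod\<close>.\<close>

definition ithe :: "'k scat \<Rightarrow> 'k scat \<Rightarrow> 'o \<Rightarrow> 'o \<Rightarrow> 'm" where
  "ithe I J X Y = pa (dd (I ** J)) (affine_ext_mu D M (prj1 I J) (prj2 I J) X Y)"

lemma ithe:
  assumes S: "small_cat I" "small_cat J" and X: "X \<in> ob (NN ** I)" and Y: "Y \<in> ob (NN ** J)"
  shows "ithe I J X Y \<in> hN (I ** J) (ixO I J X Y) (axO I J X Y)" "isoin (NN ** (I ** J)) (ithe I J X Y)"
proof -
  let ?p = "prj1 I J" and ?q = "prj2 I J" and ?d = "dd (I ** J)"
  have pq: "small_functor ?p" "small_functor ?q" "small_functor ?d" using S by simp_all
  note a = aem[OF pq(1,2), of X Y]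
  \<comment> \<open>The diagonal followed by the two projections is the identity, so the target of
    the comparison is strictly \<open>axO I J X Y\<close>.\<close>
  have "(id_f NN *** ?p *** ?q) oo ?d = id_f (NN ** (I ** J))"
    using S by (intro small_eqI) (auto simp: dd_def prod_Obj prod_Arr)
  then have e: "pb ?d (pb (id_f NN *** ?p *** ?q) (axO I J X Y)) = axO I J X Y"
    using pbO_comp[of ?d "id_f NN *** ?p *** ?q" "axO I J X Y"] S X Y by simp
  show "ithe I J X Y \<in> hN (I ** J) (ixO I J X Y) (axO I J X Y)"
    using pbA_in'[OF pq(3) _ _ a(1)] S X Y e by (simp add: ithe_def ixO_def ito_def)
  show "isoin (NN ** (I ** J)) (ithe I J X Y)"
    using pbA_iso[OF pq(3)] a(2) S X Y by (simp add: ithe_def)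
qed

lemma opc_iso_cancel:
  assumes f: "f \<in> H D u X Y" and h: "h \<in> hm (Trg u) Y Z" "isoin (Trg u) h" and o: "opc D u X Z (cm u h f)"
  shows "opc D u X Y f"
proof -
  interpret T: category "DC D (Trg u)" using HD(1)[OF f] by simp
  obtain g where g: "g \<in> hm (Trg u) Z Y" "g \<cdot>[Trg u] h = idt (Trg u) Y" "isoin (Trg u) g"
    using T.isoE[OF h(2,1)] by metis
  have "cm u g (cm u h f) = f" using cmp_mult[OF f h(1) g(1)] g(2) cmp_crt[OF f refl] by simp
  then show ?thesis using opc_iso_post[OF o g(1)] g(3) by simp
qed

text \<open>The isomorphism \<open>ithe\<close> carries this internal product of elements to their
  external product, which is opcartesian by \<open>mul_opc_ext\<close>; an isomorphism in the target
  can be cancelled.\<close>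

lemma ixm_opc:
  assumes x: "opc D (id_f NN *** u) P X x" and y: "opc D (id_f NN *** v) Q Y y" and u: "small_functor u" and v: "small_functor v"
    and A: "Src u = A" "Src v = C" and I: "Trg u = I" "Trg v = J"
  defines "p \<equiv> prj1 (NN ** A) (NN ** C)" and "q \<equiv> prj2 (NN ** A) (NN ** C)"
  defines "n \<equiv> prj1 NN A oo p" and "m \<equiv> prj1 NN C oo q" and "i \<equiv> prj2 NN A oo p" and "j \<equiv> prj2 NN C oo q"
  shows "el ((NN ** A) ** (NN ** C)) (I ** J) n <|u oo i, v oo j|> (pb p P) (pb (id_f NN *** prj1 I J) X) (pa p x)"
    and "el ((NN ** A) ** (NN ** C)) (I ** J) m <|u oo i, v oo j|> (pb q Q) (pb (id_f NN *** prj2 I J) Y) (pa q y)"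
    and "opc D <|nadd n m, <|u oo i, v oo j|>|> (exO (NN ** A) (NN ** C) P Q) (ixO I J X Y)
      (mm <|u oo i, v oo j|> n m (pb (id_f NN *** prj1 I J) X) (pb (id_f NN *** prj2 I J) Y) (pa p x) (pa q y))"
proof -
  have S: "small_cat A" "small_cat C" "small_cat I" "small_cat J" using u v A I by auto
  note xH = HD[OF opcD[OF x]] and yH = HD[OF opcD[OF y]]
  have sp: "small_functor p" "small_functor q" "Src p = (NN ** A) ** (NN ** C)" "Src q = (NN ** A) ** (NN ** C)" "Trg p = NN ** A" "Trg q = NN ** C"
    using S by (simp_all add: p_def q_def)
  let ?B = "(NN ** A) ** (NN ** C)"
  have sn: "small_functor n" "small_functor m" "small_functor i" "small_functor j" "Src n = ?B" "Src m = ?B" "Src i = ?B" "Src j = ?B"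
    "Trg n = NN" "Trg m = NN" "Trg i = A" "Trg j = C"
    using sp S by (simp_all add: n_def m_def i_def j_def)
  have XY: "X \<in> ob (NN ** I)" "Y \<in> ob (NN ** J)" using xH yH I by simp_all
  let ?k = "<|u oo i, v oo j|>"
  have b: "bs ?B I n (u oo i)" "bs ?B J m (v oo j)" "bs ?B (I ** J) n ?k" "bs ?B (I ** J) m ?k"
    using sn u v A I by (simp_all add: bs_def)
  have xp: "pa p x \<in> H D <|n, u oo i|> (pb p P) X"
    using pb_H[OF opcD[OF x] sp(1), of "id_f (NN ** I)" "<|n, u oo i|>"] sp sn u A I S XY pair_eta[of p NN A]
    by (simp add: n_def i_def prod_sf_eq)
  have yq: "pa q y \<in> H D <|m, v oo j|> (pb q Q) Y"
    using pb_H[OF opcD[OF y] sp(2), of "id_f (NN ** J)" "<|m, v oo j|>"] sp sn v A I S XY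
    by (simp add: m_def j_def prod_sf_eq)
  have ex: "el ?B I n (u oo i) (pb p P) X (pa p x)" and ey: "el ?B J m (v oo j) (pb q Q) Y (pa q y)"
    using elI[OF b(1) xp] elI[OF b(2) yq] .
  have pk: "prj1 I J oo ?k = u oo i" "prj2 I J oo ?k = v oo j" using sn u v A I by simp_all
  show x1: "el ?B (I ** J) n ?k (pb p P) (pb (id_f NN *** prj1 I J) X) (pa p x)"
    using el_base_iff[of "prj1 I J" "I ** J" ?k X ?B n] ex pk S sn u v A I XY by simp
  show y1: "el ?B (I ** J) m ?k (pb q Q) (pb (id_f NN *** prj2 I J) Y) (pa q y)"
    using el_base_iff[of "prj2 I J" "I ** J" ?k Y ?B m] ey pk S sn u v A I XY by simp
  let ?f = "mm ?k n m (pb (id_f NN *** prj1 I J) X) (pb (id_f NN *** prj2 I J) Y) (pa p x) (pa q y)"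
  note f = el_mul[OF x1 y1]
  have a: "affine_ext_mu D M (prj1 I J) (prj2 I J) X Y \<in> ar (NN ** ((I ** J) ** (I ** J)))"
    using homA[OF _ aem(1)[of "prj1 I J" "prj2 I J" X Y]] S XY by simp
  have "cm <|nadd n m, ?k|> (ithe I J X Y) ?f = cm <|nadd n m, <|?k, ?k|>|> (affine_ext_mu D M (prj1 I J) (prj2 I J) X Y) ?f"
    unfolding ithe_def by (rule cmp_dd[OF elD(1)[OF f] a])
  also have "\<dots> = mul (u oo i) (v oo j) n m X Y (pa p x) (pa q y)"
    using mul_mu[OF b(3,4), of "prj1 I J" "prj2 I J" X Y "pa p x" "pb p P" "pa q y" "pb q Q"] elD(2)[OF x1] elD(2)[OF y1] pk S XY by simp
  finally have c: "cm <|nadd n m, ?k|> (ithe I J X Y) ?f = mul (u oo i) (v oo j) n m X Y (pa p x) (pa q y)" .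
  have "opc D <|nadd n m, ?k|> (exO (NN ** A) (NN ** C) P Q) (axO I J X Y) (mul (u oo i) (v oo j) n m X Y (pa p x) (pa q y))"
    using mul_opc_ext[OF x y, of I J] u v A I S by (simp add: n_def m_def i_def j_def p_def q_def)
  then have o: "opc D <|nadd n m, ?k|> (exO (NN ** A) (NN ** C) P Q) (axO I J X Y) (cm <|nadd n m, ?k|> (ithe I J X Y) ?f)" using c by simp
  have fe: "?f \<in> H D <|nadd n m, ?k|> (exO (NN ** A) (NN ** C) P Q) (ixO I J X Y)"
    using elD(2)[OF f] by (simp add: exO_def ixO_def p_def q_def)
  show "opc D <|nadd n m, ?k|> (exO (NN ** A) (NN ** C) P Q) (ixO I J X Y) ?f"
    by (rule opc_iso_cancel[OF fe _ _ o]) (use ithe[OF S(3,4) XY] sn u v A I S in simp_all)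
qed

text \<open>Apply the arrow to the product of the tautological elements of \<open>X\<close> and
  \<open>Y\<close>. That product is opcartesian and is sent to the product of \<open>x\<close> and
  \<open>y\<close>, also opcartesian, so cancellation applies.\<close>

lemma ix_opc:
  assumes x: "opc D (id_f NN *** u) X W x" and y: "opc D (id_f NN *** v) Y Z y" and u: "small_functor u" and v: "small_functor v"
    and A: "Src u = A" "Src v = C" and I: "Trg u = I" "Trg v = J"
  shows "opc D (id_f NN *** (u *** v)) (ixO A C X Y) (ixO I J W Z)
    (iMu (u *** v) (pb (id_f NN *** prj1 I J) W) (pb (id_f NN *** prj2 I J) Z) \<cdot>[NN ** (A ** C)]
     ita (A ** C) (pa (id_f NN *** prj1 A C) x) (pa (id_f NN *** prj2 A C) y))"
    (is "opc D ?w _ _ (?mu \<cdot>\<^bsub>_\<^esub> ita _ ?px ?qy)")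
proof -
  have S: "small_cat A" "small_cat C" "small_cat I" "small_cat J" using u v A I by auto
  have sw: "small_functor (u *** v)" "Src (u *** v) = A ** C" "Trg (u *** v) = I ** J" using u v A I by simp_all
  note xH = HD[OF opcD[OF x]] and yH = HD[OF opcD[OF y]]
  have O: "X \<in> ob (NN ** A)" "Y \<in> ob (NN ** C)" "W \<in> ob (NN ** I)" "Z \<in> ob (NN ** J)"
    using xH yH A I by simp_all
  let ?p = "prj1 (NN ** A) (NN ** C)" and ?q = "prj2 (NN ** A) (NN ** C)"
  let ?n = "prj1 NN A oo ?p" and ?m = "prj1 NN C oo ?q" and ?i = "prj2 NN A oo ?p" and ?j = "prj2 NN C oo ?q"
  let ?B = "(NN ** A) ** (NN ** C)" and ?k = "<|prj2 NN A oo ?p, prj2 NN C oo ?q|>" and ?l = "<|u oo (prj2 NN A oo ?p), v oo (prj2 NN C oo ?q)|>"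
  let ?X = "pb (id_f NN *** prj1 A C) X" and ?Y = "pb (id_f NN *** prj2 A C) Y"
    and ?W = "pb (id_f NN *** prj1 I J) W" and ?Z = "pb (id_f NN *** prj2 I J) Z"
  let ?x0 = "idt ?B (pb ?p X)" and ?y0 = "idt ?B (pb ?q Y)"
  have idX: "opc D (id_f NN *** id_f A) X X (idt (NN ** A) X)" "opc D (id_f NN *** id_f C) Y Y (idt (NN ** C) Y)"
    using opc_iso_id[OF _ category.id_in[OF DC_cat O(1)] category.iso_id[OF DC_cat O(1)]] opc_iso_id[OF _ category.id_in[OF DC_cat O(2)] category.iso_id[OF DC_cat O(2)]] S
    by simp_all
  \<comment> \<open>The instance with identity functors provides the opcartesian product of
    tautological elements.\<close>
  note f = ixm_opc[OF idX small_id[OF S(1)] small_id[OF S(2)], of A C A C]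
  note g = ixm_opc[OF x y u v A I]
  have f1: "el ?B (A ** C) ?n ?k (pb ?p X) ?X ?x0" "el ?B (A ** C) ?m ?k (pb ?q Y) ?Y ?y0"
    and f3: "opc D <|nadd ?n ?m, ?k|> (exO (NN ** A) (NN ** C) X Y) (ixO A C X Y) (mm ?k ?n ?m ?X ?Y ?x0 ?y0)"
    using f S O by simp_all
  have e1: "pb (id_f NN *** prj1 A C) (pb (id_f NN *** u) W) = pb ?w ?W" "pb (id_f NN *** prj2 A C) (pb (id_f NN *** v) Z) = pb ?w ?Z"
    using pbO_comp[of "id_f NN *** prj1 A C" "id_f NN *** u" W] pbO_comp[of "id_f NN *** prj2 A C" "id_f NN *** v" Z]
      pbO_comp[of ?w "id_f NN *** prj1 I J" W] pbO_comp[of ?w "id_f NN *** prj2 I J" Z] u v A I S O by (simp_all add: prod_comp_sf del: pbO_comp)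
  have px: "?px \<in> hN (A ** C) ?X (pb ?w ?W)" and qy: "?qy \<in> hN (A ** C) ?Y (pb ?w ?Z)"
    using pbA_in'[of "id_f NN *** prj1 A C" _ "NN ** A" x X "pb (id_f NN *** u) W"] pbA_in'[of "id_f NN *** prj2 A C" _ "NN ** C" y Y "pb (id_f NN *** v) Z"]
      xH yH e1 S A by simp_all
  have WZ: "?W \<in> ob (NN ** (I ** J))" "?Z \<in> ob (NN ** (I ** J))" using S O by simp_all
  note mu = iMu_in(1)[OF sw(1), unfolded sw(2,3), OF WZ]
  note pq = ita_in[OF small_prod[OF S(1,2)] px qy]
  note mupq = category.comp_in[OF DC_cat pq mu]
  \<comment> \<open>Applied to a tautological element, the restriction of \<open>x\<close> or
    \<open>y\<close> returns that restriction itself, read as an element.\<close>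
  have c1: "cm <|?n, ?k|> ?px ?x0 = pa ?p x" "cm <|?m, ?k|> ?qy ?y0 = pa ?q y"
  proof -
    have "cm <|?n, ?k|> ?px ?x0 = cm <|?n, prj1 A C oo ?k|> x ?x0"
      by (rule cmp_base[OF elD(1)[OF f1(1)]]) (use S xH A in simp_all)
    also have "<|?n, prj1 A C oo ?k|> = ?p" using S pair_eta[of ?p NN A] by simp
    also have "cm ?p x ?x0 = pa ?p x" using cmp_Idt[OF opcD[OF x], of ?p ?B] S A by simp
    finally show "cm <|?n, ?k|> ?px ?x0 = pa ?p x" .
    have "cm <|?m, ?k|> ?qy ?y0 = cm <|?m, prj2 A C oo ?k|> y ?y0"
      by (rule cmp_base[OF elD(1)[OF f1(2)]]) (use S yH A in simp_all)
    also have "<|?m, prj2 A C oo ?k|> = ?q" using S pair_eta[of ?q NN C] by simp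
    also have "cm ?q y ?y0 = pa ?q y" using cmp_Idt[OF opcD[OF y], of ?q ?B] S A by simp
    finally show "cm <|?m, ?k|> ?qy ?y0 = pa ?q y" .
  qed
  have kl: "(u *** v) oo ?k = ?l" using u v A I S by simp
  have "cm <|nadd ?n ?m, ?k|> (?mu \<cdot>[NN ** (A ** C)] ita (A ** C) ?px ?qy) (mm ?k ?n ?m ?X ?Y ?x0 ?y0)
    = cm <|nadd ?n ?m, ?k|> ?mu (mm ?k ?n ?m (pb ?w ?W) (pb ?w ?Z) (pa ?p x) (pa ?q y))"
    unfolding el_mult[OF el_mul[OF f1] pq mu] mm_post[OF f1 px qy] c1 ..
  also have "\<dots> = mm ?l ?n ?m ?W ?Z (pa ?p x) (pa ?q y)"
    using mm_mu[OF el_cmp[OF f1(1) px] el_cmp[OF f1(2) qy] sw(1,2), unfolded sw(3), OF WZ] c1 kl by simp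
  finally have c: "cm <|nadd ?n ?m, ?k|> (?mu \<cdot>[NN ** (A ** C)] ita (A ** C) ?px ?qy) (mm ?k ?n ?m ?X ?Y ?x0 ?y0)
    = mm ?l ?n ?m ?W ?Z (pa ?p x) (pa ?q y)" .
  have "?w oo <|nadd ?n ?m, ?k|> = <|nadd ?n ?m, ?l|>" using u v A I S by simp
  then have 2: "opc D (?w oo <|nadd ?n ?m, ?k|>) (exO (NN ** A) (NN ** C) X Y) (ixO I J W Z)
      (cm <|nadd ?n ?m, ?k|> (?mu \<cdot>[NN ** (A ** C)] ita (A ** C) ?px ?qy) (mm ?k ?n ?m ?X ?Y ?x0 ?y0))"
    using g(3) c by simp
  have F: "?mu \<cdot>[NN ** (A ** C)] ita (A ** C) ?px ?qy \<in> H D ?w (ixO A C X Y) (ixO I J W Z)"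
    using mupq sw S WZ by (intro HI) (simp_all add: ixO_def)
  show ?thesis by (rule opc_cancel[OF f3 2 F]) (use sw in simp)
qed

lemma affine_mon_ext:
  assumes S: "small_cat I" "small_cat J"
  shows "\<lbrakk>X \<in> ob (NN ** I); Y \<in> ob (NN ** J)\<rbrakk> \<Longrightarrow> FObj (ext_prod (affine_line D) affine_mon I J) (X, Y) = ixO I J X Y"
    and "\<lbrakk>f \<in> ar (NN ** I); g \<in> ar (NN ** J)\<rbrakk> \<Longrightarrow> FArr (ext_prod (affine_line D) affine_mon I J) (f, g)
      = ita (I ** J) (pa (id_f NN *** prj1 I J) f) (pa (id_f NN *** prj2 I J) g)"
  using S affine_mon_ten(1,3,4)[OF small_prod[OF S]] pbA_Arr[of "id_f NN *** prj1 I J" f] pbA_Arr[of "id_f NN *** prj2 I J" g]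
  by (simp_all add: ext_prod_def prod_f_simps ixO_def)

text \<open>The canonical map is the transpose of an external product of a universal arrow with an
  identity. Both are opcartesian, so their product is by \<open>ix_opc\<close>, and the transpose is
  invertible.\<close>

theorem affine_monoidal_derivator: "monoidal_derivator (affine_line D) affine_mon"
proof (rule monoidal_derivator.intro[OF shift_derivator[OF small_NN] affine_monoidal_prederivator monoidal_derivator_axioms.intro], goal_cases)
  case (1 u C X Y)
  then have u: "small_functor u" "small_cat C" and X: "X \<in> ob (NN ** Src u)" and Y: "Y \<in> ob (NN ** C)" by simp_all
  have S: "small_cat (Src u)" "small_cat (Trg u)" using u by simp_all
  let ?U = "id_f NN *** u"
  let ?W = "FObj (lan D ?U) X" and ?e = "Cpt (lan_unit D ?U) X"
  have e: "opc D ?U X ?W ?e" using lan_opc[of ?U X] u X by simp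
  note eH = HD[OF opcD[OF e]]
  have y: "opc D (id_f NN *** id_f C) Y Y (idt (NN ** C) Y)"
    using opc_iso_id[OF _ category.id_in[OF DC_cat Y] category.iso_id[OF DC_cat Y]] u by simp
  note o = ix_opc[OF e y u(1) small_id[OF u(2)] refl _ refl, of C C]
  have "?W \<in> ob (NN ** Trg u)" "?e \<in> ar (NN ** Src u)" using eH by simp_all
  moreover have "idt (NN ** C) Y \<in> ar (NN ** C)" using homA[OF _ category.id_in[OF DC_cat Y]] u by simp
  ultimately show ?case
    using lan_transpose_iso[OF opcD[OF o]] o u S X Y
    by (simp add: cocont_left_def Let_def affine_mon_ext ext_mu_def lan_transpose_shift)
next
  case (2 A v X Y)
  then have v: "small_functor v" "small_cat A" and X: "X \<in> ob (NN ** A)" and Y: "Y \<in> ob (NN ** Src v)" by simp_all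
  have S: "small_cat (Src v)" "small_cat (Trg v)" using v by simp_all
  let ?V = "id_f NN *** v"
  let ?W = "FObj (lan D ?V) Y" and ?e = "Cpt (lan_unit D ?V) Y"
  have e: "opc D ?V Y ?W ?e" using lan_opc[of ?V Y] v Y by simp
  note eH = HD[OF opcD[OF e]]
  have x: "opc D (id_f NN *** id_f A) X X (idt (NN ** A) X)"
    using opc_iso_id[OF _ category.id_in[OF DC_cat X] category.iso_id[OF DC_cat X]] v by simp
  note o = ix_opc[OF x e small_id[OF v(2)] v(1) _ refl _ refl, of A A]
  have "?W \<in> ob (NN ** Trg v)" "?e \<in> ar (NN ** Src v)" using eH by simp_all
  moreover have "idt (NN ** A) X \<in> ar (NN ** A)" using homA[OF _ category.id_in[OF DC_cat X]] v by simp
  ultimately show ?case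
    using lan_transpose_iso[OF opcD[OF o]] o v S X Y
    by (simp add: cocont_right_def Let_def affine_mon_ext ext_mu_def lan_transpose_shift)
qed

theorem affine_mon_specified: "specified_by_affine_ext_prod D M affine_mon"
  unfolding specified_by_affine_ext_prod_def
proof (intro conjI allI impI)
  fix A show "Ten (MS affine_mon A) = DF (affine_line D) (diag A) oo affine_ext_prod D M A A" by (simp add: affine_mon_def)
next
  fix u X Y show "Mu affine_mon u X Y = pbA (affine_line D) (diag (Src u)) (affine_ext_mu D M u u X Y)" by (simp add: affine_mon_def)
next
  fix I J X Y
  assume "small_cat I \<and> small_cat J \<and> X \<in> Obj (DC (affine_line D) I) \<and> Y \<in> Obj (DC (affine_line D) J)"
  then have S: "small_cat I" "small_cat J" and XY: "X \<in> ob (NN ** I)" "Y \<in> ob (NN ** J)" by simp_all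
  show "let \<theta> = pbA (affine_line D) (diag (I ** J)) (affine_ext_mu D M (prj1 I J) (prj2 I J) X Y);
             E = DC (affine_line D) (I ** J)
         in \<theta> \<in> hom E (FObj (ext_prod (affine_line D) affine_mon I J) (X, Y)) (FObj (affine_ext_prod D M I J) (X, Y)) \<and> iso_in E \<theta>"
    using ithe[OF S XY] affine_mon_ext(1)[OF S XY] affine_ext_prod_simps(3)[OF S XY] by (simp add: Let_def ithe_def dd_def)
qed

end

theorem proposition4p4:
  fixes D :: "('k, 'o, 'm) pder" and M :: "('k, 'o, 'm) mon_pder"
  assumes "uncountable (UNIV :: 'k set)"
    and "monoidal_derivator D M"
  shows "\<exists>M'. monoidal_derivator (affine_line D) M'
    \<and> specified_by_affine_ext_prod D M M'
    \<and> Unt (MS M' pt) = affine_unit D M"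
proof -
  interpret mdv D M using assms by (intro mdv.intro big.intro)
  \<comment> \<open>Over the point the unit is the restriction of \<open>affine_unit\<close> along
    an identity, hence equal to it.\<close>
  show ?thesis using affine_monoidal_derivator affine_mon_specified uI_pt by (intro exI[of _ affine_mon]) simp
qed


end
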